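(* Let $U=\{\lambda\in\mathbb{C}\setminus\mathbb{R}: 2^{-1/2}<|\lambda|<1\}$. There exists a set $E\subset U$ with $\dim_H E=0$ such that for every $\lambda\in U\setminus E$ the complex Bernoulli convolution $\nu_\lambda$ is absolutely continuous (with respect to Lebesgue measure on $\mathbb{C}$) and has a density in $L^q$ for some $q=q(\lambda)>1$. In particular, $A_\lambda$ has positive Lebesgue measure for all $\lambda\in U\setminus E$.
   Context: For a non-zero complex number $\lambda$ with $|\lambda|<1$, the complex Bernoulli convolution $\nu_\lambda$ is the distribution of the random sum $\sum_{n=0}^\infty \pm\lambda^n$, where the signs are chosen independently with equal probability $1/2$. Equivalently, it is the unique Borel probability measure on $\mathbb{C}$ with $\nu_\lambda=\tfrac12 f_-\nu_\lambda+\tfrac12 f_+\nu_\lambda$, where $f_\pm(z)=\lambda z\pm1$ and $f\mu(A)=\mu(f^{-1}A)$ denotes push-forward. The set $A_\lambda$ is the topological support of $\nu_\lambda$; it is the unique nonempty compact set with $A_\lambda=(\lambda A_\lambda-1)\cup(\lambda A_\lambda+1)$. $\dim_H$ denotes Hausdorff dimension. *)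

theory Defs
  imports "HOL-Probability.Probability"
begin

section \<open>Hausdorff measure and dimension\<close>

text \<open>
  The weight of a covering set is its diameter to the power \<open>s\<close>, where the empty set has weight
  \<open>0\<close> and any other set has weight \<open>1\<close> if \<open>s = 0\<close>.  The cases are needed
  because \<open>0 powr 0 = 0\<close>.
\<close>

definition diam_weight :: "real \<Rightarrow> 'a::metric_space set \<Rightarrow> ennreal" where
  "diam_weight s C = (if C = {} then 0 else if s = 0 then 1 else ennreal (diameter C powr s))"

text \<open>Covering sets have to be bounded since \<open>diameter\<close> is only meaningful for bounded sets.\<close>

definition hausdorff_premeasure :: "real \<Rightarrow> real \<Rightarrow> 'a::metric_space set \<Rightarrow> ennreal" where
  "hausdorff_premeasure s \<delta> A =
     (INF C \<in> {C :: nat \<Rightarrow> 'a set. A \<subseteq> (\<Union>i. C i) \<and> (\<forall>i. bounded (C i) \<and> diameter (C i) \<le> \<delta>)}.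
        \<Sum>i. diam_weight s (C i))"

definition hausdorff_measure :: "real \<Rightarrow> 'a::metric_space set \<Rightarrow> ennreal" where
  "hausdorff_measure s A = (SUP \<delta> \<in> {0<..}. hausdorff_premeasure s \<delta> A)"

text \<open>The empty set has dimension \<open>0\<close>.\<close>

definition hausdorff_dim :: "'a::metric_space set \<Rightarrow> ennreal" where
  "hausdorff_dim A = (INF s \<in> {s. 0 \<le> s \<and> hausdorff_measure s A = 0}. ennreal s)"


section \<open>Topological support and densities\<close>

definition measure_support :: "'a::topological_space measure \<Rightarrow> 'a set" where
  "measure_support M = {x. \<forall>V. open V \<longrightarrow> x \<in> V \<longrightarrow> 0 < emeasure M V}"

lemma closed_measure_support:
  assumes [simp]: "sets M = sets borel"
  shows "closed (measure_support M)"
proof -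
  have *: "- measure_support M = \<Union>{V. open V \<and> emeasure M V = 0}"
    by (auto simp: measure_support_def not_less)
  have "open (- measure_support M)"
    unfolding * by (rule open_Union) auto
  then show ?thesis
    by (simp add: closed_def)
qed

definition has_density_in_Lp :: "'a::euclidean_space measure \<Rightarrow> real \<Rightarrow> bool" where
  "has_density_in_Lp M q \<longleftrightarrow>
     (\<exists>f :: 'a \<Rightarrow> real. f \<in> borel_measurable borel \<and> (\<forall>x. 0 \<le> f x) \<and>
        M = density lborel (\<lambda>x. ennreal (f x)) \<and>
        integrable lborel (\<lambda>x. f x powr q))"


section \<open>Complex Bernoulli convolutions\<close>

text \<open>
  The sign of the \<open>n\<close>-th term is given by the \<open>n\<close>-th of a sequence of independent fair
  coin tosses, so the series converges for every outcome when \<open>cmod l < 1\<close>.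
\<close>

definition bernoulli_conv :: "complex \<Rightarrow> complex measure" where
  "bernoulli_conv l =
     distr (PiM (UNIV :: nat set) (\<lambda>_. measure_pmf (bernoulli_pmf (1 / 2)))) borel
       (\<lambda>\<omega>. \<Sum>n. (if \<omega> n then 1 else - 1) * l ^ n)"

definition bernoulli_attractor :: "complex \<Rightarrow> complex set" where
  "bernoulli_attractor l = measure_support (bernoulli_conv l)"

definition bernoulli_params :: "complex set" where
  "bernoulli_params = {l. l \<notin> \<real> \<and> 2 powr (- 1 / 2) < cmod l \<and> cmod l < 1}"

lemma sets_bernoulli_conv [simp]: "sets (bernoulli_conv l) = sets borel"
  by (simp add: bernoulli_conv_def)

lemma prob_space_bernoulli_conv: "prob_space (bernoulli_conv l)"
  unfolding bernoulli_conv_def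
proof (rule prob_space.prob_space_distr)
  show "prob_space (PiM (UNIV :: nat set) (\<lambda>_. measure_pmf (bernoulli_pmf (1 / 2))))"
    by (rule prob_space_PiM) (rule prob_space_measure_pmf)
  have [measurable]: "Measurable.pred (PiM (UNIV :: nat set)
      (\<lambda>_. measure_pmf (bernoulli_pmf (1 / 2)))) (\<lambda>\<omega>. \<omega> n)" for n
    using measurable_component_singleton[of n UNIV "\<lambda>_. measure_pmf (bernoulli_pmf (1 / 2))"]
    by (simp cong: measurable_cong_sets)
  show "(\<lambda>\<omega>. \<Sum>n. (if \<omega> n then 1 else - 1) * l ^ n)
    \<in> borel_measurable (PiM (UNIV :: nat set) (\<lambda>_. measure_pmf (bernoulli_pmf (1 / 2))))"
    by measurable
qed

end

theory Submission
  imports Defs "HOL-Complex_Analysis.Complex_Analysis" "HOL-Computational_Algebra.Fundamental_Theorem_Algebra"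
begin

text \<open>
  Choose \<open>k\<close> with \<open>l ^ k\<close> nonreal such that the random signs with index not divisible by
  \<open>k\<close> still carry more entropy than the plane can absorb; this is possible because
  \<open>cmod l > 2 powr (- 1 / 2)\<close>.  The convolution is then the convolution of two self-similar measures
  with ratio \<open>l ^ k\<close>.  The first one, made of the signs with index divisible by \<open>k\<close>, has power
  decay of its Fourier transform unless \<open>l ^ k\<close> belongs to the exceptional set of Erdos and Kahane.  The second
  one has full dimension by Hochman's inverse theorem unless the power sums of \<open>l\<close> approach zero
  superexponentially fast.  In this special case the inverse theorem follows from entropy
  submodularity (Kaimanovich--Vershik): convolving with a high convolution power of a component costs
  little entropy if a single convolution does, whereas such a power saturates a positive proportion of
  the scales.  Both exceptional sets have dimension zero.

  Full dimension gives, up to exponentially small probability, almost optimal bounds for the masses of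
  cells.  On this part the Fourier decay of the first factor makes the L2 norms of the differences of
  Gaussian smoothings at consecutive scales decay exponentially, while the remaining part is
  exponentially small in L1.  Summing over the scales bounds the measure of a set by a positive power
  of its volume, which gives a density in some Lq with q > 1.
\<close>

section \<open>Sets of Hausdorff dimension zero\<close>

text \<open>Entropy controls only typical cells, so on its own it gives no L2 bound; a density is
  reached only because part of the signs is reserved for Fourier decay. An inert component could a
  priori live near a line, and its convolution powers would then fill a single direction. It is
  therefore used together with its image under multiplication by \<rho> = l^k. The partial sums
  reproduce themselves under this map up to one summand and a short tail, so the image is again
  inert up to a bounded error; and since \<rho> is nonreal, the two copies together spread in all
  directions. This is a second reason, besides the decay, for asking for a nonreal power.
  Submodularity concerns exact sums in a group, so convolutions are rounded to the integer lattice,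
  at a cost that depends on the number of summands but not on the scale. The surplus entropy of the
  second factor is visible only at scales much finer than its own; if the growth rate were
  deficient, this surplus would have to sit inside the cells, and there the inert component is
  found. The exponent k depends on l, so all powers contribute to the exceptional set, which stays
  of dimension zero under k-th roots and countable unions.\<close>

definition dim0 :: "complex set \<Rightarrow> bool" where
  "dim0 E \<longleftrightarrow> (\<forall>s>0. \<forall>e>0. \<exists>c r. (\<forall>i::nat. 0 \<le> r i) \<and> E \<subseteq> (\<Union>i. cball (c i) (r i)) \<and>
     (\<Sum>i. ennreal (r i powr s)) \<le> ennreal e)"

lemma dim0_subset: "dim0 E \<Longrightarrow> F \<subseteq> E \<Longrightarrow> dim0 F"
  unfolding dim0_def by (meson order_trans)

text \<open>\<open>dim0\<close> imposes no bound on the radii, but for \<open>s > 0\<close> a sum of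
  at most \<open>(\<delta> / 2) powr s\<close> forces each radius to be at most
  \<open>\<delta> / 2\<close>. So vanishing content already gives vanishing measure; passing from
  radii to diameters costs the factor \<open>2 powr s\<close>.\<close>

lemma dim0_hausdorff_dim:
  assumes "dim0 E"
  shows "hausdorff_dim E = 0"
proof -
  have "hausdorff_measure s E = 0" if s: "s > 0" for s
  proof -
    have "hausdorff_premeasure s \<delta> E \<le> ennreal e" if \<delta>: "\<delta> > 0" and e: "e > 0" for \<delta> e
    proof -
      define e' where "e' = min (e / 2 powr s) ((\<delta> / 2) powr s)"
      have "e' > 0" using e \<delta> by (simp add: e'_def)
 from assms[unfolded dim0_def, rule_format, OF s this]
      obtain c r where cr: "\<And>i::nat. 0 \<le> r i" "E \<subseteq> (\<Union>i. cball (c i) (r i))" "(\<Sum>i. ennreal (r i powr s)) \<le> ennreal e'"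
        by blast
      have ri: "r i \<le> \<delta> / 2" for i
      proof -
        have "(\<Sum>j\<in>{i}. ennreal (r j powr s)) \<le> (\<Sum>j. ennreal (r j powr s))"
          by (rule sum_le_suminf) auto
        then have "ennreal (r i powr s) \<le> ennreal e'" using cr(3) by simp
        then have "r i powr s \<le> (\<delta> / 2) powr s" using \<open>e' > 0\<close> by (simp add: e'_def)
        then show ?thesis using powr_less_mono2[OF s, of "\<delta> / 2" "r i"] \<delta> by fastforce
      qed
      have "hausdorff_premeasure s \<delta> E \<le> (\<Sum>i. diam_weight s (cball (c i) (r i)))"
        unfolding hausdorff_premeasure_def
        by (rule INF_lower) (use cr ri \<delta> in \<open>auto simp: diameter_cball field_simps\<close>)
      also have "\<dots> \<le> (\<Sum>i. ennreal (2 powr s) * ennreal (r i powr s))"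
      proof (rule suminf_le)
        fix i
        have "diameter (cball (c i) (r i)) = 2 * r i" using cr(1)[of i] by (simp add: diameter_cball)
        then show "diam_weight s (cball (c i) (r i)) \<le> ennreal (2 powr s) * ennreal (r i powr s)"
          using s cr(1)[of i] by (simp add: diam_weight_def powr_mult ennreal_mult)
      qed auto
      also have "\<dots> = ennreal (2 powr s) * (\<Sum>i. ennreal (r i powr s))" by simp
      also have "\<dots> \<le> ennreal (2 powr s) * ennreal e'" by (intro mult_left_mono cr) simp
      also have "\<dots> = ennreal (2 powr s * e')" using \<open>e' > 0\<close> by (simp add: ennreal_mult)
      also have "\<dots> \<le> ennreal e"
      proof (rule ennreal_leI)
        have "2 powr s * e' \<le> 2 powr s * (e / 2 powr s)" by (intro mult_left_mono) (auto simp: e'_def)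
        then show "2 powr s * e' \<le> e" by simp
      qed
      finally show ?thesis .
    qed
    note bd = this
    have "hausdorff_premeasure s \<delta> E = 0" if "\<delta> > 0" for \<delta>
    proof -
      have "hausdorff_premeasure s \<delta> E \<le> 0"
        by (rule ennreal_le_epsilon) (use bd[OF that] in simp)
      then show ?thesis by simp
    qed
    then show ?thesis unfolding hausdorff_measure_def by simp
  qed
  note null = this
  have "hausdorff_dim E \<le> ennreal s" if "s > 0" for s
    unfolding hausdorff_dim_def by (rule INF_lower) (use that null in auto)
  note le = this
  have "hausdorff_dim E \<le> 0"
  proof (rule ennreal_le_epsilon)
    fix e :: real assume "0 < e"
    from le[OF this] show "hausdorff_dim E \<le> 0 + ennreal e" by simp
  qed
  then show ?thesis by simp
qed

text \<open>Covers usually come as one family per level; \<open>prod_decode\<close> flattens them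
  into the single sequence that \<open>dim0\<close> asks for.\<close>

lemma dim0I2:
  assumes "\<And>s e. s > 0 \<Longrightarrow> e > 0 \<Longrightarrow> \<exists>c r. (\<forall>n m::nat. 0 \<le> r n m) \<and> E \<subseteq> (\<Union>n m. cball (c n m) (r n m)) \<and>
     (\<Sum>n::nat. \<Sum>m. ennreal (r n m powr s)) \<le> ennreal e"
  shows "dim0 E"
  unfolding dim0_def
proof (intro allI impI)
  fix s e :: real assume "s > 0" "e > 0"
  from assms[OF this] obtain c r where cr: "\<And>n m::nat. 0 \<le> r n m" "E \<subseteq> (\<Union>n m. cball (c n m) (r n m))"
     "(\<Sum>n::nat. \<Sum>m. ennreal (r n m powr s)) \<le> ennreal e"
    by blast
  let ?c = "\<lambda>i. c (fst (prod_decode i)) (snd (prod_decode i))" and ?r = "\<lambda>i. r (fst (prod_decode i)) (snd (prod_decode i))"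
  have "E \<subseteq> (\<Union>i. cball (?c i) (?r i))"
  proof
    fix x assume "x \<in> E"
    then obtain n m where "x \<in> cball (c n m) (r n m)" using cr(2) by auto
    then have "x \<in> cball (?c (prod_encode (n, m))) (?r (prod_encode (n, m)))" by (simp only: prod_encode_inverse fst_conv snd_conv)
    then show "x \<in> (\<Union>i. cball (?c i) (?r i))" by blast
  qed
  moreover have "(\<Sum>i. ennreal (?r i powr s)) = (\<Sum>n::nat. \<Sum>m. ennreal (r n m powr s))"
    using suminf_ennreal_2dimen[where g = "\<lambda>n. \<Sum>m. ennreal (r n m powr s)" and f = "\<lambda>p. ennreal (r (fst p) (snd p) powr s)"]
    by (simp only: fst_conv snd_conv)
  moreover have "\<forall>i. 0 \<le> ?r i" using cr(1) by simp
  ultimately show "\<exists>c r. (\<forall>i::nat. 0 \<le> r i) \<and> E \<subseteq> (\<Union>i. cball (c i) (r i)) \<and> (\<Sum>i. ennreal (r i powr s)) \<le> ennreal e"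
    using cr(3) by (intro exI[of _ ?c] exI[of _ ?r]) auto
qed

lemma dim0_UN:
  assumes "\<And>n::nat. dim0 (E n)"
  shows "dim0 (\<Union>n. E n)"
proof (rule dim0I2)
  fix s e :: real assume s: "s > 0" and e: "e > 0"
  have "\<exists>c r. (\<forall>i::nat. 0 \<le> r i) \<and> E n \<subseteq> (\<Union>i. cball (c i) (r i)) \<and> (\<Sum>i. ennreal (r i powr s)) \<le> ennreal (e * (1/2) ^ Suc n)" for n
    using assms[of n] s e unfolding dim0_def by simp
  then obtain c r where cr: "\<And>n i::nat. 0 \<le> r n i" "\<And>n. E n \<subseteq> (\<Union>i. cball (c n i) (r n i))"
    "\<And>n. (\<Sum>i. ennreal (r n i powr s)) \<le> ennreal (e * (1/2) ^ Suc n)"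
    by metis
  have "(\<Sum>n::nat. \<Sum>m. ennreal (r n m powr s)) \<le> (\<Sum>n. ennreal (e * (1/2) ^ Suc n))"
    by (rule suminf_le) (use cr in auto)
  also have "\<dots> = ennreal e"
    using e sums_mult[OF power_half_series, of e] by (intro suminf_ennreal_eq) auto
  finally have sum: "(\<Sum>n::nat. \<Sum>m. ennreal (r n m powr s)) \<le> ennreal e" .
  have sub: "(\<Union>n. E n) \<subseteq> (\<Union>n m. cball (c n m) (r n m))"
    by (intro UN_mono subset_refl cr(2))
  show "\<exists>c r. (\<forall>n m::nat. 0 \<le> r n m) \<and> (\<Union>n. E n) \<subseteq> (\<Union>n m. cball (c n m) (r n m)) \<and>
     (\<Sum>n::nat. \<Sum>m. ennreal (r n m powr s)) \<le> ennreal e"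
    by (rule exI[of _ c], rule exI[of _ r], intro conjI allI cr(1) sub sum)
qed

lemma dim0_Un: "dim0 A \<Longrightarrow> dim0 B \<Longrightarrow> dim0 (A \<union> B)"
proof -
  assume "dim0 A" "dim0 B"
  then have "dim0 (\<Union>n. if n = (0::nat) then A else B)" by (intro dim0_UN) simp
  moreover have "(\<Union>n. if n = (0::nat) then A else B) = A \<union> B" by (auto split: if_splits)
  ultimately show ?thesis by simp
qed

text \<open>Finite families are padded with balls of radius 0, which have weight 0 because
  \<open>s > 0\<close>.\<close>

lemma suminf_finite_const:
  assumes "s > 0"
  shows "(\<Sum>m. ennreal ((if m < (k::nat) then \<rho> else 0) powr s)) = ennreal (real k * \<rho> powr s)"
proof -
  have "(\<Sum>m. ennreal ((if m < k then \<rho> else 0) powr s)) = (\<Sum>m<k. ennreal ((if m < k then \<rho> else 0) powr s))"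
    by (rule suminf_finite) (use assms in auto)
  also have "\<dots> = ennreal (\<Sum>m<k. \<rho> powr s)" by (subst sum_ennreal[symmetric]) auto
  finally show ?thesis by simp
qed

text \<open>Borel--Cantelli: a point that lies in infinitely many of the families is covered by
  every tail, and the tails of a convergent series are arbitrarily small. Families and radii may
  depend on \<open>s\<close>.\<close>

lemma dim0_limsup:
  assumes "\<And>s. s > 0 \<Longrightarrow> \<exists>F r. (\<forall>n::nat. finite (F n)) \<and> (\<forall>n. 0 \<le> r n) \<and> summable (\<lambda>n. real (card (F n)) * r n powr s) \<and>
     (\<forall>x\<in>E. \<exists>\<^sub>\<infinity>n. x \<in> (\<Union>c\<in>F n. cball c (r n)))"
  shows "dim0 E"
proof (rule dim0I2)
  fix s e :: real assume s: "s > 0" and e: "e > 0"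
  obtain F r where F: "\<And>n::nat. finite (F n)" "\<And>n. 0 \<le> r n" "summable (\<lambda>n. real (card (F n)) * r n powr s)"
     "\<And>x. x \<in> E \<Longrightarrow> \<exists>\<^sub>\<infinity>n. x \<in> (\<Union>c\<in>F n. cball c (r n))"
    using assms[OF s] by blast
  let ?a = "\<lambda>n. real (card (F n)) * r n powr s"
  obtain N where N: "norm (\<Sum>i. ?a (i + N)) < e"
    using suminf_exist_split[OF e F(3)] by blast
  have "\<exists>f. bij_betw f {..<card (F n)} (F n)" for n
    using ex_bij_betw_nat_finite[OF F(1)[of n]] by (simp add: atLeast0LessThan)
  then obtain f where f: "\<And>n. bij_betw (f n) {..<card (F n)} (F n)" by metis
  let ?c = "\<lambda>n. f (n + N)"
  let ?r = "\<lambda>n m. if m < card (F (n + N)) then r (n + N) else 0"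
  have sub: "E \<subseteq> (\<Union>n m. cball (?c n m) (?r n m))"
  proof
    fix x assume "x \<in> E"
    then obtain n where n: "n \<ge> N" "x \<in> (\<Union>c\<in>F n. cball c (r n))"
      using F(4) by (meson INFM_nat_le)
    then obtain c where "c \<in> F n" "x \<in> cball c (r n)" by blast
    moreover then obtain m where "m < card (F n)" "c = f n m" using f[of n] by (auto simp: bij_betw_def)
    ultimately have "x \<in> cball (?c (n - N) m) (?r (n - N) m)" using n by simp
    then show "x \<in> (\<Union>n m. cball (?c n m) (?r n m))" by blast
  qed
  have "(\<Sum>n. \<Sum>m. ennreal (?r n m powr s)) = (\<Sum>n. ennreal (?a (n + N)))"
    by (simp only: suminf_finite_const[OF s])
  also have "\<dots> = ennreal (\<Sum>n. ?a (n + N))"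
    by (rule suminf_ennreal2) (simp, use summable_ignore_initial_segment[OF F(3), of N] in simp)
  also have "\<dots> \<le> ennreal e" using N by (intro ennreal_leI) simp
  finally have sum: "(\<Sum>n. \<Sum>m. ennreal (?r n m powr s)) \<le> ennreal e" .
  have nn: "0 \<le> ?r n m" for n m using F(2) by simp
  show "\<exists>c r. (\<forall>n m::nat. 0 \<le> r n m) \<and> E \<subseteq> (\<Union>n m. cball (c n m) (r n m)) \<and>
     (\<Sum>n::nat. \<Sum>m. ennreal (r n m powr s)) \<le> ennreal e"
    by (rule exI[of _ ?c], rule exI[of _ ?r], intro conjI allI nn sub sum)
qed

text \<open>If all \<open>k\<close> factors exceeded \<open>r powr (1 / k)\<close>, their product
  would exceed \<open>r\<close>.\<close>

lemma close_to_root: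
  fixes root :: "nat \<Rightarrow> complex"
  assumes "cmod (\<Prod>i<k. z - root i) \<le> r" "r \<ge> 0" "k \<ge> 1"
  shows "\<exists>i<k. cmod (z - root i) \<le> r powr (1 / k)"
proof (rule ccontr)
  assume "\<not> ?thesis"
  then have *: "\<And>i. i < k \<Longrightarrow> r powr (1 / k) < cmod (z - root i)" by force
  have "(r powr (1 / k)) ^ k = r"
  proof (cases "r = 0")
    case True
    then show ?thesis using assms(3) by simp
  next
    case False
    then have "(r powr (1 / k)) ^ k = r powr (1 / k * k)" using assms(2) by (simp add: powr_realpow[symmetric] powr_powr)
    then show ?thesis using assms by simp
  qed
  then have "r = (\<Prod>i<k. r powr (1 / k))" by simp
  also have "\<dots> < (\<Prod>i<k. cmod (z - root i))"
  proof (rule prod_mono_strict)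
    show "0 \<le> r powr (1 / k) \<and> r powr (1 / k) \<le> cmod (z - root i)" if "i \<in> {..<k}" for i
      using *[of i] that by simp
    show "0 < cmod (z - root i)" if "i \<in> {..<k}" for i
      using *[of i] that powr_ge_zero[of r "1 / k"] by (simp del: powr_ge_zero zero_less_norm_iff)
  qed (use * assms in auto)
  also have "\<dots> \<le> r" using assms(1) by (simp add: prod_norm)
  finally show False by simp
qed

text \<open>\<open>z ^ k - a\<close> splits into linear factors, so the preimage of a ball of radius
  \<open>r\<close> lies in \<open>k\<close> balls of radius \<open>r powr (1 / k)\<close> around the
  \<open>k\<close>-th roots of the centre. Exponent \<open>s\<close> for the preimage thus
  corresponds to exponent \<open>s / k\<close> for \<open>E\<close>.\<close>

lemma dim0_power_vimage:
  assumes E: "dim0 E" and k: "k \<ge> 1"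
  shows "dim0 {z. z ^ k \<in> E}"
proof (rule dim0I2)
  fix s e :: real assume s: "s > 0" and e: "e > 0"
  have "s / k > 0" "e / k > 0" using s e k by auto
  from E[unfolded dim0_def, rule_format, OF this]
  obtain c r where cr: "\<And>i::nat. 0 \<le> r i" "E \<subseteq> (\<Union>i. cball (c i) (r i))" "(\<Sum>i. ennreal (r i powr (s / k))) \<le> ennreal (e / k)"
    by blast
  have "\<exists>root. \<forall>z. z ^ k - a = (\<Prod>i<k. z - root (i::nat))" for a :: complex
  proof -
    define p where "p = monom 1 k + [:- a:]"
    have deg: "degree p = k" unfolding p_def using k by (subst degree_add_eq_left) (auto simp: degree_monom_eq)
    have lc: "lead_coeff p = 1" unfolding deg using k by (simp add: p_def coeff_pCons split: nat.splits)
    obtain root where root: "smult (lead_coeff p) (\<Prod>i<degree p. [:-root i, 1:]) = p"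
      using complex_poly_decompose'[of p] by blast
    have "z ^ k - a = (\<Prod>i<k. z - root i)" for z
    proof -
      have "z ^ k - a = poly p z" by (simp add: p_def poly_monom)
      also have "\<dots> = poly (\<Prod>i<k. [:-root i, 1:]) z" using root[unfolded lc, unfolded deg] by simp
      finally show ?thesis by (simp add: poly_prod)
    qed
    then show ?thesis by blast
  qed
  then have "\<exists>root. \<forall>a z. z ^ k - a = (\<Prod>i<k. z - root (a::complex) (i::nat))"
    by (intro choice allI)
  then obtain root :: "complex \<Rightarrow> nat \<Rightarrow> complex" where root: "\<And>a z. z ^ k - a = (\<Prod>i<k. z - root a i)"
    by blast
  let ?c = "\<lambda>n m. root (c n) m" and ?r = "\<lambda>n m. if m < k then r n powr (1 / k) else 0"
  have "{z. z ^ k \<in> E} \<subseteq> (\<Union>n m. cball (?c n m) (?r n m))"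
  proof
    fix z assume "z \<in> {z. z ^ k \<in> E}"
    then obtain n where "z ^ k \<in> cball (c n) (r n)" using cr(2) by auto
    then have "cmod (\<Prod>i<k. z - root (c n) i) \<le> r n" by (simp add: root[symmetric] dist_norm norm_minus_commute)
    from close_to_root[OF this cr(1) k] obtain i where "i < k" "cmod (z - root (c n) i) \<le> r n powr (1 / k)" by blast
    then have "z \<in> cball (?c n i) (?r n i)" by (simp add: dist_norm norm_minus_commute)
    then show "z \<in> (\<Union>n m. cball (?c n m) (?r n m))" by blast
  qed
  moreover have "(\<Sum>n. \<Sum>m. ennreal (?r n m powr s)) \<le> ennreal e"
  proof -
    have "(\<Sum>n. \<Sum>m. ennreal (?r n m powr s)) = (\<Sum>n. ennreal (real k) * ennreal (r n powr (s / k)))"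
      by (simp only: suminf_finite_const[OF s]) (simp add: powr_powr ennreal_mult)
    also have "\<dots> = ennreal (real k) * (\<Sum>n. ennreal (r n powr (s / k)))" by simp
    also have "\<dots> \<le> ennreal (real k) * ennreal (e / k)" by (intro mult_left_mono cr) simp
    also have "\<dots> = ennreal e" using k e by (simp add: ennreal_mult[symmetric])
    finally show ?thesis .
  qed
  moreover have "0 \<le> ?r n m" for n m by simp
  ultimately show "\<exists>c r. (\<forall>n m::nat. 0 \<le> r n m) \<and> {z. z ^ k \<in> E} \<subseteq> (\<Union>n m. cball (c n m) (r n m)) \<and>
     (\<Sum>n::nat. \<Sum>m. ennreal (r n m powr s)) \<le> ennreal e"
    by (intro exI[of _ ?c] exI[of _ ?r] conjI allI)
qed

section \<open>Exponential separation of power sums\<close>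

text \<open>The difference of two sign sequences is twice a sequence over -1, 0, 1, so this keeps
  the values of distinct sign sequences exponentially apart. The constant may depend on
  \<open>l\<close>; the negation says that for every \<open>C\<close> some value drops below
  \<open>C ^ n\<close> for infinitely many \<open>n\<close>.\<close>

definition separated :: "complex \<Rightarrow> bool" where
  "separated l \<longleftrightarrow> (\<exists>C>0. \<forall>\<^sub>F n in sequentially. \<forall>P::nat \<Rightarrow> int. range P \<subseteq> {-1, 0, 1} \<longrightarrow> (\<exists>i<n. P i \<noteq> 0) \<longrightarrow>
     C ^ n \<le> cmod (\<Sum>i<n. of_int (P i) * l ^ i))"

text \<open>Multiplying \<open>p\<close> by Blaschke factors for its roots leaves \<open>\<bar>p\<bar>\<close> unchanged on the circle and enlarges \<open>\<bar>p 0\<bar>\<close>.\<close>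

lemma card_roots_in_disc:
  fixes p :: "complex poly" and root :: "nat \<Rightarrow> complex"
  assumes p: "p = smult c (\<Prod>i<D. [:- root i, 1:])"
    and p0: "cmod (poly p 0) = 1"
    and M: "\<And>z. cmod z = r \<Longrightarrow> cmod (poly p z) \<le> M"
    and r: "0 < R'" "R' < r"
  shows "(r / R') ^ card {i\<in>{..<D}. cmod (root i) < R'} \<le> M"
proof -
  let ?I = "{i\<in>{..<D}. cmod (root i) < R'}"
  have poly: "poly p z = c * (\<Prod>i<D. z - root i)" for z
    unfolding p by (simp add: poly_prod)
  have nz: "root i \<noteq> 0" if "i < D" for i
  proof
    assume "root i = 0"
    then have "(\<Prod>i<D. 0 - root i) = 0" using that by (intro prod_zero) auto
    then have "poly p 0 = 0" by (simp only: poly mult_zero_right)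
    then show False using p0 by simp
  qed
  define g where "g = (\<lambda>z. c * (\<Prod>i\<in>{..<D} - ?I. z - root i) * (\<Prod>i\<in>?I. (r\<^sup>2 - cnj (root i) * z) / r))"
  have r0: "r > 0" using r by simp
  have split: "(\<Prod>i<D. f i) = (\<Prod>i\<in>{..<D} - ?I. f i) * (\<Prod>i\<in>?I. f i)" for f :: "nat \<Rightarrow> complex"
    by (rule prod.subset_diff) auto
  have "cmod (g 0) \<le> M"
  proof (rule maximum_modulus_frontier[of g "ball 0 r"])
    show "g holomorphic_on interior (ball 0 r)" unfolding g_def using r0 by (intro holomorphic_intros) auto
    show "continuous_on (closure (ball 0 r)) g" unfolding g_def using r0 by (intro continuous_intros) auto
    show "bounded (ball 0 r :: complex set)" by simp
    show "0 \<in> ball (0::complex) r" using r0 by simp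
    fix z :: complex assume "z \<in> frontier (ball 0 r)"
    then have z: "cmod z = r" using r0 by simp
    have "cmod ((r\<^sup>2 - cnj (root i) * z) / r) = cmod (z - root i)" for i
    proof -
      have "complex_of_real (r\<^sup>2) = z * cnj z" using z by (metis complex_norm_square of_real_power)
      then have "r\<^sup>2 - cnj (root i) * z = z * cnj (z - root i)" by (simp add: algebra_simps)
      then have "cmod (r\<^sup>2 - cnj (root i) * z) = r * cmod (z - root i)" using z by (simp only: norm_mult complex_mod_cnj)
      then show ?thesis using r0 by (simp add: norm_divide)
    qed
    then have "cmod (g z) = cmod (poly p z)"
      unfolding g_def poly split norm_mult by (simp only: prod_norm[symmetric] mult.assoc)
    then show "cmod (g z) \<le> M" using M[OF z] by simp
  qed
  moreover have "cmod (g 0) = (\<Prod>i\<in>?I. r / cmod (root i))"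
  proof -
    have "cmod (g 0) = cmod c * (\<Prod>i\<in>{..<D} - ?I. cmod (root i)) * (\<Prod>i\<in>?I. r)"
      unfolding g_def using r0 by (simp add: norm_mult prod_norm[symmetric] norm_divide norm_power power2_eq_square)
    moreover have "1 = cmod c * (\<Prod>i\<in>{..<D} - ?I. cmod (root i)) * (\<Prod>i\<in>?I. cmod (root i))"
      using p0 unfolding poly split by (simp add: norm_mult prod_norm[symmetric])
    moreover have "(\<Prod>i\<in>?I. r / cmod (root i)) = (\<Prod>i\<in>?I. r) / (\<Prod>i\<in>?I. cmod (root i))"
      by (rule prod_dividef)
    moreover have "x = t / b" if "x = u * t" "1 = u * b" for x u t b :: real
    proof -
      have b: "b \<noteq> 0" using that(2) by auto
      have "u = 1 / b" using that(2) b by (simp add: eq_divide_eq)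
      then show ?thesis using that(1) by simp
    qed
    ultimately show ?thesis by simp
  qed
  moreover have "(\<Prod>i\<in>?I. r / R') \<le> (\<Prod>i\<in>?I. r / cmod (root i))"
    using r nz by (intro prod_mono conjI divide_left_mono divide_nonneg_nonneg) (auto intro!: mult_pos_pos)
  ultimately show ?thesis by simp
qed

text \<open>A nonzero constant coefficient can be arranged by dividing by a power of the variable.
  It gives modulus 1 at the origin, as \<open>card_roots_in_disc\<close> requires.\<close>

definition unit_polys :: "nat \<Rightarrow> complex poly set" where
  "unit_polys n = {p. degree p < n \<and> (\<forall>i. coeff p i \<in> {-1, 0, 1}) \<and> coeff p 0 \<noteq> 0}"

lemma card_unit_polys: "finite (unit_polys n)" "card (unit_polys n) \<le> 3 ^ n"
proof -
  let ?F = "\<lambda>p. \<lambda>i\<in>{..<n}. coeff p i"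
  have inj: "inj_on ?F (unit_polys n)"
  proof (rule inj_onI)
    fix p q assume pq: "p \<in> unit_polys n" "q \<in> unit_polys n" "?F p = ?F q"
    show "p = q"
    proof (rule poly_eqI)
      fix i
      show "coeff p i = coeff q i"
      proof (cases "i < n")
        case True
        then show ?thesis using fun_cong[OF pq(3), of i] by simp
      next
        case False
        then show ?thesis using pq(1,2) by (simp add: unit_polys_def coeff_eq_0)
      qed
    qed
  qed
  have sub: "?F ` unit_polys n \<subseteq> {..<n} \<rightarrow>\<^sub>E {-1, 0, 1}" 
  proof (rule image_subsetI)
    fix p assume "p \<in> unit_polys n"
    then show "?F p \<in> {..<n} \<rightarrow>\<^sub>E {-1, 0, 1}" unfolding restrict_PiE_iff by (simp add: unit_polys_def)
  qed
  have fin: "finite ({..<n} \<rightarrow>\<^sub>E {-1, 0, 1::complex})" by (intro finite_PiE) auto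
  have card: "card ({..<n} \<rightarrow>\<^sub>E {-1, 0, 1::complex}) = 3 ^ n" by (subst card_PiE) (auto simp: numeral_3_eq_3)
  show "finite (unit_polys n)" by (rule finite_imageD[OF finite_subset[OF sub fin] inj])
  have "card (unit_polys n) = card (?F ` unit_polys n)" by (rule card_image[OF inj, symmetric])
  also have "\<dots> \<le> 3 ^ n" unfolding card[symmetric] by (rule card_mono[OF fin sub])
  finally show "card (unit_polys n) \<le> 3 ^ n" .
qed

text \<open>At most \<open>K\<close> roots lie in the disc of radius \<open>R'\<close>, with
  \<open>K\<close> independent of the degree. After normalising by the value at 0, every other root
  contributes a factor of at least \<open>1 - R / R'\<close>, so a value below
  \<open>(1 - R / R') ^ n * t ^ K\<close> forces one of the few inner roots to lie within
  \<open>t\<close>.\<close>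

lemma unit_poly_root_close:
  assumes p: "p \<in> unit_polys n" and R: "0 < R" "R < R'" "R' < r" "r < 1"
    and K: "1 / (1 - r) < (r / R') ^ Suc K"
    and t: "0 < t" "t \<le> 1" and z: "cmod z \<le> R" and small: "cmod (poly p z) < (1 - R / R') ^ n * t ^ K"
  shows "\<exists>a. poly p a = 0 \<and> cmod (z - a) \<le> t"
proof -
  define D where "D = degree p"
  have D: "D < n" using p by (simp add: D_def unit_polys_def)
  obtain root where root: "smult (lead_coeff p) (\<Prod>i<D. [:-root i, 1:]) = p"
    unfolding D_def using complex_poly_decompose'[of p] by blast
  have poly: "poly p z = lead_coeff p * (\<Prod>i<D. z - root i)" for z
    by (subst root[symmetric]) (simp add: poly_prod)
  have cf: "coeff p i \<in> {-1, 0, 1}" for i using p by (simp add: unit_polys_def)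
  have p0: "cmod (poly p 0) = 1"
    using cf[of 0] p by (auto simp: unit_polys_def poly_0_coeff_0)
  have nz: "root i \<noteq> 0" if "i < D" for i
  proof
    assume "root i = 0"
    then have "(\<Prod>i<D. 0 - root i) = 0" using that by (intro prod_zero) auto
    then have "poly p 0 = 0" by (simp only: poly mult_zero_right)
    then show False using p0 by simp
  qed
  have M: "cmod (poly p w) \<le> 1 / (1 - r)" if "cmod w = r" for w
  proof -
    have "cmod (poly p w) \<le> (\<Sum>i\<le>degree p. cmod (coeff p i * w ^ i))"
      unfolding poly_altdef by (rule norm_sum)
    also have "\<dots> \<le> (\<Sum>i\<le>degree p. r ^ i)"
    proof (rule sum_mono)
      fix i
      have "cmod (coeff p i) \<le> 1" using cf[of i] by auto
      then have "cmod (coeff p i) * r ^ i \<le> 1 * r ^ i" using R by (intro mult_right_mono) auto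
      then show "cmod (coeff p i * w ^ i) \<le> r ^ i" using that by (simp add: norm_mult norm_power)
    qed
    also have "\<dots> \<le> (\<Sum>i. r ^ i)" using R by (intro sum_le_suminf summable_geometric) auto
    also have "\<dots> = 1 / (1 - r)" using R by (intro suminf_geometric) auto
    finally show ?thesis .
  qed
  let ?I = "{i\<in>{..<D}. cmod (root i) < R'}"
  have "(r / R') ^ card ?I \<le> 1 / (1 - r)"
    by (rule card_roots_in_disc[OF root[symmetric] p0 M]) (use R in auto)
  then have "(r / R') ^ card ?I < (r / R') ^ Suc K" using K by linarith
  moreover have "1 < r / R'" using R by simp
  ultimately have "card ?I < Suc K" by (rule power_less_imp_less_exp[rotated])
  then have cardI: "card ?I \<le> K" by simp
  have "\<exists>i\<in>?I. cmod (z - root i) \<le> t"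
  proof (rule ccontr)
    assume "\<not> ?thesis"
    then have far: "\<And>i. i \<in> ?I \<Longrightarrow> t < cmod (z - root i)" by force
    define b where "b = 1 - R / R'"
    have b: "0 < b" "b \<le> 1" using R by (auto simp: b_def field_simps)
    have val: "cmod (poly p z) = (\<Prod>i<D. cmod (1 - z / root i))"
    proof -
      have "cmod (poly p z) = cmod (poly p z) / cmod (poly p 0)" using p0 by simp
      also have "\<dots> = (\<Prod>i<D. cmod (z - root i)) / (\<Prod>i<D. cmod (root i))"
      proof -
        have "lead_coeff p \<noteq> 0" using p0 by auto
        then show ?thesis unfolding poly by (simp add: norm_mult prod_norm[symmetric])
      qed
      also have "\<dots> = (\<Prod>i<D. cmod (z - root i) / cmod (root i))" by (rule prod_dividef[symmetric])
      also have "\<dots> = (\<Prod>i<D. cmod (1 - z / root i))"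
      proof (rule prod.cong[OF refl])
        fix i assume "i \<in> {..<D}"
        then have "1 - z / root i = (root i - z) / root i" using nz[of i] by (simp add: diff_divide_distrib)
        then show "cmod (z - root i) / cmod (root i) = cmod (1 - z / root i)" by (simp add: norm_divide norm_minus_commute)
      qed
      finally show ?thesis .
    qed
    have out: "b \<le> cmod (1 - z / root i)" if "i \<in> {..<D} - ?I" for i
    proof -
      have "cmod (z / root i) \<le> R / R'" unfolding norm_divide
        using that z R by (intro frac_le) auto
      then show ?thesis using norm_triangle_ineq2[of 1 "z / root i"] by (simp add: b_def)
    qed
    have "in": "t \<le> cmod (1 - z / root i)" if "i \<in> ?I" for i
    proof -
      have ri: "0 < cmod (root i)" "cmod (root i) \<le> 1" using that nz[of i] R by auto
      have "1 - z / root i = (root i - z) / root i" using that nz[of i] by (simp add: diff_divide_distrib)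
      then have "cmod (1 - z / root i) = cmod (z - root i) / cmod (root i)" by (simp add: norm_divide norm_minus_commute)
      also have "\<dots> \<ge> cmod (z - root i) / 1" using ri by (intro divide_left_mono) auto
      finally show ?thesis using far[OF that] by simp
    qed
    have "b ^ n * t ^ K \<le> b ^ card ({..<D} - ?I) * t ^ card ?I"
    proof (intro mult_mono power_decreasing)
      have "card ({..<D} - ?I) \<le> card {..<D}" by (rule card_mono) auto
      then show "card ({..<D} - ?I) \<le> n" using D by simp
    qed (use b t cardI in auto)
    also have "\<dots> = (\<Prod>i\<in>{..<D} - ?I. b) * (\<Prod>i\<in>?I. t)" by simp
    also have "\<dots> \<le> (\<Prod>i\<in>{..<D} - ?I. cmod (1 - z / root i)) * (\<Prod>i\<in>?I. cmod (1 - z / root i))"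
      using b t out "in" by (intro mult_mono prod_mono prod_nonneg) auto
    also have "\<dots> = (\<Prod>i<D. cmod (1 - z / root i))"
      by (rule prod.subset_diff[symmetric]) auto
    finally show False using small val by (simp add: b_def)
  qed
  then obtain i where i: "i < D" "cmod (z - root i) \<le> t" by auto
  then have "(\<Prod>j<D. root i - root j) = 0" by (intro prod_zero) auto
  then have "poly p (root i) = 0" by (simp add: poly)
  then show ?thesis using i by blast
qed

text \<open>As the number \<open>K\<close> of relevant roots does not grow with \<open>n\<close>, a
  value below \<open>C ^ n\<close> means distance at most \<open>\<tau> ^ n\<close> to a root, where
  \<tau> can be prescribed by the choice of \<open>C\<close>. Every exponential number of roots is
  beaten in this way, whatever the exponent \<open>s\<close>. Annuli exhaust the punctured disc and
  keep the constants uniform.\<close>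

lemma dim0_not_separated: "dim0 {l. 0 < cmod l \<and> cmod l < 1 \<and> \<not> separated l}"
proof -
  have annulus: "dim0 {l. R0 \<le> cmod l \<and> cmod l \<le> R \<and> \<not> separated l}" (is "dim0 ?E") if R: "0 < R0" "R0 < 1" "0 < R" "R < 1" for R0 R
  proof (rule dim0_limsup)
    fix s :: real assume s: "s > 0"
    define R' r where "R' = (2 * R + 1) / 3" and "r = (R + 2) / 3"
    have rr: "R < R'" "R' < r" "r < 1" using R by (auto simp: R'_def r_def)
    have "1 < r / R'" using rr R by simp
    then obtain K where K0: "1 / (1 - r) < (r / R') ^ K" using real_arch_pow by blast
    have K: "1 / (1 - r) < (r / R') ^ Suc K"
      using K0 \<open>1 < r / R'\<close> power_increasing[of K "Suc K" "r / R'"] by simp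
    \<comment> \<open>There are at most \<open>3 ^ n * n\<close> roots;
      \<open>\<tau> powr s = 1 / 6\<close> leaves the summable \<open>n / 2 ^ n\<close>.\<close>
    define \<tau> where "\<tau> = (1 / 6) powr (1 / s)"
    have \<tau>: "0 < \<tau>" "\<tau> \<le> 1" using s by (auto simp: \<tau>_def intro!: powr_le1)
    have \<tau>s: "\<tau> powr s = 1 / 6" using s by (simp add: \<tau>_def powr_powr)
    \<comment> \<open>The factor \<open>R0\<close> pays for dividing out the power of
      \<open>l\<close> below the first nonzero coefficient; the other two factors match
      \<open>unit_poly_root_close\<close> with \<open>t = \<tau> ^ n\<close>.\<close>
    define C where "C = R0 * (1 - R / R') * \<tau> ^ K"
    have C: "C > 0" using R rr \<tau> by (simp add: C_def)
    define F where "F = (\<lambda>n. \<Union>p\<in>unit_polys n. {a. poly p a = 0})"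
    have pnz: "p \<noteq> 0" if "p \<in> unit_polys n" for p n using that by (auto simp: unit_polys_def)
    have finF: "finite (F n)" for n
      unfolding F_def using card_unit_polys(1) pnz poly_roots_finite by auto
    have cardF: "real (card (F n)) \<le> 3 ^ n * n" for n
    proof -
      have "card (F n) \<le> (\<Sum>p\<in>unit_polys n. card {a. poly p a = 0})"
        unfolding F_def by (rule card_UN_le[OF card_unit_polys(1)])
      also have "\<dots> \<le> (\<Sum>p\<in>unit_polys n. n)"
      proof (rule sum_mono)
        fix p assume p: "p \<in> unit_polys n"
        have "card {a. poly p a = 0} \<le> degree p" by (rule card_poly_roots_bound[OF pnz[OF p]])
        then show "card {a. poly p a = 0} \<le> n" using p by (simp add: unit_polys_def)
      qed
      also have "\<dots> \<le> 3 ^ n * n" using card_unit_polys(2)[of n] by simp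
      finally show ?thesis using of_nat_mono[where 'a = real, of "card (F n)" "3 ^ n * n"] by simp
    qed
    have "summable (\<lambda>n. real (card (F n)) * (\<tau> ^ n) powr s)"
    proof (rule summable_comparison_test')
      show "summable (\<lambda>n. real (Suc n) * (1 / 2) ^ n :: real)"
        by (rule sums_summable[OF geometric_deriv_sums]) simp
      fix n :: nat assume "0 \<le> n"
      have "(\<tau> ^ n) powr s = (1 / 6) ^ n"
        using \<tau> by (simp add: \<tau>s[symmetric] powr_realpow[symmetric] powr_powr mult.commute)
      then have "real (card (F n)) * (\<tau> ^ n) powr s \<le> (3 ^ n * n) * (1 / 6) ^ n"
        using cardF by (intro mult_mono) auto
      also have "\<dots> = real n * (1 / 2) ^ n" by (simp add: power_mult_distrib[symmetric] mult.commute mult.left_commute)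
      also have "\<dots> \<le> real (Suc n) * (1 / 2) ^ n" by (intro mult_right_mono) auto
      finally show "norm (real (card (F n)) * (\<tau> ^ n) powr s) \<le> real (Suc n) * (1 / 2) ^ n" by simp
    qed
    moreover have "\<exists>\<^sub>\<infinity>n. l \<in> (\<Union>c\<in>F n. cball c (\<tau> ^ n))" if l: "l \<in> ?E" for l
    proof -
      have "\<exists>\<^sub>F n in sequentially. \<exists>P::nat \<Rightarrow> int. range P \<subseteq> {-1, 0, 1} \<and> (\<exists>i<n. P i \<noteq> 0) \<and> cmod (\<Sum>i<n. of_int (P i) * l ^ i) < C ^ n"
        using l C unfolding separated_def not_eventually by (auto simp: not_eventually not_le)
      then have "\<exists>\<^sub>F n in sequentially. l \<in> (\<Union>c\<in>F n. cball c (\<tau> ^ n))"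
      proof (rule frequently_elim1)
        fix n assume "\<exists>P::nat \<Rightarrow> int. range P \<subseteq> {-1, 0, 1} \<and> (\<exists>i<n. P i \<noteq> 0) \<and> cmod (\<Sum>i<n. of_int (P i) * l ^ i) < C ^ n"
        then obtain P :: "nat \<Rightarrow> int" where P: "range P \<subseteq> {-1, 0, 1}" "\<exists>i<n. P i \<noteq> 0" "cmod (\<Sum>i<n. of_int (P i) * l ^ i) < C ^ n" by blast
        define a where "a = (LEAST i. P i \<noteq> 0)"
        have a: "P a \<noteq> 0" "a < n" "\<And>i. i < a \<Longrightarrow> P i = 0"
          using P(2) unfolding a_def by (metis (mono_tags, lifting) LeastI, metis (mono_tags, lifting) Least_le order_le_less_trans, metis (mono_tags, lifting) not_less_Least)
        define q where "q = (\<Sum>i<n - a. monom (of_int (P (i + a)) :: complex) i)"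
        have cq: "coeff q i = (if i < n - a then of_int (P (i + a)) else 0)" for i
          by (simp add: q_def coeff_sum sum.delta)
        have q: "q \<in> unit_polys n"
        proof -
          have "degree q \<le> n - a - 1" by (rule degree_le) (auto simp: cq)
          moreover have "of_int (P j) \<in> {-1, 0, 1::complex}" for j using P(1) by (auto dest!: subsetD[OF _ rangeI[of P j]])
          ultimately show ?thesis using a by (auto simp: unit_polys_def cq)
        qed
        have "(\<Sum>i<n. of_int (P i) * l ^ i) = (\<Sum>i\<in>{a..<n}. of_int (P i) * l ^ i)"
          by (rule sum.mono_neutral_right) (use a in auto)
        also have "\<dots> = (\<Sum>i<n - a. of_int (P (i + a)) * l ^ (i + a))"
          using sum.shift_bounds_nat_ivl[of "\<lambda>i. of_int (P i) * l ^ i" 0 a "n - a"] a(2) by (simp add: atLeast0LessThan)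
        also have "\<dots> = l ^ a * poly q l"
          by (simp add: q_def poly_sum poly_monom sum_distrib_left power_add mult_ac)
        finally have "cmod l ^ a * cmod (poly q l) < C ^ n" using P(3) by (simp add: norm_mult norm_power)
        moreover have "R0 ^ n \<le> cmod l ^ a"
        proof -
          have "R0 ^ n \<le> R0 ^ a" using R a(2) by (intro power_decreasing) auto
          also have "\<dots> \<le> cmod l ^ a" using l R by (intro power_mono) auto
          finally show ?thesis .
        qed
        then have "R0 ^ n * cmod (poly q l) \<le> cmod l ^ a * cmod (poly q l)" by (intro mult_right_mono) auto
        ultimately have "R0 ^ n * cmod (poly q l) < R0 ^ n * ((1 - R / R') ^ n * (\<tau> ^ n) ^ K)"
          by (simp add: C_def power_mult_distrib power_mult[symmetric] mult_ac)
        then have "cmod (poly q l) < (1 - R / R') ^ n * (\<tau> ^ n) ^ K" using R by simp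
        from unit_poly_root_close[OF q R(3) rr K _ _ _ this]
        obtain c where "poly q c = 0" "cmod (l - c) \<le> \<tau> ^ n" using l \<tau> by (auto simp: power_le_one)
        then show "l \<in> (\<Union>c\<in>F n. cball c (\<tau> ^ n))"
          using q by (auto simp: F_def dist_norm norm_minus_commute)
      qed
      then show ?thesis by (simp add: cofinite_eq_sequentially)
    qed
    ultimately show "\<exists>F r. (\<forall>n::nat. finite (F n)) \<and> (\<forall>n. 0 \<le> r n) \<and> summable (\<lambda>n. real (card (F n)) * r n powr s) \<and>
     (\<forall>x\<in>?E. \<exists>\<^sub>\<infinity>n. x \<in> (\<Union>c\<in>F n. cball c (r n)))"
      using finF \<tau> by (intro exI[of _ F] exI[of _ "\<lambda>n. \<tau> ^ n"] conjI ballI allI) auto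
  qed
  have "dim0 (\<Union>n. {l. 1 / (real n + 2) \<le> cmod l \<and> cmod l \<le> 1 - 1 / (real n + 2) \<and> \<not> separated l})"
  proof (intro dim0_UN)
    fix n :: nat
    have "0 < 1 / (real n + 2)" "1 / (real n + 2) < 1" by auto
    then show "dim0 {l. 1 / (real n + 2) \<le> cmod l \<and> cmod l \<le> 1 - 1 / (real n + 2) \<and> \<not> separated l}"
      by (intro annulus) auto
  qed
  then show ?thesis
  proof (rule dim0_subset, safe)
    fix l assume l: "0 < cmod l" "cmod l < 1" "\<not> separated l"
    define m where "m = min (cmod l) (1 - cmod l)"
    obtain n where "1 / real (Suc n) < m" using l reals_Archimedean[of m] by (auto simp: m_def inverse_eq_divide)
    moreover have "1 / (real n + 2) \<le> 1 / real (Suc n)" by (rule divide_left_mono) auto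
    ultimately have "1 / (real n + 2) \<le> cmod l" "cmod l \<le> 1 - 1 / (real n + 2)" by (auto simp: m_def)
    then show "l \<in> (\<Union>n. {l. 1 / (real n + 2) \<le> cmod l \<and> cmod l \<le> 1 - 1 / (real n + 2) \<and> \<not> separated l})"
      using l by blast
  qed
qed

section \<open>Power decay of the Fourier transform (Erdos--Kahane)\<close>

text \<open>The product is the modulus of the Fourier transform of the \<open>n\<close>-th partial
  sum with fair signs, at the conjugate frequency. The condition that links \<open>\<xi>\<close> and
  \<open>n\<close> admits the frequencies visible at the scale of the partial sum, with constants
  uniform in \<open>n\<close>.\<close>

definition fourier_decay :: "complex \<Rightarrow> bool" where
  "fourier_decay \<rho> \<longleftrightarrow> (\<exists>\<delta>>0. \<exists>C>0. \<forall>n \<xi>. 1 \<le> cmod \<xi> \<longrightarrow> cmod \<xi> * cmod \<rho> ^ n \<le> 1 \<longrightarrow>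
     (\<Prod>j<n. \<bar>cos (Re (\<rho> ^ j * \<xi>))\<bar>) \<le> C * cmod \<xi> powr (- \<delta>))"

text \<open>\<open>\<kappa>\<close> stands for \<open>1 / \<rho>\<close> and \<open>z\<close> for a
  frequency rescaled to bounded modulus, so the factors of the product are read backwards and the
  terms grow. After division by \<open>pi\<close>, a cosine is close to 1 in modulus precisely when
  the term is close to an integer.\<close>

definition ekx :: "complex \<Rightarrow> complex \<Rightarrow> nat \<Rightarrow> real" where
  "ekx \<kappa> z i = Re (\<kappa> ^ i * z) / pi"

text \<open>The characteristic polynomial is the real quadratic with roots \<kappa> and its
  conjugate.\<close>

lemma ekx_rec: "ekx \<kappa> z (i + 2) = 2 * Re \<kappa> * ekx \<kappa> z (i + 1) - (cmod \<kappa>)\<^sup>2 * ekx \<kappa> z i"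
proof -
  have "\<kappa>\<^sup>2 = of_real (2 * Re \<kappa>) * \<kappa> - of_real ((cmod \<kappa>)\<^sup>2)"
    unfolding cmod_power2 by (simp add: complex_eq_iff power2_eq_square algebra_simps)
  then have sq: "\<kappa>\<^sup>2 * w = of_real (2 * Re \<kappa>) * (\<kappa> * w) - of_real ((cmod \<kappa>)\<^sup>2) * w" for w
    by (simp only: left_diff_distrib mult.assoc)
  have "\<kappa> ^ (i + 2) * z = of_real (2 * Re \<kappa>) * (\<kappa> ^ (i + 1) * z) - of_real ((cmod \<kappa>)\<^sup>2) * (\<kappa> ^ i * z)"
    using sq[of "\<kappa> ^ i * z"] by (simp only: power_add power_one_right mult_ac)
  then have "Re (\<kappa> ^ (i + 2) * z) = 2 * Re \<kappa> * Re (\<kappa> ^ (i + 1) * z) - (cmod \<kappa>)\<^sup>2 * Re (\<kappa> ^ i * z)"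
  proof -
    assume eq: "\<kappa> ^ (i + 2) * z = of_real (2 * Re \<kappa>) * (\<kappa> ^ (i + 1) * z) - of_real ((cmod \<kappa>)\<^sup>2) * (\<kappa> ^ i * z)"
    have "Re (of_real a * w) = a * Re w" for a w by simp
    then show ?thesis by (simp only: eq minus_complex.sel)
  qed
  then show ?thesis unfolding ekx_def by (simp only: diff_divide_distrib times_divide_eq_right)
qed

text \<open>A Hankel determinant of three consecutive terms. For nonreal \<kappa> and nonzero
  \<open>z\<close> it does not vanish, and it grows like the square of the natural size of the
  terms; this makes the recovery of the recurrence coefficients stable.\<close>

lemma ekx_det: "(ekx \<kappa> z (i + 1))\<^sup>2 - ekx \<kappa> z i * ekx \<kappa> z (i + 2) = (cmod z)\<^sup>2 * (cmod \<kappa>) ^ (2 * i) * (Im \<kappa>)\<^sup>2 / pi\<^sup>2"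
proof -
  define w where "w = \<kappa> ^ i * z"
  have 1: "\<kappa> ^ (i + 1) * z = \<kappa> * w" "\<kappa> ^ (i + 2) * z = \<kappa> * (\<kappa> * w)" by (simp_all add: w_def power_add power2_eq_square algebra_simps)
  have "(Re (\<kappa> * w))\<^sup>2 - Re w * Re (\<kappa> * (\<kappa> * w)) = (cmod w)\<^sup>2 * (Im \<kappa>)\<^sup>2"
    unfolding cmod_power2 by (simp add: power2_eq_square algebra_simps)
  moreover have "(cmod w)\<^sup>2 = (cmod z)\<^sup>2 * (cmod \<kappa>) ^ (2 * i)"
    by (simp add: w_def norm_mult norm_power power_mult_distrib power_mult[symmetric] mult.commute)
  moreover have "(a / p)\<^sup>2 - b / p * (d / p) = (a\<^sup>2 - b * d) / p\<^sup>2" for a b d p :: real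
    by (simp add: power2_eq_square diff_divide_distrib)
  ultimately show ?thesis
    unfolding ekx_def 1 w_def[symmetric] by simp
qed

lemma ekx_bound: "\<bar>ekx \<kappa> z i\<bar> \<le> cmod z * cmod \<kappa> ^ i"
proof -
  have "\<bar>Re (\<kappa> ^ i * z)\<bar> \<le> cmod z * cmod \<kappa> ^ i"
    using abs_Re_le_cmod[of "\<kappa> ^ i * z"] by (simp add: norm_mult norm_power mult.commute)
  moreover have "\<bar>Re (\<kappa> ^ i * z)\<bar> / pi \<le> \<bar>Re (\<kappa> ^ i * z)\<bar>"
    using pi_gt3 by (simp add: divide_le_eq mult_le_cancel_left1)
  ultimately show ?thesis by (simp add: ekx_def)
qed

text \<open>Cramer's rule for a 2 by 2 Hankel system, in the form of a perturbation bound.\<close>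

lemma cramer_bound:
  fixes u v p q r :: real
  assumes 1: "u * q + v * p = e1" and 2: "u * r + v * q = e2"
    and det: "q * q - p * r \<ge> d" "d > 0"
    and e: "\<bar>e1\<bar> \<le> e" "\<bar>e2\<bar> \<le> e" and m: "\<bar>p\<bar> \<le> m" "\<bar>q\<bar> \<le> m" "\<bar>r\<bar> \<le> m"
  shows "\<bar>u\<bar> \<le> 2 * e * m / d" "\<bar>v\<bar> \<le> 2 * e * m / d"
proof -
  let ?D = "q * q - p * r"
  have "u * ?D = e1 * q - e2 * p" "v * ?D = e2 * q - e1 * r"
    unfolding 1[symmetric] 2[symmetric] by (simp_all add: algebra_simps)
  then have "\<bar>u\<bar> * ?D = \<bar>e1 * q - e2 * p\<bar>" "\<bar>v\<bar> * ?D = \<bar>e2 * q - e1 * r\<bar>"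
    using det by (metis abs_mult abs_of_pos less_le_trans)+
  moreover have "\<bar>a * b - c * f\<bar> \<le> 2 * e * m" if "\<bar>a\<bar> \<le> e" "\<bar>b\<bar> \<le> m" "\<bar>c\<bar> \<le> e" "\<bar>f\<bar> \<le> m" for a b c f
  proof -
    have "\<bar>a * b - c * f\<bar> \<le> \<bar>a\<bar> * \<bar>b\<bar> + \<bar>c\<bar> * \<bar>f\<bar>" by (metis abs_mult abs_triangle_ineq4)
    also have "\<dots> \<le> e * m + e * m" by (intro add_mono mult_mono) (use that in auto)
    finally show ?thesis by simp
  qed
  ultimately have "\<bar>u\<bar> * ?D \<le> 2 * e * m" "\<bar>v\<bar> * ?D \<le> 2 * e * m" using e m by auto
  moreover have "\<bar>u\<bar> * d \<le> \<bar>u\<bar> * ?D" "\<bar>v\<bar> * d \<le> \<bar>v\<bar> * ?D" using det by (auto intro: mult_left_mono)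
  ultimately have "\<bar>u\<bar> * d \<le> 2 * e * m" "\<bar>v\<bar> * d \<le> 2 * e * m" by linarith+
  then show "\<bar>u\<bar> \<le> 2 * e * m / d" "\<bar>v\<bar> \<le> 2 * e * m / d" using det by (auto simp: le_divide_eq)
qed

text \<open>The covering argument needs uniform constants, so \<kappa> is kept in a compact set away
  from the unit circle and from the real axis. Countably many such sets exhaust the
  parameters.\<close>

locale erdos_kahane =
  fixes Lo L c :: real
  assumes Lo: "1 < Lo" and L: "Lo \<le> L" and c: "0 < c"
begin

definition "cls = {\<kappa>. Lo \<le> cmod \<kappa> \<and> cmod \<kappa> \<le> L \<and> c \<le> \<bar>Im \<kappa>\<bar>}"

text \<open>\<open>D\<close> is the Lipschitz constant for recovering the recurrence coefficients
  from four consecutive terms, and \<open>CC\<close> bounds the amplification of errors by one step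
  of the recurrence. The threshold \<open>c0\<close> is so small that errors below it leave only one
  candidate for the next integer; \<open>B\<close> exceeds the spread of the candidates in the
  remaining cases.\<close>

definition "D = 2 * pi\<^sup>2 * (1 + L)\<^sup>2 * L\<^sup>2 / c\<^sup>2"
definition "CC = (1 + L)\<^sup>2 + 2 * D * L ^ 5"
definition "c0 = 1 / (4 * (CC + 1))"
definition "B = nat \<lceil>CC + 2 * L ^ 5 + 2\<rceil> + 1"

lemma L1: "L > 1" using Lo L by simp

lemma D_pos: "D > 0" unfolding D_def using L1 c by simp

lemma CC_ge: "CC \<ge> 1"
proof -
  have "1 \<le> (1 + L)\<^sup>2" using L1 by (intro one_le_power) simp
  moreover have "0 \<le> 2 * D * L ^ 5" using L1 D_pos by (intro mult_nonneg_nonneg) auto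
  ultimately show ?thesis by (simp add: CC_def)
qed

lemma c0: "0 < c0" "c0 \<le> 1 / 8" "2 * c0 * CC + 2 * c0 < 1"
proof -
  show "0 < c0" using CC_ge by (simp add: c0_def)
  show "c0 \<le> 1 / 8" unfolding c0_def using CC_ge by (intro divide_left_mono) auto
  have "c0 * (CC + 1) = 1 / 4" using CC_ge by (simp add: c0_def)
  then show "2 * c0 * CC + 2 * c0 < 1" by (simp add: distrib_left)
qed

text \<open>Subtracting the two recurrences makes the coefficient differences the solution of a
  linear system with small right-hand side. Its determinant is of order
  \<open>(cmod z * cmod \<kappa> ^ j)\<^sup>2\<close> while its entries are of order
  \<open>cmod z * cmod \<kappa> ^ j\<close>; hence the gain
  \<open>cmod \<kappa> ^ j\<close>.\<close>

lemma coeff_close: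
  assumes \<kappa>: "\<kappa> \<in> cls" "\<kappa>' \<in> cls" and z: "1 \<le> cmod z"
    and e: "\<And>i. i \<in> {j..j+3} \<Longrightarrow> \<bar>ekx \<kappa> z i - ekx \<kappa>' z' i\<bar> \<le> e"
  shows "\<bar>2 * Re \<kappa> - 2 * Re \<kappa>'\<bar> \<le> D * e / cmod \<kappa> ^ j" "\<bar>(cmod \<kappa>)\<^sup>2 - (cmod \<kappa>')\<^sup>2\<bar> \<le> D * e / cmod \<kappa> ^ j"
proof -
  let ?x = "ekx \<kappa> z" and ?y = "ekx \<kappa>' z'"
  let ?a = "2 * Re \<kappa>" and ?b = "- (cmod \<kappa>)\<^sup>2" and ?a' = "2 * Re \<kappa>'" and ?b' = "- (cmod \<kappa>')\<^sup>2"
  define m where "m = cmod z * cmod \<kappa> ^ j * L\<^sup>2"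
  define d where "d = (cmod z)\<^sup>2 * (cmod \<kappa>) ^ (2 * j) * c\<^sup>2 / pi\<^sup>2"
  have k: "1 < cmod \<kappa>" "cmod \<kappa> \<le> L" "cmod \<kappa>' \<le> L" "c \<le> \<bar>Im \<kappa>\<bar>" using \<kappa> Lo by (auto simp: cls_def)
  have e0: "e \<ge> 0" using e[of j] by simp
  have rec: "?x (i + 2) = ?a * ?x (i + 1) + ?b * ?x i" "?y (i + 2) = ?a' * ?y (i + 1) + ?b' * ?y i" for i
    using ekx_rec[of \<kappa> z i] ekx_rec[of \<kappa>' z' i] by simp_all
  define E where "E = (\<lambda>i. (?x (i + 2) - ?y (i + 2)) - ?a' * (?x (i + 1) - ?y (i + 1)) - ?b' * (?x i - ?y i))"
  have eqE: "(?a - ?a') * ?x (i + 1) + (?b - ?b') * ?x i = E i" for i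
    unfolding E_def rec by (simp add: algebra_simps)
  have a': "\<bar>?a'\<bar> \<le> 2 * L" "\<bar>?b'\<bar> \<le> L\<^sup>2"
    using abs_Re_le_cmod[of \<kappa>'] k power_mono[of "cmod \<kappa>'" L 2] by auto
  have Eb: "\<bar>E i\<bar> \<le> e * (1 + L)\<^sup>2" if "i \<in> {j, j + 1}" for i
  proof -
    have "\<bar>E i\<bar> \<le> \<bar>?x (i + 2) - ?y (i + 2)\<bar> + \<bar>?a'\<bar> * \<bar>?x (i + 1) - ?y (i + 1)\<bar> + \<bar>?b'\<bar> * \<bar>?x i - ?y i\<bar>"
      unfolding E_def abs_mult[symmetric] by linarith
    also have "\<dots> \<le> e + 2 * L * e + L\<^sup>2 * e"
      using that L1 e0 by (intro add_mono mult_mono a' e) auto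
    finally show ?thesis by (simp add: power2_eq_square algebra_simps)
  qed
  have xm: "\<bar>?x i\<bar> \<le> m" if "i \<in> {j, j + 1, j + 2}" for i
  proof -
    have "\<bar>?x i\<bar> \<le> cmod z * cmod \<kappa> ^ i" by (rule ekx_bound)
    also have "\<dots> = cmod z * cmod \<kappa> ^ j * cmod \<kappa> ^ (i - j)" using that by (auto simp: power_add[symmetric])
    also have "\<dots> \<le> cmod z * cmod \<kappa> ^ j * L\<^sup>2"
    proof -
      have "cmod \<kappa> ^ (i - j) \<le> cmod \<kappa> ^ 2" using that k by (intro power_increasing) auto
      also have "\<dots> \<le> L\<^sup>2" using k by (intro power_mono) auto
      finally show ?thesis by (intro mult_left_mono) auto
    qed
    finally show ?thesis by (simp add: m_def)
  qed
  have d: "d > 0" unfolding d_def using z k c by (intro divide_pos_pos mult_pos_pos zero_less_power) auto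
  have det: "?x (j + 1) * ?x (j + 1) - ?x j * ?x (j + 2) \<ge> d"
  proof -
    have "c\<^sup>2 \<le> (Im \<kappa>)\<^sup>2" using k(4) c by (metis abs_le_square_iff abs_of_pos)
    then have "d \<le> (cmod z)\<^sup>2 * (cmod \<kappa>) ^ (2 * j) * (Im \<kappa>)\<^sup>2 / pi\<^sup>2"
      unfolding d_def by (intro divide_right_mono mult_left_mono) auto
    then show ?thesis using ekx_det[of \<kappa> z j] by (simp add: power2_eq_square)
  qed
  have "j + 1 + 1 = j + 2" by simp
  note sys = eqE[of j] eqE[of "j + 1", unfolded this]
  have "\<bar>?a - ?a'\<bar> \<le> 2 * (e * (1 + L)\<^sup>2) * m / d" "\<bar>?b - ?b'\<bar> \<le> 2 * (e * (1 + L)\<^sup>2) * m / d"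
    by (rule cramer_bound[OF sys det d Eb Eb xm xm xm]; simp)+
  moreover have "2 * (e * (1 + L)\<^sup>2) * m / d \<le> D * e / cmod \<kappa> ^ j"
  proof -
    have gen: "2 * (e * u) * (Z * G * w) / ((Z * Z) * (G * G) * q / p) = (2 * p * u * w / q * e / G) / Z"
      if "Z \<noteq> 0" "G \<noteq> 0" "q \<noteq> 0" "p \<noteq> 0" for u w Z G q p :: real
      using that by (simp add: field_simps)
    have "cmod z \<noteq> 0" "cmod \<kappa> ^ j \<noteq> 0" "c\<^sup>2 \<noteq> 0" "pi\<^sup>2 \<noteq> 0" using z k c by auto
    from gen[OF this, of "(1 + L)\<^sup>2" "L\<^sup>2"]
    have "2 * (e * (1 + L)\<^sup>2) * m / d = (D * e / cmod \<kappa> ^ j) / cmod z"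
      unfolding m_def d_def D_def by (simp only: power2_eq_square[of "cmod z"] mult_2 power_add)
    also have "\<dots> \<le> (D * e / cmod \<kappa> ^ j) / 1"
      using z e0 D_pos k by (intro divide_left_mono) auto
    finally show ?thesis by simp
  qed
  ultimately show "\<bar>2 * Re \<kappa> - 2 * Re \<kappa>'\<bar> \<le> D * e / cmod \<kappa> ^ j" "\<bar>(cmod \<kappa>)\<^sup>2 - (cmod \<kappa>')\<^sup>2\<bar> \<le> D * e / cmod \<kappa> ^ j"
    by linarith+
qed

text \<open>The gain \<open>cmod \<kappa> ^ j\<close> in the coefficients cancels against the size
  of the terms that they multiply, so the amplification does not depend on \<open>j\<close>.\<close>

lemma next_close:
  assumes \<kappa>: "\<kappa> \<in> cls" "\<kappa>' \<in> cls" and z: "1 \<le> cmod z" "cmod z \<le> L\<^sup>2"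
    and e: "\<And>i. i \<in> {j..j+3} \<Longrightarrow> \<bar>ekx \<kappa> z i - ekx \<kappa>' z' i\<bar> \<le> e"
  shows "\<bar>ekx \<kappa> z (j + 4) - ekx \<kappa>' z' (j + 4)\<bar> \<le> CC * e"
proof -
  let ?x = "ekx \<kappa> z" and ?y = "ekx \<kappa>' z'"
  let ?a = "2 * Re \<kappa>" and ?b = "- (cmod \<kappa>)\<^sup>2" and ?a' = "2 * Re \<kappa>'" and ?b' = "- (cmod \<kappa>')\<^sup>2"
  have k: "1 < cmod \<kappa>" "cmod \<kappa> \<le> L" "cmod \<kappa>' \<le> L" using \<kappa> Lo by (auto simp: cls_def)
  have e0: "e \<ge> 0" using e[of j] by simp
  define g where "g = cmod \<kappa> ^ j"
  have "cmod \<kappa> > 0" using k(1) by linarith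
  then have g: "g > 0" unfolding g_def by (rule zero_less_power)
  have rec: "?x (j + 4) = ?a * ?x (j + 3) + ?b * ?x (j + 2)" "?y (j + 4) = ?a' * ?y (j + 3) + ?b' * ?y (j + 2)"
    using ekx_rec[of \<kappa> z "j + 2"] ekx_rec[of \<kappa>' z' "j + 2"] by (simp_all add: numeral_eq_Suc)
  have ab: "\<bar>?a - ?a'\<bar> \<le> D * e / g" "\<bar>?b - ?b'\<bar> \<le> D * e / g"
    using coeff_close[OF \<kappa> z(1), where j = j and e = e and z' = z', OF e] unfolding g_def by linarith+
  have a': "\<bar>?a'\<bar> \<le> 2 * L" "\<bar>?b'\<bar> \<le> L\<^sup>2"
    using abs_Re_le_cmod[of \<kappa>'] k power_mono[of "cmod \<kappa>'" L 2] by auto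
  have xm: "\<bar>?x i\<bar> \<le> L ^ 5 * g" if "i \<in> {j + 2, j + 3}" for i
  proof -
    have "\<bar>?x i\<bar> \<le> cmod z * cmod \<kappa> ^ i" by (rule ekx_bound)
    also have "\<dots> = cmod z * cmod \<kappa> ^ (i - j) * g" using that by (auto simp: power_add g_def power2_eq_square)
    also have "\<dots> \<le> L\<^sup>2 * L ^ 3 * g"
    proof -
      have "cmod \<kappa> ^ (i - j) \<le> cmod \<kappa> ^ 3" using that k by (intro power_increasing) auto
      also have "\<dots> \<le> L ^ 3" using k by (intro power_mono) auto
      finally show ?thesis using z L1 g by (intro mult_right_mono mult_mono) auto
    qed
    finally show ?thesis by (simp add: power_add[symmetric])
  qed
  have "?x (j + 4) - ?y (j + 4) = ?a' * (?x (j + 3) - ?y (j + 3)) + ?b' * (?x (j + 2) - ?y (j + 2)) + (?a - ?a') * ?x (j + 3) + (?b - ?b') * ?x (j + 2)"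
    unfolding rec by (simp add: algebra_simps)
  then have "\<bar>?x (j + 4) - ?y (j + 4)\<bar> \<le> \<bar>?a'\<bar> * \<bar>?x (j + 3) - ?y (j + 3)\<bar> + \<bar>?b'\<bar> * \<bar>?x (j + 2) - ?y (j + 2)\<bar> + \<bar>?a - ?a'\<bar> * \<bar>?x (j + 3)\<bar> + \<bar>?b - ?b'\<bar> * \<bar>?x (j + 2)\<bar>"
    unfolding abs_mult[symmetric] by linarith
  also have "\<dots> \<le> 2 * L * e + L\<^sup>2 * e + D * e / g * (L ^ 5 * g) + D * e / g * (L ^ 5 * g)"
    using L1 e0 D_pos g by (intro add_mono mult_mono a' ab xm e) auto
  also have "\<dots> = (2 * L + L\<^sup>2 + 2 * D * L ^ 5) * e" using g by (simp add: algebra_simps)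
  also have "\<dots> \<le> CC * e" unfolding CC_def using e0 L1 by (intro mult_right_mono) (auto simp: power2_eq_square algebra_simps)
  finally show ?thesis .
qed

section \<open>Coding parameters by nearest integers\<close>

definition "rnd \<kappa> z i = round (ekx \<kappa> z i)"
definition "err \<kappa> z i = \<bar>ekx \<kappa> z i - of_int (rnd \<kappa> z i)\<bar>"
definition "bad \<kappa> z N = {i\<in>{..<N}. c0 \<le> err \<kappa> z i}"
text \<open>The positions where the recurrence does not determine the integer: the first four, and
  those with a bad index among \<open>j - 4, ..., j\<close>.\<close>

definition aff :: "nat set \<Rightarrow> nat \<Rightarrow> nat set" where
  "aff S N = {j\<in>{..<N}. j < 4 \<or> (\<exists>i\<in>S. i \<le> j \<and> j \<le> i + 4)}"

lemma err_le: "err \<kappa> z i \<le> 1 / 2"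
  unfolding err_def rnd_def using of_int_round_abs_le[of "ekx \<kappa> z i"] by (simp add: abs_minus_commute)

text \<open>
  Away from the bad indices the nearest integers nearly satisfy the recurrence \<open>ekx_rec\<close>, whose
  coefficients can be recovered from four consecutive terms.  So every integer is determined by the previous
  ones there, and up to a bounded error, hence by its residue modulo \<open>B\<close>, everywhere else.
\<close>

lemma same_code:
  assumes \<kappa>: "\<kappa> \<in> cls" "\<kappa>' \<in> cls" and z: "1 \<le> cmod z" "cmod z \<le> L\<^sup>2" "cmod z' \<le> L\<^sup>2"
    and bad: "bad \<kappa> z N = bad \<kappa>' z' N"
    and code: "\<And>j. j \<in> aff (bad \<kappa> z N) N \<Longrightarrow> rnd \<kappa> z j mod int B = rnd \<kappa>' z' j mod int B"
  shows "j < N \<Longrightarrow> rnd \<kappa> z j = rnd \<kappa>' z' j"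
proof (induction j rule: less_induct)
  case (less j)
  let ?x = "ekx \<kappa> z" and ?y = "ekx \<kappa>' z'"
  have B: "real B > CC + 2 * L ^ 5 + 2" unfolding B_def by linarith
  have L5: "L ^ 5 \<ge> 1" using L1 by (simp add: one_le_power)
  have modeq: "rnd \<kappa> z j = rnd \<kappa>' z' j" if "\<bar>?x j - ?y j\<bar> \<le> CC + 2 * L ^ 5" "j \<in> aff (bad \<kappa> z N) N"
  proof -
    have "\<bar>real_of_int (rnd \<kappa> z j - rnd \<kappa>' z' j)\<bar> \<le> CC + 2 * L ^ 5 + 1"
      using that(1) err_le[of \<kappa> z j] err_le[of \<kappa>' z' j] unfolding err_def of_int_diff by linarith
    then have "\<bar>rnd \<kappa> z j - rnd \<kappa>' z' j\<bar> < int B" using B by linarith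
    moreover have "int B dvd rnd \<kappa> z j - rnd \<kappa>' z' j" using code[OF that(2)] by (simp add: mod_eq_dvd_iff)
    ultimately show ?thesis using zdvd_imp_le[of "int B" "\<bar>rnd \<kappa> z j - rnd \<kappa>' z' j\<bar>"] by (cases "rnd \<kappa> z j = rnd \<kappa>' z' j") auto
  qed
  show ?case
  proof (cases "j < 4")
    case True
    have "\<bar>ekx \<kappa> z j\<bar> \<le> L ^ 5" if "\<kappa> \<in> cls" "cmod z \<le> L\<^sup>2" for \<kappa> z
    proof -
      have k: "1 < cmod \<kappa>" "cmod \<kappa> \<le> L" using that Lo by (auto simp: cls_def)
      have "\<bar>ekx \<kappa> z j\<bar> \<le> cmod z * cmod \<kappa> ^ j" by (rule ekx_bound)
      also have "\<dots> \<le> L\<^sup>2 * L ^ 3"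
      proof (rule mult_mono)
        have "cmod \<kappa> ^ j \<le> cmod \<kappa> ^ 3" using True k by (intro power_increasing) auto
        also have "\<dots> \<le> L ^ 3" using k by (intro power_mono) auto
        finally show "cmod \<kappa> ^ j \<le> L ^ 3" .
      qed (use that L1 in auto)
      finally show ?thesis by (simp add: power_add[symmetric])
    qed
    from this[OF \<kappa>(1) z(2)] this[OF \<kappa>(2) z(3)] have "\<bar>?x j - ?y j\<bar> \<le> CC + 2 * L ^ 5" using CC_ge by linarith
    then show ?thesis using True less.prems by (intro modeq) (auto simp: aff_def)
  next
    case False
    define i where "i = j - 4"
    have ji: "j = i + 4" using False by (simp add: i_def)
    have eq: "rnd \<kappa> z m = rnd \<kappa>' z' m" if "m \<in> {i..i+3}" for m
      using less.IH[of m] less.prems that by (auto simp: ji)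
    have diff: "\<bar>?x m - ?y m\<bar> \<le> err \<kappa> z m + err \<kappa>' z' m" if "m \<in> {i..i+3}" for m
      using eq[OF that] unfolding err_def by linarith
    show ?thesis
    proof (cases "j \<in> aff (bad \<kappa> z N) N")
      case True
      \<comment> \<open>Here only the rounding error 1/2 of each sequence is available, so the
        residue modulo \<open>B\<close> has to decide.\<close>
      have "\<bar>?x m - ?y m\<bar> \<le> 1" if "m \<in> {i..i+3}" for m
        using diff[OF that] err_le[of \<kappa> z m] err_le[of \<kappa>' z' m] by linarith
      from next_close[OF \<kappa> z(1,2) this] have "\<bar>?x j - ?y j\<bar> \<le> CC" by (simp add: ji)
      then show ?thesis using True L5 by (intro modeq) auto
    next
      case False
      then have notbad: "m \<notin> bad \<kappa> z N" if "m \<in> {i..i+4}" for m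
        using that less.prems by (auto simp: aff_def ji)
      have small: "err \<kappa> z m < c0" "err \<kappa>' z' m < c0" if "m \<in> {i..i+4}" for m
        using notbad[OF that] notbad[OF that, unfolded bad] that less.prems by (auto simp: bad_def ji)
      have "\<bar>?x m - ?y m\<bar> \<le> 2 * c0" if "m \<in> {i..i+3}" for m
        using diff[OF that] small[of m] that by force
      from next_close[OF \<kappa> z(1,2) this] have "\<bar>?x j - ?y j\<bar> \<le> CC * (2 * c0)" by (simp add: ji)
      then have "\<bar>real_of_int (rnd \<kappa> z j - rnd \<kappa>' z' j)\<bar> < 1"
        proof -
        have "err \<kappa> z j < c0" "err \<kappa>' z' j < c0" using small[of j] by (simp_all add: ji)
        moreover have "CC * (2 * c0) + 2 * c0 < 1" using c0(3) by (simp add: mult_ac)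
        moreover assume "\<bar>?x j - ?y j\<bar> \<le> CC * (2 * c0)"
        ultimately show ?thesis unfolding err_def of_int_diff by linarith
      qed
      then show ?thesis by linarith
    qed
  qed
qed

text \<open>Equal integers make the sequences differ by at most 1, so at the end of the range the
  coefficients agree up to order \<open>Lo ^ (N - 4)\<close> in the denominator.
  \<open>(\<kappa>' - \<kappa>) * (\<kappa>' - cnj \<kappa>)\<close> is the quadratic polynomial of
  \<kappa> at \<open>\<kappa>'\<close>, hence equally small, and one factor is at most the square
  root. Real parts alone cannot tell \<kappa> from its conjugate.\<close>

lemma same_code_close:
  assumes \<kappa>: "\<kappa> \<in> cls" "\<kappa>' \<in> cls" and z: "1 \<le> cmod z"
    and eq: "\<And>j. j < N \<Longrightarrow> rnd \<kappa> z j = rnd \<kappa>' z' j" and N: "N \<ge> 4"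
  shows "\<exists>w\<in>{\<kappa>, cnj \<kappa>}. cmod (\<kappa>' - w) \<le> sqrt (D * (L + 1) / Lo ^ (N - 4))"
proof -
  have k: "Lo \<le> cmod \<kappa>" "cmod \<kappa>' \<le> L" using \<kappa> by (auto simp: cls_def)
  have e: "\<bar>ekx \<kappa> z i - ekx \<kappa>' z' i\<bar> \<le> 1" if "i \<in> {N - 4..N - 4 + 3}" for i
  proof -
    have "i < N" using that N by auto
    then show ?thesis using eq[of i] err_le[of \<kappa> z i] err_le[of \<kappa>' z' i] unfolding err_def by linarith
  qed
  define \<eta> where "\<eta> = D / Lo ^ (N - 4)"
  have "cmod \<kappa> > 0" using k Lo by linarith
  then have k0: "cmod \<kappa> ^ (N - 4) > 0" by (rule zero_less_power)
  have "D * 1 / cmod \<kappa> ^ (N - 4) \<le> \<eta>"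
    unfolding \<eta>_def using D_pos Lo k k0 by (simp, intro divide_left_mono power_mono mult_pos_pos) auto
  then have ab: "\<bar>2 * Re \<kappa> - 2 * Re \<kappa>'\<bar> \<le> \<eta>" "\<bar>(cmod \<kappa>)\<^sup>2 - (cmod \<kappa>')\<^sup>2\<bar> \<le> \<eta>"
    using coeff_close[OF \<kappa> z, where j = "N - 4" and e = 1 and z' = z', OF e] by linarith+
  have "(\<kappa>' - \<kappa>) * (\<kappa>' - cnj \<kappa>) = of_real (2 * Re \<kappa>' - 2 * Re \<kappa>) * \<kappa>' - of_real ((cmod \<kappa>')\<^sup>2 - (cmod \<kappa>)\<^sup>2)"
    unfolding cmod_power2 by (simp add: complex_eq_iff power2_eq_square algebra_simps)
  then have "cmod (\<kappa>' - \<kappa>) * cmod (\<kappa>' - cnj \<kappa>) \<le> \<bar>2 * Re \<kappa>' - 2 * Re \<kappa>\<bar> * cmod \<kappa>' + \<bar>(cmod \<kappa>')\<^sup>2 - (cmod \<kappa>)\<^sup>2\<bar>"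
    by (metis norm_mult norm_of_real norm_triangle_ineq4)
  also have "\<dots> \<le> \<eta> * L + \<eta>"
    using ab k L1 by (intro add_mono mult_mono) (auto simp: abs_minus_commute)
  finally have prod: "cmod (\<kappa>' - \<kappa>) * cmod (\<kappa>' - cnj \<kappa>) \<le> D * (L + 1) / Lo ^ (N - 4)"
    by (simp add: \<eta>_def add_divide_distrib algebra_simps)
  show ?thesis
  proof (rule ccontr)
    assume "\<not> ?thesis"
    then have "sqrt (D * (L + 1) / Lo ^ (N - 4)) < cmod (\<kappa>' - \<kappa>)" "sqrt (D * (L + 1) / Lo ^ (N - 4)) < cmod (\<kappa>' - cnj \<kappa>)" by auto
    moreover have "0 \<le> D * (L + 1) / Lo ^ (N - 4)" using D_pos L1 Lo by (intro divide_nonneg_nonneg mult_nonneg_nonneg) auto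
    ultimately have "sqrt (D * (L + 1) / Lo ^ (N - 4)) * sqrt (D * (L + 1) / Lo ^ (N - 4)) < cmod (\<kappa>' - \<kappa>) * cmod (\<kappa>' - cnj \<kappa>)"
      by (intro mult_strict_mono) auto
    moreover have "sqrt W * sqrt W = W" if "0 \<le> W" for W using that by simp
    ultimately show False using prod \<open>0 \<le> D * (L + 1) / Lo ^ (N - 4)\<close> by (metis not_less)
  qed
qed

text \<open>The rescaled frequency is quantified away, so that a single covering serves all
  frequencies.\<close>

definition badset :: "real \<Rightarrow> nat \<Rightarrow> complex set" where
  "badset \<gamma> N = {\<kappa>\<in>cls. \<exists>z. 1 \<le> cmod z \<and> cmod z \<le> L\<^sup>2 \<and> real (card (bad \<kappa> z N)) \<le> \<gamma> * N}"

lemma B_ge: "B \<ge> 1" by (simp add: B_def)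

lemma card_aff:
  assumes "finite S"
  shows "card (aff S N) \<le> 4 + 5 * card S"
proof -
  have "aff S N \<subseteq> {..<4} \<union> (\<Union>i\<in>S. {i..i+4})" by (auto simp: aff_def)
  then have "card (aff S N) \<le> card ({..<4} \<union> (\<Union>i\<in>S. {i..i+4}))" using assms by (intro card_mono) auto
  also have "\<dots> \<le> card {..<4::nat} + card (\<Union>i\<in>S. {i..i+4})" by (rule card_Un_le)
  also have "\<dots> \<le> 4 + (\<Sum>i\<in>S. card {i..i+4})" using card_UN_le[OF assms, of "\<lambda>i. {i..i+4}"] by simp
  finally show ?thesis by simp
qed

definition codes :: "real \<Rightarrow> nat \<Rightarrow> (nat set \<times> (nat \<Rightarrow> int)) set" where
  "codes \<gamma> N = (SIGMA S:{S. S \<subseteq> {..<N} \<and> real (card S) \<le> \<gamma> * N}. aff S N \<rightarrow>\<^sub>E {0..<int B})"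

text \<open>The weight \<open>y ^ card S\<close> turns the sum over sets into
  \<open>(1 + y) ^ N\<close>. Since \<open>card S \<le> \<gamma> * N\<close>, the price for the
  weight and for the residues is at most \<open>(B ^ 5 / y) powr (\<gamma> * N)\<close>, apart from
  \<open>B ^ 4\<close> for the first four positions. Small \<open>y\<close> and then small \<gamma>
  bring the growth rate as close to 1 as desired.\<close>

lemma codes_card:
  fixes \<gamma> y :: real
  assumes y: "0 < y" "y \<le> 1" and g: "0 < \<gamma>"
  shows "finite (codes \<gamma> N)" "real (card (codes \<gamma> N)) \<le> B ^ 4 * ((B ^ 5 / y) powr \<gamma> * (1 + y)) ^ N"
proof -
  let ?P = "{S. S \<subseteq> {..<N} \<and> real (card S) \<le> \<gamma> * N}"
  have finP: "finite ?P" by (rule finite_subset[of _ "Pow {..<N}"]) auto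
  have finS: "finite S" if "S \<in> ?P" for S using that finite_subset by blast
  have finaff: "finite (aff S N)" for S by (simp add: aff_def)
  show "finite (codes \<gamma> N)" unfolding codes_def by (intro finite_SigmaI finP finite_PiE finaff) simp
  have Bge: "real B \<ge> 1" using B_ge by simp
  have By: "1 \<le> B ^ 5 / y"
  proof -
    have "1 \<le> real B ^ 5" using Bge by (rule one_le_power)
    then show ?thesis using y by (simp add: le_divide_eq)
  qed
  have "card (codes \<gamma> N) = (\<Sum>S\<in>?P. B ^ card (aff S N))"
    unfolding codes_def by (subst card_SigmaI) (auto simp: finP finaff card_PiE intro!: finite_PiE)
  then have "real (card (codes \<gamma> N)) = (\<Sum>S\<in>?P. real B ^ card (aff S N))" by simp
  also have "\<dots> \<le> (\<Sum>S\<in>?P. B ^ 4 * ((B ^ 5 / y) powr (\<gamma> * N) * y ^ card S))"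
  proof (rule sum_mono)
    fix S assume S: "S \<in> ?P"
    have "real B ^ card (aff S N) \<le> real B ^ (4 + 5 * card S)"
      using card_aff[OF finS[OF S]] Bge by (intro power_increasing) auto
    also have "\<dots> = B ^ 4 * ((B ^ 5 / y) ^ card S * y ^ card S)"
      using y by (simp add: power_add power_mult power_divide)
    also have "(B ^ 5 / y) ^ card S \<le> (B ^ 5 / y) powr (\<gamma> * N)"
    proof -
      have "(B ^ 5 / y) ^ card S = (B ^ 5 / y) powr (real (card S))" using By by (subst powr_realpow) auto
      also have "\<dots> \<le> (B ^ 5 / y) powr (\<gamma> * N)" using By S by (intro powr_mono) auto
      finally show ?thesis .
    qed
    finally show "real B ^ card (aff S N) \<le> B ^ 4 * ((B ^ 5 / y) powr (\<gamma> * N) * y ^ card S)"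
      using y by (simp add: mult_left_mono mult_right_mono)
  qed
  also have "\<dots> = B ^ 4 * (B ^ 5 / y) powr (\<gamma> * N) * (\<Sum>S\<in>?P. y ^ card S)"
    by (simp add: sum_distrib_left mult.assoc)
  also have "\<dots> \<le> B ^ 4 * (B ^ 5 / y) powr (\<gamma> * N) * (\<Sum>S\<in>Pow {..<N}. y ^ card S)"
    using y by (intro mult_left_mono sum_mono2) auto
  also have "(\<Sum>S\<in>Pow {..<N}. y ^ card S) = (1 + y) ^ N"
    using prod_add[of "{..<N}" "\<lambda>_. y" "\<lambda>_. 1"] by (simp add: add.commute)
  also have "B ^ 4 * (B ^ 5 / y) powr (\<gamma> * N) * (1 + y) ^ N = B ^ 4 * ((B ^ 5 / y) powr \<gamma> * (1 + y)) ^ N"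
  proof -
    have "(B ^ 5 / y) powr (\<gamma> * N) = ((B ^ 5 / y) powr \<gamma>) ^ N"
      using By B_ge y by (subst powr_realpow[symmetric]) (auto simp: powr_powr)
    then show ?thesis by (simp add: power_mult_distrib)
  qed
  finally show "real (card (codes \<gamma> N)) \<le> B ^ 4 * ((B ^ 5 / y) powr \<gamma> * (1 + y)) ^ N" .
qed

text \<open>One representative is chosen for each code that occurs; by \<open>same_code\<close> and
  \<open>same_code_close\<close> any parameter with the same code is close to it or to its
  conjugate. The modulus of the centres is recorded for a later inversion.\<close>

lemma cover_badset:
  fixes \<gamma> :: real
  assumes N: "N \<ge> 4" and fin: "finite (codes \<gamma> N)"
  shows "\<exists>F. finite F \<and> card F \<le> 2 * card (codes \<gamma> N) \<and> F \<subseteq> {w. 1 < cmod w} \<and>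
    badset \<gamma> N \<subseteq> (\<Union>w\<in>F. cball w (sqrt (D * (L + 1) / Lo ^ (N - 4))))"
proof -
  define code where "code = (\<lambda>\<kappa> z. (bad \<kappa> z N, \<lambda>j\<in>aff (bad \<kappa> z N) N. rnd \<kappa> z j mod int B))"
  have "\<forall>\<kappa>\<in>badset \<gamma> N. \<exists>z. 1 \<le> cmod z \<and> cmod z \<le> L\<^sup>2 \<and> real (card (bad \<kappa> z N)) \<le> \<gamma> * N"
    by (simp add: badset_def)
  from bchoice[OF this] obtain zz where zz: "\<And>\<kappa>. \<kappa> \<in> badset \<gamma> N \<Longrightarrow> 1 \<le> cmod (zz \<kappa>) \<and> cmod (zz \<kappa>) \<le> L\<^sup>2 \<and> real (card (bad \<kappa> (zz \<kappa>) N)) \<le> \<gamma> * N"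
    by blast
  let ?c = "\<lambda>\<kappa>. code \<kappa> (zz \<kappa>)"
  have cls: "\<kappa> \<in> cls" if "\<kappa> \<in> badset \<gamma> N" for \<kappa> using that by (simp add: badset_def)
  have sub: "?c ` badset \<gamma> N \<subseteq> codes \<gamma> N"
  proof (rule image_subsetI)
    fix \<kappa> assume k: "\<kappa> \<in> badset \<gamma> N"
    have "bad \<kappa> (zz \<kappa>) N \<subseteq> {..<N}" by (auto simp: bad_def)
    moreover have "0 \<le> m mod int B" "m mod int B < int B" for m using B_ge by auto
    ultimately show "?c \<kappa> \<in> codes \<gamma> N"
      using zz[OF k] unfolding codes_def code_def by (simp add: restrict_PiE_iff)
  qed
  define rep where "rep = (\<lambda>v. SOME \<kappa>. \<kappa> \<in> badset \<gamma> N \<and> ?c \<kappa> = v)"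
  have rep: "rep v \<in> badset \<gamma> N \<and> ?c (rep v) = v" if "v \<in> ?c ` badset \<gamma> N" for v
    unfolding rep_def by (rule someI_ex) (use that in auto)
  let ?R = "rep ` ?c ` badset \<gamma> N"
  let ?F = "?R \<union> cnj ` ?R"
  have finc: "finite (?c ` badset \<gamma> N)" by (rule finite_subset[OF sub fin])
  have "card ?R \<le> card (codes \<gamma> N)"
    using card_image_le[OF finc, of rep] card_mono[OF fin sub] by linarith
  moreover have "card (cnj ` ?R) \<le> card ?R" using finc by (intro card_image_le) auto
  ultimately have "card ?F \<le> 2 * card (codes \<gamma> N)" using card_Un_le[of ?R "cnj ` ?R"] by linarith
  moreover have "finite ?F" using finc by auto
  moreover have "?F \<subseteq> {w. 1 < cmod w}"
  proof -
    have "1 < cmod w" if "w \<in> ?R" for w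
    proof -
      from that obtain v where "v \<in> ?c ` badset \<gamma> N" "w = rep v" by blast
      then show ?thesis using cls[of w] rep[of v] Lo by (simp add: cls_def)
    qed
    then show ?thesis by auto
  qed
  moreover have "badset \<gamma> N \<subseteq> (\<Union>w\<in>?F. cball w (sqrt (D * (L + 1) / Lo ^ (N - 4))))"
  proof
    fix \<kappa> assume k: "\<kappa> \<in> badset \<gamma> N"
    define k0 where "k0 = rep (?c \<kappa>)"
    have k0: "k0 \<in> badset \<gamma> N" "?c k0 = ?c \<kappa>" "k0 \<in> ?R" using rep[of "?c \<kappa>"] k by (auto simp: k0_def)
    have b: "bad k0 (zz k0) N = bad \<kappa> (zz \<kappa>) N" using k0(2) by (simp add: code_def)
    have "(\<lambda>j\<in>aff (bad k0 (zz k0) N) N. rnd k0 (zz k0) j mod int B) = (\<lambda>j\<in>aff (bad \<kappa> (zz \<kappa>) N) N. rnd \<kappa> (zz \<kappa>) j mod int B)"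
      using k0(2) unfolding code_def prod.inject by (rule conjunct2)
    from fun_cong[OF this] have "rnd k0 (zz k0) j mod int B = rnd \<kappa> (zz \<kappa>) j mod int B" if "j \<in> aff (bad k0 (zz k0) N) N" for j
      using that b by (simp add: restrict_def) metis
    then have eq: "rnd k0 (zz k0) j = rnd \<kappa> (zz \<kappa>) j" if "j < N" for j
      using same_code[OF cls[OF k0(1)] cls[OF k] _ _ _ b _ that] zz[OF k0(1)] zz[OF k] by blast
    obtain w where "w \<in> {k0, cnj k0}" "cmod (\<kappa> - w) \<le> sqrt (D * (L + 1) / Lo ^ (N - 4))"
      using same_code_close[OF cls[OF k0(1)] cls[OF k] _ eq N] zz[OF k0(1)] by blast
    then show "\<kappa> \<in> (\<Union>w\<in>?F. cball w (sqrt (D * (L + 1) / Lo ^ (N - 4))))"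
      using k0(3) by (auto simp: dist_norm norm_minus_commute)
  qed
  ultimately show ?thesis by blast
qed

section \<open>From bad indices to Fourier decay\<close>

lemma cos_bad:
  assumes "c0 \<le> err \<kappa> z i"
  shows "\<bar>cos (Re (\<kappa> ^ i * z))\<bar> \<le> cos (pi * c0)"
proof -
  define K where "K = rnd \<kappa> z i"
  define e where "e = ekx \<kappa> z i - of_int K"
  have "pi * ekx \<kappa> z i = Re (\<kappa> ^ i * z)"
    unfolding ekx_def by (simp only: times_divide_eq_right nonzero_mult_div_cancel_left[OF pi_neq_zero])
  then have "Re (\<kappa> ^ i * z) = pi * of_int K + pi * e" by (simp only: e_def right_diff_distrib)
  then have "cos (Re (\<kappa> ^ i * z)) = cos (pi * of_int K) * cos (pi * e)"
    by (simp add: cos_add sin_npi_int)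
  then have "\<bar>cos (Re (\<kappa> ^ i * z))\<bar> = \<bar>cos (pi * \<bar>e\<bar>)\<bar>"
    by (cases "e \<ge> 0") (simp_all add: abs_mult cos_npi_int)
  also have "\<bar>e\<bar> = err \<kappa> z i" by (simp add: err_def e_def K_def)
  also have "\<bar>cos (pi * err \<kappa> z i)\<bar> = cos (pi * err \<kappa> z i)"
  proof -
    have "0 \<le> pi * err \<kappa> z i" "pi * err \<kappa> z i \<le> pi / 2" using err_le[of \<kappa> z i] by (auto simp: err_def)
    then have "0 \<le> cos (pi * err \<kappa> z i)" using pi_gt_zero by (intro cos_ge_zero) linarith+
    then show ?thesis by simp
  qed
  also have "\<dots> \<le> cos (pi * c0)"
  proof (rule cos_monotone_0_pi_le)
    show "0 \<le> pi * c0" "pi * c0 \<le> pi * err \<kappa> z i" using c0(1) assms by simp_all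
    show "pi * err \<kappa> z i \<le> pi" using err_le[of \<kappa> z i] by (simp add: mult_le_cancel_left1)
  qed
  finally show ?thesis .
qed

text \<open>For the largest \<open>N\<close> with \<open>cmod \<kappa> ^ N \<le> cmod \<xi>\<close>,
  rescaling gives \<open>z\<close> of bounded modulus, and the first \<open>N\<close> factors of the
  product read backwards are the cosines along the orbit of \<open>z\<close>. More than
  \<open>\<gamma> * N\<close> of them are bad, and each bad one gains a factor
  \<open>q < 1\<close>.\<close>

lemma decay_if_not_bad:
  assumes \<kappa>: "\<kappa> \<in> cls" and \<gamma>: "\<gamma> > 0" and ev: "\<forall>\<^sub>F N in sequentially. \<kappa> \<notin> badset \<gamma> N"
  shows "fourier_decay (inverse \<kappa>)"
proof -
  have k: "1 < cmod \<kappa>" "cmod \<kappa> \<le> L" using \<kappa> Lo by (auto simp: cls_def)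
  have k0: "\<kappa> \<noteq> 0" using k by auto
  obtain N0 where N0: "\<And>N. N \<ge> N0 \<Longrightarrow> \<kappa> \<notin> badset \<gamma> N" using ev by (auto simp: eventually_sequentially)
  define q where "q = cos (pi * c0)"
  have q: "0 < q" "q < 1"
  proof -
    have b: "0 < pi * c0" "pi * c0 < pi / 2" using c0 by auto
    then show "0 < q" unfolding q_def by (intro cos_gt_zero) auto
    have "cos (pi * c0) < cos 0" using b by (intro cos_monotone_0_pi) auto
    then show "q < 1" by (simp add: q_def)
  qed
  \<comment> \<open>Chosen such that
    \<open>q powr \<gamma> = cmod \<kappa> powr (- \<delta>)\<close>, the decay per step.\<close>
  define \<delta> where "\<delta> = - \<gamma> * ln q / ln (cmod \<kappa>)"
  have \<delta>: "\<delta> > 0" unfolding \<delta>_def using \<gamma> q ln_gt_zero[OF k(1)] by (intro divide_pos_pos) (auto simp: mult_pos_neg)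
  have q\<gamma>: "q powr \<gamma> = cmod \<kappa> powr (- \<delta>)" using q k k0 by (simp add: powr_def \<delta>_def)
  \<comment> \<open>\<open>N0 + 1\<close> absorbs the lengths below \<open>N0\<close>, where only
    the trivial bound 1 is at hand, and the off-by-one in \<open>m = Suc N\<close>.\<close>
  define C where "C = cmod \<kappa> powr (\<delta> * (N0 + 1))"
  have C: "C > 0" using k0 by (simp add: C_def)
  have "(\<Prod>j<n. \<bar>cos (Re (inverse \<kappa> ^ j * \<xi>))\<bar>) \<le> C * cmod \<xi> powr (- \<delta>)"
    if \<xi>: "1 \<le> cmod \<xi>" "cmod \<xi> * cmod (inverse \<kappa>) ^ n \<le> 1" for n \<xi>
  proof -
    have kn: "cmod \<xi> \<le> cmod \<kappa> ^ n"
    proof -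
      have "cmod \<xi> * cmod (inverse \<kappa>) ^ n = cmod \<xi> / cmod \<kappa> ^ n"
        by (simp only: norm_inverse power_inverse divide_inverse)
      moreover have "0 < cmod \<kappa> ^ n" using k0 by simp
      ultimately show ?thesis using \<xi>(2) by (simp only: pos_divide_le_eq mult_1)
    qed
    define m where "m = (LEAST m. cmod \<xi> < cmod \<kappa> ^ m)"
    have "cmod \<kappa> ^ n < cmod \<kappa> ^ Suc n" using k by (intro power_strict_increasing) auto
    then have "cmod \<xi> < cmod \<kappa> ^ Suc n" using kn by linarith
    then have m: "cmod \<xi> < cmod \<kappa> ^ m" "m \<le> Suc n" unfolding m_def
      by (rule LeastI[where P = "\<lambda>m. cmod \<xi> < cmod \<kappa> ^ m"], rule Least_le)
    have m0: "m \<noteq> 0" using m(1) \<xi>(1) by (cases m) auto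
    define N where "N = m - 1"
    have N: "N \<le> n" "m = Suc N" using m m0 by (auto simp: N_def)
    have "\<not> cmod \<xi> < cmod \<kappa> ^ N" using not_less_Least[of N "\<lambda>m. cmod \<xi> < cmod \<kappa> ^ m"] N by (simp add: m_def)
    then have Nlo: "cmod \<kappa> ^ N \<le> cmod \<xi>" by simp
    \<comment> \<open>The additional factor \<kappa> makes index 0 correspond to the exponent
      \<open>N - 1\<close>, the last factor of the shortened product.\<close>
    define z where "z = \<kappa> * (inverse \<kappa> ^ N * \<xi>)"
    have zn: "cmod z = cmod \<kappa> * (cmod \<xi> / cmod \<kappa> ^ N)"
      by (simp only: z_def norm_mult norm_power norm_inverse power_inverse divide_inverse mult_ac)
    have "1 \<le> cmod \<xi> / cmod \<kappa> ^ N" "cmod \<xi> / cmod \<kappa> ^ N \<le> cmod \<kappa>" using Nlo m k k0 by (simp_all add: N(2) le_divide_eq divide_le_eq)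
    then have z: "1 \<le> cmod z" "cmod z \<le> L\<^sup>2"
      unfolding zn using k mult_mono[of "1::real" "cmod \<kappa>" 1 "cmod \<xi> / cmod \<kappa> ^ N"] mult_mono[of "cmod \<kappa>" L "cmod \<xi> / cmod \<kappa> ^ N" L]
      by (auto simp: power2_eq_square)
    have kz: "\<kappa> ^ i * z = inverse \<kappa> ^ (N - Suc i) * \<xi>" if "i < N" for i
    proof -
      have "N = Suc i + (N - Suc i)" using that by simp
      then have "inverse \<kappa> ^ N = inverse \<kappa> ^ Suc i * inverse \<kappa> ^ (N - Suc i)" by (metis power_add)
      then show ?thesis using k0 by (simp add: z_def power_inverse field_simps)
    qed
    have "(\<Prod>j<n. \<bar>cos (Re (inverse \<kappa> ^ j * \<xi>))\<bar>) \<le> (\<Prod>j<N. \<bar>cos (Re (inverse \<kappa> ^ j * \<xi>))\<bar>)"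
    proof -
      have "(\<Prod>j<n. \<bar>cos (Re (inverse \<kappa> ^ j * \<xi>))\<bar>) = (\<Prod>j\<in>{..<n} - {..<N}. \<bar>cos (Re (inverse \<kappa> ^ j * \<xi>))\<bar>) * (\<Prod>j<N. \<bar>cos (Re (inverse \<kappa> ^ j * \<xi>))\<bar>)"
        using N(1) by (intro prod.subset_diff) auto
      also have "\<dots> \<le> 1 * (\<Prod>j<N. \<bar>cos (Re (inverse \<kappa> ^ j * \<xi>))\<bar>)"
        by (intro mult_right_mono prod_le_1 prod_nonneg) auto
      finally show ?thesis by simp
    qed
    also have "\<dots> = (\<Prod>i<N. \<bar>cos (Re (inverse \<kappa> ^ (N - Suc i) * \<xi>))\<bar>)"
      by (rule prod.nat_diff_reindex[symmetric])
    also have "\<dots> = (\<Prod>i<N. \<bar>cos (Re (\<kappa> ^ i * z))\<bar>)" by (rule prod.cong) (simp_all add: kz)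
    also have "\<dots> \<le> C * cmod \<xi> powr (- \<delta>)"
    proof -
      have lower: "cmod \<kappa> powr (- \<delta> * (N + 1)) \<le> cmod \<xi> powr (- \<delta>)"
      proof -
        have "(cmod \<kappa> ^ m) powr (- \<delta>) \<le> cmod \<xi> powr (- \<delta>)"
          using m \<xi>(1) \<delta> by (intro powr_mono2') auto
        moreover have "(cmod \<kappa> ^ m) powr (- \<delta>) = cmod \<kappa> powr (- \<delta> * (N + 1))"
        proof -
          have "cmod \<kappa> ^ m = cmod \<kappa> powr real m" using k0 by (simp only: powr_realpow zero_less_norm_iff not_False_eq_True)
          then show ?thesis by (simp add: powr_powr N(2) mult.commute)
        qed
        ultimately show ?thesis by simp
      qed
      have "(\<Prod>i<N. \<bar>cos (Re (\<kappa> ^ i * z))\<bar>) \<le> cmod \<kappa> powr (\<delta> * (N0 + 1)) * cmod \<kappa> powr (- \<delta> * (N + 1))"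
      proof (cases "N \<ge> N0")
        case True
        have "\<kappa> \<notin> badset \<gamma> N" by (rule N0[OF True])
        then have card: "\<gamma> * N < card (bad \<kappa> z N)" using z \<kappa> by (auto simp: badset_def)
        have sub: "bad \<kappa> z N \<subseteq> {..<N}" by (auto simp: bad_def)
        have "(\<Prod>i<N. \<bar>cos (Re (\<kappa> ^ i * z))\<bar>) = (\<Prod>i\<in>{..<N} - bad \<kappa> z N. \<bar>cos (Re (\<kappa> ^ i * z))\<bar>) * (\<Prod>i\<in>bad \<kappa> z N. \<bar>cos (Re (\<kappa> ^ i * z))\<bar>)"
          using sub by (intro prod.subset_diff) auto
        also have "\<dots> \<le> 1 * (\<Prod>i\<in>bad \<kappa> z N. q)"
          unfolding q_def by (intro mult_mono prod_le_1 prod_mono conjI cos_bad prod_nonneg) (auto simp: bad_def)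
        also have "\<dots> = q powr (card (bad \<kappa> z N))" using q by (simp add: powr_realpow)
        also have "\<dots> \<le> q powr (\<gamma> * N)" using q card by (intro powr_mono') auto
        also have "\<dots> = cmod \<kappa> powr (- \<delta> * N)" by (simp only: powr_powr[symmetric] q\<gamma>)
        also have "\<dots> \<le> cmod \<kappa> powr (\<delta> * (N0 + 1) + - \<delta> * (N + 1))"
          using k \<delta> by (intro powr_mono) (auto simp: algebra_simps)
        finally show ?thesis by (simp only: powr_add)
      next
        case False
        have "(\<Prod>i<N. \<bar>cos (Re (\<kappa> ^ i * z))\<bar>) \<le> 1" by (intro prod_le_1) auto
        also have "1 = cmod \<kappa> powr 0" using k0 by simp
        also have "\<dots> \<le> cmod \<kappa> powr (\<delta> * (N0 + 1) + - \<delta> * (N + 1))"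
        proof (rule powr_mono)
          have "\<delta> * (N + 1) \<le> \<delta> * (N0 + 1)" using False \<delta> by (intro mult_left_mono) auto
          then show "0 \<le> \<delta> * (N0 + 1) + - \<delta> * (N + 1)" by simp
        qed (use k in simp)
        finally show ?thesis by (simp only: powr_add)
      qed
      also have "\<dots> \<le> C * cmod \<xi> powr (- \<delta>)" unfolding C_def using lower by (intro mult_left_mono) auto
      finally show ?thesis .
    qed
    finally show ?thesis .
  qed
  then show ?thesis unfolding fourier_decay_def using \<delta> C by blast
qed

text \<open>The number of codes grows at most like \<open>Lo powr (s * n / 4)\<close> up to a
  constant, while the radii to the power \<open>s\<close> decay like
  \<open>Lo powr (- s * n / 2)\<close>, so the sums converge geometrically. The covering in \<kappa>
  is carried over to \<open>\<rho> = 1 / \<kappa>\<close> by inversion.\<close>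

lemma dim0_class: "dim0 {\<rho>. inverse \<rho> \<in> cls \<and> \<not> fourier_decay \<rho>}" (is "dim0 ?E")
proof (rule dim0_limsup)
  fix s :: real assume s: "s > 0"
  \<comment> \<open>With \<gamma> below, \<open>1 + y\<close> and
    \<open>(B ^ 5 / y) powr \<gamma>\<close> each contribute at most
    \<open>Lo powr (s / 8)\<close>.\<close>
  define y where "y = min 1 (Lo powr (s / 8) - 1)"
  have "1 < Lo powr (s / 8)" using Lo s by simp
  then have y: "0 < y" "y \<le> 1" "1 + y \<le> Lo powr (s / 8)" by (auto simp: y_def)
  have B5: "1 < B ^ 5 / y"
  proof -
    have "real B \<ge> 2" unfolding B_def using CC_ge L1 zero_le_power[of L 5] by linarith
    then have "1 < real B ^ 5" by (intro one_less_power) auto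
    then show ?thesis using y by (simp add: less_divide_eq)
  qed
  define \<gamma> where "\<gamma> = (s / 8) * ln Lo / ln (B ^ 5 / y)"
  have \<gamma>: "\<gamma> > 0" unfolding \<gamma>_def using s Lo B5 by (intro divide_pos_pos mult_pos_pos ln_gt_zero) auto
  have B\<gamma>: "(B ^ 5 / y) powr \<gamma> = Lo powr (s / 8)"
  proof -
    have "ln (B ^ 5 / y) \<noteq> 0" using B5 ln_gt_zero by fastforce
    then show ?thesis using Lo B5 y B_ge by (simp add: powr_def \<gamma>_def)
  qed
  define G where "G = (B ^ 5 / y) powr \<gamma> * (1 + y)"
  have G: "0 \<le> G" "G \<le> Lo powr (s / 4)"
  proof -
    show "0 \<le> G" using y by (simp add: G_def)
    have "G \<le> Lo powr (s / 8) * Lo powr (s / 8)" unfolding G_def B\<gamma> using y by (intro mult_left_mono) auto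
    then show "G \<le> Lo powr (s / 4)" by (simp add: powr_add[symmetric])
  qed
  define r where "r = (\<lambda>n. sqrt (D * (L + 1) / Lo ^ (n - 4)))"
  have "\<exists>F. n \<ge> 4 \<longrightarrow> finite F \<and> card F \<le> 2 * card (codes \<gamma> n) \<and> F \<subseteq> {w. 1 < cmod w} \<and> badset \<gamma> n \<subseteq> (\<Union>w\<in>F. cball w (r n))" for n
    unfolding r_def using cover_badset[OF _ codes_card(1)[OF y(1,2) \<gamma>], of n] by blast
  then obtain F' where F': "\<And>n. n \<ge> 4 \<Longrightarrow> finite (F' n) \<and> card (F' n) \<le> 2 * card (codes \<gamma> n) \<and> F' n \<subseteq> {w. 1 < cmod w} \<and> badset \<gamma> n \<subseteq> (\<Union>w\<in>F' n. cball w (r n))"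
    by metis
  define F where "F = (\<lambda>n. if n \<ge> 4 then inverse ` F' n else {})"
  have finF: "finite (F n)" for n using F' by (simp add: F_def)
  have r0: "0 \<le> r n" for n unfolding r_def using D_pos L1 Lo by simp
  define A where "A = (D * (L + 1) * Lo ^ 4) powr (s / 2)"
  have rs: "r n powr s = A * (Lo powr (- s / 2)) ^ n" if "n \<ge> 4" for n
  proof -
    have pos: "0 < D * (L + 1) * Lo ^ 4" using D_pos L1 Lo by simp
    have "D * (L + 1) / Lo ^ (n - 4) = D * (L + 1) * Lo ^ 4 / Lo ^ n"
      using that Lo by (simp add: power_diff)
    then have "r n = (D * (L + 1) * Lo ^ 4 / Lo ^ n) powr (1 / 2)"
      unfolding r_def using pos Lo by (simp add: powr_half_sqrt)
    then have "r n powr s = (D * (L + 1) * Lo ^ 4 / Lo ^ n) powr (s / 2)" by (simp add: powr_powr)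
    also have "\<dots> = A * (Lo ^ n) powr (- (s / 2))"
      unfolding A_def using pos Lo by (simp add: powr_divide powr_minus_divide)
    also have "(Lo ^ n) powr (- (s / 2)) = (Lo powr (- s / 2)) ^ n"
      using Lo by (simp add: powr_realpow[symmetric] powr_powr mult.commute)
    finally show ?thesis .
  qed
  have "summable (\<lambda>n. real (card (F n)) * r n powr s)"
  proof (rule summable_comparison_test_ev)
    have "Lo powr (- s / 4) < 1" using Lo s by (intro powr_less_one) auto
    then show "summable (\<lambda>n. (2 * B ^ 4 * A) * (Lo powr (- s / 4)) ^ n)"
      by (intro summable_mult summable_geometric) simp
    show "\<forall>\<^sub>F n in sequentially. norm (real (card (F n)) * r n powr s) \<le> (2 * B ^ 4 * A) * (Lo powr (- s / 4)) ^ n"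
      using eventually_ge_at_top[of 4]
    proof eventually_elim
      case (elim n)
      have "card (F n) \<le> card (F' n)" unfolding F_def using elim F'[OF elim] by (auto intro: card_image_le)
      also have "\<dots> \<le> 2 * card (codes \<gamma> n)" using F'[OF elim] by simp
      finally have "real (card (F n)) \<le> 2 * real (card (codes \<gamma> n))" by linarith
      also have "\<dots> \<le> 2 * (B ^ 4 * G ^ n)" unfolding G_def using codes_card(2)[OF y(1,2) \<gamma>, of n] by simp
      finally have "real (card (F n)) * r n powr s \<le> 2 * (B ^ 4 * G ^ n) * (A * (Lo powr (- s / 2)) ^ n)"
        unfolding rs[OF elim] by (intro mult_right_mono) (auto simp: A_def)
      also have "\<dots> = 2 * B ^ 4 * A * (G * Lo powr (- s / 2)) ^ n" by (simp add: power_mult_distrib)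
      also have "\<dots> \<le> 2 * B ^ 4 * A * (Lo powr (s / 4) * Lo powr (- s / 2)) ^ n"
        using G by (intro mult_left_mono power_mono mult_right_mono) (auto simp: A_def)
      also have "Lo powr (s / 4) * Lo powr (- s / 2) = Lo powr (- s / 4)" by (simp add: powr_add[symmetric])
      finally show ?case by simp
    qed
  qed
  moreover have "\<exists>\<^sub>\<infinity>n. \<rho> \<in> (\<Union>c\<in>F n. cball c (r n))" if \<rho>: "\<rho> \<in> ?E" for \<rho>
  proof -
    have k: "inverse \<rho> \<in> cls" "\<not> fourier_decay (inverse (inverse \<rho>))" using \<rho> by auto
    then have "\<exists>\<^sub>F n in sequentially. inverse \<rho> \<in> badset \<gamma> n"
      using decay_if_not_bad[OF k(1) \<gamma>] by (auto simp: not_eventually[symmetric] frequently_def)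
    then have "\<exists>\<^sub>F n in sequentially. inverse \<rho> \<in> badset \<gamma> n \<and> n \<ge> 4"
      by (rule frequently_eventually_frequently) (rule eventually_ge_at_top)
    then have "\<exists>\<^sub>F n in sequentially. \<rho> \<in> (\<Union>c\<in>F n. cball c (r n))"
    proof (rule frequently_elim1)
      fix n assume n: "inverse \<rho> \<in> badset \<gamma> n \<and> n \<ge> 4"
      then obtain w where w: "w \<in> F' n" "inverse \<rho> \<in> cball w (r n)" "1 < cmod w" using F'[of n] by blast
      have k1: "1 < cmod (inverse \<rho>)" using k(1) Lo unfolding cls_def by auto
      then have \<rho>0: "\<rho> \<noteq> 0" by (intro notI) simp
      have "inverse (cmod (inverse \<rho>)) \<le> 1" using k1 by (intro inverse_le_1_iff[THEN iffD2]) simp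
      then have \<rho>1: "cmod \<rho> \<le> 1" by (simp only: norm_inverse inverse_inverse_eq)
      \<comment> \<open>Inversion does not increase distances outside the unit disc.\<close>
      have "w \<noteq> 0" using w by auto
      then have "inverse w - \<rho> = \<rho> * (inverse \<rho> - w) * inverse w" using \<rho>0 by (simp add: field_simps)
      then have "cmod (inverse w - \<rho>) = cmod \<rho> * cmod (inverse \<rho> - w) * cmod (inverse w)" by (simp only: norm_mult)
      also have "\<dots> \<le> 1 * cmod (inverse \<rho> - w) * 1"
        using \<rho>1 w(3) by (intro mult_mono) (auto simp: norm_inverse inverse_le_1_iff)
      also have "\<dots> \<le> r n" using w(2) by (simp add: dist_norm norm_minus_commute)
      finally have "\<rho> \<in> cball (inverse w) (r n)" by (simp add: dist_norm)
      then show "\<rho> \<in> (\<Union>c\<in>F n. cball c (r n))" using w(1) n by (auto simp: F_def)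
    qed
    then show ?thesis by (simp add: cofinite_eq_sequentially)
  qed
  ultimately show "\<exists>F r. (\<forall>n::nat. finite (F n)) \<and> (\<forall>n. 0 \<le> r n) \<and> summable (\<lambda>n. real (card (F n)) * r n powr s) \<and>
     (\<forall>x\<in>?E. \<exists>\<^sub>\<infinity>n. x \<in> (\<Union>c\<in>F n. cball c (r n)))"
    using finF r0 by (intro exI[of _ F] exI[of _ r] conjI ballI allI)
qed

end

lemma dim0_not_fourier_decay: "dim0 {\<rho>. 0 < cmod \<rho> \<and> cmod \<rho> < 1 \<and> Im \<rho> \<noteq> 0 \<and> \<not> fourier_decay \<rho>}"
proof -
  let ?cls = "\<lambda>n::nat. erdos_kahane.cls (1 + 1 / (real n + 1)) (real n + 2) (1 / (real n + 1))"
  have ek: "erdos_kahane (1 + 1 / (real n + 1)) (real n + 2) (1 / (real n + 1))" for n :: nat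
    by unfold_locales (auto simp: field_simps)
  have "dim0 (\<Union>n. {\<rho>. inverse \<rho> \<in> ?cls n \<and> \<not> fourier_decay \<rho>})"
    by (intro dim0_UN erdos_kahane.dim0_class ek)
  then show ?thesis
  proof (rule dim0_subset, safe)
    fix \<rho> :: complex assume \<rho>: "0 < cmod \<rho>" "cmod \<rho> < 1" "Im \<rho> \<noteq> 0" "\<not> fourier_decay \<rho>"
    have im: "Im (inverse \<rho>) \<noteq> 0" using \<rho> by (simp add: inverse_complex.sel)
    have k: "1 < cmod (inverse \<rho>)" using \<rho> by (simp add: norm_inverse one_less_inverse)
    define e where "e = min (cmod (inverse \<rho>) - 1) \<bar>Im (inverse \<rho>)\<bar>"
    have "0 < cmod (inverse \<rho>) - 1" "0 < \<bar>Im (inverse \<rho>)\<bar>" using im k by (simp_all only: zero_less_abs_iff diff_gt_0_iff_gt not_False_eq_True)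
    then have "e > 0" unfolding e_def by (simp only: min_less_iff_conj)
    then obtain n1 where n1: "1 / real (Suc n1) < e" using reals_Archimedean by (auto simp: inverse_eq_divide)
    obtain n2 where n2: "cmod (inverse \<rho>) \<le> real n2" using real_arch_simple by blast
    define n where "n = max n1 n2"
    have "1 / (real n + 1) \<le> 1 / real (Suc n1)" by (rule divide_left_mono) (auto simp: n_def)
    then have "1 / (real n + 1) \<le> e" using n1 by simp
    moreover have "cmod (inverse \<rho>) \<le> real n + 2" using n2 by (simp add: n_def)
    ultimately have "inverse \<rho> \<in> ?cls n" unfolding erdos_kahane.cls_def[OF ek] e_def by auto
    then show "\<rho> \<in> (\<Union>n. {\<rho>. inverse \<rho> \<in> ?cls n \<and> \<not> fourier_decay \<rho>})" using \<rho> by blast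
  qed
qed

section \<open>Entropy of finitely supported distributions\<close>

abbreviation pE :: "'a pmf \<Rightarrow> ('a \<Rightarrow> 'b::{banach, second_countable_topology}) \<Rightarrow> 'b" where
  "pE p f \<equiv> measure_pmf.expectation p f"

abbreviation fin_pmf :: "'a pmf \<Rightarrow> bool" where
  "fin_pmf p \<equiv> finite (set_pmf p)"

lemma pE_sum:
  assumes "fin_pmf p"
  shows "pE p f = (\<Sum>x\<in>set_pmf p. pmf p x *\<^sub>R f x)"
  by (rule integral_measure_pmf) (use assms in auto)

lemma pE_sum_real:
  fixes f :: "'a \<Rightarrow> real"
  assumes "fin_pmf p"
  shows "pE p f = (\<Sum>x\<in>set_pmf p. pmf p x * f x)"
  using pE_sum[OF assms, of f] by simp

lemma sum_pmf_set: "fin_pmf p \<Longrightarrow> (\<Sum>x\<in>set_pmf p. pmf p x) = 1"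
  by (rule sum_pmf_eq_1) auto

lemma pE_cong: "(\<And>x. x \<in> set_pmf p \<Longrightarrow> f x = g x) \<Longrightarrow> pE p f = pE p g"
  by (rule integral_cong_AE) (auto simp: AE_measure_pmf_iff)

lemma pE_mono:
  fixes f :: "'a \<Rightarrow> real"
  assumes "fin_pmf p" "\<And>x. x \<in> set_pmf p \<Longrightarrow> f x \<le> g x"
  shows "pE p f \<le> pE p g"
  unfolding pE_sum_real[OF assms(1)]
  by (rule sum_mono) (auto intro: mult_left_mono assms)

lemma pE_nonneg:
  fixes f :: "'a \<Rightarrow> real"
  assumes "\<And>x. x \<in> set_pmf p \<Longrightarrow> f x \<ge> 0"
  shows "pE p f \<ge> 0"
  by (rule integral_nonneg_AE) (auto simp: AE_measure_pmf_iff assms)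

lemma pE_ge_point:
  fixes f :: "'a \<Rightarrow> real"
  assumes "fin_pmf p" "pE p f \<ge> c"
  shows "\<exists>x\<in>set_pmf p. f x \<ge> c"
proof (rule ccontr)
  assume "\<not> ?thesis"
  then have *: "\<And>x. x \<in> set_pmf p \<Longrightarrow> f x < c" by force
  have "pE p f = (\<Sum>x\<in>set_pmf p. pmf p x * f x)" by (rule pE_sum_real[OF assms(1)])
  also have "\<dots> < (\<Sum>x\<in>set_pmf p. pmf p x * c)"
    by (rule sum_strict_mono)
       (auto simp: assms set_pmf_not_empty pmf_positive intro!: mult_strict_left_mono *)
  also have "\<dots> = c" by (simp add: sum_distrib_right[symmetric] sum_pmf_set assms)
  finally show False using assms by simp
qed

lemma pE_const [simp]: "pE p (\<lambda>_. c) = c"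
  by simp

lemma pE_add: "fin_pmf p \<Longrightarrow> pE p (\<lambda>x. f x + g x) = pE p f + pE p g"
  by (intro Bochner_Integration.integral_add integrable_measure_pmf_finite)

lemma pE_diff: "fin_pmf p \<Longrightarrow> pE p (\<lambda>x. f x - g x) = pE p f - pE p g"
  by (intro Bochner_Integration.integral_diff integrable_measure_pmf_finite)

lemma pE_bind:
  assumes "fin_pmf p" "\<And>x. x \<in> set_pmf p \<Longrightarrow> fin_pmf (k x)"
  shows "pE (bind_pmf p k) f = pE p (\<lambda>x. pE (k x) f)"
  using pmf_expectation_bind[of "set_pmf p" k p f] assms by (simp add: pE_sum)

lemma fin_pmf_bind: "fin_pmf p \<Longrightarrow> (\<And>x. x \<in> set_pmf p \<Longrightarrow> fin_pmf (k x)) \<Longrightarrow> fin_pmf (bind_pmf p k)"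
  by auto

lemma pE_pair:
  assumes "fin_pmf p" "fin_pmf q"
  shows "pE (pair_pmf p q) f = pE p (\<lambda>x. pE q (\<lambda>y. f (x, y)))"
  by (simp add: pair_pmf_def pE_bind fin_pmf_bind assms)

definition ent :: "'a pmf \<Rightarrow> real" where
  "ent p = pE p (\<lambda>x. - ln (pmf p x))"

lemma ent_nonneg: "ent p \<ge> 0"
  unfolding ent_def
  by (rule pE_nonneg) (auto simp: pmf_le_1 pmf_positive)

lemma gibbs:
  assumes "fin_pmf p" "\<And>x. x \<in> set_pmf p \<Longrightarrow> q x > 0" "(\<Sum>x\<in>set_pmf p. q x) \<le> (1::real)"
  shows "ent p \<le> pE p (\<lambda>x. - ln (q x))"
proof -
  have "ent p - pE p (\<lambda>x. - ln (q x)) = pE p (\<lambda>x. ln (q x / pmf p x))"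
    unfolding ent_def pE_diff[symmetric, OF assms(1)]
  proof (rule pE_cong)
    fix x assume "x \<in> set_pmf p"
    with assms(2)[of x] pmf_positive[of x p]
    show "- ln (pmf p x) - - ln (q x) = ln (q x / pmf p x)" by (simp add: ln_div)
  qed
  also have "\<dots> \<le> pE p (\<lambda>x. q x / pmf p x - 1)"
    by (rule pE_mono) (auto intro!: ln_le_minus_one divide_pos_pos assms pmf_positive)
  also have "\<dots> = (\<Sum>x\<in>set_pmf p. q x) - 1"
    unfolding pE_diff[OF assms(1)] pE_sum_real[OF assms(1)]
    by (simp add: sum_pmf_set assms pmf_eq_0_set_pmf)
  finally show ?thesis using assms(3) by simp
qed

lemma pE_map: "pE (map_pmf f p) g = pE p (\<lambda>x. g (f x))"
  by (rule integral_map_pmf)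

lemma ent_map: "ent (map_pmf f P) = pE P (\<lambda>w. - ln (pmf (map_pmf f P) (f w)))"
  by (simp add: ent_def pE_map)

text \<open>On the support \<open>f\<close> is a function of \<open>g\<close>, so the atoms of
  \<open>g\<close> are contained in atoms of \<open>f\<close>.\<close>

lemma ent_mono:
  assumes "fin_pmf P"
    "\<And>v w. v \<in> set_pmf P \<Longrightarrow> w \<in> set_pmf P \<Longrightarrow> g v = g w \<Longrightarrow> f v = f w"
  shows "ent (map_pmf f P) \<le> ent (map_pmf g P)"
  unfolding ent_map
proof (rule pE_mono[OF assms(1)])
  fix w assume w: "w \<in> set_pmf P"
  have sub: "set_pmf P \<inter> g -` {g w} \<subseteq> set_pmf P \<inter> f -` {f w}"
  proof
    fix v assume "v \<in> set_pmf P \<inter> g -` {g w}"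
    then have "v \<in> set_pmf P" "g v = g w" by auto
    from this(1) assms(2)[OF this(1) w this(2)] show "v \<in> set_pmf P \<inter> f -` {f w}" by simp
  qed
  have "measure P (set_pmf P \<inter> g -` {g w}) \<le> measure P (set_pmf P \<inter> f -` {f w})"
    by (rule measure_pmf.finite_measure_mono[OF sub]) simp
  then have "pmf (map_pmf g P) (g w) \<le> pmf (map_pmf f P) (f w)"
    by (simp add: pmf_map measure_Int_set_pmf Int_commute[of "set_pmf P"])
  moreover have "pmf (map_pmf g P) (g w) > 0" using w by (simp add: pmf_positive)
  ultimately show "- ln (pmf (map_pmf f P) (f w)) \<le> - ln (pmf (map_pmf g P) (g w))"
    by simp
qed

lemma ent_cong_part:
  assumes "fin_pmf P"
    "\<And>v w. v \<in> set_pmf P \<Longrightarrow> w \<in> set_pmf P \<Longrightarrow> g v = g w \<longleftrightarrow> f v = f w"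
  shows "ent (map_pmf f P) = ent (map_pmf g P)"
  by (rule antisym; rule ent_mono[OF assms(1)]) (blast dest: assms(2))+

text \<open>Gibbs with the weights that spread the mass of each value of \<open>g\<close> evenly
  over \<open>K\<close> slots. It is the source of the bounded errors below: quantisations that
  determine each other up to \<open>K\<close> choices differ by at most \<open>ln K\<close> in
  entropy.\<close>

lemma ent_joint_le_card:
  assumes fin: "fin_pmf P" and K: "K \<ge> 1"
    and card: "\<And>w. w \<in> set_pmf P \<Longrightarrow> card (f ` {v\<in>set_pmf P. g v = g w}) \<le> K"
  shows "ent (map_pmf (\<lambda>w. (f w, g w)) P) \<le> ent (map_pmf g P) + ln (real K)"
proof -
  let ?J = "map_pmf (\<lambda>w. (f w, g w)) P" and ?p = "pmf (map_pmf g P)"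
  have "(\<Sum>x\<in>set_pmf ?J. ?p (snd x) / K) \<le> 1"
  proof -
    have "(\<Sum>x\<in>set_pmf ?J. ?p (snd x) / K) =
       (\<Sum>y\<in>g ` set_pmf P. \<Sum>x\<in>{x\<in>set_pmf ?J. snd x = y}. ?p (snd x) / K)"
      by (rule sum.group[symmetric]) (use fin in auto)
    also have "\<dots> \<le> (\<Sum>y\<in>g ` set_pmf P. ?p y)"
    proof (rule sum_mono)
      fix y assume "y \<in> g ` set_pmf P"
      then obtain w where w: "w \<in> set_pmf P" "y = g w" by auto
      have "{x\<in>set_pmf ?J. snd x = y} = (\<lambda>a. (a, y)) ` (f ` {v\<in>set_pmf P. g v = g w})"
        using w by force
      then have "card {x\<in>set_pmf ?J. snd x = y} \<le> K"
        using card_image_le[of "f ` {v\<in>set_pmf P. g v = g w}" "\<lambda>a. (a, y)"] card[OF w(1)] fin by auto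
      then have "real (card {x\<in>set_pmf ?J. snd x = y}) * (?p y / K) \<le> K * (?p y / K)"
        by (intro mult_right_mono) auto
      moreover have "(\<Sum>x\<in>{x\<in>set_pmf ?J. snd x = y}. ?p (snd x) / K) =
          real (card {x\<in>set_pmf ?J. snd x = y}) * (?p y / K)"
        by simp
      ultimately show "(\<Sum>x\<in>{x\<in>set_pmf ?J. snd x = y}. ?p (snd x) / K) \<le> ?p y"
        using K by simp
    qed
    also have "\<dots> = 1" using sum_pmf_set[of "map_pmf g P"] fin by simp
    finally show ?thesis .
  qed
  then have "ent ?J \<le> pE ?J (\<lambda>x. - ln (?p (snd x) / K))"
    by (intro gibbs) (use fin K in \<open>auto simp: pmf_positive\<close>)
  also have "\<dots> = pE P (\<lambda>w. - ln (?p (g w)) + ln K)"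
    unfolding pE_map by (rule pE_cong) (use K in \<open>auto simp: ln_div pmf_eq_0_set_pmf\<close>)
  also have "\<dots> = ent (map_pmf g P) + ln K"
    unfolding ent_map pE_add[OF fin] by simp
  finally show ?thesis .
qed

lemma ent_le_card:
  assumes "fin_pmf P" "K \<ge> 1"
    "\<And>w. w \<in> set_pmf P \<Longrightarrow> card (f ` {v\<in>set_pmf P. g v = g w}) \<le> K"
  shows "ent (map_pmf f P) \<le> ent (map_pmf g P) + ln (real K)"
proof -
  have "ent (map_pmf f P) \<le> ent (map_pmf (\<lambda>w. (f w, g w)) P)"
    by (rule ent_mono) (use assms in auto)
  also note ent_joint_le_card[OF assms]
  finally show ?thesis by simp
qed

text \<open>Gibbs with the conditionally independent coupling of \<open>f\<close> and
  \<open>g\<close> given \<open>h\<close>; in other words, conditional mutual information is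
  nonnegative.\<close>

lemma ent_submod:
  assumes fin: "fin_pmf P"
  shows "ent (map_pmf (\<lambda>w. (f w, g w, h w)) P) + ent (map_pmf h P) \<le>
    ent (map_pmf (\<lambda>w. (f w, h w)) P) + ent (map_pmf (\<lambda>w. (g w, h w)) P)"
proof -
  let ?S = "set_pmf P"
  let ?J = "map_pmf (\<lambda>w. (f w, g w, h w)) P"
  let ?a = "pmf (map_pmf (\<lambda>w. (f w, h w)) P)" and ?b = "pmf (map_pmf (\<lambda>w. (g w, h w)) P)"
    and ?c = "pmf (map_pmf h P)"
  define q where "q = (\<lambda>(x, y, z). ?a (x, z) * ?b (y, z) / ?c z)"
  have marg: "(\<Sum>x\<in>u ` ?S. pmf (map_pmf (\<lambda>w. (u w, h w)) P) (x, z)) = ?c z" for u :: "'a \<Rightarrow> 'e" and z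
  proof -
    have "?c z = pmf (map_pmf snd (map_pmf (\<lambda>w. (u w, h w)) P)) z"
      by (simp add: pmf.map_comp o_def)
    also have "\<dots> = measure (map_pmf (\<lambda>w. (u w, h w)) P) ((\<lambda>x. (x, z)) ` (u ` ?S))"
      unfolding pmf_map[of snd] by (subst (1 2) measure_Int_set_pmf[symmetric]) (rule arg_cong[where f = "measure _"], force)
    also have "\<dots> = (\<Sum>x\<in>(\<lambda>x. (x, z)) ` (u ` ?S). pmf (map_pmf (\<lambda>w. (u w, h w)) P) x)"
      by (rule measure_measure_pmf_finite) (use fin in auto)
    also have "\<dots> = (\<Sum>x\<in>u ` ?S. pmf (map_pmf (\<lambda>w. (u w, h w)) P) (x, z))"
      by (subst sum.reindex) (auto simp: inj_on_def)
    finally show ?thesis by simp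
  qed
  have pos: "?a (f w, h w) > 0" "?b (g w, h w) > 0" "?c (h w) > 0" if "w \<in> ?S" for w
    using that by (auto simp: pmf_positive_iff)
  have "(\<Sum>x\<in>set_pmf ?J. q x) \<le> (\<Sum>x\<in>f ` ?S \<times> g ` ?S \<times> h ` ?S. q x)"
    by (rule sum_mono2) (use fin in \<open>auto simp: q_def\<close>)
  also have "\<dots> = (\<Sum>x\<in>f ` ?S. \<Sum>y\<in>g ` ?S. \<Sum>z\<in>h ` ?S. q (x, y, z))"
    by (simp add: sum.cartesian_product)
  also have "\<dots> = (\<Sum>x\<in>f ` ?S. \<Sum>z\<in>h ` ?S. \<Sum>y\<in>g ` ?S. q (x, y, z))"
    by (rule sum.cong[OF refl], rule sum.swap)
  also have "\<dots> = (\<Sum>z\<in>h ` ?S. \<Sum>x\<in>f ` ?S. \<Sum>y\<in>g ` ?S. q (x, y, z))"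
    by (rule sum.swap)
  also have "\<dots> = (\<Sum>z\<in>h ` ?S. ?c z)"
  proof (rule sum.cong[OF refl])
    fix z assume "z \<in> h ` ?S"
    then have "?c z > 0" using pos by auto
    have "(\<Sum>x\<in>f ` ?S. \<Sum>y\<in>g ` ?S. q (x, y, z)) = (\<Sum>x\<in>f ` ?S. \<Sum>y\<in>g ` ?S. ?a (x, z) * (?b (y, z) / ?c z))"
      by (simp add: q_def)
    also have "\<dots> = (\<Sum>x\<in>f ` ?S. ?a (x, z)) * ((\<Sum>y\<in>g ` ?S. ?b (y, z)) / ?c z)"
      by (simp only: sum_distrib_left[symmetric] sum_distrib_right[symmetric] sum_divide_distrib[symmetric])
    also have "\<dots> = ?c z" using \<open>?c z > 0\<close> by (simp add: marg)
    finally show "(\<Sum>x\<in>f ` ?S. \<Sum>y\<in>g ` ?S. q (x, y, z)) = ?c z" .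
  qed
  also have "\<dots> = 1" using sum_pmf_set[of "map_pmf h P"] fin by simp
  finally have "ent ?J \<le> pE ?J (\<lambda>x. - ln (q x))"
    by (intro gibbs) (use fin pos in \<open>auto simp: q_def\<close>)
  also have "\<dots> = pE P (\<lambda>w. - ln (?a (f w, h w)) - ln (?b (g w, h w)) - (- ln (?c (h w))))"
    unfolding pE_map
  proof (rule pE_cong)
    fix w assume "w \<in> ?S"
    from pos[OF this] show "- ln (q (f w, g w, h w)) = - ln (?a (f w, h w)) - ln (?b (g w, h w)) - - ln (?c (h w))"
      by (simp add: q_def ln_div ln_mult)
  qed
  also have "\<dots> = ent (map_pmf (\<lambda>w. (f w, h w)) P) + ent (map_pmf (\<lambda>w. (g w, h w)) P) - ent (map_pmf h P)"
    unfolding ent_map pE_diff[OF fin] by simp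
  finally show ?thesis by simp
qed

section \<open>Conditional entropy and its stability\<close>

definition cent :: "'a pmf \<Rightarrow> ('a \<Rightarrow> 'b) \<Rightarrow> ('a \<Rightarrow> 'c) \<Rightarrow> real" where
  "cent P f g = ent (map_pmf (\<lambda>w. (f w, g w)) P) - ent (map_pmf g P)"

lemma cent_le_card:
  assumes "fin_pmf P" "K \<ge> 1"
    "\<And>w. w \<in> set_pmf P \<Longrightarrow> card (f ` {v\<in>set_pmf P. g v = g w}) \<le> K"
  shows "cent P f g \<le> ln (real K)"
  using ent_joint_le_card[OF assms] by (simp add: cent_def)

text \<open>Submodularity with the coarser variable \<open>g\<close> in the common place.\<close>

lemma cent_antimono:
  assumes fin: "fin_pmf P"
    and det: "\<And>v w. v \<in> set_pmf P \<Longrightarrow> w \<in> set_pmf P \<Longrightarrow> k v = k w \<Longrightarrow> g v = g w"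
  shows "cent P f k \<le> cent P f g"
proof -
  have "ent (map_pmf (\<lambda>w. (f w, k w, g w)) P) = ent (map_pmf (\<lambda>w. (f w, k w)) P)"
    "ent (map_pmf (\<lambda>w. (k w, g w)) P) = ent (map_pmf k P)"
    by (rule ent_cong_part[OF fin]; blast dest: det)+
  then show ?thesis using ent_submod[OF fin, of f k g] by (simp add: cent_def)
qed

text \<open>Adding \<open>g\<close> to the condition \<open>k\<close> costs at most
  \<open>ln K\<close>, and dropping \<open>k\<close> afterwards only raises the entropy. So
  conditions may be exchanged when one determines the other up to \<open>K\<close> choices.\<close>

lemma cent_ge_cond:
  assumes fin: "fin_pmf P" and K: "K \<ge> 1"
    and card: "\<And>w. w \<in> set_pmf P \<Longrightarrow> card (g ` {v\<in>set_pmf P. k v = k w}) \<le> K"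
  shows "cent P f g \<ge> cent P f k - ln (real K)"
proof -
  have "cent P f (\<lambda>w. (g w, k w)) \<le> cent P f g"
    by (rule cent_antimono) (use fin in auto)
  moreover have "ent (map_pmf (\<lambda>w. (f w, k w)) P) \<le> ent (map_pmf (\<lambda>w. (f w, g w, k w)) P)"
    by (rule ent_mono) (use fin in auto)
  moreover have "ent (map_pmf (\<lambda>w. (g w, k w)) P) \<le> ent (map_pmf k P) + ln K"
    by (rule ent_joint_le_card[OF fin K card])
  ultimately show ?thesis unfolding cent_def by linarith
qed

lemma cent_ge_target:
  assumes fin: "fin_pmf P" and K: "K \<ge> 1"
    and card: "\<And>w. w \<in> set_pmf P \<Longrightarrow> card (f' ` {v\<in>set_pmf P. f v = f w \<and> g v = g w}) \<le> K"
  shows "cent P f g \<ge> cent P f' g - ln (real K)"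
proof -
  have "ent (map_pmf (\<lambda>w. (f' w, g w)) P) \<le> ent (map_pmf (\<lambda>w. (f' w, f w, g w)) P)"
    by (rule ent_mono) (use fin in auto)
  also have "\<dots> \<le> ent (map_pmf (\<lambda>w. (f w, g w)) P) + ln K"
    by (rule ent_joint_le_card) (use fin K card in auto)
  finally show ?thesis unfolding cent_def by linarith
qed

lemma pmf_bind_Pair:
  assumes "fin_pmf q"
  shows "pmf (bind_pmf q (\<lambda>y. map_pmf (Pair y) (k y))) (y, x) = pmf q y * pmf (k y) x"
proof -
  have "pmf (map_pmf (Pair z) (k z)) (y, x) = (if z = y then pmf (k y) x else 0)" for z
  proof (cases "z = y")
    case True
    then show ?thesis by (simp add: pmf_map_inj' inj_on_def)
  next
    case False
    then have "(y, x) \<notin> set_pmf (map_pmf (Pair z) (k z))" by auto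
    then show ?thesis using False by (simp only: pmf_eq_0_set_pmf[symmetric]) simp
  qed
  then have "pmf (bind_pmf q (\<lambda>y. map_pmf (Pair y) (k y))) (y, x) = pE q (\<lambda>z. if z = y then pmf (k y) x else 0)"
    by (simp add: pmf_bind)
  also have "\<dots> = (\<Sum>z\<in>{y}. pmf q z *\<^sub>R (if z = y then pmf (k y) x else 0))"
    by (rule integral_measure_pmf) (auto split: if_splits)
  finally show ?thesis by simp
qed

lemma ent_bind_Pair:
  assumes fin: "fin_pmf q" "\<And>y. y \<in> set_pmf q \<Longrightarrow> fin_pmf (k y)"
  shows "ent (bind_pmf q (\<lambda>y. map_pmf (Pair y) (k y))) = ent q + pE q (\<lambda>y. ent (k y))"
proof -
  have "ent (bind_pmf q (\<lambda>y. map_pmf (Pair y) (k y))) =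
     pE q (\<lambda>y. pE (k y) (\<lambda>x. - ln (pmf q y * pmf (k y) x)))"
    unfolding ent_def by (subst pE_bind) (use fin in \<open>auto simp: pE_map pmf_bind_Pair\<close>)
  also have "\<dots> = pE q (\<lambda>y. - ln (pmf q y) + ent (k y))"
  proof (rule pE_cong)
    fix y assume y: "y \<in> set_pmf q"
    have "pE (k y) (\<lambda>x. - ln (pmf q y * pmf (k y) x)) = pE (k y) (\<lambda>x. - ln (pmf q y) + - ln (pmf (k y) x))"
      by (rule pE_cong) (use y in \<open>auto simp: ln_mult pmf_eq_0_set_pmf\<close>)
    also have "\<dots> = - ln (pmf q y) + ent (k y)"
      by (subst pE_add) (use fin y in \<open>auto simp: ent_def\<close>)
    finally show "pE (k y) (\<lambda>x. - ln (pmf q y * pmf (k y) x)) = - ln (pmf q y) + ent (k y)" .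
  qed
  also have "\<dots> = ent q + pE q (\<lambda>y. ent (k y))"
    using pE_add[OF fin(1), of "\<lambda>y. - ln (pmf q y)" "\<lambda>y. ent (k y)"]
    by (simp only: ent_def[of q])
  finally show ?thesis .
qed

lemma cent_bind_Pair:
  assumes fin: "fin_pmf q" "\<And>y. y \<in> set_pmf q \<Longrightarrow> fin_pmf (k y)"
  shows "cent (bind_pmf q (\<lambda>y. map_pmf (Pair y) (k y))) (\<lambda>(y, x). f y x) fst = pE q (\<lambda>y. ent (map_pmf (f y) (k y)))"
proof -
  let ?B = "bind_pmf q (\<lambda>y. map_pmf (Pair y) (k y))"
  have finB: "fin_pmf ?B" using fin by auto
  have 1: "map_pmf fst ?B = q"
    by (simp add: map_bind_pmf pmf.map_comp o_def map_pmf_const bind_return_pmf')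
  have "ent (map_pmf (\<lambda>w. ((\<lambda>(y, x). f y x) w, fst w)) ?B) = ent (map_pmf (\<lambda>w. (fst w, (\<lambda>(y, x). f y x) w)) ?B)"
    by (rule ent_cong_part[OF finB]) auto
  also have "map_pmf (\<lambda>w. (fst w, (\<lambda>(y, x). f y x) w)) ?B = bind_pmf q (\<lambda>y. map_pmf (Pair y) (map_pmf (f y) (k y)))"
    by (simp add: map_bind_pmf pmf.map_comp o_def)
  also have "ent \<dots> = ent q + pE q (\<lambda>y. ent (map_pmf (f y) (k y)))"
    by (rule ent_bind_Pair) (use fin in auto)
  finally show ?thesis by (simp add: cent_def 1)
qed

lemma pair_pmf_eq_bind: "pair_pmf p q = bind_pmf p (\<lambda>y. map_pmf (Pair y) q)"
  by (simp add: pair_pmf_def map_pmf_def)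

lemma cent_pair_fst:
  assumes "fin_pmf p" "fin_pmf q"
  shows "cent (pair_pmf p q) (\<lambda>(y, x). f y x) fst = pE p (\<lambda>y. ent (map_pmf (f y) q))"
  unfolding pair_pmf_eq_bind by (rule cent_bind_Pair) (use assms in auto)

lemma cent_map: "cent (map_pmf u P) f g = cent P (\<lambda>w. f (u w)) (\<lambda>w. g (u w))"
  by (simp add: cent_def pmf.map_comp o_def)

text \<open>Conditioning on the mixture index as well can only lower the entropy; after that the
  chain rule splits it into the components.\<close>

lemma cent_mixture:
  assumes fin: "fin_pmf q" "\<And>y. y \<in> set_pmf q \<Longrightarrow> fin_pmf (k y)"
  shows "cent (bind_pmf q k) f g \<ge> pE q (\<lambda>y. cent (k y) f g)"
proof -
  let ?B = "bind_pmf q (\<lambda>y. map_pmf (Pair y) (k y))"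
  have finB: "fin_pmf ?B" using fin by auto
  have 1: "map_pmf snd ?B = bind_pmf q k"
    by (simp add: map_bind_pmf pmf.map_comp o_def)
  have 2: "ent (map_pmf (\<lambda>w. (case w of (y, x) \<Rightarrow> h x, fst w)) ?B) = cent ?B (\<lambda>(y, x). h x) fst + ent (map_pmf fst ?B)"
    for h :: "'b \<Rightarrow> 'e" unfolding cent_def by simp
  have "cent (bind_pmf q k) f g = cent ?B (\<lambda>w. f (snd w)) (\<lambda>w. g (snd w))"
    unfolding 1[symmetric] by (rule cent_map)
  also have "\<dots> \<ge> cent ?B (\<lambda>w. f (snd w)) (\<lambda>w. (g (snd w), fst w))"
    by (rule cent_antimono[OF finB]) auto
  moreover have "cent ?B (\<lambda>w. f (snd w)) (\<lambda>w. (g (snd w), fst w)) =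
      ent (map_pmf (\<lambda>w. (case w of (y, x) \<Rightarrow> (f x, g x), fst w)) ?B) - ent (map_pmf (\<lambda>w. (case w of (y, x) \<Rightarrow> g x, fst w)) ?B)"
    unfolding cent_def
    by (rule arg_cong2[where f = "(-)"]) (rule ent_cong_part[OF finB], force)+
  moreover have "\<dots> = pE q (\<lambda>y. ent (map_pmf (\<lambda>x. (f x, g x)) (k y))) - pE q (\<lambda>y. ent (map_pmf g (k y)))"
    unfolding 2 using cent_bind_Pair[where f = "\<lambda>y x. (f x, g x)", OF fin] cent_bind_Pair[where f = "\<lambda>y. g", OF fin]
    by (simp add: case_prod_beta)
  moreover have "\<dots> = pE q (\<lambda>y. cent (k y) f g)"
    unfolding cent_def by (rule pE_diff[symmetric, OF fin(1)])
  ultimately show ?thesis by simp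
qed

lemma cent_pair_snd:
  assumes fin: "fin_pmf p" "fin_pmf q"
  shows "cent (pair_pmf p q) (\<lambda>(y, x). f x) (\<lambda>(y, x). (y, g x)) = cent q f g"
proof -
  let ?B = "pair_pmf p q"
  have finB: "fin_pmf ?B" using fin by auto
  have 2: "ent (map_pmf (\<lambda>w. (case w of (y, x) \<Rightarrow> h x, fst w)) ?B) = cent ?B (\<lambda>(y, x). h x) fst + ent (map_pmf fst ?B)"
    for h :: "'b \<Rightarrow> 'e" unfolding cent_def by simp
  have "cent (pair_pmf p q) (\<lambda>(y, x). f x) (\<lambda>(y, x). (y, g x)) =
     ent (map_pmf (\<lambda>w. (case w of (y, x) \<Rightarrow> (f x, g x), fst w)) ?B) - ent (map_pmf (\<lambda>w. (case w of (y, x) \<Rightarrow> g x, fst w)) ?B)"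
    unfolding cent_def
    by (rule arg_cong2[where f = "(-)"]) (rule ent_cong_part[OF finB], force)+
  also have "\<dots> = ent (map_pmf (\<lambda>x. (f x, g x)) q) - ent (map_pmf g q)"
    unfolding 2 using cent_pair_fst[OF fin, of "\<lambda>y x. (f x, g x)"] cent_pair_fst[OF fin, of "\<lambda>y. g"]
    by (simp add: case_prod_beta)
  finally show ?thesis by (simp add: cent_def)
qed

text \<open>Disintegration over the fibres of \<open>g\<close>: the fibre is drawn first, then a
  point inside it.\<close>

lemma cond_pmf_cell:
  fixes g :: "'a \<Rightarrow> 'b"
  assumes "fin_pmf p"
  shows "bind_pmf (map_pmf g p) (\<lambda>c. map_pmf (Pair c) (cond_pmf p (g -` {c}))) = map_pmf (\<lambda>x. (g x, x)) p"
proof (rule pmf_eqI)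
  fix z :: "'b \<times> 'a"
  obtain c x where z: "z = (c, x)" by fastforce
  have "pmf (bind_pmf (map_pmf g p) (\<lambda>c. map_pmf (Pair c) (cond_pmf p (g -` {c})))) (c, x) =
    pmf (map_pmf g p) c * pmf (cond_pmf p (g -` {c})) x"
    by (rule pmf_bind_Pair) (use assms in auto)
  also have "\<dots> = (if g x = c then pmf p x else 0)"
  proof (cases "c \<in> g ` set_pmf p")
    case True
    then have ne: "set_pmf p \<inter> g -` {c} \<noteq> {}" by auto
    have "measure p (g -` {c}) > 0" using ne
      by (metis Int_commute measure_Int_set_pmf measure_measure_pmf_not_zero measure_nonneg order_less_le)
    then show ?thesis by (auto simp: pmf_cond[OF ne] pmf_map)
  next
    case False
    then have "pmf (map_pmf g p) c = 0" by (metis pmf_eq_0_set_pmf set_map_pmf)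
    moreover have "g x = c \<Longrightarrow> pmf p x = 0" using False by (auto simp: pmf_eq_0_set_pmf)
    ultimately show ?thesis by auto
  qed
  also have "\<dots> = pmf (map_pmf (\<lambda>x. (g x, x)) p) (c, x)"
  proof (cases "g x = c")
    case True
    have "pmf (map_pmf (\<lambda>x. (g x, x)) p) ((\<lambda>x. (g x, x)) x) = pmf p x"
      by (rule pmf_map_inj') (auto simp: inj_on_def)
    then show ?thesis using True by simp
  next
    case False
    then have "(c, x) \<notin> set_pmf (map_pmf (\<lambda>x. (g x, x)) p)" by auto
    then show ?thesis using False by (simp only: pmf_eq_0_set_pmf[symmetric]) simp
  qed
  finally show "pmf (bind_pmf (map_pmf g p) (\<lambda>c. map_pmf (Pair c) (cond_pmf p (g -` {c})))) z =
      pmf (map_pmf (\<lambda>x. (g x, x)) p) z" using z by simp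
qed

lemma ent_ge_max:
  assumes "fin_pmf p" "\<And>x. x \<in> set_pmf p \<Longrightarrow> pmf p x \<le> M"
  shows "ent p \<ge> - ln M"
proof -
  have "pE p (\<lambda>x. - ln M) \<le> ent p" unfolding ent_def
  proof (rule pE_mono[OF assms(1)])
    fix x assume x: "x \<in> set_pmf p"
    then show "- ln M \<le> - ln (pmf p x)"
      using assms(2)[OF x] pmf_positive[OF x] by (simp add: ln_mono)
  qed
  then show ?thesis by simp
qed

section \<open>Convolution\<close>

definition conv :: "'a::monoid_add pmf \<Rightarrow> 'a pmf \<Rightarrow> 'a pmf" where
  "conv p q = map_pmf (\<lambda>(x, y). x + y) (pair_pmf p q)"

lemma conv_bind: "conv p q = bind_pmf p (\<lambda>x. bind_pmf q (\<lambda>y. return_pmf (x + y)))"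
  by (simp add: conv_def pair_pmf_def map_bind_pmf)

lemma fin_conv [simp, intro]: "fin_pmf p \<Longrightarrow> fin_pmf q \<Longrightarrow> fin_pmf (conv p q)"
  by (simp add: conv_def)

lemma set_conv: "set_pmf (conv p q) = (\<lambda>(x, y). x + y) ` (set_pmf p \<times> set_pmf q)"
  by (simp add: conv_def)

lemma pE_conv:
  "fin_pmf p \<Longrightarrow> fin_pmf q \<Longrightarrow> pE (conv p q) f = pE p (\<lambda>x. pE q (\<lambda>y. f (x + y)))"
  by (simp add: conv_def pE_map pE_pair)

lemma conv_0 [simp]: "conv (return_pmf 0) p = p" "conv p (return_pmf 0) = p"
  by (simp_all add: conv_bind bind_return_pmf bind_return_pmf')

lemma conv_assoc: "conv (conv p q) r = conv p (conv q r)"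
  by (simp add: conv_bind bind_assoc_pmf bind_return_pmf add.assoc)

lemma conv_commute: "conv p q = conv q (p :: 'a::comm_monoid_add pmf)"
  unfolding conv_bind by (subst bind_commute_pmf) (simp add: add.commute)

lemma conv_left_commute: "conv p (conv q r) = conv q (conv p (r :: 'a::comm_monoid_add pmf))"
  by (metis conv_assoc conv_commute)

lemma map_conv:
  assumes "\<And>x y. f (x + y) = f x + f y"
  shows "map_pmf f (conv p q) = conv (map_pmf f p) (map_pmf f q)"
  by (simp add: conv_bind map_bind_pmf bind_map_pmf assms)

lemma map_mult_conv: "map_pmf ((*) c) (conv p q) = conv (map_pmf ((*) c) p) (map_pmf ((*) (c::complex)) q)"
  by (rule map_conv) (simp add: algebra_simps)

lemma conv_bind_left: "conv (bind_pmf p k) q = bind_pmf p (\<lambda>y. conv (k y) q)"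
  by (simp add: conv_bind bind_assoc_pmf)

lemma conv_bind_right: "conv q (bind_pmf p k) = bind_pmf p (\<lambda>y. conv q (k y))"
  unfolding conv_bind bind_assoc_pmf by (subst bind_commute_pmf) simp

definition convl :: "'a::monoid_add pmf list \<Rightarrow> 'a pmf" where
  "convl ps = foldr conv ps (return_pmf 0)"

lemma convl_simps [simp]: "convl [] = return_pmf 0" "convl (p # ps) = conv p (convl ps)"
  by (simp_all add: convl_def)

definition convpow :: "nat \<Rightarrow> 'a::monoid_add pmf \<Rightarrow> 'a pmf" where
  "convpow n p = convl (replicate n p)"

lemma convpow_simps [simp]: "convpow 0 p = return_pmf 0" "convpow (Suc n) p = conv p (convpow n p)"
  by (simp_all add: convpow_def)

lemma fin_convl: "(\<And>p. p \<in> set ps \<Longrightarrow> fin_pmf p) \<Longrightarrow> fin_pmf (convl ps)"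
  by (induction ps) auto

lemma fin_convpow [simp, intro]: "fin_pmf p \<Longrightarrow> fin_pmf (convpow n p)"
  by (auto simp: convpow_def intro!: fin_convl)

text \<open>Every factor draws its own component, so given the draws one faces a convolution of
  independent, possibly different components.\<close>

lemma convpow_bind: "convpow n (bind_pmf q k) = bind_pmf (replicate_pmf n q) (\<lambda>cs. convl (map k cs))"
proof (induction n)
  case (Suc n)
  then show ?case
    by (simp add: bind_return_pmf conv_bind_left conv_bind_right bind_assoc_pmf bind_commute_pmf[of q])
qed (simp add: bind_return_pmf)

lemma fin_replicate [simp, intro]: "fin_pmf p \<Longrightarrow> fin_pmf (replicate_pmf n p)"
  by (induction n) auto

lemma pE_replicate_prod:
  fixes f :: "'a \<Rightarrow> real"
  assumes "fin_pmf p"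
  shows "pE (replicate_pmf n p) (\<lambda>cs. prod_list (map f cs)) = pE p f ^ n"
proof (induction n)
  case (Suc n)
  have "pE (replicate_pmf (Suc n) p) (\<lambda>cs. prod_list (map f cs)) =
     pE p (\<lambda>c. pE (replicate_pmf n p) (\<lambda>cs. f c * prod_list (map f cs)))"
    by (simp add: pE_bind assms)
  then show ?case by (simp add: Suc)
qed simp

lemma pE_replicate_sum:
  fixes f :: "'a \<Rightarrow> real"
  assumes "fin_pmf p"
  shows "pE (replicate_pmf n p) (\<lambda>cs. sum_list (map f cs)) = n * pE p f"
proof (induction n)
  case (Suc n)
  have "pE (replicate_pmf (Suc n) p) (\<lambda>cs. sum_list (map f cs)) =
     pE p (\<lambda>c. pE (replicate_pmf n p) (\<lambda>cs. f c + sum_list (map f cs)))"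
    by (simp add: pE_bind assms)
  then show ?case by (simp add: Suc pE_add assms algebra_simps)
qed simp

lemma ent_pair:
  assumes "fin_pmf p" "fin_pmf q"
  shows "ent (pair_pmf p q) = ent p + ent q"
  unfolding pair_pmf_eq_bind by (subst ent_bind_Pair) (use assms in auto)

text \<open>Submodularity for independent \<open>X\<close>, \<open>Y\<close>, \<open>Z\<close>, with
  \<open>Y\<close> and \<open>Z\<close> conditioned on the total \<open>X + Y + Z\<close>. The
  triple carries all of \<open>(X, Y, Z)\<close>, and \<open>Y\<close> together with the total
  amounts to the independent pair of \<open>Y\<close> and \<open>X + Z\<close>, likewise for
  \<open>Z\<close>; the entropies of \<open>Y\<close> and \<open>Z\<close> cancel.\<close>

lemma ent_conv_submod:
  fixes p q r :: "'a::ab_group_add pmf"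
  assumes fin: "fin_pmf p" "fin_pmf q" "fin_pmf r"
  shows "ent (conv (conv p q) r) + ent p \<le> ent (conv p q) + ent (conv p r)"
proof -
  let ?P = "pair_pmf p (pair_pmf q r)"
  let ?t = "\<lambda>(x, y, z). x + y + z"
  have finP: "fin_pmf ?P" using fin by simp
  have "ent (map_pmf (\<lambda>w. (fst (snd w), snd (snd w), ?t w)) ?P) + ent (map_pmf ?t ?P)
     \<le> ent (map_pmf (\<lambda>w. (fst (snd w), ?t w)) ?P) + ent (map_pmf (\<lambda>w. (snd (snd w), ?t w)) ?P)"
    by (rule ent_submod[OF finP])
  moreover have "ent (map_pmf (\<lambda>w. (fst (snd w), snd (snd w), ?t w)) ?P) = ent (map_pmf (\<lambda>w. w) ?P)"
    by (rule ent_cong_part[OF finP]) auto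
  moreover have "\<dots> = ent p + ent q + ent r"
    by (simp add: ent_pair fin)
  moreover have "ent (map_pmf ?t ?P) = ent (conv (conv p q) r)"
    by (rule arg_cong[where f = ent]) (simp add: conv_bind pair_pmf_def map_bind_pmf bind_assoc_pmf bind_return_pmf)
  moreover have "ent (map_pmf (\<lambda>w. (fst (snd w), ?t w)) ?P) = ent q + ent (conv p r)"
  proof -
    have "ent (map_pmf (\<lambda>w. (fst (snd w), ?t w)) ?P) = ent (map_pmf (\<lambda>(x, y, z). (y, x + z)) ?P)"
      by (rule ent_cong_part[OF finP]) (auto simp: algebra_simps)
    also have "map_pmf (\<lambda>(x, y, z). (y, x + z)) ?P = pair_pmf q (conv p r)"
      by (simp add: pair_pmf_def conv_bind map_bind_pmf bind_assoc_pmf bind_return_pmf bind_commute_pmf[of q p])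
    finally show ?thesis by (simp add: ent_pair fin)
  qed
  moreover have "ent (map_pmf (\<lambda>w. (snd (snd w), ?t w)) ?P) = ent r + ent (conv p q)"
  proof -
    have "ent (map_pmf (\<lambda>w. (snd (snd w), ?t w)) ?P) = ent (map_pmf (\<lambda>(x, y, z). (x + y, z)) ?P)"
      by (rule ent_cong_part[OF finP]) (auto simp: algebra_simps)
    also have "map_pmf (\<lambda>(x, y, z). (x + y, z)) ?P = pair_pmf (conv p q) r"
      by (simp add: pair_pmf_def conv_bind map_bind_pmf bind_assoc_pmf bind_return_pmf)
    finally show ?thesis by (simp add: ent_pair fin)
  qed
  ultimately show ?thesis by linarith
qed

text \<open>By submodularity each further convolution gains at most as much as the first
  one.\<close>

lemma ent_convpow_le:
  fixes p q :: "'a::ab_group_add pmf"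
  assumes fin: "fin_pmf p" "fin_pmf q"
  shows "ent (conv p (convpow n q)) \<le> ent p + n * (ent (conv p q) - ent p)"
proof (induction n)
  case (Suc n)
  have "ent (conv p (convpow (Suc n) q)) = ent (conv (conv p (convpow n q)) q)"
    by (simp add: conv_assoc conv_commute[of q])
  also have "\<dots> \<le> ent (conv p (convpow n q)) + ent (conv p q) - ent p"
    using ent_conv_submod[OF fin(1) _ fin(2), of "convpow n q"] fin by simp
  finally show ?case using Suc by (simp add: algebra_simps)
qed simp

lemma ent_convpow2_le:
  fixes p q :: "'a::ab_group_add pmf"
  assumes fin: "fin_pmf p" "fin_pmf q" "fin_pmf r"
    and "ent (conv p q) \<le> ent p + e" "ent (conv p r) \<le> ent p + e"
  shows "ent (conv p (conv (convpow n q) (convpow n r))) \<le> ent p + 2 * n * e"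
proof -
  have "ent (conv (conv p (convpow n q)) (convpow n r)) + ent p \<le>
    ent (conv p (convpow n q)) + ent (conv p (convpow n r))"
    by (rule ent_conv_submod) (use fin in auto)
  moreover have "ent (conv p (convpow n q)) \<le> ent p + n * (ent (conv p q) - ent p)"
    "ent (conv p (convpow n r)) \<le> ent p + n * (ent (conv p r) - ent p)"
    by (rule ent_convpow_le; use fin in auto)+
  moreover have "n * (ent (conv p q) - ent p) \<le> n * e" "n * (ent (conv p r) - ent p) \<le> n * e"
    using assms by (auto intro!: mult_left_mono)
  ultimately show ?thesis by (simp add: conv_assoc)
qed

section \<open>Self-similar sums\<close>

text \<open>The law of the sum of \<open>l ^ i * X i\<close> over \<open>i < n\<close>, where the
  \<open>X i\<close> are independent with law \<open>d\<close>.\<close>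

primrec selfsim :: "complex \<Rightarrow> complex pmf \<Rightarrow> nat \<Rightarrow> complex pmf" where
  "selfsim l d 0 = return_pmf 0"
| "selfsim l d (Suc n) = conv d (map_pmf ((*) l) (selfsim l d n))"

lemma fin_selfsim [simp, intro]: "fin_pmf d \<Longrightarrow> fin_pmf (selfsim l d n)"
  by (induction n) auto

lemma selfsim_add: "selfsim l d (s + t) = conv (selfsim l d s) (map_pmf ((*) (l ^ s)) (selfsim l d t))"
  by (induction s) (simp_all add: conv_assoc map_mult_conv pmf.map_comp o_def mult.assoc)

text \<open>Together with \<open>selfsim_mult\<close> this produces the two factors: blocks of
  \<open>k\<close> signs lead to the ratio \<open>l ^ k\<close>, and a block splits into its first
  sign and the rest.\<close>

lemma selfsim_conv: "selfsim l (conv p q) n = conv (selfsim l p n) (selfsim l q n)"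
  by (induction n) (simp_all add: map_mult_conv conv_assoc conv_left_commute)

lemma selfsim_mult: "selfsim l d (k * n) = selfsim (l ^ k) (selfsim l d k) n"
  by (induction n) (simp_all add: selfsim_add)

lemma selfsim_bound:
  assumes l: "cmod l < 1" and B: "\<And>x. x \<in> set_pmf d \<Longrightarrow> cmod x \<le> B" and x: "x \<in> set_pmf (selfsim l d n)"
  shows "cmod x \<le> B / (1 - cmod l)"
  using x
proof (induction n arbitrary: x)
  case 0
  have "B \<ge> 0" using B set_pmf_not_empty[of d] by (meson ex_in_conv norm_ge_zero order_trans)
  then show ?case using 0 l by simp
next
  case (Suc n)
  then obtain a y where "a \<in> set_pmf d" "y \<in> set_pmf (selfsim l d n)" "x = a + l * y"
    by (auto simp: set_conv)
  then have "cmod x \<le> B + cmod l * (B / (1 - cmod l))"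
    using B[of a] Suc.IH[of y] norm_triangle_ineq[of a "l * y"]
      mult_left_mono[of "cmod y" "B / (1 - cmod l)" "cmod l"] by (auto simp: norm_mult)
  also have "\<dots> = B / (1 - cmod l)" using l by (simp add: field_simps)
  finally show ?case .
qed

section \<open>Fourier transform of finite distributions\<close>

definition ft :: "complex pmf \<Rightarrow> complex \<Rightarrow> complex" where
  "ft p \<xi> = pE p (\<lambda>x. cis (Re (cnj \<xi> * x)))"

lemma ft_conv: "fin_pmf p \<Longrightarrow> fin_pmf q \<Longrightarrow> ft (conv p q) \<xi> = ft p \<xi> * ft q \<xi>"
proof -
  assume fin: "fin_pmf p" "fin_pmf q"
  let ?e = "\<lambda>x. cis (Re (cnj \<xi> * x))"
  have "?e (x + y) = ?e x * ?e y" for x y by (simp add: distrib_left cis_mult)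
  then have "ft (conv p q) \<xi> = pE p (\<lambda>x. pE q (\<lambda>y. ?e x * ?e y))"
    by (simp only: ft_def pE_conv[OF fin])
  also have "\<dots> = ft p \<xi> * ft q \<xi>"
    by (simp only: ft_def integral_mult_right_zero integral_mult_left_zero)
  finally show ?thesis .
qed

lemma ft_return_0 [simp]: "ft (return_pmf 0) \<xi> = 1"
  by (simp add: ft_def)

lemma norm_ft_le_1: "cmod (ft p \<xi>) \<le> 1"
  unfolding ft_def by (rule measure_pmf.integral_le_const[THEN order_trans[OF integral_norm_bound]]) (auto intro: measure_pmf.integrable_const_bound[where B=1])

lemma ft_map_mult: "ft (map_pmf ((*) c) p) \<xi> = ft p (cnj c * \<xi>)"
proof -
  have "cnj \<xi> * (c * x) = cnj (cnj c * \<xi>) * x" for x by simp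
  then show ?thesis by (simp only: ft_def pE_map)
qed

lemma ft_convl:
  assumes "\<And>p. p \<in> set ps \<Longrightarrow> fin_pmf p"
  shows "ft (convl ps) \<xi> = prod_list (map (\<lambda>p. ft p \<xi>) ps)"
  using assms by (induction ps) (auto simp: ft_conv fin_convl)

section \<open>Entropy at a given scale\<close>

definition grid :: "real \<Rightarrow> complex \<Rightarrow> int \<times> int" where
  "grid r z = (\<lfloor>Re z / r\<rfloor>, \<lfloor>Im z / r\<rfloor>)"

text \<open>The cells of points within \<open>C * r\<close> of a given point have coordinates
  differing from its own by at most \<open>\<lceil>C\<rceil> + 1\<close>.\<close>

definition grid_const :: "real \<Rightarrow> nat" where
  "grid_const C = (2 * nat \<lceil>C\<rceil> + 3) ^ 2"

lemma grid_const_ge_1: "grid_const C \<ge> 1"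
  by (simp add: grid_const_def)

lemma grid_eq_dist:
  assumes "r > 0" "grid r z = grid r w"
  shows "cmod (z - w) \<le> 2 * r"
proof -
  have *: "\<bar>x - y\<bar> \<le> r" if "\<lfloor>x / r\<rfloor> = \<lfloor>y / r\<rfloor>" for x y :: real
  proof -
    have "\<bar>x / r - y / r\<bar> \<le> 1" using that by linarith
    then have "\<bar>(x - y) / r\<bar> \<le> 1" by (simp add: diff_divide_distrib)
    then show ?thesis using assms(1) by (simp add: abs_le_iff field_simps)
  qed
  have "cmod (z - w) \<le> \<bar>Re (z - w)\<bar> + \<bar>Im (z - w)\<bar>" by (rule cmod_le)
  then show ?thesis using assms(2) *[of "Re z" "Re w"] *[of "Im z" "Im w"] by (simp add: grid_def)
qed

lemma floor_close:
  fixes x y C :: real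
  assumes "\<bar>x - y\<bar> \<le> C"
  shows "\<lfloor>x\<rfloor> \<in> {\<lfloor>y\<rfloor> - (\<lceil>C\<rceil> + 1)..\<lfloor>y\<rfloor> + (\<lceil>C\<rceil> + 1)}"
proof -
  have "x \<le> y + C" "y - C \<le> x" using assms by (auto simp: abs_le_iff)
  moreover have "C \<le> \<lceil>C\<rceil>" "\<lfloor>y\<rfloor> \<le> y" "y < \<lfloor>y\<rfloor> + 1" by linarith+
  ultimately show ?thesis by (simp add: le_floor_iff floor_le_iff) linarith
qed

lemma grid_close:
  assumes "r > 0" "cmod (z - w) \<le> C * r"
  shows "grid r z \<in> (\<lambda>a. {fst a - (\<lceil>C\<rceil> + 1)..fst a + (\<lceil>C\<rceil> + 1)} \<times> {snd a - (\<lceil>C\<rceil> + 1)..snd a + (\<lceil>C\<rceil> + 1)}) (grid r w)"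
proof -
  have "\<bar>Re z / r - Re w / r\<bar> \<le> C" "\<bar>Im z / r - Im w / r\<bar> \<le> C"
    using abs_Re_le_cmod[of "z - w"] abs_Im_le_cmod[of "z - w"] assms
    by (auto simp: diff_divide_distrib[symmetric] field_simps)
  from this[THEN floor_close] show ?thesis by (simp add: grid_def)
qed

lemma grid_card:
  assumes "r > 0" "C \<ge> 0" "\<And>z. z \<in> S \<Longrightarrow> cmod (z - w) \<le> C * r"
  shows "card (grid r ` S) \<le> grid_const C" "finite (grid r ` S)"
proof -
  let ?B = "(\<lambda>a. {fst a - (\<lceil>C\<rceil> + 1)..fst a + (\<lceil>C\<rceil> + 1)} \<times> {snd a - (\<lceil>C\<rceil> + 1)..snd a + (\<lceil>C\<rceil> + 1)}) (grid r w)"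
  have sub: "grid r ` S \<subseteq> ?B" using grid_close[OF assms(1) assms(3)] by (intro image_subsetI)
  have "0 \<le> \<lceil>C\<rceil>" using assms(2) by linarith
  then have "nat (2 * (\<lceil>C\<rceil> + 1) + 1) = 2 * nat \<lceil>C\<rceil> + 3" by (simp add: nat_eq_iff)
  then have "card ?B = grid_const C"
    by (simp add: card_cartesian_product grid_const_def power2_eq_square algebra_simps)
  then show "card (grid r ` S) \<le> grid_const C" "finite (grid r ` S)"
    using card_mono[OF _ sub] finite_subset[OF sub] by auto
qed

text \<open>On a fibre of \<open>g\<close> the values of \<open>F\<close> stay within
  \<open>C * r\<close> of one of them, so they meet boundedly many cells.\<close>

lemma ent_grid_le:
  assumes "fin_pmf P" "r > 0" "C \<ge> 0"
    "\<And>v w. v \<in> set_pmf P \<Longrightarrow> w \<in> set_pmf P \<Longrightarrow> g v = g w \<Longrightarrow> cmod (F v - F w) \<le> C * r"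
  shows "ent (map_pmf (\<lambda>w. grid r (F w)) P) \<le> ent (map_pmf g P) + ln (grid_const C)"
proof (rule ent_le_card[OF assms(1) grid_const_ge_1])
  fix w assume w: "w \<in> set_pmf P"
  have "card (grid r ` (F ` {v\<in>set_pmf P. g v = g w})) \<le> grid_const C"
    by (rule grid_card(1)[where w = "F w"]) (use assms w in blast)+
  then show "card ((\<lambda>w. grid r (F w)) ` {v\<in>set_pmf P. g v = g w}) \<le> grid_const C"
    by (simp add: image_image)
qed

text \<open>The bound \<open>B\<close> is uniform in the length, so the summands from index
  \<open>t\<close> on are felt only at scale \<open>cmod \<rho> ^ t\<close>.\<close>

locale selfsim_setup =
  fixes \<rho> :: complex and d :: "complex pmf" and B :: real
  assumes rho: "0 < cmod \<rho>" "cmod \<rho> < 1" "Im \<rho> \<noteq> 0"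
    and fin_d [simp, intro]: "fin_pmf d"
    and bound: "\<And>n x. x \<in> set_pmf (selfsim \<rho> d n) \<Longrightarrow> cmod x \<le> B"
begin

abbreviation "A n \<equiv> selfsim \<rho> d n"
abbreviation "rad n \<equiv> cmod \<rho> ^ n"
abbreviation "Dn n \<equiv> grid (rad n)"

text \<open>\<open>Lam\<close> is the entropy cost of a bounded displacement at the scale
  considered; \<open>4 * B + 8\<close> is a common bound for the displacements in use, made of a few
  cells and a few tails. \<open>hc s t\<close> is the entropy between two scales,
  \<open>aent\<close> that of a partial sum at its own scale, and \<open>\<beta>\<close> the
  capacity of the plane per step: two dimensions times \<open>ln (1 / cmod \<rho>)\<close>.\<close>

definition "Lam = ln (grid_const (4 * B + 8))"
definition "hc s t p = cent p (Dn t) (Dn s)"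
definition "aent t = ent (map_pmf (Dn t) (A t))"
definition "\<beta> = 2 * ln (1 / cmod \<rho>)"

lemma B_nonneg: "B \<ge> 0"
  using bound[of 0 0] by simp

lemma Lam_nonneg: "Lam \<ge> 0"
  using grid_const_ge_1[of "4 * B + 8"] by (simp add: Lam_def)

lemma rad_pos [simp]: "rad n > 0" using rho by simp

lemma rad_mono: "s \<le> t \<Longrightarrow> rad t \<le> rad s"
  using rho by (intro power_decreasing) auto

lemma beta_pos: "\<beta> > 0"
  unfolding \<beta>_def using rho by simp

lemma ent_Dn_le:
  assumes "fin_pmf P"
    "\<And>v w. v \<in> set_pmf P \<Longrightarrow> w \<in> set_pmf P \<Longrightarrow> g v = g w \<Longrightarrow> cmod (F v - F w) \<le> (4 * B + 8) * rad t"
  shows "ent (map_pmf (\<lambda>w. Dn t (F w)) P) \<le> ent (map_pmf g P) + Lam"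
  unfolding Lam_def by (rule ent_grid_le) (use assms B_nonneg in auto)

lemma card_Dn:
  assumes "\<And>v. v \<in> S \<Longrightarrow> cmod (F v - w) \<le> (4 * B + 8) * rad t"
  shows "card ((\<lambda>v. Dn t (F v)) ` S) \<le> grid_const (4 * B + 8)"
  using grid_card(1)[of "rad t" "4 * B + 8" "F ` S" w] assms B_nonneg by (auto simp: image_image)

lemma Dn_eq_dist: "Dn t z = Dn t w \<Longrightarrow> cmod (z - w) \<le> 2 * rad t"
  by (rule grid_eq_dist) auto

lemma const_le: "2 * rad t \<le> (4 * B + 8) * rad t" "(2 + 2 * B) * rad t \<le> (4 * B + 8) * rad t"
  "2 * B * rad t \<le> (4 * B + 8) * rad t"  "4 * rad t \<le> (4 * B + 8) * rad t"
  using B_nonneg by (intro mult_right_mono; simp)+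

text \<open>The grids of different scales are not nested. A fine cell meets boundedly many coarse
  ones, which costs \<open>Lam\<close>.\<close>

lemma ent_step:
  assumes "fin_pmf p" "s \<le> t"
  shows "ent (map_pmf (Dn t) p) \<ge> ent (map_pmf (Dn s) p) + hc s t p - Lam"
proof -
  have "ent (map_pmf (\<lambda>w. (Dn s w, Dn t w)) p) \<le> ent (map_pmf (Dn t) p) + Lam"
    unfolding Lam_def
  proof (rule ent_joint_le_card[OF assms(1) grid_const_ge_1])
    fix w
    show "card (Dn s ` {v \<in> set_pmf p. Dn t v = Dn t w}) \<le> grid_const (4 * B + 8)"
    proof (rule card_Dn[where w = w and F = "\<lambda>x. x"])
      fix v assume "v \<in> {v \<in> set_pmf p. Dn t v = Dn t w}"
      then have "cmod (v - w) \<le> 2 * rad t" using Dn_eq_dist[of t v w] by auto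
      then show "cmod (v - w) \<le> (4 * B + 8) * rad s"
        using const_le(1)[of s] rad_mono[OF assms(2)] by linarith
    qed
  qed
  moreover have "ent (map_pmf (\<lambda>w. (Dn s w, Dn t w)) p) = ent (map_pmf (\<lambda>w. (Dn t w, Dn s w)) p)"
    by (rule ent_cong_part) (use assms in auto)
  ultimately show ?thesis by (simp add: hc_def cent_def)
qed

lemma ent_step_upper:
  assumes "fin_pmf p"
  shows "ent (map_pmf (Dn t) p) \<le> ent (map_pmf (Dn s) p) + hc s t p"
  using ent_mono[OF assms, of "\<lambda>w. (Dn t w, Dn s w)" "Dn t"] by (simp add: hc_def cent_def)

text \<open>Each value of \<open>g\<close> confines \<open>V\<close> to boundedly many cells of
  scale \<open>s\<close>, so conditioning on the cell is hardly more informative than conditioning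
  on \<open>g\<close>.\<close>

lemma hc_local:
  assumes fin: "fin_pmf P"
    and g: "\<And>v w. v \<in> set_pmf P \<Longrightarrow> w \<in> set_pmf P \<Longrightarrow> g v = g w \<Longrightarrow> cmod (V v - V w) \<le> (4 * B + 8) * rad s"
  shows "hc s t (map_pmf V P) \<ge> cent P (\<lambda>w. Dn t (V w)) g - Lam"
  unfolding hc_def cent_map Lam_def
proof (rule cent_ge_cond[OF fin grid_const_ge_1])
  fix w assume "w \<in> set_pmf P"
  then show "card ((\<lambda>w. Dn s (V w)) ` {v \<in> set_pmf P. g v = g w}) \<le> grid_const (4 * B + 8)"
    by (intro card_Dn[where w = "V w"]) (use g in blast)
qed

text \<open>The summands with index at least \<open>t\<close> move a point by at most
  \<open>B * rad t\<close>.\<close>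

lemma ent_scale_A:
  assumes "t \<le> u"
  shows "ent (map_pmf (Dn t) (A u)) \<ge> aent t - Lam" "ent (map_pmf (Dn t) (A u)) \<le> aent t + Lam"
proof -
  let ?P = "pair_pmf (A t) (A (u - t))"
  let ?V = "\<lambda>(a, b). a + \<rho> ^ t * b"
  have A: "A u = map_pmf ?V ?P"
    using selfsim_add[of \<rho> d t "u - t"] assms
    by (simp add: conv_def pair_map_pmf2 pmf.map_comp o_def case_prod_unfold)
  have *: "cmod (fst v - fst w) \<le> cmod (?V v - ?V w) + 2 * B * rad t"
    "cmod (?V v - ?V w) \<le> cmod (fst v - fst w) + 2 * B * rad t"
    if "v \<in> set_pmf ?P" "w \<in> set_pmf ?P" for v w
  proof -
    define x y where "x = fst v - fst w" and "y = \<rho> ^ t * (snd v - snd w)"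
    have "cmod y \<le> rad t * (B + B)"
      unfolding norm_mult norm_power y_def
      by (intro mult_left_mono order_trans[OF norm_triangle_ineq4] add_mono bound) (use that in auto)
    moreover have "?V v - ?V w = x + y"
      by (simp add: case_prod_unfold algebra_simps x_def y_def)
    moreover have "cmod x \<le> cmod (x + y) + cmod y" "cmod (x + y) \<le> cmod x + cmod y"
      using norm_triangle_ineq4[of "x + y" y] norm_triangle_ineq[of x y] by auto
    ultimately show "cmod (fst v - fst w) \<le> cmod (?V v - ?V w) + 2 * B * rad t"
      "cmod (?V v - ?V w) \<le> cmod (fst v - fst w) + 2 * B * rad t"
      by (simp_all only: x_def[symmetric]) (simp_all add: algebra_simps)
  qed
  have "ent (map_pmf (\<lambda>w. Dn t (fst w)) ?P) \<le> ent (map_pmf (\<lambda>w. Dn t (?V w)) ?P) + Lam"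
  proof (rule ent_Dn_le)
    fix v w assume vw: "v \<in> set_pmf ?P" "w \<in> set_pmf ?P" "Dn t (?V v) = Dn t (?V w)"
    show "cmod (fst v - fst w) \<le> (4 * B + 8) * rad t"
      using *(1)[OF vw(1,2)] Dn_eq_dist[OF vw(3)] const_le(2)[of t] by (simp add: algebra_simps)
  qed simp
  moreover have "ent (map_pmf (\<lambda>w. Dn t (?V w)) ?P) \<le> ent (map_pmf (\<lambda>w. Dn t (fst w)) ?P) + Lam"
  proof (rule ent_Dn_le)
    fix v w assume vw: "v \<in> set_pmf ?P" "w \<in> set_pmf ?P" "Dn t (fst v) = Dn t (fst w)"
    show "cmod (?V v - ?V w) \<le> (4 * B + 8) * rad t"
      using *(2)[OF vw(1,2)] Dn_eq_dist[OF vw(3)] const_le(2)[of t] by (simp add: algebra_simps)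
  qed simp
  moreover have "map_pmf (\<lambda>w. Dn t (fst w)) ?P = map_pmf (Dn t) (A t)"
    using pmf.map_comp[of "Dn t" fst ?P] by (simp add: map_fst_pair_pmf o_def)
  moreover have "map_pmf (\<lambda>w. Dn t (?V w)) ?P = map_pmf (Dn t) (A u)"
    by (simp add: A pmf.map_comp o_def)
  ultimately show "ent (map_pmf (Dn t) (A u)) \<ge> aent t - Lam" "ent (map_pmf (Dn t) (A u)) \<le> aent t + Lam"
    by (simp_all add: aent_def)
qed

text \<open>Multiplication by \<open>\<rho> ^ s\<close> shifts all scales by \<open>s\<close>; the
  rotation in it and the translation do not respect the grid and cost \<open>Lam\<close>.\<close>

lemma ent_affine:
  assumes "fin_pmf p"
  shows "ent (map_pmf (\<lambda>b. Dn (s + t) (a + \<rho> ^ s * b)) p) \<ge> ent (map_pmf (Dn t) p) - Lam"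
    "ent (map_pmf (\<lambda>b. Dn (s + t) (a + \<rho> ^ s * b)) p) \<le> ent (map_pmf (Dn t) p) + Lam"
proof -
  have eq: "cmod (a + \<rho> ^ s * v - (a + \<rho> ^ s * w)) = rad s * cmod (v - w)" for v w
    by (simp add: norm_mult norm_power flip: right_diff_distrib)
  have "ent (map_pmf (\<lambda>b. Dn t b) p) \<le> ent (map_pmf (\<lambda>b. Dn (s + t) (a + \<rho> ^ s * b)) p) + Lam"
  proof (rule ent_Dn_le[OF assms])
    fix v w assume "Dn (s + t) (a + \<rho> ^ s * v) = Dn (s + t) (a + \<rho> ^ s * w)"
    from Dn_eq_dist[OF this] have "rad s * cmod (v - w) \<le> rad s * (2 * rad t)"
      unfolding eq by (simp add: power_add)
    then have "cmod (v - w) \<le> 2 * rad t" by (rule mult_left_le_imp_le) simp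
    then show "cmod (v - w) \<le> (4 * B + 8) * rad t" using const_le(1)[of t] by (rule order_trans)
  qed
  then show "ent (map_pmf (\<lambda>b. Dn (s + t) (a + \<rho> ^ s * b)) p) \<ge> ent (map_pmf (Dn t) p) - Lam" by simp
  show "ent (map_pmf (\<lambda>b. Dn (s + t) (a + \<rho> ^ s * b)) p) \<le> ent (map_pmf (Dn t) p) + Lam"
  proof (rule ent_Dn_le[OF assms])
    fix v w assume "Dn t v = Dn t w"
    from Dn_eq_dist[OF this] have "rad s * cmod (v - w) \<le> rad s * (2 * rad t)"
      by (intro mult_left_mono) auto
    then have "cmod (a + \<rho> ^ s * v - (a + \<rho> ^ s * w)) \<le> 2 * rad (s + t)"
      unfolding eq by (simp add: power_add)
    then show "cmod (a + \<rho> ^ s * v - (a + \<rho> ^ s * w)) \<le> (4 * B + 8) * rad (s + t)"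
      using const_le(1)[of "s + t"] by (rule order_trans)
  qed
qed

lemma map_mult_pair: "conv p (map_pmf f q) = map_pmf (\<lambda>(a, b). a + f b) (pair_pmf p q)"
  by (simp add: conv_def pair_map_pmf2 pmf.map_comp o_def case_prod_unfold)

text \<open>Given the first summand, what remains is a translate of \<open>A u\<close> shrunk to
  scale \<open>s\<close>. Hence convolution with any \<open>p\<close> leaves at least the entropy of
  \<open>A t\<close> between \<open>s\<close> and \<open>s + t\<close>, up to constants.\<close>

lemma hc_selfsim:
  assumes "fin_pmf p" "t \<le> u"
  shows "hc s (s + t) (conv p (map_pmf ((*) (\<rho> ^ s)) (A u))) \<ge> aent t - 3 * Lam"
proof -
  let ?P = "pair_pmf p (A u)"
  let ?V = "\<lambda>(a, b). a + \<rho> ^ s * b"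
  have finP: "fin_pmf ?P" using assms by simp
  have "hc s (s + t) (map_pmf ?V ?P) \<ge> cent ?P (\<lambda>w. Dn (s + t) (?V w)) fst - Lam"
  proof (rule hc_local[OF finP])
    fix v w assume vw: "v \<in> set_pmf ?P" "w \<in> set_pmf ?P" "fst v = fst w"
    have "cmod (\<rho> ^ s * (snd v - snd w)) \<le> rad s * (B + B)"
      unfolding norm_mult norm_power
      by (intro mult_left_mono order_trans[OF norm_triangle_ineq4] add_mono bound) (use vw in auto)
    moreover have "?V v - ?V w = \<rho> ^ s * (snd v - snd w)"
      using vw by (simp add: case_prod_unfold algebra_simps)
    ultimately have "cmod (?V v - ?V w) \<le> 2 * B * rad s"
      by (simp only:) (simp add: algebra_simps)
    then show "cmod (?V v - ?V w) \<le> (4 * B + 8) * rad s"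
      using const_le(3)[of s] by linarith
  qed
  also have "(\<lambda>w. Dn (s + t) (?V w)) = (\<lambda>(y, x). Dn (s + t) (y + \<rho> ^ s * x))" by auto
  also have "cent ?P (\<lambda>(y, x). Dn (s + t) (y + \<rho> ^ s * x)) fst = pE p (\<lambda>a. ent (map_pmf (\<lambda>b. Dn (s + t) (a + \<rho> ^ s * b)) (A u)))"
    using cent_pair_fst[OF assms(1), of "A u" "\<lambda>y x. Dn (s + t) (y + \<rho> ^ s * x)"] by simp
  finally have "hc s (s + t) (map_pmf ?V ?P) \<ge> \<dots> - Lam" .
  moreover have "pE p (\<lambda>a. aent t - 2 * Lam) \<le> pE p (\<lambda>a. ent (map_pmf (\<lambda>b. Dn (s + t) (a + \<rho> ^ s * b)) (A u)))"
  proof (rule pE_mono[OF assms(1)])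
    fix x
    show "aent t - 2 * Lam \<le> ent (map_pmf (\<lambda>b. Dn (s + t) (x + \<rho> ^ s * b)) (A u))"
      using ent_affine(1)[where p = "A u" and s = s and t = t and a = x] ent_scale_A(1)[OF assms(2)] by simp
  qed
  ultimately show ?thesis by (simp add: map_mult_pair)
qed

text \<open>The first \<open>s\<close> summands provide the entropy at scale \<open>s\<close>, the
  others, a shrunk copy, that between \<open>s\<close> and \<open>s + t\<close>. Superadditivity up
  to a constant opens the way for Fekete's argument.\<close>

lemma aent_superadd: "aent (s + t) \<ge> aent s + aent t - 5 * Lam"
proof -
  have "aent (s + t) \<ge> ent (map_pmf (Dn s) (A (s + t))) + hc s (s + t) (A (s + t)) - Lam"
    unfolding aent_def by (rule ent_step) auto
  moreover have "hc s (s + t) (A (s + t)) \<ge> aent t - 3 * Lam"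
    using hc_selfsim[of "A s" t t s] by (simp add: selfsim_add)
  moreover have "ent (map_pmf (Dn s) (A (s + t))) \<ge> aent s - Lam"
    by (rule ent_scale_A) simp
  ultimately show ?thesis by simp
qed

text \<open>A cell meets at most \<open>(9 / rad t)\<^sup>2\<close> cells that are \<open>t\<close>
  steps finer, and \<open>2 * ln 9 \<le> 6\<close>.\<close>

lemma hc_upper:
  assumes "fin_pmf p"
  shows "hc s (s + t) p \<le> \<beta> * t + 6"
proof -
  define C where "C = 2 / rad t"
  have "C \<ge> 2" unfolding C_def using rho by (simp add: power_le_one le_divide_eq)
  have "hc s (s + t) p \<le> ln (grid_const C)"
    unfolding hc_def
  proof (rule cent_le_card[OF assms grid_const_ge_1])
    fix w
    show "card (Dn (s + t) ` {v \<in> set_pmf p. Dn s v = Dn s w}) \<le> grid_const C"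
    proof (rule grid_card(1)[where w = w])
      fix z assume "z \<in> {v \<in> set_pmf p. Dn s v = Dn s w}"
      then have "cmod (z - w) \<le> 2 * rad s" using Dn_eq_dist by auto
      also have "2 * rad s = C * rad (s + t)" using rho by (simp add: C_def power_add)
      finally show "cmod (z - w) \<le> C * rad (s + t)" .
    qed (use \<open>C \<ge> 2\<close> in auto)
  qed
  also have "\<dots> \<le> ln ((9 / rad t)^2)"
  proof -
    have "real (2 * nat \<lceil>C\<rceil> + 3) \<le> 2 * (C + 1) + 3" using \<open>C \<ge> 2\<close> by (simp; linarith)
    also have "\<dots> \<le> 9 / rad t" using \<open>C \<ge> 2\<close> by (simp add: C_def)
    finally have "real (2 * nat \<lceil>C\<rceil> + 3) ^ 2 \<le> (9 / rad t)^2" by (rule power_mono) simp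
    moreover have "9 / rad t > 0" using rad_pos[of t] by (rule divide_pos_pos[rotated]) simp
    ultimately show ?thesis unfolding grid_const_def of_nat_power by (intro ln_mono) auto
  qed
  also have "\<dots> = 2 * ln 9 + \<beta> * t"
    using rho by (simp add: ln_realpow ln_div \<beta>_def algebra_simps)
  also have "ln 9 \<le> (3::real)"
  proof -
    have "(9::real) \<le> exp 3"
      using exp_ge_one_plus_x_over_n_power_n[of 6 3] by (simp add: power_numeral_reduce)
    then show ?thesis by (metis ln_exp ln_le_cancel_iff exp_gt_zero zero_less_numeral)
  qed
  finally show ?thesis by simp
qed

lemma ent_D0_le:
  assumes "fin_pmf p" "\<And>x y. x \<in> set_pmf p \<Longrightarrow> y \<in> set_pmf p \<Longrightarrow> cmod (x - y) \<le> 4 * B + 8"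
  shows "ent (map_pmf (Dn 0) p) \<le> Lam"
proof -
  have "ent (map_pmf (Dn 0) p) \<le> ent (map_pmf (\<lambda>_. ()) p) + Lam"
    using ent_Dn_le[OF assms(1), of "\<lambda>_. ()" "\<lambda>x. x" 0] assms(2) by simp
  also have "ent (map_pmf (\<lambda>_. ()) p) = 0"
    by (simp add: map_pmf_const ent_def)
  finally show ?thesis by simp
qed

lemma ent_upper:
  assumes "fin_pmf p" "\<And>x y. x \<in> set_pmf p \<Longrightarrow> y \<in> set_pmf p \<Longrightarrow> cmod (x - y) \<le> 4 * B + 8"
  shows "ent (map_pmf (Dn t) p) \<le> \<beta> * t + 6 + Lam"
  using ent_step_upper[OF assms(1), of t 0] hc_upper[OF assms(1), of 0 t] ent_D0_le[OF assms] by simp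

lemma aent_upper: "aent t \<le> \<beta> * t + 6 + Lam"
  unfolding aent_def
proof (rule ent_upper)
  fix x y assume "x \<in> set_pmf (A t)" "y \<in> set_pmf (A t)"
  then show "cmod (x - y) \<le> 4 * B + 8"
    using bound[of x t] bound[of y t] norm_triangle_ineq4[of x y] B_nonneg by linarith
qed simp

end

section \<open>Gaussian integrals over the complex plane\<close>

lemma lborel_complex: "(lborel :: complex measure) = distr (lborel \<Otimes>\<^sub>M lborel) borel (\<lambda>(x, y). Complex x y)"
proof (rule lborel_eqI)
  fix l u :: complex assume le: "\<And>b. b \<in> Basis \<Longrightarrow> l \<bullet> b \<le> u \<bullet> b"
  have [measurable]: "(\<lambda>(x,y). Complex x y) \<in> borel_measurable (lborel \<Otimes>\<^sub>M lborel)"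
    by (simp add: Complex_eq case_prod_unfold)
  have "(\<lambda>(x,y). Complex x y) -` box l u = {Re l<..<Re u} \<times> {Im l<..<Im u}"
    by (auto simp: box_def Basis_complex_def inner_complex_def)
  moreover have "Re l \<le> Re u" "Im l \<le> Im u"
    using le[of 1] le[of \<i>] by (auto simp: Basis_complex_def inner_complex_def)
  ultimately show "emeasure (distr (lborel \<Otimes>\<^sub>M lborel) borel (\<lambda>(x,y). Complex x y)) (box l u) = (\<Prod>b\<in>Basis. (u - l) \<bullet> b)"
    by (simp add: emeasure_distr space_pair_measure lborel.emeasure_pair_measure_Times Basis_complex_def
        inner_complex_def ennreal_mult)
qed simp

text \<open>Substitution in the characteristic function of the standard normal law.\<close>

lemma gauss_ft_real:
  fixes c t :: real
  assumes c: "c > 0"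
  shows "integrable lborel (\<lambda>x. exp (- c * x\<^sup>2) *\<^sub>R iexp (t * x))"
    "(LINT x|lborel. exp (- c * x\<^sup>2) *\<^sub>R iexp (t * x)) = of_real (sqrt (pi / c) * exp (- t\<^sup>2 / (4 * c)))"
proof -
  define k where "k = sqrt (2 * c)"
  have k: "k > 0" "k\<^sup>2 = 2 * c" using c by (auto simp: k_def)
  let ?f = "\<lambda>x. exp (- x\<^sup>2 / 2) *\<^sub>R iexp ((t / k) * x)"
  have dens: "exp (- x\<^sup>2 / 2) = sqrt (2 * pi) * std_normal_density x" for x
    by (simp add: std_normal_density_def)
  have int1: "integrable lborel (\<lambda>x. exp (- x\<^sup>2 / 2) :: real)"
    unfolding dens by (intro integrable_mult_right integrable_normal_density) simp
  have int: "integrable lborel ?f"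
    by (rule Bochner_Integration.integrable_bound[OF int1]) (auto simp: norm_exp_i_times)
  have fk: "?f (k * x) = exp (- c * x\<^sup>2) *\<^sub>R iexp (t * x)" for x
    using k c by (simp add: power_mult_distrib)
  show "integrable lborel (\<lambda>x. exp (- c * x\<^sup>2) *\<^sub>R iexp (t * x))"
    using lborel_integrable_real_affine[OF int, of k 0] k fk by simp
  have "integral\<^sup>L lborel ?f = sqrt (2 * pi) *\<^sub>R (LINT x|lborel. std_normal_density x *\<^sub>R iexp ((t / k) * x))"
    unfolding dens by (simp flip: integral_scaleR_right)
  also have "(LINT x|lborel. std_normal_density x *\<^sub>R iexp ((t / k) * x)) = char std_normal_distribution (t / k)"
    unfolding char_def by (subst integral_density) auto
  also have "\<dots> = of_real (exp (- (t / k)\<^sup>2 / 2))"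
    by (simp add: char_std_normal_distribution)
  finally have "integral\<^sup>L lborel ?f = of_real (sqrt (2 * pi) * exp (- (t / k)\<^sup>2 / 2))"
    by (simp add: scaleR_conv_of_real)
  moreover have "integral\<^sup>L lborel ?f = k *\<^sub>R (LINT x|lborel. exp (- c * x\<^sup>2) *\<^sub>R iexp (t * x))"
    using lborel_integral_real_affine[of k ?f 0] k by (simp only: fk add_0_left) simp
  ultimately have "(LINT x|lborel. exp (- c * x\<^sup>2) *\<^sub>R iexp (t * x)) = of_real (sqrt (2 * pi) * exp (- (t / k)\<^sup>2 / 2) / k)"
    using k by (simp add: scaleR_conv_of_real field_simps)
  also have "sqrt (2 * pi) * exp (- (t / k)\<^sup>2 / 2) / k = sqrt (pi / c) * exp (- t\<^sup>2 / (4 * c))"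
    using c by (simp add: k_def real_sqrt_mult real_sqrt_divide power_divide power_mult_distrib)
  finally show "(LINT x|lborel. exp (- c * x\<^sup>2) *\<^sub>R iexp (t * x)) = of_real (sqrt (pi / c) * exp (- t\<^sup>2 / (4 * c)))" .
qed

lemma integral_prod_complex:
  fixes f g :: "real \<Rightarrow> complex"
  assumes f: "integrable lborel f" and g: "integrable lborel g"
  shows "integrable lborel (\<lambda>z. f (Re z) * g (Im z))"
    "(LINT z|lborel. f (Re z) * g (Im z)) = (LINT x|lborel. f x) * (LINT y|lborel. g y)"
proof -
  have [measurable]: "f \<in> borel_measurable borel" "g \<in> borel_measurable borel"
    using f g by auto
  have [measurable]: "(\<lambda>(x,y). Complex x y) \<in> borel_measurable (lborel \<Otimes>\<^sub>M lborel)"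
    by (simp add: Complex_eq case_prod_unfold)
  let ?F = "\<lambda>(x, y). f x * g y"
  have intF: "integrable (lborel \<Otimes>\<^sub>M lborel) ?F"
  proof (rule lborel_pair.Fubini_integrable)
    show "integrable lborel (\<lambda>x. LINT y|lborel. norm (case (x, y) of (x, y) \<Rightarrow> f x * g y))"
      using f g by (simp add: norm_mult integrable_norm)
    show "AE x in lborel. integrable lborel (\<lambda>y. case (x, y) of (x, y) \<Rightarrow> f x * g y)"
      using g by simp
  qed simp
  have eq: "(\<lambda>(x, y). f (Re (Complex x y)) * g (Im (Complex x y))) = ?F" by auto
  show "integrable lborel (\<lambda>z. f (Re z) * g (Im z))"
    unfolding lborel_complex by (subst integrable_distr_eq) (use intF in \<open>auto simp: case_prod_unfold\<close>)
  have "(LINT z|lborel. f (Re z) * g (Im z)) = (LINT p|(lborel \<Otimes>\<^sub>M lborel). ?F p)"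
    unfolding lborel_complex by (subst integral_distr) (auto simp: case_prod_unfold)
  also have "\<dots> = (LINT x|lborel. LINT y|lborel. f x * g y)"
    using lborel_pair.integral_fst'[OF intF] by simp
  finally show "(LINT z|lborel. f (Re z) * g (Im z)) = (LINT x|lborel. f x) * (LINT y|lborel. g y)"
    by simp
qed

text \<open>Left unnormalised so that products and powers are again of this form, and Fourier
  transforms up to a factor.\<close>

definition gs :: "real \<Rightarrow> complex \<Rightarrow> real" where
  "gs c z = exp (- c * (cmod z)\<^sup>2)"

lemma gs_pos [simp]: "gs c z > 0" by (simp add: gs_def)

lemma gs_nonneg [simp]: "gs c z \<ge> 0" by (simp add: gs_def)

lemma gs_measurable [measurable]: "gs c \<in> borel_measurable borel"
  unfolding gs_def by measurable

lemma gs_ft: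
  assumes c: "c > 0"
  shows "integrable lborel (\<lambda>\<xi>. gs c \<xi> *\<^sub>R cis (Re (cnj \<xi> * y)))"
    "(LINT \<xi>|lborel. gs c \<xi> *\<^sub>R cis (Re (cnj \<xi> * y))) = of_real (pi / c * gs (1 / (4 * c)) y)"
proof -
  let ?f = "\<lambda>t x. exp (- c * x\<^sup>2) *\<^sub>R iexp (t * x)"
  have eq: "gs c \<xi> *\<^sub>R cis (Re (cnj \<xi> * y)) = ?f (Re y) (Re \<xi>) * ?f (Im y) (Im \<xi>)" for \<xi>
  proof -
    have "gs c \<xi> = exp (- c * (Re \<xi>)\<^sup>2) * exp (- c * (Im \<xi>)\<^sup>2)"
      by (simp add: gs_def cmod_power2 exp_add[symmetric] algebra_simps)
    moreover have "cis (Re (cnj \<xi> * y)) = iexp (Re y * Re \<xi>) * iexp (Im y * Im \<xi>)"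
      by (simp add: cis_conv_exp exp_add[symmetric] algebra_simps)
    ultimately show ?thesis by (simp add: scaleR_conv_of_real mult_ac)
  qed
  show "integrable lborel (\<lambda>\<xi>. gs c \<xi> *\<^sub>R cis (Re (cnj \<xi> * y)))"
    unfolding eq by (intro integral_prod_complex gauss_ft_real c)
  have "(LINT \<xi>|lborel. gs c \<xi> *\<^sub>R cis (Re (cnj \<xi> * y))) =
     of_real (sqrt (pi / c) * exp (- (Re y)\<^sup>2 / (4 * c))) * of_real (sqrt (pi / c) * exp (- (Im y)\<^sup>2 / (4 * c)))"
    unfolding eq
    by (simp only: integral_prod_complex(2)[OF gauss_ft_real(1)[OF c, of "Re y"] gauss_ft_real(1)[OF c, of "Im y"]]
        gauss_ft_real(2)[OF c])
  also have "\<dots> = of_real ((sqrt (pi / c))\<^sup>2 * (exp (- (Re y)\<^sup>2 / (4 * c)) * exp (- (Im y)\<^sup>2 / (4 * c))))"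
    by (simp only: of_real_mult[symmetric] power2_eq_square mult_ac)
  also have "exp (- (Re y)\<^sup>2 / (4 * c)) * exp (- (Im y)\<^sup>2 / (4 * c)) = gs (1 / (4 * c)) y"
    by (simp add: gs_def cmod_power2 exp_add[symmetric] add_divide_distrib)
  finally show "(LINT \<xi>|lborel. gs c \<xi> *\<^sub>R cis (Re (cnj \<xi> * y))) = of_real (pi / c * gs (1 / (4 * c)) y)"
    using c by simp
qed

lemma integrable_gs: "c > 0 \<Longrightarrow> integrable lborel (gs c)"
  and integral_gs: "c > 0 \<Longrightarrow> (LINT z|lborel. gs c z) = pi / c"
proof -
  assume c: "c > 0"
  have 1: "integrable lborel (\<lambda>z. complex_of_real (gs c z))"
    and 2: "(LINT z|lborel. complex_of_real (gs c z)) = of_real (pi / c)"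
    using gs_ft[OF c, of 0] by (simp_all add: scaleR_conv_of_real gs_def[of "1 / (4 * c)"])
  show 3: "integrable lborel (gs c)" using integrable_Re[OF 1] by simp
  show "(LINT z|lborel. gs c z) = pi / c"
    using 2 unfolding integral_of_real[OF 3] by (simp only: of_real_eq_iff)
qed

lemma ft_measurable [measurable]:
  assumes "fin_pmf p"
  shows "ft p \<in> borel_measurable borel"
proof -
  have [measurable]: "cnj \<in> borel_measurable borel"
    by (intro borel_measurable_continuous_onI continuous_intros)
  have "(\<lambda>\<xi>. \<Sum>x\<in>set_pmf p. pmf p x *\<^sub>R cis (Re (cnj \<xi> * x))) \<in> borel_measurable borel"
    unfolding cis_conv_exp by measurable
  then show ?thesis by (simp add: ft_def[abs_def] pE_sum[OF assms])
qed

lemma integrable_gs_bounded: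
  fixes f :: "complex \<Rightarrow> 'b::{banach, second_countable_topology}"
  assumes "c > 0" "f \<in> borel_measurable borel" "\<And>\<xi>. norm (f \<xi>) \<le> 1"
  shows "integrable lborel (\<lambda>\<xi>. gs c \<xi> *\<^sub>R f \<xi>)"
  by (rule Bochner_Integration.integrable_bound[OF integrable_gs[OF assms(1)]])
     (use assms in \<open>auto intro!: mult_left_le\<close>)

section \<open>Concentration and spread of finitely supported distributions\<close>

text \<open>A Gaussian is the transform of a Gaussian; exchanging the integral with the sum over the
  atoms brings in \<open>ft p\<close>.\<close>

lemma gs_sum_ft:
  assumes fin: "fin_pmf p" and c: "c > 0"
  shows "of_real (pi / c * pE p (\<lambda>x. gs (1 / (4 * c)) (x - a))) = (LINT \<xi>|lborel. gs c \<xi> *\<^sub>R (ft p \<xi> * cis (- Re (cnj \<xi> * a))))"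
proof -
  have "of_real (pi / c * pE p (\<lambda>x. gs (1 / (4 * c)) (x - a))) = (\<Sum>x\<in>set_pmf p. pmf p x *\<^sub>R complex_of_real (pi / c * gs (1 / (4 * c)) (x - a)))"
    by (simp add: pE_sum_real[OF fin] sum_distrib_left scaleR_conv_of_real mult_ac)
  also have "\<dots> = (\<Sum>x\<in>set_pmf p. (LINT \<xi>|lborel. pmf p x *\<^sub>R (gs c \<xi> *\<^sub>R cis (Re (cnj \<xi> * (x - a))))))"
    by (simp only: gs_ft(2)[OF c, symmetric] integral_scaleR_right)
  also have "\<dots> = (LINT \<xi>|lborel. (\<Sum>x\<in>set_pmf p. pmf p x *\<^sub>R (gs c \<xi> *\<^sub>R cis (Re (cnj \<xi> * (x - a))))))"
    by (rule Bochner_Integration.integral_sum[symmetric]) (intro integrable_scaleR_right gs_ft c)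
  also have "(\<lambda>\<xi>. \<Sum>x\<in>set_pmf p. pmf p x *\<^sub>R (gs c \<xi> *\<^sub>R cis (Re (cnj \<xi> * (x - a))))) = (\<lambda>\<xi>. gs c \<xi> *\<^sub>R (ft p \<xi> * cis (- Re (cnj \<xi> * a))))"
  proof
    fix \<xi>
    have "cis (Re (cnj \<xi> * (x - a))) = cis (Re (cnj \<xi> * x)) * cis (- Re (cnj \<xi> * a))" for x
      unfolding cis_mult by (rule arg_cong[where f = cis]) (simp add: algebra_simps)
    then show "(\<Sum>x\<in>set_pmf p. pmf p x *\<^sub>R (gs c \<xi> *\<^sub>R cis (Re (cnj \<xi> * (x - a))))) = gs c \<xi> *\<^sub>R (ft p \<xi> * cis (- Re (cnj \<xi> * a)))"
      by (simp only: ft_def pE_sum[OF fin] sum_distrib_right scaleR_sum_right)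
         (simp add: mult.commute)
  qed
  finally show ?thesis .
qed

text \<open>Esseen's inequality: a Gaussian of width comparable to \<open>r\<close>, centred at a
  point of the cell, is at least \<open>exp (- 2)\<close> on the cell, and its mean is an integral
  of the Fourier transform.\<close>

lemma small_ball:
  assumes fin: "fin_pmf p" and r: "r > 0"
  shows "pmf (map_pmf (grid r) p) a \<le> 2 * r\<^sup>2 * (LINT \<xi>|lborel. gs (r\<^sup>2 / 2) \<xi> * cmod (ft p \<xi>))"
proof (cases "a \<in> grid r ` set_pmf p")
  case False
  then have "pmf (map_pmf (grid r) p) a = 0" by (metis pmf_eq_0_set_pmf set_map_pmf)
  then show ?thesis by (simp add: integral_nonneg_AE)
next
  case True
  then obtain x0 where x0: "x0 \<in> set_pmf p" "a = grid r x0" by auto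
  define c where "c = r\<^sup>2 / 2"
  have c: "c > 0" using r by (simp add: c_def)
  have "pmf (map_pmf (grid r) p) a = pE p (\<lambda>x. indicator {x. grid r x = a} x)"
    by (simp add: pmf_map vimage_def)
  also have "\<dots> \<le> pE p (\<lambda>x. exp 2 * gs (1 / (4 * c)) (x - x0))"
  proof (rule pE_mono[OF fin])
    fix x
    show "indicator {x. grid r x = a} x \<le> exp 2 * gs (1 / (4 * c)) (x - x0)"
    proof (cases "grid r x = a")
      case True
      then have "cmod (x - x0) \<le> 2 * r" using grid_eq_dist[OF r] x0 by auto
      then have "(cmod (x - x0))\<^sup>2 \<le> (2 * r)\<^sup>2" by (rule power_mono) simp
      then have "(cmod (x - x0))\<^sup>2 / (4 * c) \<le> 2" using r by (simp add: c_def field_simps)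
      then have "exp (- 2) \<le> gs (1 / (4 * c)) (x - x0)" by (simp add: gs_def)
      then show ?thesis using True by (simp add: exp_minus field_simps)
    qed simp
  qed
  also have "\<dots> = exp 2 * c / pi * (pi / c * pE p (\<lambda>x. gs (1 / (4 * c)) (x - x0)))"
    using c by simp
  also have "\<dots> \<le> exp 2 * c / pi * cmod (LINT \<xi>|lborel. gs c \<xi> *\<^sub>R (ft p \<xi> * cis (- Re (cnj \<xi> * x0))))"
    unfolding gs_sum_ft[OF fin c, symmetric] using c by (intro mult_left_mono) (simp_all only: norm_of_real abs_ge_self, simp)
  also have "\<dots> \<le> exp 2 * c / pi * (LINT \<xi>|lborel. gs c \<xi> * cmod (ft p \<xi>))"
    using c by (intro mult_left_mono order_trans[OF integral_norm_bound]) (auto simp: norm_mult)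
  also have "\<dots> \<le> 4 * c * (LINT \<xi>|lborel. gs c \<xi> * cmod (ft p \<xi>))"
  proof (rule mult_right_mono)
    have "exp 2 = exp 1 * exp (1::real)" by (simp flip: exp_add)
    also have "\<dots> \<le> 3 * 3" by (intro mult_mono exp_le) auto
    also have "\<dots> \<le> 4 * pi" using pi_gt3 by simp
    finally have "exp 2 / pi \<le> 4" by (simp add: field_simps)
    then show "exp 2 * c / pi \<le> 4 * c" using c by (simp add: field_simps)
  qed (auto intro!: integral_nonneg_AE)
  finally show ?thesis by (simp add: c_def)
qed

section \<open>Variance and its directions\<close>

definition mean :: "complex pmf \<Rightarrow> complex" where "mean p = pE p (\<lambda>x. x)"

definition var :: "complex pmf \<Rightarrow> real" where "var p = pE p (\<lambda>x. (cmod (x - mean p))\<^sup>2)"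

text \<open>The quadratic form of the covariance matrix, whose trace is \<open>var\<close>.\<close>

definition var_dir :: "complex pmf \<Rightarrow> complex \<Rightarrow> real" where
  "var_dir p \<xi> = pE p (\<lambda>x. (Re (cnj \<xi> * (x - mean p)))\<^sup>2)"

lemma var_nonneg: "var p \<ge> 0" unfolding var_def by (rule pE_nonneg) simp

lemma cos_le_quadratic:
  fixes y :: real
  assumes "\<bar>y\<bar> \<le> 1"
  shows "cos y \<le> 1 - y\<^sup>2 / 4"
proof -
  define x where "x = \<bar>y\<bar> / 2"
  have x: "0 \<le> x" "x \<le> 1 / 2" using assms by (auto simp: x_def)
  have cos: "cos t \<ge> 7 / 8" if "0 \<le> t" "t \<le> 1 / 2" for t :: real
  proof -
    have "\<bar>sin (t / 2)\<bar> \<le> 1 / 4" using abs_sin_x_le_abs_x[of "t / 2"] that by simp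
    then have "(sin (t / 2))\<^sup>2 \<le> (1 / 4)\<^sup>2" unfolding abs_le_square_iff[symmetric] by simp
    then show ?thesis using cos_double_sin[of "t / 2"] by (simp add: power2_eq_square)
  qed
  have "sin 0 - 7 / 8 * 0 \<le> sin x - 7 / 8 * x"
  proof (rule DERIV_nonneg_imp_nondecreasing[OF x(1)])
    fix t assume t: "0 \<le> t" "t \<le> x"
    have "((\<lambda>t. sin t - 7 / 8 * t) has_real_derivative cos t - 7 / 8) (at t)"
      by (auto intro!: derivative_eq_intros)
    then show "\<exists>z. ((\<lambda>t. sin t - 7 / 8 * t) has_real_derivative z) (at t) \<and> 0 \<le> z"
      using cos[of t] t x by auto
  qed
  then have "(7 / 8 * x)\<^sup>2 \<le> (sin x)\<^sup>2" using x by (intro power_mono) auto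
  then have "49 / 64 * x\<^sup>2 \<le> (sin x)\<^sup>2" by (simp add: power_mult_distrib power_divide)
  then have "x\<^sup>2 \<le> 2 * (sin x)\<^sup>2" using zero_le_power2[of x] by linarith
  moreover have "cos y = 1 - 2 * (sin x)\<^sup>2"
    using cos_double_sin[of x] by (simp add: x_def)
  moreover have "x\<^sup>2 = y\<^sup>2 / 4" by (simp add: x_def power_divide)
  ultimately show ?thesis by simp
qed

lemma pE_complex_linear:
  assumes "fin_pmf p"
  shows "pE p (\<lambda>x. Re (c * x)) = Re (c * pE p (\<lambda>x. x))"
proof -
  have "pE p (\<lambda>x. Re (c * x)) = Re (pE p (\<lambda>x. c * x))"
    by (rule integral_Re) (rule integrable_measure_pmf_finite[OF assms])
  then show ?thesis by simp
qed

lemma pE_dir_0: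
  assumes fin: "fin_pmf p"
  shows "pE p (\<lambda>x. Re (c * (x - mean p))) = 0"
proof -
  have "pE p (\<lambda>x. Re (c * (x - mean p))) = pE p (\<lambda>x. Re (c * x) - Re (c * mean p))"
    by (simp only: right_diff_distrib minus_complex.sel)
  also have "\<dots> = 0"
    unfolding pE_diff[OF fin] pE_complex_linear[OF fin] by (simp add: mean_def)
  finally show ?thesis .
qed

text \<open>The square of the modulus is the mean of \<open>cos (v x - v y)\<close> over two
  independent copies. The bound on the diameter keeps the argument in the range of the quadratic
  estimate, and the mixed term vanishes because \<open>v\<close> is centred.\<close>

lemma norm_ft_le_var:
  assumes fin: "fin_pmf p"
    and diam: "\<And>x y. x \<in> set_pmf p \<Longrightarrow> y \<in> set_pmf p \<Longrightarrow> cmod (x - y) * cmod \<xi> \<le> 1"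
  shows "cmod (ft p \<xi>) \<le> 1 - var_dir p \<xi> / 4"
proof -
  define v where "v = (\<lambda>x. Re (cnj \<xi> * (x - mean p)))"
  have v0: "pE p v = 0" unfolding v_def by (rule pE_dir_0[OF fin])
  have vd: "var_dir p \<xi> = pE p (\<lambda>x. (v x)\<^sup>2)" by (simp add: var_dir_def v_def)
  have vxy: "Re (cnj \<xi> * x) - Re (cnj \<xi> * y) = v x - v y" for x y by (simp add: v_def algebra_simps)
  have "of_real ((cmod (ft p \<xi>))\<^sup>2) = ft p \<xi> * cnj (ft p \<xi>)"
    by (simp only: complex_norm_square)
  also have "\<dots> = (\<Sum>x\<in>set_pmf p. \<Sum>y\<in>set_pmf p. of_real (pmf p x * pmf p y) * cis (v x - v y))"
    unfolding ft_def pE_sum[OF fin] cnj_sum sum_product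
  proof (intro sum.cong refl)
    fix x y
    have "cis (Re (cnj \<xi> * x)) * cnj (cis (Re (cnj \<xi> * y))) = cis (v x - v y)"
      by (simp only: cis_cnj cis_mult vxy[symmetric]) (rule arg_cong[where f = cis], simp)
    moreover have "(a *\<^sub>R w) * cnj (b *\<^sub>R z) = of_real (a * b) * (w * cnj z)" for a b w z
      by (simp add: scaleR_conv_of_real)
    ultimately show "pmf p x *\<^sub>R cis (Re (cnj \<xi> * x)) * cnj (pmf p y *\<^sub>R cis (Re (cnj \<xi> * y))) =
        of_real (pmf p x * pmf p y) * cis (v x - v y)"
      by (simp only:)
  qed
  finally have "(cmod (ft p \<xi>))\<^sup>2 = Re (\<Sum>x\<in>set_pmf p. \<Sum>y\<in>set_pmf p. of_real (pmf p x * pmf p y) * cis (v x - v y))"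
    by (metis Re_complex_of_real)
  also have "\<dots> = pE p (\<lambda>x. pE p (\<lambda>y. cos (v x - v y)))"
    by (simp add: pE_sum[OF fin] Re_sum sum_distrib_left mult_ac)
  also have "\<dots> \<le> pE p (\<lambda>x. pE p (\<lambda>y. 1 - (v x - v y)\<^sup>2 / 4))"
  proof (intro pE_mono[OF fin] cos_le_quadratic)
    fix x y assume xy: "x \<in> set_pmf p" "y \<in> set_pmf p"
    have "\<bar>v x - v y\<bar> = \<bar>Re (cnj \<xi> * (x - y))\<bar>" unfolding vxy[symmetric] by (simp add: algebra_simps)
    also have "\<dots> \<le> cmod (cnj \<xi> * (x - y))" by (rule abs_Re_le_cmod)
    also have "\<dots> \<le> 1" using diam[OF xy] by (simp add: norm_mult mult.commute)
    finally show "\<bar>v x - v y\<bar> \<le> 1" .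
  qed
  also have "\<dots> = pE p (\<lambda>x. pE p (\<lambda>y. 1 - (v x)\<^sup>2 / 4 - (v y)\<^sup>2 / 4 + v x / 2 * v y))"
    by (intro pE_cong) (simp add: power2_eq_square field_simps)
  also have "\<dots> = pE p (\<lambda>x. (1 - var_dir p \<xi> / 4) - (v x)\<^sup>2 / 4)"
  proof (rule pE_cong)
    fix x
    have "pE p (\<lambda>y. 1 - (v x)\<^sup>2 / 4 - (v y)\<^sup>2 / 4 + v x / 2 * v y) =
      pE p (\<lambda>y. 1 - (v x)\<^sup>2 / 4) - pE p (\<lambda>y. (v y)\<^sup>2 / 4) + pE p (\<lambda>y. v x / 2 * v y)"
      by (simp only: pE_add[OF fin] pE_diff[OF fin])
    then show "pE p (\<lambda>y. 1 - (v x)\<^sup>2 / 4 - (v y)\<^sup>2 / 4 + v x / 2 * v y) = (1 - var_dir p \<xi> / 4) - (v x)\<^sup>2 / 4"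
      by (simp add: v0 vd)
  qed
  also have "\<dots> = 1 - var_dir p \<xi> / 2"
    by (simp only: pE_diff[OF fin]) (simp add: vd)
  finally have le: "(cmod (ft p \<xi>))\<^sup>2 \<le> 1 - var_dir p \<xi> / 2" .
  then have "var_dir p \<xi> \<le> 2" using zero_le_power2[of "cmod (ft p \<xi>)"] by linarith
  then have nn: "0 \<le> 1 - var_dir p \<xi> / 4" by simp
  have "(cmod (ft p \<xi>))\<^sup>2 \<le> (1 - var_dir p \<xi> / 4)\<^sup>2"
    by (rule order_trans[OF le]) (simp add: power2_eq_square algebra_simps)
  then show ?thesis using nn by (rule power2_le_imp_le)
qed

text \<open>If \<open>Re z\<close> and \<open>Re (\<rho> * z)\<close> are both small, then so is
  \<open>Im \<rho> * Im z\<close>; a nonreal \<rho> thus leaves no direction in which both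
  vanish.\<close>

lemma two_directions:
  assumes "cmod \<rho> \<le> 1"
  shows "(Re z)\<^sup>2 + (Re (\<rho> * z))\<^sup>2 \<ge> (Im \<rho>)\<^sup>2 / 3 * (cmod z)\<^sup>2"
proof -
  define a b u v where "a = Re z" and "b = Im z" and "u = Re \<rho>" and "v = Im \<rho>"
  have u: "u\<^sup>2 \<le> 1" "v\<^sup>2 \<le> 1"
  proof -
    have "u\<^sup>2 + v\<^sup>2 \<le> 1"
      using assms power_le_one[of "cmod \<rho>" 2] by (simp add: u_def v_def cmod_power2)
    then show "u\<^sup>2 \<le> 1" "v\<^sup>2 \<le> 1" using zero_le_power2[of u] zero_le_power2[of v] by linarith+
  qed
  define w where "w = u * a - v * b"
  have "v\<^sup>2 * b\<^sup>2 = (u * a - w)\<^sup>2" by (simp add: w_def power_mult_distrib)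
  also have "\<dots> \<le> 2 * (u * a)\<^sup>2 + 2 * w\<^sup>2" using zero_le_power2[of "u * a + w"] by (simp add: power2_eq_square algebra_simps)
  also have "(u * a)\<^sup>2 \<le> a\<^sup>2" using u(1) by (simp add: power_mult_distrib mult_left_le_one_le)
  finally have 1: "v\<^sup>2 * b\<^sup>2 \<le> 2 * a\<^sup>2 + 2 * w\<^sup>2" by simp
  have "v\<^sup>2 * a\<^sup>2 \<le> a\<^sup>2" using u(2) by (simp add: mult_left_le_one_le)
  with 1 have "v\<^sup>2 * (a\<^sup>2 + b\<^sup>2) \<le> 3 * (a\<^sup>2 + w\<^sup>2)" by (simp add: distrib_left) (use zero_le_power2[of w] in linarith)
  then show ?thesis by (simp add: cmod_power2 a_def b_def u_def v_def w_def)
qed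

lemma var_dir_sum:
  assumes fin: "fin_pmf p" and \<rho>: "cmod \<rho> \<le> 1"
  shows "var_dir p \<xi> + var_dir p (cnj \<rho> * \<xi>) \<ge> (Im \<rho>)\<^sup>2 / 3 * (cmod \<xi>)\<^sup>2 * var p"
proof -
  have "(Im \<rho>)\<^sup>2 / 3 * (cmod \<xi>)\<^sup>2 * var p = pE p (\<lambda>x. (Im \<rho>)\<^sup>2 / 3 * (cmod (cnj \<xi> * (x - mean p)))\<^sup>2)"
    by (simp add: var_def norm_mult power_mult_distrib)
  also have "\<dots> \<le> pE p (\<lambda>x. (Re (cnj \<xi> * (x - mean p)))\<^sup>2 + (Re (\<rho> * (cnj \<xi> * (x - mean p))))\<^sup>2)"
    by (intro pE_mono[OF fin] two_directions \<rho>)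
  also have "\<dots> = var_dir p \<xi> + var_dir p (cnj \<rho> * \<xi>)"
    by (simp only: pE_add[OF fin] var_dir_def complex_cnj_mult complex_cnj_cnj mult.assoc)
  finally show ?thesis .
qed

lemma mean_conv: "fin_pmf p \<Longrightarrow> fin_pmf q \<Longrightarrow> mean (conv p q) = mean p + mean q"
  by (simp add: mean_def pE_conv pE_add)

lemma var_conv:
  assumes fin: "fin_pmf p" "fin_pmf q"
  shows "var (conv p q) = var p + var q"
proof -
  let ?x = "\<lambda>x. x - mean p" and ?y = "\<lambda>y. y - mean q"
  have eq: "(cmod (x + y - mean (conv p q)))\<^sup>2 = (cmod (?x x))\<^sup>2 + (cmod (?y y))\<^sup>2 + 2 * Re (cnj (?x x) * (y - mean q))" for x y
    unfolding mean_conv[OF fin] cmod_power2 by (simp add: power2_eq_square algebra_simps)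
  have "var (conv p q) = pE p (\<lambda>x. pE q (\<lambda>y. (cmod (?x x))\<^sup>2 + (cmod (?y y))\<^sup>2 + 2 * Re (cnj (?x x) * (y - mean q))))"
    by (simp only: var_def pE_conv[OF fin] eq)
  also have "\<dots> = pE p (\<lambda>x. (cmod (?x x))\<^sup>2 + var q)"
  proof (rule pE_cong)
    fix x
    have "pE q (\<lambda>y. (cmod (?x x))\<^sup>2 + (cmod (?y y))\<^sup>2 + 2 * Re (cnj (?x x) * (y - mean q))) =
      (cmod (?x x))\<^sup>2 + var q + 2 * pE q (\<lambda>y. Re (cnj (?x x) * (y - mean q)))"
      by (simp only: pE_add[OF fin(2)] var_def integral_mult_right_zero pE_const)
    then show "pE q (\<lambda>y. (cmod (?x x))\<^sup>2 + (cmod (?y y))\<^sup>2 + 2 * Re (cnj (?x x) * (y - mean q))) = (cmod (?x x))\<^sup>2 + var q"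
      by (simp only: pE_dir_0[OF fin(2)] mult_zero_right add_0_right)
  qed
  also have "\<dots> = var p + var q"
    by (simp only: pE_add[OF fin(1)] var_def pE_const)
  finally show ?thesis .
qed

lemma var_map_mult: "var (map_pmf ((*) c) p) = (cmod c)\<^sup>2 * var p"
proof -
  have "mean (map_pmf ((*) c) p) = c * mean p" by (simp add: mean_def pE_map)
  then show ?thesis by (simp add: var_def pE_map norm_mult power_mult_distrib flip: right_diff_distrib)
qed

lemma var_convl:
  "(\<And>p. p \<in> set ps \<Longrightarrow> fin_pmf p) \<Longrightarrow> var (convl ps) = sum_list (map var ps)"
proof (induction ps)
  case Nil
  then show ?case by (simp add: var_def mean_def)
next
  case (Cons p ps)
  then show ?case by (simp add: var_conv fin_convl)
qed

lemma pE_ln_le: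
  fixes f :: "'a \<Rightarrow> real"
  assumes fin: "fin_pmf q" and pos: "\<And>x. x \<in> set_pmf q \<Longrightarrow> f x > 0"
  shows "pE q (\<lambda>x. ln (f x)) \<le> ln (pE q f)" "pE q f > 0"
proof -
  define m where "m = pE q f"
  obtain x0 where "x0 \<in> set_pmf q" using set_pmf_not_empty[of q] by auto
  then have "0 < pmf q x0 * f x0" by (simp add: pos pmf_positive)
  also have "\<dots> \<le> (\<Sum>x\<in>set_pmf q. pmf q x * f x)"
    by (rule member_le_sum) (use \<open>x0 \<in> set_pmf q\<close> fin pos in \<open>auto intro!: mult_nonneg_nonneg intro: less_imp_le\<close>)
  finally have m: "m > 0" by (simp add: m_def pE_sum_real[OF fin])
  then show "pE q f > 0" by (simp add: m_def)
  have "pE q (\<lambda>x. ln (f x)) \<le> pE q (\<lambda>x. ln m + (f x / m - 1))"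
  proof (rule pE_mono[OF fin])
    fix x assume x: "x \<in> set_pmf q"
    have "ln (f x / m) \<le> f x / m - 1" by (rule ln_le_minus_one) (use pos[OF x] m in simp)
    then show "ln (f x) \<le> ln m + (f x / m - 1)" using pos[OF x] m by (simp add: ln_div)
  qed
  also have "\<dots> = ln m"
    using m by (simp only: pE_add[OF fin] pE_diff[OF fin]) (simp add: m_def)
  finally show "pE q (\<lambda>x. ln (f x)) \<le> ln (pE q f)" by (simp add: m_def)
qed

lemma sum_int_power_le:
  fixes x :: real
  assumes x: "0 \<le> x" "x < 1" and F: "finite F"
  shows "(\<Sum>m\<in>F. x ^ nat \<bar>m - m0\<bar>) \<le> 2 / (1 - x)"
proof -
  have geo: "(\<Sum>n\<in>G. x ^ n) \<le> 1 / (1 - x)" if "finite G" for G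
  proof -
    have "(\<Sum>n\<in>G. x ^ n) \<le> (\<Sum>n. x ^ n)"
      by (rule sum_le_suminf) (use x that in \<open>auto intro!: summable_geometric\<close>)
    then show ?thesis using x by (simp add: suminf_geometric)
  qed
  have inj: "inj_on (\<lambda>m. nat \<bar>m - m0\<bar>) (F \<inter> {m0..})" "inj_on (\<lambda>m. nat \<bar>m - m0\<bar>) (F - {m0..})"
    by (auto simp: inj_on_def)
  have "(\<Sum>m\<in>F. x ^ nat \<bar>m - m0\<bar>) = (\<Sum>m\<in>F \<inter> {m0..}. x ^ nat \<bar>m - m0\<bar>) + (\<Sum>m\<in>F - {m0..}. x ^ nat \<bar>m - m0\<bar>)"
    by (rule sum.Int_Diff[OF F])
  also have "\<dots> \<le> 1 / (1 - x) + 1 / (1 - x)"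
    using geo[of "(\<lambda>m. nat \<bar>m - m0\<bar>) ` (F \<inter> {m0..})"] geo[of "(\<lambda>m. nat \<bar>m - m0\<bar>) ` (F - {m0..})"] F
    unfolding sum.reindex[OF inj(1)] sum.reindex[OF inj(2)] o_def
    by (intro add_mono) blast+
  finally show ?thesis by simp
qed

lemma floor_diff_le:
  fixes u w :: real
  shows "\<bar>of_int \<lfloor>u\<rfloor> - of_int \<lfloor>w\<rfloor>\<bar> \<le> \<bar>u - w\<bar> + 1"
  by linarith

text \<open>Gibbs with a two-sided geometric distribution on the lattice, centred at the cell of the
  mean. Its width \<open>s\<close> is the standard deviation in units of \<open>R\<close>, plus
  one.\<close>

lemma ent_grid_var:
  assumes fin: "fin_pmf p" and R: "R > 0"
  shows "ent (map_pmf (grid R) p) \<le> ln (32 * exp 2 * (1 + var p / R\<^sup>2))"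
proof -
  define a where "a = mean p"
  define s where "s = sqrt (var p) / R + 1"
  have s: "s \<ge> 1" using R by (simp add: s_def var_nonneg)
  define x where "x = exp (- 1 / s)"
  have x: "0 < x" "x < 1" using s by (auto simp: x_def)
  have 1: "1 / (1 - x) \<le> s + 1"
  proof -
    have "1 + 1 / s \<le> exp (1 / s)" by (rule exp_ge_add_one_self)
    then have "(1 + 1 / s) * x \<le> 1" using s by (simp add: x_def exp_minus field_simps)
    then have "1 \<le> (s + 1) * (1 - x)" using s by (simp add: field_simps)
    then show ?thesis using x by (simp add: field_simps)
  qed
  obtain m0 n0 where a: "grid R a = (m0, n0)" by fastforce
  let ?q = "\<lambda>(m, n). x ^ nat \<bar>m - m0\<bar> * x ^ nat \<bar>n - n0\<bar> / (2 * (s + 1))\<^sup>2"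
  let ?S = "set_pmf (map_pmf (grid R) p)"
  have "(\<Sum>z\<in>?S. ?q z) \<le> (\<Sum>z\<in>fst ` ?S \<times> snd ` ?S. ?q z)"
  proof (rule sum_mono2)
    show "?S \<subseteq> fst ` ?S \<times> snd ` ?S" by (rule subset_fst_snd)
  qed (use fin x in \<open>auto simp: case_prod_unfold\<close>)
  also have "\<dots> = (\<Sum>m\<in>fst ` ?S. x ^ nat \<bar>m - m0\<bar>) * (\<Sum>n\<in>snd ` ?S. x ^ nat \<bar>n - n0\<bar>) / (2 * (s + 1))\<^sup>2"
    by (simp add: sum.cartesian_product[symmetric] sum_product sum_divide_distrib)
  also have "\<dots> \<le> (2 / (1 - x)) * (2 / (1 - x)) / (2 * (s + 1))\<^sup>2"
    by (intro divide_right_mono mult_mono sum_int_power_le sum_nonneg) (use x fin in auto)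
  also have "\<dots> \<le> (2 * (s + 1)) * (2 * (s + 1)) / (2 * (s + 1))\<^sup>2"
    using 1 x s by (intro divide_right_mono mult_mono) auto
  also have "\<dots> = 1" using s by (simp add: power2_eq_square)
  finally have "ent (map_pmf (grid R) p) \<le> pE (map_pmf (grid R) p) (\<lambda>z. - ln (?q z))"
    by (intro gibbs) (use fin x s in \<open>auto split: prod.splits\<close>)
  also have "\<dots> \<le> pE p (\<lambda>z. 2 * ln (2 * (s + 1)) + 2 / s * (cmod (z - a) / R + 1))"
    unfolding pE_map
  proof (rule pE_mono[OF fin])
    fix z
    obtain m n where mn: "grid R z = (m, n)" by fastforce
    have close: "\<bar>of_int \<lfloor>u / R\<rfloor> - of_int \<lfloor>w / R\<rfloor>\<bar> \<le> \<bar>u - w\<bar> / R + 1" for u w :: real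
    proof -
      have "\<bar>u / R - w / R\<bar> = \<bar>u - w\<bar> / R" using R by (simp add: diff_divide_distrib[symmetric])
      then show ?thesis using floor_diff_le[of "u / R" "w / R"] by simp
    qed
    define u v where "u = nat \<bar>m - m0\<bar>" and "v = nat \<bar>n - n0\<bar>"
    define e where "e = cmod (z - a) / R + 1"
    have "real u \<le> e" "real v \<le> e"
    proof -
      have "real u = \<bar>of_int \<lfloor>Re z / R\<rfloor> - of_int \<lfloor>Re a / R\<rfloor>\<bar>"
        "real v = \<bar>of_int \<lfloor>Im z / R\<rfloor> - of_int \<lfloor>Im a / R\<rfloor>\<bar>"
        using mn a by (auto simp: grid_def u_def v_def)
      moreover have "\<bar>Re z - Re a\<bar> / R + 1 \<le> e" "\<bar>Im z - Im a\<bar> / R + 1 \<le> e"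
        using abs_Re_le_cmod[of "z - a"] abs_Im_le_cmod[of "z - a"] R
        by (auto simp: e_def intro!: divide_right_mono)
      ultimately show "real u \<le> e" "real v \<le> e"
        using close[of "Re z" "Re a"] close[of "Im z" "Im a"] by auto
    qed
    then have "(real u + real v) / s \<le> 2 * e / s"
      using s by (intro divide_right_mono) auto
    then have le: "real u / s + real v / s \<le> 2 / s * e"
      by (simp add: add_divide_distrib)
    have lnx: "ln x = - 1 / s" by (simp add: x_def)
    have "- ln (x ^ u * x ^ v / (2 * (s + 1))\<^sup>2) = 2 * ln (2 * (s + 1)) + (real u / s + real v / s)"
      using x s by (simp add: ln_div ln_mult ln_realpow lnx)
    then have "- ln (x ^ u * x ^ v / (2 * (s + 1))\<^sup>2) \<le> 2 * ln (2 * (s + 1)) + 2 / s * e"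
      using le by simp
    then show "- ln (?q (grid R z)) \<le> 2 * ln (2 * (s + 1)) + 2 / s * (cmod (z - a) / R + 1)"
      unfolding mn e_def[symmetric] by (simp only: prod.case u_def v_def)
  qed
  also have "\<dots> = 2 * ln (2 * (s + 1)) + 2 / s * (pE p (\<lambda>z. cmod (z - a)) / R + 1)"
    by (simp only: pE_add[OF fin] integral_mult_right_zero integral_divide_zero pE_const)
  also have "\<dots> \<le> 2 * ln (2 * (s + 1)) + 2 / s * s"
  proof -
    have "(pE p (\<lambda>z. cmod (z - a)))\<^sup>2 \<le> var p"
    proof -
      define m where "m = pE p (\<lambda>z. cmod (z - a))"
      have "0 \<le> pE p (\<lambda>z. (cmod (z - a) - m)\<^sup>2)" by (rule pE_nonneg) simp
      also have "\<dots> = pE p (\<lambda>z. (cmod (z - a))\<^sup>2 + m\<^sup>2 - 2 * m * cmod (z - a))"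
        by (simp add: power2_eq_square algebra_simps)
      also have "\<dots> = var p + m\<^sup>2 - 2 * m * m"
        by (simp only: pE_add[OF fin] pE_diff[OF fin] integral_mult_right_zero pE_const) (simp add: var_def a_def m_def)
      finally show ?thesis by (simp add: m_def power2_eq_square)
    qed
    then have "pE p (\<lambda>z. cmod (z - a)) \<le> sqrt (var p)" by (rule real_le_rsqrt)
    then have "pE p (\<lambda>z. cmod (z - a)) / R + 1 \<le> s" using R by (simp add: s_def divide_right_mono)
    then show ?thesis using s by (intro add_left_mono mult_left_mono) auto
  qed
  also have "\<dots> = ln ((2 * (s + 1))\<^sup>2 * exp 2)"
    using s by (simp add: ln_mult ln_realpow)
  also have "\<dots> \<le> ln (32 * exp 2 * (1 + var p / R\<^sup>2))"
  proof -
    have "(s + 1)\<^sup>2 \<le> 2 * (sqrt (var p) / R)\<^sup>2 + 8"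
    proof -
      define y where "y = sqrt (var p) / R"
      have "s + 1 = y + 2" by (simp add: s_def y_def)
      then show ?thesis using zero_le_power2[of "y - 2"]
        unfolding y_def[symmetric] by (simp add: power2_eq_square algebra_simps)
    qed
    also have "(sqrt (var p) / R)\<^sup>2 = var p / R\<^sup>2" by (simp add: power_divide var_nonneg)
    finally have le: "(s + 1)\<^sup>2 \<le> 2 * (var p / R\<^sup>2) + 8" .
    have gen: "4 * A \<le> 32 * (1 + V)" if "A \<le> 2 * V + 8" "0 \<le> V" for A V :: real
      using that by simp
    have "4 * (s + 1)\<^sup>2 \<le> 32 * (1 + var p / R\<^sup>2)"
      by (rule gen[OF le]) (simp add: var_nonneg)
    then have "(2 * (s + 1))\<^sup>2 * exp 2 \<le> 32 * exp 2 * (1 + var p / R\<^sup>2)"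
    proof -
      assume le: "4 * (s + 1)\<^sup>2 \<le> 32 * (1 + var p / R\<^sup>2)"
      have "(2 * (s + 1))\<^sup>2 = 4 * (s + 1)\<^sup>2" by (simp only: power_mult_distrib) simp
      then show ?thesis using mult_right_mono[OF le, of "exp 2"] by (simp add: mult_ac)
    qed
    then show ?thesis using s by (intro ln_mono) auto
  qed
  finally show ?thesis .
qed

section \<open>Convolution powers saturate scales of positive entropy\<close>

lemma norm_prod_list: "cmod (prod_list xs) = prod_list (map cmod xs)"
  by (induction xs) (auto simp: norm_mult)

lemma exp_neg_le: "exp (- y) \<le> 2 / y\<^sup>2" if "y > 0" for y :: real
proof -
  have "y\<^sup>2 / 2 \<le> 1 + y + y\<^sup>2 / 2" using that by simp
  also have "\<dots> \<le> exp y" by (rule exp_lower_Taylor_quadratic) (use that in simp)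
  finally show ?thesis using that by (simp add: exp_minus field_simps)
qed

context selfsim_setup
begin

text \<open>\<open>L3\<close> is the bound of \<open>ent_grid_var\<close> at variance
  \<open>R\<^sup>2\<close>, so at least this much mean entropy forces at least this mean variance.
  \<open>c\<rho>\<close> is the constant of \<open>two_directions\<close>, and \<open>L5\<close>
  gathers the constants of the small-ball and the variance estimates.\<close>

definition "L3 = ln (64 * exp 2)"

definition "c\<rho> = (Im \<rho>)\<^sup>2 / 3"

definition "L5 = ln (3 * (32 * exp 2) * (8 * pi * (1 / c\<rho> + 4096)))"

lemma c\<rho>_pos: "c\<rho> > 0" using rho by (simp add: c\<rho>_def)

definition spread :: "nat \<Rightarrow> complex pmf \<Rightarrow> complex pmf" where
  "spread n \<theta> = conv (convpow n \<theta>) (map_pmf ((*) \<rho>) (convpow n \<theta>))"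

text \<open>
  Conditioned on the cells of the summands at a finer scale, the convolution is a sum of independent
  bounded variables. Multiplication by \<open>\<rho>\<close> turns by an angle that is not a multiple of
  \<open>\<pi>\<close>, so the variance of the two blocks together is comparable in all directions.
\<close>

lemma hc_spread:
  assumes fin: "fin_pmf \<theta>"
    and hc: "hc (s + 2 * l) (s + 3 * l) \<theta> \<ge> L3"
    and n: "(1 / rad l) ^ 6 \<le> real n" "real n \<le> 2 * (1 / rad l) ^ 6"
  shows "hc s (s + l) (spread n \<theta>) \<ge> \<beta> * l - L5"
proof -
  \<comment> \<open>Four scales, each finer than the previous one by the factor \<open>x\<close>.
    With \<open>n\<close> about \<open>x ^ 6\<close> the total variance \<open>n * v\<close> reaches
    \<open>R\<^sup>2\<close> even if \<open>v\<close> is only \<open>r3\<^sup>2\<close>, which is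
    all that the entropy hypothesis gives.\<close>
  define x where "x = 1 / rad l"
  define R r r2 r3 where "R = rad s" and "r = rad (s + l)" and "r2 = rad (s + 2 * l)" and "r3 = rad (s + 3 * l)"
  have x: "x \<ge> 1" using rho by (simp add: x_def le_divide_eq power_le_one)
  have pos: "R > 0" "r > 0" "r2 > 0" "r3 > 0" by (simp_all add: R_def r_def r2_def r3_def)
  have rl: "rad l = 1 / x" by (simp add: x_def)
  have rr: "r = R / x" "r2 = r / x" "r3 = r2 / x"
    unfolding R_def r_def r2_def r3_def using rl by (simp_all add: power_add mult_2 numeral_3_eq_3)
  define q where "q = map_pmf (Dn (s + 2 * l)) \<theta>"
  define k where "k = (\<lambda>c. cond_pmf \<theta> (Dn (s + 2 * l) -` {c}))"
  have cell: "set_pmf \<theta> \<inter> Dn (s + 2 * l) -` {c} \<noteq> {}" if "c \<in> set_pmf q" for c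
    using that by (auto simp: q_def)
  have finq: "fin_pmf q" using fin by (simp add: q_def)
  have fink: "fin_pmf (k c)" if "c \<in> set_pmf q" for c
    using fin by (simp add: k_def set_cond_pmf[OF cell[OF that]])
  have joint: "bind_pmf q (\<lambda>c. map_pmf (Pair c) (k c)) = map_pmf (\<lambda>y. (Dn (s + 2 * l) y, y)) \<theta>"
    unfolding q_def k_def by (rule cond_pmf_cell[OF fin])
  have mix: "\<theta> = bind_pmf q k"
  proof -
    have "bind_pmf q k = map_pmf snd (bind_pmf q (\<lambda>c. map_pmf (Pair c) (k c)))"
      by (simp add: map_bind_pmf pmf.map_comp o_def)
    then show ?thesis unfolding joint by (simp add: pmf.map_comp o_def)
  qed
  have diam: "cmod (y - z) \<le> 2 * r2" if "c \<in> set_pmf q" "y \<in> set_pmf (k c)" "z \<in> set_pmf (k c)" for c y z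
    using that(2,3) unfolding k_def set_cond_pmf[OF cell[OF that(1)]] r2_def
    by (intro Dn_eq_dist) auto
  define v where "v = pE q (\<lambda>c. var (k c))"
  have var_le: "var (k c) \<le> 4 * r2\<^sup>2" if c: "c \<in> set_pmf q" for c
  proof -
    have "cmod (y - mean (k c)) \<le> 2 * r2" if y: "y \<in> set_pmf (k c)" for y
    proof -
      have "y - mean (k c) = pE (k c) (\<lambda>z. y - z)"
        by (simp add: pE_diff fink[OF c] mean_def)
      then have "cmod (y - mean (k c)) \<le> pE (k c) (\<lambda>z. cmod (y - z))"
        by (simp only: integral_norm_bound)
      also have "\<dots> \<le> pE (k c) (\<lambda>z. 2 * r2)"
        by (rule pE_mono[OF fink[OF c]]) (rule diam[OF c y])
      finally show ?thesis by simp
    qed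
    then have "var (k c) \<le> pE (k c) (\<lambda>y. (2 * r2)\<^sup>2)"
      unfolding var_def by (intro pE_mono fink c power_mono) auto
    then show ?thesis by (simp add: power_mult_distrib)
  qed
  have v_upper: "v \<le> 4 * r2\<^sup>2"
  proof -
    have "v \<le> pE q (\<lambda>_. 4 * r2\<^sup>2)" unfolding v_def by (rule pE_mono[OF finq var_le])
    then show ?thesis by simp
  qed
  \<comment> \<open>\<open>ent_grid_var\<close> in every cell, then concavity of the logarithm: a
    smaller mean variance would contradict the entropy \<open>L3\<close>.\<close>
  have v_lower: "v \<ge> r3\<^sup>2"
  proof -
    have "hc (s + 2 * l) (s + 3 * l) \<theta> = pE q (\<lambda>c. ent (map_pmf (Dn (s + 3 * l)) (k c)))"
    proof -
      have "hc (s + 2 * l) (s + 3 * l) \<theta> = cent (map_pmf (\<lambda>y. (Dn (s + 2 * l) y, y)) \<theta>) (\<lambda>(c, y). Dn (s + 3 * l) y) fst"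
        by (simp add: hc_def cent_map)
      also have "\<dots> = pE q (\<lambda>c. ent (map_pmf (Dn (s + 3 * l)) (k c)))"
        unfolding joint[symmetric] by (rule cent_bind_Pair[OF finq fink])
      finally show ?thesis .
    qed
    also have "\<dots> \<le> pE q (\<lambda>c. ln (32 * exp 2 * (1 + var (k c) / r3\<^sup>2)))"
      unfolding r3_def by (intro pE_mono finq ent_grid_var fink) auto
    also have "\<dots> \<le> ln (pE q (\<lambda>c. 32 * exp 2 * (1 + var (k c) / r3\<^sup>2)))"
      by (rule pE_ln_le(1)[OF finq]) (intro mult_pos_pos add_pos_nonneg divide_nonneg_nonneg var_nonneg; simp)
    also have "pE q (\<lambda>c. 32 * exp 2 * (1 + var (k c) / r3\<^sup>2)) = 32 * exp 2 * (1 + v / r3\<^sup>2)"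
      by (simp only: integral_mult_right_zero integral_divide_zero pE_add[OF finq] pE_const v_def)
    finally have "ln (64 * exp 2) \<le> ln (32 * exp 2 * (1 + v / r3\<^sup>2))"
      using hc by (simp add: L3_def)
    moreover have "0 \<le> v" unfolding v_def by (intro pE_nonneg var_nonneg)
    then have "0 < 32 * exp 2 * (1 + v / r3\<^sup>2)" by (intro mult_pos_pos add_pos_nonneg divide_nonneg_nonneg) auto
    ultimately have "64 * exp 2 \<le> 32 * exp 2 * (1 + v / r3\<^sup>2)" by (subst (asm) ln_le_cancel_iff) auto
    then have "1 \<le> v / r3\<^sup>2" by simp
    then show ?thesis using pos by (simp add: field_simps)
  qed
  have v_pos: "v > 0" using v_lower pos by (smt (verit) zero_less_power)
  have n_pos: "real n > 0" using n(1) x by (smt (verit) x_def one_le_power)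
  define Q where "Q = pair_pmf (replicate_pmf n q) (replicate_pmf n q)"
  define S where "S = (\<lambda>(cs, cs'). conv (convl (map k cs)) (map_pmf ((*) \<rho>) (convl (map k cs'))))"
  have finQ: "fin_pmf Q" using finq by (simp add: Q_def)
  have setQ: "set (fst y) \<subseteq> set_pmf q" "set (snd y) \<subseteq> set_pmf q" if "y \<in> set_pmf Q" for y
    using that by (auto simp: Q_def set_replicate_pmf)
  have finl: "fin_pmf (convl (map k cs))" if "set cs \<subseteq> set_pmf q" for cs
    using that fink by (intro fin_convl) auto
  have finS: "fin_pmf (S y)" if "y \<in> set_pmf Q" for y
    using finl setQ[OF that] by (auto simp: S_def case_prod_unfold)
  have spread: "spread n \<theta> = bind_pmf Q S"
    unfolding spread_def Q_def S_def
    by (subst (1 2) mix) (simp add: convpow_bind pair_pmf_def conv_bind_left conv_bind_right map_bind_pmf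
        bind_assoc_pmf bind_return_pmf, rule bind_commute_pmf)
  \<comment> \<open>\<open>Z y\<close> dominates all cell masses of \<open>S y\<close>, so
    \<open>- ln (Z y)\<close> bounds its entropy from below. Only the mean of \<open>Z\<close> over
    the draws is needed, and there the independent components factor.\<close>
  define Z where "Z = (\<lambda>y. 2 * r\<^sup>2 * (LINT \<xi>|lborel. gs (r\<^sup>2 / 2) \<xi> * cmod (ft (S y) \<xi>)))"
  have max: "pmf (map_pmf (Dn (s + l)) (S y)) a \<le> Z y" if "y \<in> set_pmf Q" for y a
    unfolding Z_def r_def by (rule small_ball) (use finS[OF that] in auto)
  have Zpos: "Z y > 0" if y: "y \<in> set_pmf Q" for y
  proof -
    obtain a where "a \<in> set_pmf (map_pmf (Dn (s + l)) (S y))" using set_pmf_not_empty[of "map_pmf (Dn (s + l)) (S y)"] by blast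
    then show ?thesis using max[OF y, of a] pmf_positive[of a "map_pmf (Dn (s + l)) (S y)"] by linarith
  qed
  have ZE: "pE Q Z \<le> 8 * pi * (1 / c\<rho> + 4096) * r\<^sup>2 / (n * v)"
  proof -
    define H where "H = (\<lambda>\<xi>. pE q (\<lambda>c. cmod (ft (k c) \<xi>)))"
    have ftS: "cmod (ft (S y) \<xi>) = prod_list (map (\<lambda>c. cmod (ft (k c) \<xi>)) (fst y)) * prod_list (map (\<lambda>c. cmod (ft (k c) (cnj \<rho> * \<xi>))) (snd y))"
      if y: "y \<in> set_pmf Q" for y \<xi>
    proof -
      have "ft (convl (map k cs)) \<zeta> = prod_list (map (\<lambda>c. ft (k c) \<zeta>) cs)" if "set cs \<subseteq> set_pmf q" for cs \<zeta>
        using that fink by (subst ft_convl) (auto simp: o_def)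
      then show ?thesis using setQ[OF y] finl
        by (simp add: S_def case_prod_unfold ft_conv ft_map_mult norm_mult norm_prod_list o_def)
    qed
    have EftS: "pE Q (\<lambda>y. cmod (ft (S y) \<xi>)) = H \<xi> ^ n * H (cnj \<rho> * \<xi>) ^ n" for \<xi>
    proof -
      have "pE Q (\<lambda>y. cmod (ft (S y) \<xi>)) = pE Q (\<lambda>y. prod_list (map (\<lambda>c. cmod (ft (k c) \<xi>)) (fst y)) * prod_list (map (\<lambda>c. cmod (ft (k c) (cnj \<rho> * \<xi>))) (snd y)))"
        by (rule pE_cong[OF ftS])
      also have "\<dots> = H \<xi> ^ n * H (cnj \<rho> * \<xi>) ^ n"
        unfolding Q_def pE_pair[OF fin_replicate[OF finq] fin_replicate[OF finq]] fst_conv snd_conv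
        by (simp only: integral_mult_right_zero integral_mult_left_zero pE_replicate_prod[OF finq] H_def)
      finally show ?thesis .
    qed
    have H01: "0 \<le> H \<xi>" "H \<xi> \<le> 1" for \<xi>
    proof -
      show "0 \<le> H \<xi>" unfolding H_def by (rule pE_nonneg) simp
      have "H \<xi> \<le> pE q (\<lambda>_. 1)" unfolding H_def by (rule pE_mono[OF finq norm_ft_le_1])
      then show "H \<xi> \<le> 1" by simp
    qed
    have Hvar: "H \<xi> \<le> exp (- pE q (\<lambda>c. var_dir (k c) \<xi>) / 4)" if "cmod \<xi> * (2 * r2) \<le> 1" for \<xi>
    proof -
      have "H \<xi> \<le> pE q (\<lambda>c. 1 - var_dir (k c) \<xi> / 4)"
        unfolding H_def
      proof (intro pE_mono finq norm_ft_le_var fink)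
        fix c y z assume "c \<in> set_pmf q" "y \<in> set_pmf (k c)" "z \<in> set_pmf (k c)"
        then have "cmod (y - z) * cmod \<xi> \<le> 2 * r2 * cmod \<xi>" by (intro mult_right_mono diam) auto
        then show "cmod (y - z) * cmod \<xi> \<le> 1" using that by (simp add: mult_ac)
      qed
      also have "\<dots> = 1 + - pE q (\<lambda>c. var_dir (k c) \<xi>) / 4"
        by (simp only: pE_diff[OF finq] integral_divide_zero pE_const)
      also have "\<dots> \<le> exp (- pE q (\<lambda>c. var_dir (k c) \<xi>) / 4)" by (rule exp_ge_add_one_self)
      finally show ?thesis .
    qed
    \<comment> \<open>Up to frequency \<open>1 / (2 * r2)\<close> the two directions give Gaussian
      decay governed by the total variance \<open>n * v\<close>; beyond it the weight is tiny
      because \<open>r = x * r2\<close>.\<close>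
    have point: "gs (r\<^sup>2 / 2) \<xi> * (H \<xi> ^ n * H (cnj \<rho> * \<xi>) ^ n) \<le> gs (n * c\<rho> * v / 4) \<xi> + exp (- (x\<^sup>2 / 16)) * gs (r\<^sup>2 / 4) \<xi>" for \<xi>
    proof (cases "cmod \<xi> * (2 * r2) \<le> 1")
      case True
      have "cmod (cnj \<rho> * \<xi>) * (2 * r2) \<le> 1 * (cmod \<xi> * (2 * r2))"
        using rho pos by (simp add: norm_mult mult_left_le_one_le)
      then have T2: "cmod (cnj \<rho> * \<xi>) * (2 * r2) \<le> 1" using True by simp
      let ?D = "pE q (\<lambda>c. var_dir (k c) \<xi>)" and ?D' = "pE q (\<lambda>c. var_dir (k c) (cnj \<rho> * \<xi>))"
      have "H \<xi> ^ n * H (cnj \<rho> * \<xi>) ^ n \<le> exp (- ?D / 4) ^ n * exp (- ?D' / 4) ^ n"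
        by (intro mult_mono power_mono Hvar True T2 H01 zero_le_power) auto
      also have "\<dots> = exp (- real n * (?D + ?D') / 4)"
        by (simp add: exp_of_nat_mult[symmetric] exp_add[symmetric] algebra_simps add_divide_distrib)
      also have "\<dots> \<le> gs (n * c\<rho> * v / 4) \<xi>"
      proof -
        have "c\<rho> * (cmod \<xi>)\<^sup>2 * v = pE q (\<lambda>c. (Im \<rho>)\<^sup>2 / 3 * (cmod \<xi>)\<^sup>2 * var (k c))"
          by (simp only: integral_mult_right_zero v_def c\<rho>_def)
        also have "\<dots> \<le> pE q (\<lambda>c. var_dir (k c) \<xi> + var_dir (k c) (cnj \<rho> * \<xi>))"
          by (intro pE_mono finq var_dir_sum fink) (use rho in auto)
        also have "\<dots> = ?D + ?D'" by (rule pE_add[OF finq])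
        finally have "real n * (c\<rho> * (cmod \<xi>)\<^sup>2 * v) \<le> real n * (?D + ?D')" by (rule mult_left_mono) simp
        then show ?thesis by (simp add: gs_def mult_ac)
      qed
      finally have "H \<xi> ^ n * H (cnj \<rho> * \<xi>) ^ n \<le> gs (n * c\<rho> * v / 4) \<xi>" .
      moreover have "gs (r\<^sup>2 / 2) \<xi> \<le> 1" by (simp add: gs_def)
      ultimately have "gs (r\<^sup>2 / 2) \<xi> * (H \<xi> ^ n * H (cnj \<rho> * \<xi>) ^ n) \<le> 1 * gs (n * c\<rho> * v / 4) \<xi>"
        by (intro mult_mono) (use H01 in auto)
      then show ?thesis by (simp add: add_increasing2)
    next
      case False
      have "H \<xi> ^ n * H (cnj \<rho> * \<xi>) ^ n \<le> 1"
        by (intro mult_le_one power_le_one zero_le_power H01)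
      then have "gs (r\<^sup>2 / 2) \<xi> * (H \<xi> ^ n * H (cnj \<rho> * \<xi>) ^ n) \<le> gs (r\<^sup>2 / 2) \<xi>"
        by (intro mult_left_le) auto
      also have "\<dots> = exp (- (r\<^sup>2 * (cmod \<xi>)\<^sup>2 / 4)) * gs (r\<^sup>2 / 4) \<xi>"
        by (simp add: gs_def exp_add[symmetric])
      also have "\<dots> \<le> exp (- (x\<^sup>2 / 16)) * gs (r\<^sup>2 / 4) \<xi>"
      proof -
        have "x \<le> 2 * (r * cmod \<xi>)"
        proof -
          have "r = x * r2" using x by (simp add: rr(2))
          moreover have "x * 1 \<le> x * (cmod \<xi> * (2 * r2))" using False x by (intro mult_left_mono) auto
          ultimately show ?thesis by (simp add: mult_ac)
        qed
        then have "x\<^sup>2 \<le> (2 * (r * cmod \<xi>))\<^sup>2" using x by (intro power_mono) auto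
        then have "x\<^sup>2 / 16 \<le> r\<^sup>2 * (cmod \<xi>)\<^sup>2 / 4" by (simp add: power_mult_distrib)
        then show ?thesis by (intro mult_right_mono) auto
      qed
      finally show ?thesis by (simp add: add_increasing)
    qed
    have cpos: "n * c\<rho> * v / 4 > 0" "r\<^sup>2 / 4 > 0" "r\<^sup>2 / 2 > 0" using n_pos c\<rho>_pos v_pos pos by auto
    have int1: "integrable lborel (\<lambda>\<xi>. gs (r\<^sup>2 / 2) \<xi> * cmod (ft (S y) \<xi>))" if "y \<in> set_pmf Q" for y
      using integrable_gs_bounded[OF cpos(3), of "\<lambda>\<xi>. cmod (ft (S y) \<xi>)"] ft_measurable[OF finS[OF that]] norm_ft_le_1
      by simp
    have "pE Q Z = 2 * r\<^sup>2 * (\<Sum>y\<in>set_pmf Q. (LINT \<xi>|lborel. pmf Q y * (gs (r\<^sup>2 / 2) \<xi> * cmod (ft (S y) \<xi>))))"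
      unfolding pE_sum_real[OF finQ] Z_def by (simp add: sum_distrib_left mult_ac)
    also have "\<dots> = 2 * r\<^sup>2 * (LINT \<xi>|lborel. (\<Sum>y\<in>set_pmf Q. pmf Q y * (gs (r\<^sup>2 / 2) \<xi> * cmod (ft (S y) \<xi>))))"
      by (subst Bochner_Integration.integral_sum) (use int1 in auto)
    also have "(\<lambda>\<xi>. \<Sum>y\<in>set_pmf Q. pmf Q y * (gs (r\<^sup>2 / 2) \<xi> * cmod (ft (S y) \<xi>))) = (\<lambda>\<xi>. gs (r\<^sup>2 / 2) \<xi> * (H \<xi> ^ n * H (cnj \<rho> * \<xi>) ^ n))"
      unfolding EftS[symmetric] pE_sum_real[OF finQ] by (simp add: sum_distrib_left mult_ac)
    also have "2 * r\<^sup>2 * (LINT \<xi>|lborel. gs (r\<^sup>2 / 2) \<xi> * (H \<xi> ^ n * H (cnj \<rho> * \<xi>) ^ n)) \<le>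
       2 * r\<^sup>2 * (LINT \<xi>|lborel. gs (n * c\<rho> * v / 4) \<xi> + exp (- (x\<^sup>2 / 16)) * gs (r\<^sup>2 / 4) \<xi>)"
      by (intro mult_left_mono integral_mono' point Bochner_Integration.integrable_add integrable_mult_right integrable_gs cpos)
         (auto simp: H01)
    also have "\<dots> = 2 * r\<^sup>2 * (pi / (n * c\<rho> * v / 4) + exp (- (x\<^sup>2 / 16)) * (pi / (r\<^sup>2 / 4)))"
      using cpos by (subst Bochner_Integration.integral_add) (auto simp: integrable_gs integral_gs)
    also have "\<dots> = 8 * pi * (1 / c\<rho> * (r\<^sup>2 / (n * v)) + exp (- (x\<^sup>2 / 16)))"
      using pos v_pos n_pos c\<rho>_pos by (simp add: field_simps)
    also have "\<dots> \<le> 8 * pi * (1 / c\<rho> * (r\<^sup>2 / (n * v)) + 4096 * (r\<^sup>2 / (n * v)))"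
    proof -
      have "exp (- (x\<^sup>2 / 16)) \<le> 2 / (x\<^sup>2 / 16)\<^sup>2" by (rule exp_neg_le) (use x in simp)
      also have "\<dots> = 512 / x ^ 4" by (simp add: power_divide power_mult[symmetric])
      also have "\<dots> \<le> 4096 * (r\<^sup>2 / (n * v))"
      proof -
        have "real n * v \<le> (2 * x ^ 6) * (4 * r2\<^sup>2)"
          using n(2) v_upper v_pos by (intro mult_mono) (auto simp: x_def)
        also have "\<dots> = 8 * r\<^sup>2 * x ^ 4" using x by (simp add: rr(2) power_divide field_simps eval_nat_numeral)
        finally have "r\<^sup>2 / (8 * r\<^sup>2 * x ^ 4) \<le> r\<^sup>2 / (n * v)"
          using n_pos v_pos pos x by (intro divide_left_mono mult_pos_pos) auto
        then have "4096 * (r\<^sup>2 / (8 * r\<^sup>2 * x ^ 4)) \<le> 4096 * (r\<^sup>2 / (n * v))" by (rule mult_left_mono) simp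
        moreover have "4096 * (r\<^sup>2 / (8 * r\<^sup>2 * x ^ 4)) = 512 / x ^ 4" using pos by simp
        ultimately show ?thesis by simp
      qed
      finally show ?thesis by simp
    qed
    also have "\<dots> = 8 * pi * (1 / c\<rho> + 4096) * r\<^sup>2 / (n * v)"
      unfolding distrib_right[symmetric] by simp
    finally show ?thesis .
  qed
  have VE: "pE Q (\<lambda>y. ent (map_pmf (Dn s) (S y))) \<le> ln (3 * (32 * exp 2) * (n * v / R\<^sup>2))"
  proof -
    let ?w = "\<lambda>cs. sum_list (map (\<lambda>c. var (k c)) cs)"
    have varS: "var (S y) = ?w (fst y) + (cmod \<rho>)\<^sup>2 * ?w (snd y)" if y: "y \<in> set_pmf Q" for y
    proof -
      have "var (convl (map k cs)) = ?w cs" if "set cs \<subseteq> set_pmf q" for cs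
        using that fink by (subst var_convl) (auto simp: o_def)
      then show ?thesis using setQ[OF y] finl
        by (simp add: S_def case_prod_unfold var_conv var_map_mult)
    qed
    have "pE Q (\<lambda>y. ent (map_pmf (Dn s) (S y))) \<le> pE Q (\<lambda>y. ln (32 * exp 2 * (1 + var (S y) / R\<^sup>2)))"
      unfolding R_def by (intro pE_mono finQ ent_grid_var finS) auto
    also have "\<dots> \<le> ln (pE Q (\<lambda>y. 32 * exp 2 * (1 + var (S y) / R\<^sup>2)))"
      by (rule pE_ln_le(1)[OF finQ]) (intro mult_pos_pos add_pos_nonneg divide_nonneg_nonneg var_nonneg; simp)
    also have "pE Q (\<lambda>y. 32 * exp 2 * (1 + var (S y) / R\<^sup>2)) = 32 * exp 2 * (1 + pE Q (\<lambda>y. var (S y)) / R\<^sup>2)"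
      by (simp only: integral_mult_right_zero integral_divide_zero pE_add[OF finQ] pE_const)
    also have "pE Q (\<lambda>y. var (S y)) = pE Q (\<lambda>y. ?w (fst y) + (cmod \<rho>)\<^sup>2 * ?w (snd y))"
      by (rule pE_cong[OF varS])
    also have "\<dots> = pE Q (\<lambda>y. ?w (fst y)) + (cmod \<rho>)\<^sup>2 * pE Q (\<lambda>y. ?w (snd y))"
      by (simp only: pE_add[OF finQ] integral_mult_right_zero)
    also have "\<dots> = n * v + (cmod \<rho>)\<^sup>2 * (n * v)"
      unfolding Q_def
      by (simp only: expectation_pair_pmf_fst[where f = ?w] expectation_pair_pmf_snd[where f = ?w] pE_replicate_sum[OF finq] v_def)
    finally have le: "pE Q (\<lambda>y. ent (map_pmf (Dn s) (S y))) \<le> ln (32 * exp 2 * (1 + (n * v + (cmod \<rho>)\<^sup>2 * (n * v)) / R\<^sup>2))" .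
    have "R\<^sup>2 \<le> n * v"
    proof -
      have "R\<^sup>2 = x ^ 6 * r3\<^sup>2" using x by (simp add: rr power_divide power_mult[symmetric] power_mult_distrib field_simps)
      also have "\<dots> \<le> n * v" using n(1) v_lower by (intro mult_mono) (auto simp: x_def)
      finally show ?thesis .
    qed
    then have 1: "1 \<le> n * v / R\<^sup>2" using pos by simp
    have "(cmod \<rho>)\<^sup>2 * (n * v) \<le> 1 * (n * v)"
      using rho v_pos n_pos by (intro mult_right_mono power_le_one) auto
    then have "(n * v + (cmod \<rho>)\<^sup>2 * (n * v)) / R\<^sup>2 \<le> (2 * (n * v)) / R\<^sup>2"
      by (intro divide_right_mono) (linarith, simp)
    then have "1 + (n * v + (cmod \<rho>)\<^sup>2 * (n * v)) / R\<^sup>2 \<le> 3 * (n * v / R\<^sup>2)" using 1 by simp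
    then have "32 * exp 2 * (1 + (n * v + (cmod \<rho>)\<^sup>2 * (n * v)) / R\<^sup>2) \<le> 32 * exp 2 * (3 * (n * v / R\<^sup>2))"
      by (rule mult_left_mono) simp
    also have "\<dots> = 3 * (32 * exp 2) * (n * v / R\<^sup>2)" by simp
    finally show ?thesis
      by (intro order_trans[OF le] ln_mono mult_pos_pos add_pos_nonneg divide_nonneg_nonneg add_nonneg_nonneg mult_nonneg_nonneg)
         (use v_pos in auto)
  qed
  have "hc s (s + l) (spread n \<theta>) \<ge> pE Q (\<lambda>y. cent (S y) (Dn (s + l)) (Dn s))"
    unfolding hc_def spread by (rule cent_mixture[OF finQ finS])
  moreover have "pE Q (\<lambda>y. - ln (Z y) - ent (map_pmf (Dn s) (S y))) \<le> pE Q (\<lambda>y. cent (S y) (Dn (s + l)) (Dn s))"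
  proof (rule pE_mono[OF finQ])
    fix y assume y: "y \<in> set_pmf Q"
    have "ent (map_pmf (Dn (s + l)) (S y)) \<ge> - ln (Z y)"
      by (rule ent_ge_max) (use finS[OF y] max[OF y] in auto)
    moreover have "ent (map_pmf (Dn (s + l)) (S y)) \<le> ent (map_pmf (\<lambda>w. (Dn (s + l) w, Dn s w)) (S y))"
      by (rule ent_mono[OF finS[OF y]]) auto
    ultimately show "- ln (Z y) - ent (map_pmf (Dn s) (S y)) \<le> cent (S y) (Dn (s + l)) (Dn s)"
      by (simp add: cent_def)
  qed
  moreover have "pE Q (\<lambda>y. - ln (Z y) - ent (map_pmf (Dn s) (S y))) = - pE Q (\<lambda>y. ln (Z y)) - pE Q (\<lambda>y. ent (map_pmf (Dn s) (S y)))"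
    by (simp only: pE_diff[OF finQ] Bochner_Integration.integral_minus)
  moreover have "pE Q (\<lambda>y. ln (Z y)) \<le> ln (8 * pi * (1 / c\<rho> + 4096) * r\<^sup>2 / (n * v))"
  proof -
    have "pE Q Z > 0" by (rule pE_ln_le(2)[OF finQ Zpos])
    then have "ln (pE Q Z) \<le> ln (8 * pi * (1 / c\<rho> + 4096) * r\<^sup>2 / (n * v))"
      using ZE by (simp only: ln_mono)
    then show ?thesis using pE_ln_le(1)[OF finQ Zpos, of "\<lambda>y. y"] by linarith
  qed
  \<comment> \<open>The unknown \<open>n * v\<close> cancels between the fine and the coarse bound.
    Besides constants there remains
    \<open>R\<^sup>2 / r\<^sup>2 = x\<^sup>2 = exp (\<beta> * l)\<close>.\<close>
  moreover have "ln (8 * pi * (1 / c\<rho> + 4096) * r\<^sup>2 / (n * v)) + ln (3 * (32 * exp 2) * (n * v / R\<^sup>2)) = L5 - \<beta> * l"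
  proof -
    define G where "G = 8 * pi * (1 / c\<rho> + 4096)"
    have G: "G > 0" unfolding G_def using c\<rho>_pos by (intro mult_pos_pos add_pos_pos) auto
    have "ln (G * r\<^sup>2 / (n * v)) + ln (3 * (32 * exp 2) * (n * v / R\<^sup>2)) = ln ((G * r\<^sup>2 / (n * v)) * (3 * (32 * exp 2) * (n * v / R\<^sup>2)))"
      using G pos v_pos n_pos by (subst ln_mult) simp_all
    also have "(G * r\<^sup>2 / (n * v)) * (3 * (32 * exp 2) * (n * v / R\<^sup>2)) = (3 * (32 * exp 2) * G) / x\<^sup>2"
      using pos v_pos n_pos x by (simp add: rr(1) field_simps)
    also have "ln \<dots> = L5 - ln (x\<^sup>2)"
      unfolding L5_def G_def[symmetric] using G x by (subst ln_div) simp_all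
    also have "ln (x\<^sup>2) = \<beta> * l"
      using rho by (simp add: x_def \<beta>_def ln_realpow ln_div power_one_over[symmetric] power_mult[symmetric])
    finally show ?thesis by (simp only: G_def)
  qed
  ultimately show ?thesis using VE by linarith
qed

end

section \<open>Entropy dimension of self-similar sums\<close>

lemma cent_le_ent: "fin_pmf P \<Longrightarrow> cent P f g \<le> ent (map_pmf f P)"
proof -
  assume fin: "fin_pmf P"
  have "cent P f g \<le> cent P f (\<lambda>_. ())" by (rule cent_antimono[OF fin]) simp
  also have "\<dots> = ent (map_pmf f P)"
  proof -
    have "ent (map_pmf (\<lambda>w. (f w, ())) P) = ent (map_pmf f P)" by (rule ent_cong_part[OF fin]) simp
    moreover have "ent (map_pmf (\<lambda>_. ()) P) = 0" by (simp add: map_pmf_const ent_def)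
    ultimately show ?thesis by (simp add: cent_def)
  qed
  finally show ?thesis .
qed

context selfsim_setup
begin

lemma Dn_eq_dist2: "Dn t z = Dn t w \<Longrightarrow> cmod (z - w) \<le> (4 * B + 8) * rad t"
  by (rule order_trans[OF Dn_eq_dist const_le(1)])

text \<open>Given the summand from \<open>p\<close> the sum is a translate of the other one, and
  translations respect cells up to boundedly many choices.\<close>

lemma hc_conv:
  assumes fin: "fin_pmf p" "fin_pmf S" and st: "s \<le> t"
  shows "hc s t (conv p S) \<ge> hc s t S - 2 * Lam"
proof -
  let ?P = "pair_pmf p S" and ?V = "\<lambda>(x, y). x + y :: complex" and ?g = "\<lambda>(x, y). (x, Dn s y)"
  have finP: "fin_pmf ?P" using fin by simp
  have "hc s t (map_pmf ?V ?P) \<ge> cent ?P (\<lambda>w. Dn t (?V w)) ?g - Lam"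
  proof (rule hc_local[OF finP])
    fix v w :: "complex \<times> complex" assume "?g v = ?g w"
    then have "?V v - ?V w = snd v - snd w" "Dn s (snd v) = Dn s (snd w)" by (auto simp: case_prod_unfold)
    then show "cmod (?V v - ?V w) \<le> (4 * B + 8) * rad s"
      using Dn_eq_dist2[of s "snd v" "snd w"] by simp
  qed
  moreover have "cent ?P (\<lambda>w. Dn t (?V w)) ?g \<ge> cent ?P (\<lambda>(x, y). Dn t y) ?g - Lam"
    unfolding Lam_def
  proof (rule cent_ge_target[OF finP grid_const_ge_1])
    fix w assume "w \<in> set_pmf ?P"
    have "card ((\<lambda>v. Dn t (snd v)) ` {v \<in> set_pmf ?P. Dn t (?V v) = Dn t (?V w) \<and> ?g v = ?g w}) \<le> grid_const (4 * B + 8)"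
    proof (rule card_Dn[where w = "snd w"])
      fix v assume "v \<in> {v \<in> set_pmf ?P. Dn t (?V v) = Dn t (?V w) \<and> ?g v = ?g w}"
      then have "?V v - ?V w = snd v - snd w" "Dn t (?V v) = Dn t (?V w)" by (auto simp: case_prod_unfold)
      then show "cmod (snd v - snd w) \<le> (4 * B + 8) * rad t"
        using Dn_eq_dist2[of t "?V v" "?V w"] by simp
    qed
    then show "card ((\<lambda>(x, y). Dn t y) ` {v \<in> set_pmf ?P. Dn t (?V v) = Dn t (?V w) \<and> ?g v = ?g w}) \<le> grid_const (4 * B + 8)"
      by (simp add: case_prod_unfold)
  qed
  moreover have "cent ?P (\<lambda>(x, y). Dn t y) ?g = hc s t S"
    unfolding hc_def by (rule cent_pair_snd[OF fin])
  ultimately show ?thesis by (simp add: conv_def)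
qed

lemma ent_conv_ge:
  assumes fin: "fin_pmf p" "fin_pmf q"
  shows "ent (map_pmf (Dn t) (conv p q)) \<ge> ent (map_pmf (Dn t) q) - Lam"
proof -
  have "ent (map_pmf (Dn t) q) - Lam = pE p (\<lambda>_. ent (map_pmf (Dn t) q) - Lam)" by simp
  also have "\<dots> \<le> pE p (\<lambda>a. ent (map_pmf (\<lambda>b. Dn t (a + b)) q))"
    by (rule pE_mono[OF fin(1)]) (use ent_affine(1)[OF fin(2), where s = 0 and t = t] in simp)
  also have "\<dots> = cent (pair_pmf p q) (\<lambda>(a, b). Dn t (a + b)) fst"
    by (rule cent_pair_fst[OF fin, symmetric])
  also have "\<dots> \<le> ent (map_pmf (\<lambda>(a, b). Dn t (a + b)) (pair_pmf p q))"
    by (rule cent_le_ent) (use fin in simp)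
  also have "\<dots> = ent (map_pmf (Dn t) (conv p q))"
    by (simp add: conv_def pmf.map_comp o_def case_prod_unfold)
  finally show ?thesis .
qed

lemma ent_conv_le:
  assumes fin: "fin_pmf p" "fin_pmf q"
  shows "ent (map_pmf (Dn t) (conv p q)) \<le> ent p + ent (map_pmf (Dn t) q) + Lam"
proof -
  let ?P = "pair_pmf p q" and ?f = "\<lambda>(a, b). Dn t (a + b)"
  have "ent (map_pmf (Dn t) (conv p q)) = ent (map_pmf ?f ?P)"
    by (simp add: conv_def pmf.map_comp o_def case_prod_unfold)
  also have "\<dots> \<le> ent (map_pmf (\<lambda>w. (?f w, fst w)) ?P)"
    by (rule ent_mono) (use fin in auto)
  also have "\<dots> = cent ?P ?f fst + ent p"
    by (simp add: cent_def map_fst_pair_pmf)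
  also have "cent ?P ?f fst = pE p (\<lambda>a. ent (map_pmf (\<lambda>b. Dn t (a + b)) q))"
    by (rule cent_pair_fst[OF fin])
  also have "\<dots> \<le> pE p (\<lambda>_. ent (map_pmf (Dn t) q) + Lam)"
    by (rule pE_mono[OF fin(1)]) (use ent_affine(2)[OF fin(2), where s = 0 and t = t] in simp)
  finally show ?thesis by simp
qed

text \<open>\<open>A t\<close> followed by one more summand at scale \<open>t\<close> has the law of
  \<open>d\<close> plus \<open>\<rho>\<close> times \<open>A t\<close>. After adding
  \<open>\<rho>\<close> times \<open>\<theta>\<close> one obtains \<open>d\<close> plus
  \<open>\<rho>\<close> times the convolution of \<open>A t\<close> and \<open>\<theta>\<close>. So
  a small entropy gain from \<theta> passes to its rotated copy at the cost of \<open>ent d\<close>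
  and constants.\<close>

lemma ent_rotate_le:
  assumes fin: "fin_pmf \<theta>"
  shows "ent (map_pmf (Dn t) (conv (A t) (map_pmf ((*) \<rho>) \<theta>))) \<le> ent (map_pmf (Dn t) (conv (A t) \<theta>)) + ent d + 3 * Lam"
proof -
  let ?r = "map_pmf ((*) \<rho>)"
  let ?P = "pair_pmf (pair_pmf (A t) (A 1)) (?r \<theta>)"
  let ?V = "\<lambda>((a, b), x). a + \<rho> ^ t * b + x"
  have finP: "fin_pmf ?P" using fin by simp
  have "ent (map_pmf (\<lambda>w. Dn t (fst (fst w) + snd w)) ?P) \<le> ent (map_pmf (\<lambda>w. Dn t (?V w)) ?P) + Lam"
  proof (rule ent_Dn_le[OF finP])
    fix v w assume vw: "v \<in> set_pmf ?P" "w \<in> set_pmf ?P" "Dn t (?V v) = Dn t (?V w)"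
    define x y where "x = fst (fst v) + snd v - (fst (fst w) + snd w)" and "y = \<rho> ^ t * (snd (fst v) - snd (fst w))"
    have "cmod y \<le> rad t * (B + B)"
      unfolding norm_mult norm_power y_def
      by (intro mult_left_mono order_trans[OF norm_triangle_ineq4] add_mono bound[of _ 1]) (use vw in auto)
    moreover have "x = (?V v - ?V w) - y" by (simp add: x_def y_def case_prod_unfold algebra_simps)
    then have "cmod x \<le> cmod (?V v - ?V w) + cmod y" by (metis norm_triangle_ineq4)
    moreover note Dn_eq_dist[OF vw(3)]
    ultimately have "cmod x \<le> 2 * rad t + rad t * (B + B)" by linarith
    also have "\<dots> = (2 + 2 * B) * rad t" by (simp add: algebra_simps)
    finally show "cmod (fst (fst v) + snd v - (fst (fst w) + snd w)) \<le> (4 * B + 8) * rad t"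
      unfolding x_def[symmetric] using const_le(2)[of t] by linarith
  qed
  moreover have "map_pmf (\<lambda>w. Dn t (fst (fst w) + snd w)) ?P = map_pmf (Dn t) (conv (A t) (?r \<theta>))"
  proof -
    have "map_pmf (\<lambda>w. (fst (fst w), snd w)) ?P = pair_pmf (A t) (?r \<theta>)"
      using map_pair[of fst id "pair_pmf (A t) (A 1)" "?r \<theta>"]
      by (simp add: map_fst_pair_pmf case_prod_unfold pmf.map_id)
    then show ?thesis
      by (simp add: conv_def pmf.map_comp o_def case_prod_unfold flip: \<open>map_pmf _ ?P = _\<close>)
  qed
  moreover have "map_pmf (\<lambda>w. Dn t (?V w)) ?P = map_pmf (Dn t) (conv (conv (A t) (map_pmf ((*) (\<rho> ^ t)) (A 1))) (?r \<theta>))"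
    by (simp add: conv_bind pair_pmf_def map_bind_pmf bind_map_pmf bind_assoc_pmf bind_return_pmf)
  moreover have "conv (A t) (map_pmf ((*) (\<rho> ^ t)) (A 1)) = conv d (?r (A t))"
    using selfsim_add[of \<rho> d t 1] by simp
  moreover have "conv (conv d (?r (A t))) (?r \<theta>) = conv d (?r (conv (A t) \<theta>))"
    by (simp add: conv_assoc map_mult_conv)
  moreover have "ent (map_pmf (Dn t) (conv d (?r (conv (A t) \<theta>)))) \<le> ent d + ent (map_pmf (Dn t) (?r (conv (A t) \<theta>))) + Lam"
    by (rule ent_conv_le) (use fin in auto)
  moreover have "ent (map_pmf (Dn t) (?r (conv (A t) \<theta>))) \<le> ent (map_pmf (Dn t) (conv (A t) \<theta>)) + Lam"
    unfolding pmf.map_comp o_def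
  proof (rule ent_Dn_le)
    fix v w assume "Dn t v = Dn t w"
    have "cmod (\<rho> * v - \<rho> * w) = cmod \<rho> * cmod (v - w)" by (simp add: norm_mult flip: right_diff_distrib)
    also have "\<dots> \<le> 1 * ((4 * B + 8) * rad t)" using rho Dn_eq_dist2[OF \<open>Dn t v = Dn t w\<close>] by (intro mult_mono) auto
    finally show "cmod (\<rho> * v - \<rho> * w) \<le> (4 * B + 8) * rad t" by simp
  qed (use fin in auto)
  ultimately show ?thesis by simp
qed

text \<open>Submodularity needs exact sums, but rounding is not additive. The coupling compares a
  law of points with a law on the integer lattice. Each convolution increases the discrepancy by 1,
  whatever the scale \<open>t\<close>.\<close>

definition near :: "nat \<Rightarrow> nat \<Rightarrow> complex pmf \<Rightarrow> (int \<times> int) pmf \<Rightarrow> bool" where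
  "near t K p p' \<longleftrightarrow> (\<exists>J. fin_pmf J \<and> map_pmf fst J = p \<and> map_pmf snd J = p' \<and>
     (\<forall>(x, y)\<in>set_pmf J. \<bar>fst (Dn t x) - fst y\<bar> \<le> int K \<and> \<bar>snd (Dn t x) - snd y\<bar> \<le> int K))"

lemma near_self: "fin_pmf p \<Longrightarrow> near t 0 p (map_pmf (Dn t) p)"
  unfolding near_def by (rule exI[of _ "map_pmf (\<lambda>x. (x, Dn t x)) p"]) (auto simp: pmf.map_comp o_def)

lemma near_0: "near t 0 (return_pmf 0) (return_pmf 0)"
  unfolding near_def by (rule exI[of _ "return_pmf (0, 0)"]) (auto simp: grid_def)

lemma floor_add_close: "\<bar>\<lfloor>x + y\<rfloor> - (a + b)\<bar> \<le> int (K + L + 1)"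
  if "\<bar>\<lfloor>x\<rfloor> - a\<bar> \<le> int K" "\<bar>\<lfloor>y\<rfloor> - b\<bar> \<le> int L" for x y :: real
  using that by linarith

lemma near_conv:
  assumes "near t K p p'" "near t L q q'"
  shows "near t (K + L + 1) (conv p q) (conv p' q')"
proof -
  obtain J where J: "fin_pmf J" "map_pmf fst J = p" "map_pmf snd J = p'"
     "\<And>x y. (x, y) \<in> set_pmf J \<Longrightarrow> \<bar>fst (Dn t x) - fst y\<bar> \<le> int K \<and> \<bar>snd (Dn t x) - snd y\<bar> \<le> int K"
    using assms(1) unfolding near_def by blast
  obtain J' where J': "fin_pmf J'" "map_pmf fst J' = q" "map_pmf snd J' = q'"
     "\<And>x y. (x, y) \<in> set_pmf J' \<Longrightarrow> \<bar>fst (Dn t x) - fst y\<bar> \<le> int L \<and> \<bar>snd (Dn t x) - snd y\<bar> \<le> int L"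
    using assms(2) unfolding near_def by blast
  let ?J = "conv J J'"
  have "\<bar>fst (Dn t x) - fst y\<bar> \<le> int (K + L + 1) \<and> \<bar>snd (Dn t x) - snd y\<bar> \<le> int (K + L + 1)"
    if "(x, y) \<in> set_pmf ?J" for x y
  proof -
    have "\<exists>z\<in>set_pmf J \<times> set_pmf J'. (x, y) = fst z + snd z"
      using that by (simp add: set_conv image_iff case_prod_unfold)
    then obtain z where z: "z \<in> set_pmf J \<times> set_pmf J'" "(x, y) = fst z + snd z" by blast
    define a b a' b' where "a = fst (fst z)" and "b = snd (fst z)" and "a' = fst (snd z)" and "b' = snd (snd z)"
    have *: "(a, b) \<in> set_pmf J" "(a', b') \<in> set_pmf J'" "x = a + a'" "y = b + b'"
      using z by (auto simp: a_def b_def a'_def b'_def plus_prod_def)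
    show ?thesis
      using J(4)[OF *(1)] J'(4)[OF *(2)]
        floor_add_close[of "Re a / rad t" "fst b" K "Re a' / rad t" "fst b'" L]
        floor_add_close[of "Im a / rad t" "snd b" K "Im a' / rad t" "snd b'" L]
      by (simp add: * grid_def add_divide_distrib)
  qed
  moreover have "map_pmf fst ?J = conv p q" "map_pmf snd ?J = conv p' q'"
    using map_conv[of fst J J'] map_conv[of snd J J'] J J' by auto
  ultimately show ?thesis unfolding near_def using J(1) J'(1) by (intro exI[of _ ?J]) auto
qed

lemma near_convpow: "near t K p p' \<Longrightarrow> near t (n * (K + 1)) (convpow n p) (convpow n p')"
proof (induction n)
  case (Suc n)
  from near_conv[OF Suc.prems Suc.IH[OF Suc.prems]] show ?case by (simp add: algebra_simps)
qed (simp add: near_0)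

lemma card_int_box:
  assumes "\<And>z. z \<in> S \<Longrightarrow> \<bar>fst z - a\<bar> \<le> int K \<and> \<bar>snd z - b\<bar> \<le> int K"
  shows "card S \<le> (2 * K + 1)\<^sup>2"
proof -
  have "S \<subseteq> {a - int K..a + int K} \<times> {b - int K..b + int K}"
    using assms by (force simp: abs_le_iff)
  then have "card S \<le> card ({a - int K..a + int K} \<times> {b - int K..b + int K})" by (intro card_mono) auto
  also have "\<dots> = (2 * K + 1)\<^sup>2"
  proof -
    have "card {c - int K..c + int K} = 2 * K + 1" for c by (simp add: nat_eq_iff)
    then show ?thesis by (simp only: card_cartesian_product power2_eq_square)
  qed
  finally show ?thesis .
qed

text \<open>Under the coupling, the rounded point and the lattice point determine each other up to a
  box of side \<open>2 * K + 1\<close>.\<close>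

lemma near_ent:
  assumes "near t K p p'"
  shows "ent (map_pmf (Dn t) p) \<le> ent p' + ln (real ((2 * K + 1)\<^sup>2))" "ent p' \<le> ent (map_pmf (Dn t) p) + ln (real ((2 * K + 1)\<^sup>2))"
proof -
  obtain J where J: "fin_pmf J" "map_pmf fst J = p" "map_pmf snd J = p'"
     "\<And>x y. (x, y) \<in> set_pmf J \<Longrightarrow> \<bar>fst (Dn t x) - fst y\<bar> \<le> int K \<and> \<bar>snd (Dn t x) - snd y\<bar> \<le> int K"
    using assms unfolding near_def by blast
  have K: "(2 * K + 1)\<^sup>2 \<ge> 1" by simp
  have "ent (map_pmf (\<lambda>w. Dn t (fst w)) J) \<le> ent (map_pmf snd J) + ln (real ((2 * K + 1)\<^sup>2))"
  proof (rule ent_le_card[OF J(1) K])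
    fix w
    show "card ((\<lambda>w. Dn t (fst w)) ` {v \<in> set_pmf J. snd v = snd w}) \<le> (2 * K + 1)\<^sup>2"
    proof (rule card_int_box[where a = "fst (snd w)" and b = "snd (snd w)"])
      fix z assume "z \<in> (\<lambda>w. Dn t (fst w)) ` {v \<in> set_pmf J. snd v = snd w}"
      then obtain x where "(x, snd w) \<in> set_pmf J" "z = Dn t x" by auto
      then show "\<bar>fst z - fst (snd w)\<bar> \<le> int K \<and> \<bar>snd z - snd (snd w)\<bar> \<le> int K"
        using J(4)[of x "snd w"] by simp
    qed
  qed
  moreover have "ent (map_pmf snd J) \<le> ent (map_pmf (\<lambda>w. Dn t (fst w)) J) + ln (real ((2 * K + 1)\<^sup>2))"
  proof (rule ent_le_card[OF J(1) K])
    fix w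
    show "card (snd ` {v \<in> set_pmf J. Dn t (fst v) = Dn t (fst w)}) \<le> (2 * K + 1)\<^sup>2"
    proof (rule card_int_box[where a = "fst (Dn t (fst w))" and b = "snd (Dn t (fst w))"])
      fix z assume "z \<in> snd ` {v \<in> set_pmf J. Dn t (fst v) = Dn t (fst w)}"
      then obtain x where "(x, z) \<in> set_pmf J" "Dn t x = Dn t (fst w)" by auto
      then show "\<bar>fst z - fst (Dn t (fst w))\<bar> \<le> int K \<and> \<bar>snd z - snd (Dn t (fst w))\<bar> \<le> int K"
        using J(4)[of x z] by (simp add: abs_minus_commute)
    qed
  qed
  moreover have "map_pmf (\<lambda>w. Dn t (fst w)) J = map_pmf (Dn t) p"
    using J(2) by (simp add: pmf.map_comp o_def flip: J(2))
  ultimately show "ent (map_pmf (Dn t) p) \<le> ent p' + ln (real ((2 * K + 1)\<^sup>2))" "ent p' \<le> ent (map_pmf (Dn t) p) + ln (real ((2 * K + 1)\<^sup>2))"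
    by (simp_all add: J)
qed

definition "spread_const n = ln (real ((2 * (2 * n + 2) + 1)\<^sup>2)) + 2 * real n * (ln 9 + ent d + 3 * Lam)"

text \<open>After rounding, \<theta> and its rotated copy each gain at most \<open>e\<close> plus
  constants, so by submodularity the two \<open>n\<close>-fold powers together gain at most
  \<open>2 * n\<close> times as much. \<open>spread_const\<close> depends on \<open>n\<close> but
  not on the scale \<open>N\<close>.\<close>

lemma ent_spread_le:
  assumes fin: "fin_pmf \<theta>"
    and e: "ent (map_pmf (Dn N) (conv (A N) \<theta>)) \<le> aent N + e"
  shows "ent (map_pmf (Dn N) (conv (A N) (spread n \<theta>))) \<le> aent N + 2 * real n * e + spread_const n"
proof -
  let ?G = "map_pmf (Dn N)"
  let ?r = "map_pmf ((*) \<rho>)"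
  let ?p = "?G (A N)" and ?q = "?G \<theta>" and ?q' = "?G (?r \<theta>)"
  have r: "?r (convpow n \<theta>) = convpow n (?r \<theta>)" by (induction n) (auto simp: map_mult_conv)
  \<comment> \<open>\<open>ln 9\<close> is the price of discrepancy 1 for a single convolution; the
    rest comes from \<open>ent_rotate_le\<close>.\<close>
  define e' where "e' = e + ln 9 + ent d + 3 * Lam"
  have finr: "fin_pmf (?r \<theta>)" using fin by simp
  have finA: "fin_pmf (A N)" by simp
  note lam = Lam_nonneg ent_nonneg[of d]
  have 1: "ent (conv ?p ?q) \<le> ent ?p + e'"
    using near_ent(2)[OF near_conv[OF near_self[OF finA] near_self[OF fin]], of N] e lam by (simp add: e'_def aent_def)
  have 2: "ent (conv ?p ?q') \<le> ent ?p + e'"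
    using near_ent(2)[OF near_conv[OF near_self[OF finA] near_self[OF finr]], of N] e ent_rotate_le[OF fin, of N] lam
    by (simp add: e'_def aent_def)
  have "ent (conv ?p (conv (convpow n ?q) (convpow n ?q'))) \<le> ent ?p + 2 * real n * e'"
    by (rule ent_convpow2_le) (use fin 1 2 in auto)
  moreover have "near N (2 * n + 2) (conv (A N) (spread n \<theta>)) (conv ?p (conv (convpow n ?q) (convpow n ?q')))"
    using near_conv[OF near_self[OF finA, of N] near_conv[OF near_convpow[OF near_self[OF fin]] near_convpow[OF near_self[OF finr]]], of n n]
    by (simp add: spread_def r mult_2)
  ultimately show ?thesis
    using near_ent(1)[of N "2 * n + 2"] by (force simp: spread_const_def e'_def aent_def algebra_simps)
qed

lemma ent_blocks:
  assumes "fin_pmf p"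
  shows "ent (map_pmf (Dn (M * l)) p) \<ge> (\<Sum>j<M. hc (j * l) (j * l + l) p - Lam)"
proof (induction M)
  case 0
  then show ?case by (simp add: ent_nonneg)
next
  case (Suc M)
  have "ent (map_pmf (Dn (M * l + l)) p) \<ge> ent (map_pmf (Dn (M * l)) p) + hc (M * l) (M * l + l) p - Lam"
    by (rule ent_step[OF assms]) simp
  then show ?case using Suc by (simp add: add.commute)
qed

lemma ent_blocks_upper:
  assumes "fin_pmf p"
  shows "ent (map_pmf (Dn (M * l)) p) \<le> ent (map_pmf (Dn 0) p) + (\<Sum>j<M. hc (j * l) (j * l + l) p)"
proof (induction M)
  case (Suc M)
  have "ent (map_pmf (Dn (M * l + l)) p) \<le> ent (map_pmf (Dn (M * l)) p) + hc (M * l) (M * l + l) p"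
    by (rule ent_step_upper[OF assms])
  then show ?case using Suc by (simp add: add.commute)
qed simp

text \<open>The limit of \<open>aent t / t\<close> in Fekete's lemma, written as a supremum;
  subtracting \<open>5 * Lam\<close> makes the sequence superadditive.\<close>

definition "rate = (SUP t\<in>{1..}. (aent t - 5 * Lam) / real t)"

lemma aent_nonneg: "aent t \<ge> 0"
  by (simp add: aent_def ent_nonneg)

lemma rate_bdd: "bdd_above ((\<lambda>t. (aent t - 5 * Lam) / real t) ` {1..})"
proof (rule bdd_aboveI2)
  fix t :: nat assume "t \<in> {1..}"
  then have "aent t - 5 * Lam \<le> (\<beta> + 6) * t"
    using aent_upper[of t] Lam_nonneg by (simp add: algebra_simps)
  then show "(aent t - 5 * Lam) / real t \<le> \<beta> + 6" using \<open>t \<in> {1..}\<close> by (simp add: divide_le_eq)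
qed

lemma aent_le_rate: "aent t \<le> rate * t + 5 * Lam"
proof (cases "t = 0")
  case True
  then show ?thesis using Lam_nonneg by (simp add: aent_def ent_def)
next
  case False
  then have "(aent t - 5 * Lam) / real t \<le> rate"
    unfolding rate_def by (intro cSUP_upper rate_bdd) auto
  then show ?thesis using False by (simp add: divide_le_eq)
qed

text \<open>Fekete: a length \<open>t0\<close> that nearly attains the supremum is repeated as often
  as it fits into \<open>t\<close>. The entropy of the remainder is nonnegative and may be
  dropped.\<close>

lemma aent_ge_rate:
  assumes "\<epsilon> > 0"
  shows "\<forall>\<^sub>F t in sequentially. aent t \<ge> (rate - \<epsilon>) * t"
proof (cases "rate - \<epsilon> / 2 < 0")
  case True
  then have "(rate - \<epsilon>) * t \<le> 0" for t :: nat using assms by (intro mult_nonpos_nonneg) auto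
  then show ?thesis using aent_nonneg by (intro always_eventually allI) (meson order_trans)
next
  case False
  have "rate - \<epsilon> / 2 < rate" using assms by simp
  then obtain t0 where t0: "t0 \<in> {1..}" "rate - \<epsilon> / 2 < (aent t0 - 5 * Lam) / real t0"
    unfolding rate_def by (subst (asm) less_cSUP_iff[OF _ rate_bdd]) auto
  have t0': "(rate - \<epsilon> / 2) * t0 \<le> aent t0 - 5 * Lam" using t0 by (simp add: less_divide_eq)
  have mult: "aent (q * t0) \<ge> q * ((rate - \<epsilon> / 2) * t0)" for q
  proof (induction q)
    case (Suc q)
    have "aent (t0 + q * t0) \<ge> aent t0 + aent (q * t0) - 5 * Lam" by (rule aent_superadd)
    then show ?case using Suc t0' by (simp add: algebra_simps add_divide_distrib)
  qed (simp add: aent_nonneg)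
  define T where "T = nat \<lceil>(2 * (rate * t0 + 5 * Lam)) / \<epsilon>\<rceil>"
  show ?thesis
  proof (rule eventually_sequentiallyI[of T])
    fix t assume "T \<le> t"
    then have "(2 * (rate * t0 + 5 * Lam)) / \<epsilon> \<le> t" unfolding T_def by linarith
    then have t: "rate * t0 + 5 * Lam \<le> \<epsilon> / 2 * t" using assms by (simp add: field_simps)
    define q s where "q = t div t0" and "s = t mod t0"
    have ts: "t = q * t0 + s" "s < t0" using t0 by (auto simp: q_def s_def)
    have "real t - t0 \<le> q * t0" using ts by (simp add: ts(1))
    then have "(real t - t0) * (rate - \<epsilon> / 2) \<le> (q * t0) * (rate - \<epsilon> / 2)"
      using False by (intro mult_right_mono) auto
    moreover have "aent t \<ge> aent (q * t0) + aent s - 5 * Lam" unfolding ts(1) by (rule aent_superadd)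
    moreover have "real t0 * (\<epsilon> / 2) \<ge> 0" using assms by simp
    ultimately show "(rate - \<epsilon>) * t \<le> aent t"
      using mult[of q] aent_nonneg[of s] t by (simp add: algebra_simps add_divide_distrib diff_divide_distrib)
  qed
qed

lemma cell_distribution:
  fixes m :: nat
  assumes fin: "fin_pmf p" "fin_pmf q"
  defines "k \<equiv> (\<lambda>c. cond_pmf p (Dn m -` {c}))"
  shows "bind_pmf (map_pmf (Dn m) p) (\<lambda>c. map_pmf (Pair c) (pair_pmf (k c) q)) = map_pmf (\<lambda>w. (Dn m (fst w), w)) (pair_pmf p q)"
proof -
  let ?f = "\<lambda>z. bind_pmf q (\<lambda>b. return_pmf (fst z, snd z, b))"
  have "bind_pmf (map_pmf (Dn m) p) (\<lambda>c. map_pmf (Pair c) (pair_pmf (k c) q)) =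
     bind_pmf (bind_pmf (map_pmf (Dn m) p) (\<lambda>c. map_pmf (Pair c) (k c))) ?f"
    by (simp add: pair_pmf_def map_bind_pmf bind_assoc_pmf bind_map_pmf)
  also have "\<dots> = bind_pmf (map_pmf (\<lambda>x. (Dn m x, x)) p) ?f"
    unfolding k_def cond_pmf_cell[OF fin(1)] ..
  also have "\<dots> = map_pmf (\<lambda>w. (Dn m (fst w), w)) (pair_pmf p q)"
    by (simp add: pair_pmf_def map_bind_pmf bind_map_pmf)
  finally show ?thesis .
qed

text \<open>
  If the sums of length \<open>m\<close> carry more entropy at a very fine scale than the limiting measure,
  then some cell of scale \<open>m\<close> contains a conditional distribution \<open>\<theta>\<close> of positive
  entropy whose convolution with the measure does not gain entropy.
\<close>

lemma exists_inert_component: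
  fixes c0 \<epsilon>' :: real and C1 :: nat
  assumes c: "rate < c0" and C1: "C1 \<ge> 1"
    and sep: "\<forall>\<^sub>F m in sequentially. ent (map_pmf (Dn (m + C1 * m)) (A m)) \<ge> c0 * m"
    and eps: "\<epsilon>' > 0"
  defines "c' \<equiv> (c0 - rate) / (4 * C1)"
  shows "\<forall>\<^sub>F m in sequentially. \<exists>\<theta>. fin_pmf \<theta> \<and> (\<forall>x\<in>set_pmf \<theta>. \<forall>y\<in>set_pmf \<theta>. cmod (x - y) \<le> 2) \<and>
     ent (map_pmf (Dn (C1 * m)) \<theta>) \<ge> c' * (C1 * m) \<and>
     ent (map_pmf (Dn (C1 * m)) (conv (A (C1 * m)) \<theta>)) \<le> aent (C1 * m) + \<epsilon>' * (C1 * m)"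
proof -
  define c1 where "c1 = c0 - rate"
  have c1: "c1 > 0" using c by (simp add: c1_def)
  \<comment> \<open>Tuned so that the selection with the weight \<open>w\<close> below ends with an
    excess of at most \<open>\<epsilon>' / 4 * N\<close>.\<close>
  define \<epsilon> where "\<epsilon> = \<epsilon>' * c1 / (12 * C1 * (\<beta> + 1) * 2)"
  have \<epsilon>: "\<epsilon> > 0" unfolding \<epsilon>_def using c1 eps beta_pos C1 by (intro divide_pos_pos mult_pos_pos) auto
  have fs: "filterlim (\<lambda>m::nat. C1 * m) sequentially sequentially"
    using C1 by (intro filterlim_subseq) (auto simp: strict_mono_def)
  have ev1: "\<forall>\<^sub>F m in sequentially. aent m \<ge> (rate - \<epsilon>) * m" by (rule aent_ge_rate[OF \<epsilon>])
  have ev2: "\<forall>\<^sub>F m in sequentially. aent (C1 * m) \<ge> (rate - \<epsilon>) * (C1 * m)"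
    using eventually_compose_filterlim[OF ev1 fs] by simp
  have big: "\<forall>\<^sub>F m in sequentially. real m \<ge> K" for K :: real
    by (rule filterlim_real_sequentially[unfolded filterlim_at_top, rule_format])
  show ?thesis
    using sep ev1 ev2 big[of "12 * Lam / (c1 / 2)"] big[of "20 * Lam / \<epsilon>"] big[of "6 + Lam"] big[of 1] big[of "2 * Lam / \<epsilon>'"]
  proof eventually_elim
    case (elim m)
    define N where "N = C1 * m"
    have Nm: "real N = C1 * real m" by (simp add: N_def)
    have mN: "real m \<le> N" using C1 by (simp add: Nm mult_le_cancel_right1)
    have m1: "real m \<ge> 1" using elim by simp
    let ?P = "pair_pmf (A m) (A N)" and ?V = "\<lambda>(a, b). a + \<rho> ^ m * b"
    define q where "q = map_pmf (Dn m) (A m)"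
    define k where "k = (\<lambda>c. cond_pmf (A m) (Dn m -` {c}))"
    have kc: "cond_pmf (A m) (Dn m -` {c}) = k c" for c by (simp add: k_def)
    \<comment> \<open>The part of \<open>A m\<close> inside one cell, rescaled to bounded
      size.\<close>
    define \<theta> where "\<theta> = (\<lambda>c. map_pmf (\<lambda>a. a / \<rho> ^ m) (k c))"
    have finA: "fin_pmf (A n)" for n by simp
    have finP: "fin_pmf ?P" by simp
    have finq: "fin_pmf q" by (simp add: q_def)
    have cell: "set_pmf (A m) \<inter> Dn m -` {c} \<noteq> {}" if "c \<in> set_pmf q" for c
      using that by (auto simp: q_def)
    have fink: "fin_pmf (k c)" if "c \<in> set_pmf q" for c
      by (simp add: k_def set_cond_pmf[OF cell[OF that]])
    have fin\<theta>: "fin_pmf (\<theta> c)" if "c \<in> set_pmf q" for c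
      using fink[OF that] by (simp add: \<theta>_def)
    have diam: "cmod (x - y) \<le> 2" if c: "c \<in> set_pmf q" "x \<in> set_pmf (\<theta> c)" "y \<in> set_pmf (\<theta> c)" for c x y
    proof -
      obtain a where a: "x = a / \<rho> ^ m" "Dn m a = c"
        using c(2) unfolding \<theta>_def k_def set_map_pmf set_cond_pmf[OF cell[OF c(1)]] by blast
      obtain b where b: "y = b / \<rho> ^ m" "Dn m b = c"
        using c(3) unfolding \<theta>_def k_def set_map_pmf set_cond_pmf[OF cell[OF c(1)]] by blast
      have ab: "x = a / \<rho> ^ m" "y = b / \<rho> ^ m" "Dn m a = Dn m b" using a b by auto
      have "cmod (x - y) = cmod (a - b) / rad m"
        by (simp add: ab diff_divide_distrib[symmetric] norm_divide norm_power)
      then show ?thesis using Dn_eq_dist[OF ab(3)] by (simp add: divide_le_eq)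
    qed
    have Vlaw: "map_pmf ?V ?P = A (m + N)"
      by (simp add: selfsim_add map_mult_pair)
    define e where "e = (\<lambda>c. ent (map_pmf (Dn N) (conv (A N) (\<theta> c))))"
    define h where "h = (\<lambda>c. ent (map_pmf (Dn N) (\<theta> c)))"
    have rho_m: "\<rho> ^ m * (a / \<rho> ^ m) = a" for a using rho by auto
    \<comment> \<open>\<open>A (m + N)\<close> is \<open>A m\<close> plus a shrunk
      \<open>A N\<close>. Given the cell of the former, the convolution of the rescaled part with
      \<open>A N\<close> uses entropy between the scales \<open>m\<close> and \<open>m + N\<close>,
      and on average only about \<open>rate * N\<close> is available there.\<close>
    have E1: "pE q e \<le> rate * N + \<epsilon> * m + 9 * Lam"
    proof -
      have "aent (m + N) \<ge> ent (map_pmf (Dn m) (A (m + N))) + hc m (m + N) (A (m + N)) - Lam"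
        unfolding aent_def by (rule ent_step) auto
      moreover have "ent (map_pmf (Dn m) (A (m + N))) \<ge> aent m - Lam"
        by (rule ent_scale_A) simp
      moreover have "hc m (m + N) (A (m + N)) \<ge> cent ?P (\<lambda>w. Dn (m + N) (?V w)) (\<lambda>w. Dn m (fst w)) - Lam"
        unfolding Vlaw[symmetric]
      proof (rule hc_local[OF finP])
        fix v w assume vw: "v \<in> set_pmf ?P" "w \<in> set_pmf ?P" "Dn m (fst v) = Dn m (fst w)"
        have "cmod (\<rho> ^ m * (snd v - snd w)) \<le> rad m * (B + B)"
          unfolding norm_mult norm_power
          by (intro mult_left_mono order_trans[OF norm_triangle_ineq4] add_mono bound) (use vw in auto)
        moreover have "?V v - ?V w = (fst v - fst w) + \<rho> ^ m * (snd v - snd w)"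
          by (simp add: case_prod_unfold algebra_simps)
        then have "cmod (?V v - ?V w) \<le> cmod (fst v - fst w) + cmod (\<rho> ^ m * (snd v - snd w))"
          by (simp only: norm_triangle_ineq)
        moreover note Dn_eq_dist[OF vw(3)]
        ultimately have "cmod (?V v - ?V w) \<le> (2 + 2 * B) * rad m" by (simp add: algebra_simps)
        then show "cmod (?V v - ?V w) \<le> (4 * B + 8) * rad m" using const_le(2)[of m] by linarith
      qed
      moreover have "cent ?P (\<lambda>w. Dn (m + N) (?V w)) (\<lambda>w. Dn m (fst w)) = pE q (\<lambda>c. ent (map_pmf (\<lambda>w. Dn (m + N) (?V w)) (pair_pmf (k c) (A N))))"
      proof -
        have "cent ?P (\<lambda>w. Dn (m + N) (?V w)) (\<lambda>w. Dn m (fst w)) =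
          cent (map_pmf (\<lambda>w. (Dn m (fst w), w)) ?P) (\<lambda>(c, w). Dn (m + N) (?V w)) fst"
          by (simp add: cent_map)
        also have "\<dots> = pE q (\<lambda>c. ent (map_pmf (\<lambda>w. Dn (m + N) (?V w)) (pair_pmf (k c) (A N))))"
          unfolding cell_distribution[OF finA finA, symmetric] kc q_def[symmetric]
          by (rule cent_bind_Pair[OF finq]) (use fink in simp)
        finally show ?thesis .
      qed
      moreover have "pE q (\<lambda>c. e c - Lam) \<le> pE q (\<lambda>c. ent (map_pmf (\<lambda>w. Dn (m + N) (?V w)) (pair_pmf (k c) (A N))))"
      proof (rule pE_mono[OF finq])
        fix c assume c: "c \<in> set_pmf q"
        have "map_pmf (\<lambda>x. Dn (m + N) (0 + \<rho> ^ m * x)) (conv (\<theta> c) (A N)) = map_pmf (\<lambda>w. Dn (m + N) (?V w)) (pair_pmf (k c) (A N))"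
          by (simp add: conv_bind pair_pmf_def \<theta>_def map_bind_pmf bind_map_pmf distrib_left rho_m del: times_divide_eq_right)
        then show "e c - Lam \<le> ent (map_pmf (\<lambda>w. Dn (m + N) (?V w)) (pair_pmf (k c) (A N)))"
          using ent_affine(1)[where p = "conv (\<theta> c) (A N)" and s = m and t = N and a = 0] fin\<theta>[OF c]
          by (simp add: e_def conv_commute[of "A N"])
      qed
      ultimately have "pE q e \<le> aent (m + N) - aent m + 4 * Lam"
        by (simp only: pE_diff[OF finq] pE_const)
      then show ?thesis using aent_le_rate[of "m + N"] elim(2) by (simp add: algebra_simps)
    qed
    \<comment> \<open>Of the entropy \<open>c0 * m\<close> at the fine scale at most about
      \<open>rate * m\<close> is visible at scale \<open>m\<close>; the rest must lie inside the
      cells.\<close>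
    have E2: "pE q h \<ge> c1 * m - 6 * Lam"
    proof -
      have "pE q h \<ge> pE q (\<lambda>c. ent (map_pmf (Dn (m + N)) (k c)) - Lam)"
      proof (rule pE_mono[OF finq])
        fix c assume c: "c \<in> set_pmf q"
        have "map_pmf (\<lambda>x. Dn (m + N) (0 + \<rho> ^ m * x)) (\<theta> c) = map_pmf (Dn (m + N)) (k c)"
          by (simp add: \<theta>_def pmf.map_comp o_def rho_m del: times_divide_eq_right)
        then show "ent (map_pmf (Dn (m + N)) (k c)) - Lam \<le> h c"
          using ent_affine(2)[where p = "\<theta> c" and s = m and t = N and a = 0] fin\<theta>[OF c]
          by (simp add: h_def)
      qed
      moreover have "pE q (\<lambda>c. ent (map_pmf (Dn (m + N)) (k c)) - Lam) = hc m (m + N) (A m) - Lam"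
      proof -
        have "hc m (m + N) (A m) = cent (map_pmf (\<lambda>y. (Dn m y, y)) (A m)) (\<lambda>(c, y). Dn (m + N) y) fst"
          by (simp add: hc_def cent_map)
        also have "\<dots> = pE q (\<lambda>c. ent (map_pmf (Dn (m + N)) (k c)))"
          unfolding cond_pmf_cell[OF finA, symmetric] kc q_def[symmetric]
          by (rule cent_bind_Pair[OF finq fink])
        finally show ?thesis by (simp only: pE_diff[OF finq] pE_const)
      qed
      moreover have "ent (map_pmf (Dn (m + N)) (A m)) \<le> aent m + hc m (m + N) (A m)"
        unfolding aent_def by (rule ent_step_upper) simp
      moreover have "c0 * m \<le> ent (map_pmf (Dn (m + N)) (A m))" using elim(1) by (simp add: N_def)
      ultimately show ?thesis using aent_le_rate[of m] by (simp add: c1_def algebra_simps)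
    qed
    define D where "D = (\<lambda>c. e c - ((rate - \<epsilon>) * N - Lam))"
    have D0: "D c \<ge> 0" if c: "c \<in> set_pmf q" for c
    proof -
      have "e c \<ge> aent N - Lam"
        using ent_conv_ge[OF fin\<theta>[OF c] finA, of N N] by (simp add: e_def aent_def conv_commute[of "A N"])
      then show ?thesis using elim(3) by (simp add: D_def N_def)
    qed
    have lam20: "20 * Lam \<le> \<epsilon> * m" using elim(5) \<epsilon> by (simp add: field_simps)
    have epsmN: "\<epsilon> * m \<le> \<epsilon> * N" using mN \<epsilon> by simp
    have ED: "pE q D \<le> 3 * \<epsilon> * N"
    proof -
      have "pE q D = pE q e - ((rate - \<epsilon>) * N - Lam)"
        unfolding D_def by (simp only: pE_diff[OF finq] pE_const)
      also have "\<dots> \<le> \<epsilon> * m + \<epsilon> * N + 10 * Lam" using E1 by (simp add: algebra_simps)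
      also have "\<dots> \<le> 3 * \<epsilon> * N" using lam20 epsmN Lam_nonneg by linarith
      finally show ?thesis .
    qed
    \<comment> \<open>A single cell has to combine large entropy \<open>h\<close> with small excess
      \<open>D\<close>. For this \<open>w\<close> the mean of \<open>h - w * D\<close> is still
      large, and as \<open>D\<close> is nonnegative and \<open>h\<close> bounded, a cell that
      reaches the mean is good in both respects.\<close>
    define w where "w = c1 * m / 2 / (3 * \<epsilon> * N)"
    have Npos: "real N > 0" using mN m1 by linarith
    have w: "w > 0" unfolding w_def using c1 \<epsilon> m1 Npos by (intro divide_pos_pos mult_pos_pos) auto
    have "w * pE q D \<le> w * (3 * \<epsilon> * N)" using ED w by (intro mult_left_mono) auto
    also have "\<dots> = c1 * m / 2" using \<epsilon> Npos by (simp add: w_def)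
    finally have wD: "w * pE q D \<le> c1 * m / 2" .
    have "pE q (\<lambda>c. h c - w * D c) = pE q h - w * pE q D"
      by (simp only: pE_diff[OF finq] integral_mult_right_zero)
    then have "pE q (\<lambda>c. h c - w * D c) \<ge> c1 * m / 2 - 6 * Lam" using E2 wD by linarith
    then obtain c where c: "c \<in> set_pmf q" "h c - w * D c \<ge> c1 * m / 2 - 6 * Lam"
      using pE_ge_point[OF finq] by blast
    have lam24: "12 * Lam \<le> c1 / 2 * m"
    proof -
      have "12 * Lam = c1 / 2 * (12 * Lam / (c1 / 2))" using c1 by simp
      also have "\<dots> \<le> c1 / 2 * m" using elim(4) c1 by (intro mult_left_mono) auto
      finally show ?thesis .
    qed
    have "w * D c \<ge> 0" using w D0[OF c(1)] by simp
    then have hc_ge: "h c \<ge> c1 * m / 4" using c(2) lam24 by linarith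
    have "h c \<le> \<beta> * N + 6 + Lam"
      unfolding h_def
    proof (rule ent_upper[OF fin\<theta>[OF c(1)]])
      fix x y assume "x \<in> set_pmf (\<theta> c)" "y \<in> set_pmf (\<theta> c)"
      from diam[OF c(1) this] show "cmod (x - y) \<le> 4 * B + 8" using B_nonneg by simp
    qed
    also have "\<dots> \<le> (\<beta> + 1) * N" using elim(6) mN by (simp add: algebra_simps)
    finally have hup: "h c \<le> (\<beta> + 1) * N" .
    have "w * D c \<le> (\<beta> + 1) * N"
    proof -
      have "0 \<le> c1 * real m / 2 - 6 * Lam" using lam24 Lam_nonneg by linarith
      then show ?thesis using c(2) hup by linarith
    qed
    then have "D c \<le> (\<beta> + 1) * N / w" using w by (simp add: field_simps)
    also have "\<dots> = \<epsilon>' / 4 * N"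
      using c1 m1 eps beta_pos C1 Npos unfolding w_def \<epsilon>_def by (simp add: Nm divide_simps)
    finally have Dc: "D c \<le> \<epsilon>' / 4 * N" .
    have "aent N \<ge> (rate - \<epsilon>) * N" using elim(3) by (simp add: N_def)
    moreover have "e c = D c + ((rate - \<epsilon>) * N - Lam)" by (simp add: D_def)
    moreover have "\<epsilon>' / 4 * N \<le> \<epsilon>' * N" using eps Npos by simp
    ultimately have "e c \<le> aent N + \<epsilon>' * N" using Dc Lam_nonneg by linarith
    moreover have "c' * N = c1 * m / 4" using C1 by (simp add: c'_def c1_def Nm)
    ultimately show ?case
      using fin\<theta>[OF c(1)] diam[OF c(1)] hc_ge
      by (intro exI[of _ "\<theta> c"]) (simp add: N_def[symmetric] h_def e_def Nm[symmetric])
  qed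
qed

end

context selfsim_setup
begin

text \<open>
  Entropy at a fine scale exceeding the rate is incompatible with a deficient rate: the convolution
  powers of an inert component would have to saturate a positive proportion of the scales.
\<close>

theorem full_rate:
  fixes c0 :: real and C1 :: nat
  assumes c0: "\<beta> < c0" and C1: "C1 \<ge> 1"
    and sep: "\<forall>\<^sub>F m in sequentially. ent (map_pmf (Dn (m + C1 * m)) (A m)) \<ge> c0 * m"
  shows "rate \<ge> \<beta>"
proof (rule ccontr)
  assume "\<not> rate \<ge> \<beta>"
  define \<gamma> where "\<gamma> = \<beta> - rate"
  have \<gamma>: "\<gamma> > 0" using \<open>\<not> rate \<ge> \<beta>\<close> by (simp add: \<gamma>_def)
  define c' where "c' = (c0 - rate) / (4 * C1)"
  have c': "c' > 0" unfolding c'_def using c0 \<open>\<not> rate \<ge> \<beta>\<close> C1 by (intro divide_pos_pos) auto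
  \<comment> \<open>A block of \<open>l\<close> scales holds at most \<open>2 * \<beta> * l\<close>,
    so the entropy of \<theta> occupies at least this proportion of the blocks once the losses are
    deducted.\<close>
  define p where "p = c' / (8 * \<beta>)"
  have p: "p > 0" unfolding p_def using c' beta_pos by simp
  define K where "K = \<bar>L5\<bar> + 4 * Lam"
  have K: "K \<ge> 0" using Lam_nonneg by (simp add: K_def)
  define \<epsilon>1 where "\<epsilon>1 = p * \<gamma> / 8"
  have \<epsilon>1: "\<epsilon>1 > 0" using p \<gamma> by (simp add: \<epsilon>1_def)
  have big: "\<forall>\<^sub>F m in sequentially. real m \<ge> x" for x :: real
    by (rule filterlim_real_sequentially[unfolded filterlim_at_top, rule_format])
  have "\<forall>\<^sub>F l in sequentially. l \<ge> 1 \<and> aent l \<ge> (rate - \<epsilon>1) * l \<and> K \<le> \<epsilon>1 * l \<and> L3 \<le> c' / 2 * l \<and> 6 \<le> \<beta> * l"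
    using aent_ge_rate[OF \<epsilon>1] big[of "K / \<epsilon>1"] big[of "L3 / (c' / 2)"] big[of "6 / \<beta>"] eventually_ge_at_top[of 1]
  proof eventually_elim
    case (elim l)
    have div: "a \<le> c * x" if "a / c \<le> x" "c > 0" for a c x :: real
      using that by (simp add: pos_divide_le_eq mult.commute)
    show ?case
      using elim(1,5) div[OF elim(2) \<epsilon>1] div[OF elim(3)] div[OF elim(4) beta_pos] c' by simp
  qed
  from eventually_happens'[OF sequentially_bot this] obtain l where l: "l \<ge> 1" "aent l \<ge> (rate - \<epsilon>1) * l" "K \<le> \<epsilon>1 * l" "L3 \<le> c' / 2 * l" "6 \<le> \<beta> * l"
    by blast
  \<comment> \<open>The number of summands required by \<open>hc_spread\<close>. It depends on
    \<open>l\<close> only, so the admissible gain \<epsilon> per convolution can be fixed after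
    it.\<close>
  define n where "n = nat \<lceil>(1 / rad l) ^ 6\<rceil>"
  have n1: "(1 / rad l) ^ 6 \<ge> 1" using rho by (intro one_le_power) (simp add: power_le_one)
  have n: "(1 / rad l) ^ 6 \<le> real n" "real n \<le> 2 * (1 / rad l) ^ 6"
    using n1 unfolding n_def by linarith+
  define \<epsilon> where "\<epsilon> = p * \<gamma> / (8 * (real n + 1))"
  have \<epsilon>: "\<epsilon> > 0" using p \<gamma> by (simp add: \<epsilon>_def)
  have fl: "filterlim (\<lambda>m::nat. l * m) sequentially sequentially"
    using l(1) by (intro filterlim_subseq) (auto simp: strict_mono_def)
  have "\<forall>\<^sub>F m in sequentially. \<exists>\<theta>. fin_pmf \<theta> \<and> (\<forall>x\<in>set_pmf \<theta>. \<forall>y\<in>set_pmf \<theta>. cmod (x - y) \<le> 2) \<and>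
     ent (map_pmf (Dn (C1 * (l * m))) \<theta>) \<ge> c' * (C1 * (l * m)) \<and>
     ent (map_pmf (Dn (C1 * (l * m))) (conv (A (C1 * (l * m))) \<theta>)) \<le> aent (C1 * (l * m)) + \<epsilon> * (C1 * (l * m))"
    using eventually_compose_filterlim[OF exists_inert_component[OF _ C1 sep \<epsilon>] fl] c0 \<open>\<not> rate \<ge> \<beta>\<close>
    unfolding c'_def by simp
  moreover note big[of "4 * Lam / c'"] big[of "(5 * Lam + spread_const n + 2 * (\<gamma> + \<epsilon>1) * l) / (p * \<gamma> / 4) + 1"] eventually_ge_at_top[of 1]
  ultimately have "\<forall>\<^sub>F m in sequentially. False"
  proof eventually_elim
    case (elim m)
    define M where "M = C1 * m"
    have NM: "C1 * (l * m) = M * l" by (simp add: M_def)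
    have Mm: "real M \<ge> real m" using C1 by (simp add: M_def mult_le_cancel_right1)
    obtain \<theta> where fin: "fin_pmf \<theta>" and diam: "\<And>x y. x \<in> set_pmf \<theta> \<Longrightarrow> y \<in> set_pmf \<theta> \<Longrightarrow> cmod (x - y) \<le> 2"
      and ent\<theta>: "ent (map_pmf (Dn (M * l)) \<theta>) \<ge> c' * (M * l)"
      and inert: "ent (map_pmf (Dn (M * l)) (conv (A (M * l)) \<theta>)) \<le> aent (M * l) + \<epsilon> * (M * l)"
      using elim(1) unfolding NM by (metis of_nat_mult)
    define T where "T = {t\<in>{..<M}. hc (t * l) (t * l + l) \<theta> \<ge> c' / 2 * l}"
    have finT: "finite T" by (simp add: T_def)
    have cardT: "real (card T) \<ge> p * M"
    proof -
      have "ent (map_pmf (Dn 0) \<theta>) \<le> Lam"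
      proof (rule ent_D0_le[OF fin])
        fix x y assume "x \<in> set_pmf \<theta>" "y \<in> set_pmf \<theta>"
        from diam[OF this] show "cmod (x - y) \<le> 4 * B + 8" using B_nonneg by simp
      qed
      then have "c' * (M * l) \<le> Lam + (\<Sum>t<M. hc (t * l) (t * l + l) \<theta>)"
        using ent\<theta> ent_blocks_upper[OF fin, of M l] by simp
      also have "(\<Sum>t<M. hc (t * l) (t * l + l) \<theta>) \<le> (\<Sum>t<M. (if t \<in> T then 2 * \<beta> * l else 0) + c' / 2 * l)"
      proof (rule sum_mono)
        fix t assume "t \<in> {..<M}"
        have nn: "c' / 2 * l \<ge> 0" using c' by simp
        show "hc (t * l) (t * l + l) \<theta> \<le> (if t \<in> T then 2 * \<beta> * l else 0) + c' / 2 * l"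
        proof (cases "t \<in> T")
          case True
          have "2 * \<beta> * l = \<beta> * l + \<beta> * l" by simp
          then show ?thesis using True nn hc_upper[OF fin, of "t * l" l] l(5) by (simp only: if_True)
        next
          case False
          then have "hc (t * l) (t * l + l) \<theta> < c' / 2 * l" using \<open>t \<in> {..<M}\<close> by (auto simp: T_def)
          then show ?thesis using False by (simp only: if_False)
        qed
      qed
      also have "\<dots> = card T * (2 * \<beta> * l) + M * (c' / 2 * l)"
      proof -
        have "{..<M} \<inter> {t. t \<in> T} = T" by (auto simp: T_def)
        then show ?thesis by (simp add: sum.distrib sum.If_cases)
      qed
      finally have "c' / 2 * M * l - Lam \<le> card T * (2 * \<beta> * l)" by (simp add: algebra_simps)
      moreover have "Lam \<le> c' / 4 * M * l"
      proof -
        have "4 * Lam \<le> c' * m" using elim(2) c' by (simp add: field_simps)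
        also have "\<dots> \<le> c' * (M * l)"
        proof -
          have "real M * 1 \<le> real M * real l" using l(1) by (intro mult_left_mono) auto
          then show ?thesis using Mm c' by (intro mult_left_mono) auto
        qed
        finally show ?thesis by simp
      qed
      ultimately have "c' / 4 * M * l \<le> card T * (2 * \<beta> * l)" by linarith
      then have "(c' / 4 * M) * l \<le> (card T * (2 * \<beta>)) * l" by (simp add: mult_ac)
      then have "c' / 4 * M \<le> card T * (2 * \<beta>)" by (rule mult_right_le_imp_le) (use l(1) in simp)
      then show ?thesis using beta_pos by (simp add: p_def field_simps)
    qed
    \<comment> \<open>\<open>hc_spread\<close> converts entropy two blocks further down into
      saturation; hence the shift by 2 and the loss of the blocks 0 and 1.\<close>
    define T' where "T' = (\<lambda>t. t - 2) ` (T - {0, 1})"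
    have T'M: "T' \<subseteq> {..<M}" by (auto simp: T'_def T_def)
    have finT': "finite T'" using finT by (simp add: T'_def)
    have cardT': "real (card T') \<ge> p * M - 2"
    proof -
      have "card T' = card (T - {0, 1})" unfolding T'_def
        by (rule card_image) (auto simp: inj_on_def)
      moreover have "card (T - {0, 1}) \<ge> card T - card {0::nat, 1}"
        by (rule diff_card_le_card_Diff) simp
      ultimately have "card T' + 2 \<ge> card T" by simp
      then show ?thesis using cardT by linarith
    qed
    let ?V = "conv (A (M * l)) (spread n \<theta>)"
    have finS: "fin_pmf (spread n \<theta>)" using fin by (simp add: spread_def)
    have finV: "fin_pmf ?V" using finS by simp
    \<comment> \<open>Saturated blocks carry almost \<open>\<beta> * l\<close>, and in the others
      self-similarity of \<open>A (M * l)\<close> already yields almost \<open>rate * l\<close>.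
      Summing, a surplus of about \<open>\<gamma> * l\<close> on a positive proportion of blocks
      contradicts inertness.\<close>
    have blk: "hc (j * l) (j * l + l) ?V - Lam \<ge> (rate - \<epsilon>1) * l - K + (if j \<in> T' then (\<gamma> + \<epsilon>1) * l else 0)"
      if j: "j < M" for j
    proof (cases "j \<in> T'")
      case True
      then obtain t where t: "t \<in> T" "t \<ge> 2" "j = t - 2" by (force simp: T'_def)
      then have tl: "t * l = j * l + 2 * l" "t * l + l = j * l + 3 * l"
        by (simp_all add: diff_mult_distrib)
      have "hc (j * l + 2 * l) (j * l + 3 * l) \<theta> \<ge> L3"
        using t(1) l(4) unfolding tl[symmetric] T_def by simp
      from hc_spread[OF fin this n] have "hc (j * l) (j * l + l) (spread n \<theta>) \<ge> \<beta> * l - L5" .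
      moreover have "hc (j * l) (j * l + l) ?V \<ge> hc (j * l) (j * l + l) (spread n \<theta>) - 2 * Lam"
        by (rule hc_conv) (use finS in auto)
      ultimately have "hc (j * l) (j * l + l) ?V - Lam \<ge> \<beta> * l - K" using Lam_nonneg by (simp add: K_def)
      then show ?thesis using True by (simp add: \<gamma>_def algebra_simps)
    next
      case False
      have "j * l + l \<le> M * l"
        using mult_le_mono1[of "Suc j" M l] j by (simp add: add.commute)
      then have le: "l \<le> M * l - j * l" "j * l + (M * l - j * l) = M * l" by linarith+
      have "A (M * l) = conv (A (j * l)) (map_pmf ((*) (\<rho> ^ (j * l))) (A (M * l - j * l)))"
        using selfsim_add[of \<rho> d "j * l" "M * l - j * l"] le(2) by simp
      then have "?V = conv (conv (spread n \<theta>) (A (j * l))) (map_pmf ((*) (\<rho> ^ (j * l))) (A (M * l - j * l)))"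
        by (simp only: conv_assoc conv_commute[of _ "spread n \<theta>"])
      then have "hc (j * l) (j * l + l) ?V \<ge> aent l - 3 * Lam"
        using hc_selfsim[of "conv (spread n \<theta>) (A (j * l))" l "M * l - j * l" "j * l"] finS le(1) by simp
      then show ?thesis using False l(2) by (simp add: K_def)
    qed
    have "M * ((rate - \<epsilon>1) * l - K) + card T' * ((\<gamma> + \<epsilon>1) * l) = (\<Sum>j<M. (rate - \<epsilon>1) * l - K + (if j \<in> T' then (\<gamma> + \<epsilon>1) * l else 0))"
    proof -
      have "{..<M} \<inter> {j. j \<in> T'} = T'" using T'M by auto
      then show ?thesis by (simp add: sum.distrib sum.If_cases)
    qed
    also have "\<dots> \<le> (\<Sum>j<M. hc (j * l) (j * l + l) ?V - Lam)"
      by (rule sum_mono) (use blk in auto)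
    also have "\<dots> \<le> ent (map_pmf (Dn (M * l)) ?V)" by (rule ent_blocks[OF finV])
    also have "\<dots> \<le> aent (M * l) + 2 * real n * (\<epsilon> * (M * l)) + spread_const n"
      by (rule ent_spread_le[OF fin inert])
    also have "\<dots> \<le> rate * (M * l) + 5 * Lam + 2 * real n * (\<epsilon> * (M * l)) + spread_const n"
      using aent_le_rate[of "M * l"] by simp
    also have "2 * real n * (\<epsilon> * (M * l)) \<le> p * \<gamma> / 4 * (M * l)"
    proof -
      have "2 * a * (x / (8 * u)) = x / 4 * (a / u)" for a x u :: real by simp
      then have "2 * real n * \<epsilon> = (p * \<gamma> / 4) * (real n / (real n + 1))" unfolding \<epsilon>_def .
      also have "\<dots> \<le> (p * \<gamma> / 4) * 1" using p \<gamma> by (intro mult_left_mono) auto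
      finally have "(2 * real n * \<epsilon>) * (real M * real l) \<le> (p * \<gamma> / 4) * (real M * real l)" by (intro mult_right_mono) auto
      then show ?thesis by (simp add: mult_ac)
    qed
    finally have up: "M * ((rate - \<epsilon>1) * l - K) + card T' * ((\<gamma> + \<epsilon>1) * l) \<le> rate * (M * l) + 5 * Lam + p * \<gamma> / 4 * (M * l) + spread_const n"
      by simp
    have "(p * M - 2) * ((\<gamma> + \<epsilon>1) * l) \<le> card T' * ((\<gamma> + \<epsilon>1) * l)"
      using cardT' \<gamma> \<epsilon>1 by (intro mult_right_mono) auto
    moreover have "real M * K \<le> real M * (\<epsilon>1 * l)" using l(3) by (intro mult_left_mono) auto
    moreover have "p * (real M * real l) * \<epsilon>1 \<ge> 0" using p \<epsilon>1 by simp
    ultimately have "(p * \<gamma> - 2 * \<epsilon>1 - p * \<gamma> / 4) * (real M * real l) \<le> 5 * Lam + spread_const n + 2 * (\<gamma> + \<epsilon>1) * l"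
      using up by (simp add: algebra_simps)
    also have "p * \<gamma> - 2 * \<epsilon>1 - p * \<gamma> / 4 = p * \<gamma> / 2" by (simp add: \<epsilon>1_def)
    finally have 1: "p * \<gamma> / 2 * (real M * real l) \<le> 5 * Lam + spread_const n + 2 * (\<gamma> + \<epsilon>1) * l" .
    have "(5 * Lam + spread_const n + 2 * (\<gamma> + \<epsilon>1) * l) / (p * \<gamma> / 4) < real m" using elim(3) by linarith
    then have 2: "5 * Lam + spread_const n + 2 * (\<gamma> + \<epsilon>1) * l < p * \<gamma> / 4 * m"
      using p \<gamma> by (simp add: pos_divide_less_eq mult.commute)
    have "real m * 1 \<le> real M * real l" using Mm l(1) by (intro mult_mono) auto
    then have "p * \<gamma> / 4 * m \<le> p * \<gamma> / 4 * (real M * real l)" using p \<gamma> by (intro mult_left_mono) auto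
    moreover have "p * \<gamma> / 4 * (real M * real l) \<le> p * \<gamma> / 2 * (real M * real l)" using p \<gamma> by (intro mult_right_mono) auto
    ultimately show False using 1 2 by linarith
  qed
  then show False by simp
qed

corollary exists_full_entropy:
  fixes c0 \<epsilon> :: real and C1 :: nat
  assumes "\<beta> < c0" "C1 \<ge> 1" "\<forall>\<^sub>F m in sequentially. ent (map_pmf (Dn (m + C1 * m)) (A m)) \<ge> c0 * m" "\<epsilon> > 0"
  shows "\<forall>\<^sub>F m in sequentially. aent m \<ge> (\<beta> - \<epsilon>) * m"
  using aent_ge_rate[OF assms(4)]
proof eventually_elim
  case (elim m)
  have "(\<beta> - \<epsilon>) * m \<le> (rate - \<epsilon>) * m" using full_rate[OF assms(1-3)] by (intro mult_right_mono) auto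
  then show ?case using elim by simp
qed

end

section \<open>Gaussian smoothing and Plancherel's identity\<close>

lemma
  fixes f :: "'a \<Rightarrow> 'b \<Rightarrow> 'c::{banach, second_countable_topology}"
  assumes fin: "fin_pmf p" and int: "\<And>x. x \<in> set_pmf p \<Longrightarrow> integrable M (f x)"
  shows integrable_pE: "integrable M (\<lambda>z. pE p (\<lambda>x. f x z))"
    and integral_pE: "(LINT z|M. pE p (\<lambda>x. f x z)) = pE p (\<lambda>x. LINT z|M. f x z)"
  unfolding pE_sum[OF fin] using int by (auto simp: Bochner_Integration.integral_sum)

lemma gs_mult: "gs c z * gs d z = gs (c + d) z"
  by (simp add: gs_def algebra_simps flip: exp_add)

lemma gs_power2: "(gs c z)\<^sup>2 = gs (2 * c) z"
  by (simp add: power2_eq_square gs_mult)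

lemma gs_le_1: "c \<ge> 0 \<Longrightarrow> gs c z \<le> 1"
  by (simp add: gs_def)

lemma gs_antimono: "c \<le> d \<Longrightarrow> gs d z \<le> gs c z"
  by (simp add: gs_def mult_right_mono)

lemma gs_minus_commute: "gs c (x - y) = gs c (y - x)"
  by (simp add: gs_def norm_minus_commute)

text \<open>The Gaussian density with variance \<open>v\<close> in each coordinate, so that
  convolution adds the parameters.\<close>

definition phi :: "real \<Rightarrow> complex \<Rightarrow> real" where
  "phi v z = gs (1 / (2 * v)) z / (2 * pi * v)"

lemma phi_nonneg: "v > 0 \<Longrightarrow> phi v z \<ge> 0"
  by (simp add: phi_def)

lemma phi_measurable [measurable]: "phi v \<in> borel_measurable borel"
  unfolding phi_def by measurable

lemma phi_le: "v > 0 \<Longrightarrow> phi v z \<le> 1 / (2 * pi * v)"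
  unfolding phi_def by (intro divide_right_mono gs_le_1) auto

lemma
  fixes f :: "complex \<Rightarrow> 'b::{banach, second_countable_topology}"
  assumes f: "integrable lborel f"
  shows integrable_shift: "integrable lborel (\<lambda>z. f (z - x))"
    and integral_shift: "(LINT z|lborel. f (z - x)) = (LINT z|lborel. f z)"
proof -
  have d: "distr lborel borel (\<lambda>z. z - x) = (lborel :: complex measure)"
  proof -
    have "(\<lambda>z. z - x) = (+) (- x)" by (rule ext) simp
    then show ?thesis using lborel_distr_plus[of "- x"] by (simp only:)
  qed
  have [measurable]: "f \<in> borel_measurable borel" using borel_measurable_integrable[OF f] by simp
  have "integrable (distr lborel borel (\<lambda>z. z - x)) f = integrable lborel (\<lambda>z. f (z - x))"
    by (rule integrable_distr_eq) simp_all
  then show "integrable lborel (\<lambda>z. f (z - x))" using f d by simp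
  have "(LINT z|distr lborel borel (\<lambda>z. z - x). f z) = (LINT z|lborel. f (z - x))"
    by (rule integral_distr) simp_all
  then show "(LINT z|lborel. f (z - x)) = (LINT z|lborel. f z)" using d by simp
qed

lemma
  assumes v: "v > 0"
  shows integrable_phi: "integrable lborel (\<lambda>z. phi v (z - x))"
    and integral_phi: "(LINT z|lborel. phi v (z - x)) = 1"
proof -
  have i: "integrable lborel (phi v)" "(LINT z|lborel. phi v z) = 1"
    unfolding phi_def using v integral_gs[of "1 / (2 * v)"] integrable_gs[of "1 / (2 * v)"] by simp_all
  show "integrable lborel (\<lambda>z. phi v (z - x))" "(LINT z|lborel. phi v (z - x)) = 1"
    using integrable_shift[OF i(1)] integral_shift[OF i(1)] i(2) by simp_all
qed

lemma complete_square:
  fixes a b p x y :: real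
  assumes "a > 0" "b > 0"
  shows "a * (p - x)\<^sup>2 + b * (p - y)\<^sup>2 = (a + b) * (p - (a * x + b * y) / (a + b))\<^sup>2 + a * b / (a + b) * (x - y)\<^sup>2"
proof -
  define s where "s = a + b"
  have s: "s > 0" "b = s - a" using assms by (auto simp: s_def)
  have "s * (p - (a * x + b * y) / s)\<^sup>2 = (s * p - (a * x + b * y))\<^sup>2 / s"
  proof -
    have "s * (p - (a * x + b * y) / s) = s * p - (a * x + b * y)" using s(1) by (simp add: right_diff_distrib)
    then have "(s * p - (a * x + b * y))\<^sup>2 = s * s * (p - (a * x + b * y) / s)\<^sup>2"
      by (simp add: power_mult_distrib power2_eq_square flip: \<open>s * (p - (a * x + b * y) / s) = _\<close>)
    then show ?thesis using s(1) by simp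
  qed
  moreover have "s * (a * (p - x)\<^sup>2 + b * (p - y)\<^sup>2) = (s * p - (a * x + b * y))\<^sup>2 + a * b * (x - y)\<^sup>2"
    unfolding s(2) by (simp add: power2_eq_square algebra_simps)
  ultimately have "s * (a * (p - x)\<^sup>2 + b * (p - y)\<^sup>2) = s * (s * (p - (a * x + b * y) / s)\<^sup>2 + a * b / s * (x - y)\<^sup>2)"
    using s(1) by (simp only: distrib_left[of s]) simp
  then show ?thesis unfolding s_def[symmetric] using s(1) by (simp only: mult_left_cancel)
qed

lemma gs_prod: "gs a x * gs b y = exp (- (a * (cmod x)\<^sup>2 + b * (cmod y)\<^sup>2))"
  by (simp add: gs_def flip: exp_add)

lemma gs_gs:
  assumes "a > 0" "b > 0"
  shows "gs a (z - x) * gs b (z - y) = gs (a + b) (z - (of_real a * x + of_real b * y) / of_real (a + b)) * gs (a * b / (a + b)) (x - y)"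
proof -
  have "a * (cmod (z - x))\<^sup>2 + b * (cmod (z - y))\<^sup>2 =
    (a + b) * (cmod (z - (of_real a * x + of_real b * y) / of_real (a + b)))\<^sup>2 + a * b / (a + b) * (cmod (x - y))\<^sup>2"
    using complete_square[OF assms, of "Re z" "Re x" "Re y"] complete_square[OF assms, of "Im z" "Im x" "Im y"]
    unfolding cmod_power2 by (simp only: minus_complex.sel Re_divide_of_real Im_divide_of_real plus_complex.sel Re_complex_of_real Im_complex_of_real times_complex.sel) (simp add: algebra_simps)
  then show ?thesis unfolding gs_prod by (simp only:)
qed

text \<open>By completing the square, the product is a Gaussian around a weighted mean of the
  centres, times a Gaussian in their difference.\<close>

lemma
  assumes ab: "a > 0" "b > 0"
  shows integrable_phi_phi: "integrable lborel (\<lambda>z. phi a (z - x) * phi b (z - y))"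
    and integral_phi_phi: "(LINT z|lborel. phi a (z - x) * phi b (z - y)) = phi (a + b) (x - y)"
proof -
  let ?a = "1 / (2 * a)" and ?b = "1 / (2 * b)"
  have pos: "?a > 0" "?b > 0" using ab by auto
  have s: "?a + ?b = (a + b) / (2 * a * b)" using ab by (simp add: field_simps)
  have h: "?a * ?b / (?a + ?b) = 1 / (2 * (a + b))" unfolding s using ab by (simp add: field_simps)
  define w where "w = (of_real ?a * x + of_real ?b * y) / of_real (?a + ?b)"
  have eq: "phi a (z - x) * phi b (z - y) = gs (?a + ?b) (z - w) * (gs (1 / (2 * (a + b))) (x - y) / (4 * pi\<^sup>2 * a * b))" for z
  proof -
    have "phi a (z - x) * phi b (z - y) = (gs ?a (z - x) * gs ?b (z - y)) / (4 * pi\<^sup>2 * a * b)"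
      by (simp add: phi_def power2_eq_square)
    then show ?thesis unfolding gs_gs[OF pos] w_def[symmetric] h by simp
  qed
  have c: "?a + ?b > 0" by (rule add_pos_pos[OF pos])
  show "integrable lborel (\<lambda>z. phi a (z - x) * phi b (z - y))"
    unfolding eq using integrable_shift[OF integrable_gs[OF c]] by simp
  have "(LINT z|lborel. phi a (z - x) * phi b (z - y)) = pi / (?a + ?b) * (gs (1 / (2 * (a + b))) (x - y) / (4 * pi\<^sup>2 * a * b))"
    unfolding eq using integral_shift[OF integrable_gs[OF c], of w] integral_gs[OF c] by simp
  also have "\<dots> = phi (a + b) (x - y)"
  proof -
    have "pi / (t / (2 * a * b)) * (G / (4 * pi\<^sup>2 * a * b)) = G / (2 * pi * t)" if "t > 0" for t G :: real
      using that ab by (simp add: field_simps power2_eq_square)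
    then show ?thesis unfolding s phi_def by this (use ab in simp)
  qed
  finally show "(LINT z|lborel. phi a (z - x) * phi b (z - y)) = phi (a + b) (x - y)" .
qed

text \<open>The Fourier transform of the image under \<open>X\<close> of \<open>P\<close> weighted
  by \<open>g\<close>. The weight will cut off the atypical part, and what is left need not be a
  probability distribution.\<close>

definition wft :: "'a pmf \<Rightarrow> ('a \<Rightarrow> real) \<Rightarrow> ('a \<Rightarrow> complex) \<Rightarrow> complex \<Rightarrow> complex" where
  "wft P g X \<xi> = pE P (\<lambda>w. g w *\<^sub>R cis (Re (cnj \<xi> * X w)))"

lemma norm_wft_le_1:
  assumes fin: "fin_pmf P" and g: "\<And>w. 0 \<le> g w \<and> g w \<le> 1"
  shows "cmod (wft P g X \<xi>) \<le> 1"
proof -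
  have "cmod (wft P g X \<xi>) \<le> pE P (\<lambda>w. cmod (g w *\<^sub>R cis (Re (cnj \<xi> * X w))))"
    unfolding wft_def by (rule integral_norm_bound)
  also have "\<dots> \<le> pE P (\<lambda>w. 1)" using g by (intro pE_mono fin) auto
  finally show ?thesis by simp
qed

lemma wft_sq:
  assumes fin: "fin_pmf P"
  shows "of_real ((cmod (wft P g X \<xi>))\<^sup>2) = pE P (\<lambda>w. pE P (\<lambda>v. (g w * g v) *\<^sub>R cis (Re (cnj \<xi> * (X w - X v)))))"
proof -
  have cn: "cnj (wft P g X \<xi>) = pE P (\<lambda>v. g v *\<^sub>R cis (- Re (cnj \<xi> * X v)))"
    unfolding wft_def pE_sum[OF fin] by (simp add: cis_cnj)
  have "of_real ((cmod (wft P g X \<xi>))\<^sup>2) = wft P g X \<xi> * cnj (wft P g X \<xi>)"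
    by (rule complex_norm_square)
  also have "\<dots> = pE P (\<lambda>w. g w *\<^sub>R cis (Re (cnj \<xi> * X w)) * cnj (wft P g X \<xi>))"
    unfolding wft_def by (rule integral_mult_left_zero[symmetric])
  also have "\<dots> = pE P (\<lambda>w. pE P (\<lambda>v. (g w *\<^sub>R cis (Re (cnj \<xi> * X w))) * (g v *\<^sub>R cis (- Re (cnj \<xi> * X v)))))"
    unfolding cn by (intro pE_cong integral_mult_right_zero[symmetric])
  also have "(\<lambda>w v. (g w *\<^sub>R cis (Re (cnj \<xi> * X w))) * (g v *\<^sub>R cis (- Re (cnj \<xi> * X v)))) =
      (\<lambda>w v. (g w * g v) *\<^sub>R cis (Re (cnj \<xi> * (X w - X v))))"
    by (intro ext) (simp only: mult_scaleR_left mult_scaleR_right scaleR_scaleR cis_mult right_diff_distrib minus_complex.sel add_uminus_conv_diff, simp only: mult.commute)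
  finally show ?thesis .
qed

lemma
  assumes fin: "fin_pmf P" and c: "c > 0"
  shows integrable_wft: "integrable lborel (\<lambda>\<xi>. gs c \<xi> * (cmod (wft P g X \<xi>))\<^sup>2)"
    and integral_wft: "(LINT \<xi>|lborel. gs c \<xi> * (cmod (wft P g X \<xi>))\<^sup>2) =
      pi / c * pE P (\<lambda>w. g w * pE P (\<lambda>v. g v * gs (1 / (4 * c)) (X w - X v)))"
proof -
  let ?h = "\<lambda>w v \<xi>. (g w * g v) *\<^sub>R (gs c \<xi> *\<^sub>R cis (Re (cnj \<xi> * (X w - X v))))"
  have eq: "of_real (gs c \<xi> * (cmod (wft P g X \<xi>))\<^sup>2) = pE P (\<lambda>w. pE P (\<lambda>v. ?h w v \<xi>))" for \<xi>
  proof -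
    have "of_real (gs c \<xi> * (cmod (wft P g X \<xi>))\<^sup>2) = gs c \<xi> *\<^sub>R of_real ((cmod (wft P g X \<xi>))\<^sup>2)"
      by (simp add: scaleR_conv_of_real)
    also have "\<dots> = pE P (\<lambda>w. pE P (\<lambda>v. ?h w v \<xi>))"
    proof -
      have "c *\<^sub>R pE P (\<lambda>w. pE P (\<lambda>v. a w v *\<^sub>R f w v)) = pE P (\<lambda>w. pE P (\<lambda>v. a w v *\<^sub>R (c *\<^sub>R f w v)))"
        for c :: real and a :: "'a \<Rightarrow> 'a \<Rightarrow> real" and f :: "'a \<Rightarrow> 'a \<Rightarrow> complex"
        by (simp add: pE_sum[OF fin] scaleR_sum_right mult_ac)
      then show ?thesis unfolding wft_sq[OF fin] .
    qed
    finally show ?thesis .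
  qed
  have i1: "integrable lborel (?h w v)" for w v
    using gs_ft(1)[OF c, of "X w - X v"] by (intro integrable_scaleR_right)
  have i2: "(LINT \<xi>|lborel. ?h w v \<xi>) = of_real (g w * (g v * (pi / c * gs (1 / (4 * c)) (X w - X v))))" for w v
    using gs_ft(2)[OF c, of "X w - X v"] by (simp add: scaleR_conv_of_real)
  have i3: "integrable lborel (\<lambda>\<xi>. pE P (\<lambda>v. ?h w v \<xi>))" for w
    by (intro integrable_pE fin i1)
  have i4: "integrable lborel (\<lambda>\<xi>. pE P (\<lambda>w. pE P (\<lambda>v. ?h w v \<xi>)))"
    by (intro integrable_pE fin i3)
  then have "integrable lborel (\<lambda>\<xi>. complex_of_real (gs c \<xi> * (cmod (wft P g X \<xi>))\<^sup>2))"
    unfolding eq .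
  then show "integrable lborel (\<lambda>\<xi>. gs c \<xi> * (cmod (wft P g X \<xi>))\<^sup>2)"
    by (rule iffD1[OF complex_of_real_integrable_eq])
  have "complex_of_real (LINT \<xi>|lborel. gs c \<xi> * (cmod (wft P g X \<xi>))\<^sup>2) = (LINT \<xi>|lborel. complex_of_real (gs c \<xi> * (cmod (wft P g X \<xi>))\<^sup>2))"
    by (rule integral_complex_of_real[symmetric])
  also have "\<dots> = pE P (\<lambda>w. pE P (\<lambda>v. of_real (g w * (g v * (pi / c * gs (1 / (4 * c)) (X w - X v))))))"
    unfolding eq by (simp only: integral_pE[OF fin i3] integral_pE[OF fin i1] i2)
  also have "\<dots> = of_real (pE P (\<lambda>w. pE P (\<lambda>v. g w * (g v * (pi / c * gs (1 / (4 * c)) (X w - X v))))))"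
    by (simp only: integral_complex_of_real)
  also have "pE P (\<lambda>w. pE P (\<lambda>v. g w * (g v * (pi / c * gs (1 / (4 * c)) (X w - X v))))) =
     pi / c * pE P (\<lambda>w. g w * pE P (\<lambda>v. g v * gs (1 / (4 * c)) (X w - X v)))"
    unfolding pE_sum_real[OF fin] by (simp add: sum_distrib_left mult_ac)
  finally show "(LINT \<xi>|lborel. gs c \<xi> * (cmod (wft P g X \<xi>))\<^sup>2) =
      pi / c * pE P (\<lambda>w. g w * pE P (\<lambda>v. g v * gs (1 / (4 * c)) (X w - X v)))"
    by (simp only: of_real_eq_iff)
qed


text \<open>Plancherel without inversion theory: with finitely many atoms both sides are the same
  combination of the Gaussian double sums \<open>PP\<close>, obtained from
  \<open>integral_phi_phi\<close> on one side and from \<open>integral_wft\<close> on the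
  other.\<close>

lemma
  fixes P :: "'a pmf" and g :: "'a \<Rightarrow> real" and X :: "'a \<Rightarrow> complex"
  assumes fin: "fin_pmf P" and ab: "a > 0" "b > 0"
  defines "H \<equiv> \<lambda>z. pE P (\<lambda>w. g w * (phi a (z - X w) - phi b (z - X w)))"
  shows integrable_smooth_sq: "integrable lborel (\<lambda>z. (H z)\<^sup>2)"
    and integral_smooth_sq: "(LINT z|lborel. (H z)\<^sup>2) =
      1 / (4 * pi\<^sup>2) * (LINT \<xi>|lborel. (gs (a / 2) \<xi> - gs (b / 2) \<xi>)\<^sup>2 * (cmod (wft P g X \<xi>))\<^sup>2)"
proof -
  define PP where "PP = (\<lambda>v. pE P (\<lambda>w. g w * pE P (\<lambda>w'. g w' * phi v (X w - X w'))))"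
  define Kf where "Kf = (\<lambda>w w' z. (phi a (z - X w) - phi b (z - X w)) * (phi a (z - X w') - phi b (z - X w')))"
  have Kf: "Kf w w' = (\<lambda>z. phi a (z - X w) * phi a (z - X w') - phi a (z - X w) * phi b (z - X w') - phi b (z - X w) * phi a (z - X w') + phi b (z - X w) * phi b (z - X w'))" for w w'
    by (rule ext) (simp add: Kf_def algebra_simps)
  have iK: "integrable lborel (Kf w w')" for w w'
    unfolding Kf using ab by (intro Bochner_Integration.integrable_add Bochner_Integration.integrable_diff integrable_phi_phi)
  have IK: "(LINT z|lborel. Kf w w' z) = phi (2 * a) (X w - X w') - 2 * phi (a + b) (X w - X w') + phi (2 * b) (X w - X w')" for w w'
    unfolding Kf using ab by (simp add: integrable_phi_phi integral_phi_phi add.commute)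
  have sq: "(H z)\<^sup>2 = pE P (\<lambda>w. pE P (\<lambda>w'. g w * (g w' * Kf w w' z)))" for z
    unfolding H_def power2_eq_square pE_sum_real[OF fin] sum_product Kf_def by (simp add: sum_distrib_left mult_ac)
  have iK1: "integrable lborel (\<lambda>z. g w * (g w' * Kf w w' z))" for w w'
    by (intro integrable_mult_right iK)
  have iK2: "integrable lborel (\<lambda>z. pE P (\<lambda>w'. g w * (g w' * Kf w w' z)))" for w
    by (intro integrable_pE fin iK1)
  show "integrable lborel (\<lambda>z. (H z)\<^sup>2)" unfolding sq by (intro integrable_pE fin iK2)
  have "(LINT z|lborel. (H z)\<^sup>2) = pE P (\<lambda>w. pE P (\<lambda>w'. LINT z|lborel. g w * (g w' * Kf w w' z)))"
    unfolding sq by (simp only: integral_pE[OF fin iK2] integral_pE[OF fin iK1])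
  also have "\<dots> = pE P (\<lambda>w. pE P (\<lambda>w'. g w * (g w' * (LINT z|lborel. Kf w w' z))))"
    by simp
  also have "\<dots> = PP (2 * a) - 2 * PP (a + b) + PP (2 * b)"
    unfolding IK PP_def pE_sum_real[OF fin]
    by (simp add: sum_distrib_left algebra_simps sum.distrib sum_subtractf)
  finally have L: "(LINT z|lborel. (H z)\<^sup>2) = PP (2 * a) - 2 * PP (a + b) + PP (2 * b)" .
  have W: "(LINT \<xi>|lborel. gs c \<xi> * (cmod (wft P g X \<xi>))\<^sup>2) = 4 * pi\<^sup>2 * PP (2 * c)" if c: "c > 0" for c
  proof -
    have e: "gs (1 / (4 * c)) x = 4 * pi * c * phi (2 * c) x" for x
      using c by (simp add: phi_def)
    have "pE P (\<lambda>w. g w * pE P (\<lambda>v. g v * gs (1 / (4 * c)) (X w - X v))) = 4 * pi * c * PP (2 * c)"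
      unfolding PP_def pE_sum_real[OF fin] e sum_distrib_left by (simp only: mult_ac)
    then show ?thesis unfolding integral_wft[OF fin c] using c by (simp add: power2_eq_square)
  qed
  have "(gs (a / 2) \<xi> - gs (b / 2) \<xi>)\<^sup>2 * Q = gs a \<xi> * Q - 2 * (gs ((a + b) / 2) \<xi> * Q) + gs b \<xi> * Q" for \<xi> Q
    using gs_mult[of "a / 2" \<xi> "b / 2"] by (simp add: power2_diff gs_power2 algebra_simps add_divide_distrib)
  note sqd = this
  have c: "(a + b) / 2 > 0" using ab by simp
  have "(LINT \<xi>|lborel. (gs (a / 2) \<xi> - gs (b / 2) \<xi>)\<^sup>2 * (cmod (wft P g X \<xi>))\<^sup>2) =
    4 * pi\<^sup>2 * PP (2 * a) - 2 * (4 * pi\<^sup>2 * PP (2 * ((a + b) / 2))) + 4 * pi\<^sup>2 * PP (2 * b)"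
    unfolding sqd W[OF ab(1), symmetric] W[OF ab(2), symmetric] W[OF c, symmetric]
    using integrable_wft[OF fin ab(1), of g X] integrable_wft[OF fin ab(2), of g X] integrable_wft[OF fin c, of g X]
    by simp
  moreover have "2 * ((a + b) / 2) = a + b" by simp
  ultimately show "(LINT z|lborel. (H z)\<^sup>2) =
      1 / (4 * pi\<^sup>2) * (LINT \<xi>|lborel. (gs (a / 2) \<xi> - gs (b / 2) \<xi>)\<^sup>2 * (cmod (wft P g X \<xi>))\<^sup>2)"
    unfolding L by (simp only:) (simp add: field_simps)
qed

text \<open>Averaging over small balls turns a bound on the mass of balls into a bound on Gaussian averages.\<close>

lemma gauss_average_le:
  assumes fin: "fin_pmf P" and g: "\<And>w. 0 \<le> g w" and r: "r > 0"
    and ball: "\<And>z. pE P (\<lambda>w. g w * indicator (cball z r) (X w)) \<le> M"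
  shows "pE P (\<lambda>w. g w * gs (1 / (4 * r\<^sup>2)) (X w - x)) \<le> 8 * exp (1 / 4) * M"
proof -
  let ?G = "\<lambda>z. gs (1 / (8 * r\<^sup>2)) (z - x)"
  have c: "1 / (8 * r\<^sup>2) > 0" using r by simp
  have iG: "integrable lborel ?G" "(LINT z|lborel. ?G z) = 8 * pi * r\<^sup>2"
    using integrable_shift[OF integrable_gs[OF c]] integral_shift[OF integrable_gs[OF c], of x] integral_gs[OF c] by simp_all
  have iB: "integrable lborel (\<lambda>z. indicator (cball z r) y * ?G z)" for y
  proof (rule Bochner_Integration.integrable_bound[OF iG(1)])
    have eq: "(\<lambda>z. indicator (cball z r) y * ?G z) = (\<lambda>z. indicator (cball y r) z * ?G z)"
      by (auto simp: indicator_def dist_commute)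
    show "(\<lambda>z. indicator (cball z r) y * ?G z) \<in> borel_measurable lborel" unfolding eq
      by (intro borel_measurable_times borel_measurable_indicator measurable_compose[OF _ gs_measurable]) simp_all
  qed (auto simp: indicator_def)
  have low: "pi * r\<^sup>2 * exp (- 1 / 4) * gs (1 / (4 * r\<^sup>2)) (y - x) \<le> (LINT z|lborel. indicator (cball z r) y * ?G z)" for y
  proof -
    have m: "measure lborel (cball y r) = pi * r\<^sup>2"
      using r by (simp add: measure_def emeasure_cball unit_ball_vol_2)
    have "pi * r\<^sup>2 * exp (- 1 / 4) * gs (1 / (4 * r\<^sup>2)) (y - x) = (LINT z|lborel. indicator (cball y r) z *\<^sub>R (exp (- 1 / 4) * gs (1 / (4 * r\<^sup>2)) (y - x)))"
      using m by (simp add: mult_ac)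
    also have "\<dots> \<le> (LINT z|lborel. indicator (cball z r) y * ?G z)"
    proof (rule integral_mono[OF _ iB])
      show "integrable lborel (\<lambda>z. indicator (cball y r) z *\<^sub>R (exp (- 1 / 4) * gs (1 / (4 * r\<^sup>2)) (y - x)))"
        by (intro integrable_scaleR_left integrable_real_indicator) (use emeasure_lborel_cball_finite[of y r] in simp_all)
      fix z
      have "exp (- 1 / 4) * gs (1 / (4 * r\<^sup>2)) (y - x) \<le> ?G z" if "cmod (y - z) \<le> r"
      proof -
        have "cmod (z - x) \<le> cmod (y - x) + r"
          using norm_triangle_ineq4[of "y - x" "y - z"] that by simp
        then have "(cmod (z - x))\<^sup>2 \<le> (cmod (y - x) + r)\<^sup>2" by (intro power_mono) auto
        also have "\<dots> \<le> 2 * (cmod (y - x))\<^sup>2 + 2 * r\<^sup>2"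
          using sum_squares_bound[of "cmod (y - x)" r] by (simp add: power2_sum)
        finally have "(cmod (z - x))\<^sup>2 / (8 * r\<^sup>2) \<le> (2 * (cmod (y - x))\<^sup>2 + 2 * r\<^sup>2) / (8 * r\<^sup>2)"
          by (intro divide_right_mono) auto
        also have "\<dots> = 1 / 4 + (cmod (y - x))\<^sup>2 / (4 * r\<^sup>2)" using r by (simp add: field_simps)
        finally show ?thesis by (simp add: gs_def flip: exp_add)
      qed
      then show "indicator (cball y r) z *\<^sub>R (exp (- 1 / 4) * gs (1 / (4 * r\<^sup>2)) (y - x)) \<le> indicator (cball z r) y * ?G z"
        by (auto simp: indicator_def dist_norm norm_minus_commute)
    qed
    finally show ?thesis .
  qed
  have "pi * r\<^sup>2 * exp (- 1 / 4) * pE P (\<lambda>w. g w * gs (1 / (4 * r\<^sup>2)) (X w - x)) =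
      pE P (\<lambda>w. g w * (pi * r\<^sup>2 * exp (- 1 / 4) * gs (1 / (4 * r\<^sup>2)) (X w - x)))"
    unfolding pE_sum_real[OF fin] by (simp add: sum_distrib_left mult_ac)
  also have "\<dots> \<le> pE P (\<lambda>w. g w * (LINT z|lborel. indicator (cball z r) (X w) * ?G z))"
    using g low by (intro pE_mono fin mult_left_mono) auto
  also have "\<dots> = (LINT z|lborel. pE P (\<lambda>w. g w * (indicator (cball z r) (X w) * ?G z)))"
    using iB by (subst integral_pE[OF fin]) auto
  also have "\<dots> = (LINT z|lborel. pE P (\<lambda>w. g w * indicator (cball z r) (X w)) * ?G z)"
    unfolding pE_sum_real[OF fin] by (simp add: sum_distrib_right mult_ac)
  also have "\<dots> \<le> (LINT z|lborel. M * ?G z)"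
  proof (rule integral_mono)
    have "integrable lborel (\<lambda>z. pE P (\<lambda>w. g w * (indicator (cball z r) (X w) * ?G z)))"
      using iB by (intro integrable_pE fin) auto
    then show "integrable lborel (\<lambda>z. pE P (\<lambda>w. g w * indicator (cball z r) (X w)) * ?G z)"
      unfolding pE_sum_real[OF fin] by (simp add: sum_distrib_right mult_ac)
    show "pE P (\<lambda>w. g w * indicator (cball z r) (X w)) * ?G z \<le> M * ?G z" for z
      by (intro mult_right_mono ball) simp
  qed (use iG in simp)
  also have "\<dots> = M * (8 * pi * r\<^sup>2)" using iG by simp
  finally have "pi * r\<^sup>2 * (exp (- 1 / 4) * pE P (\<lambda>w. g w * gs (1 / (4 * r\<^sup>2)) (X w - x))) \<le> pi * r\<^sup>2 * (8 * M)"
    by (simp add: mult_ac)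
  then have "exp (- 1 / 4) * pE P (\<lambda>w. g w * gs (1 / (4 * r\<^sup>2)) (X w - x)) \<le> 8 * M"
    by (rule mult_left_le_imp_le) (use r in simp)
  then have "exp (1 / 4) * (exp (- 1 / 4) * pE P (\<lambda>w. g w * gs (1 / (4 * r\<^sup>2)) (X w - x))) \<le> exp (1 / 4) * (8 * M)"
    by (intro mult_left_mono) auto
  then show ?thesis by (simp add: mult.assoc[symmetric] flip: exp_add)
qed

section \<open>Large deviations for the cell masses\<close>

lemma exp_neg_le_quadratic:
  fixes y :: real
  assumes "y \<ge> 0"
  shows "exp (- y) \<le> 1 - y + y\<^sup>2 / 2"
proof -
  define f where "f = (\<lambda>y::real. 1 - y + y\<^sup>2 / 2 - exp (- y))"
  have "f 0 \<le> f y"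
  proof (rule DERIV_nonneg_imp_nondecreasing[OF assms])
    fix x :: real
    have "(f has_real_derivative (- 1 + x + exp (- x))) (at x)"
      unfolding f_def by (auto intro!: derivative_eq_intros)
    moreover have "0 \<le> - 1 + x + exp (- x)" using exp_ge_add_one_self[of "- x"] by linarith
    ultimately show "\<exists>y. (f has_real_derivative y) (at x) \<and> 0 \<le> y" by blast
  qed
  then show ?thesis by (simp add: f_def)
qed

context selfsim_setup
begin

definition pm :: "nat \<Rightarrow> complex \<Rightarrow> real" where
  "pm m a = pmf (map_pmf (Dn m) (A m)) (Dn m a)"

lemma pm_pos: "a \<in> set_pmf (A m) \<Longrightarrow> pm m a > 0"
  by (simp add: pm_def pmf_positive_iff)

lemma pm_le_1: "pm m a \<le> 1"
  by (simp add: pm_def pmf_le_1)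

text \<open>The second component records the product of the masses of the level-\<open>m\<close> cells of the blocks
  that make up the first component.\<close>

primrec G :: "nat \<Rightarrow> nat \<Rightarrow> (complex \<times> real) pmf" where
  "G m 0 = return_pmf (0, 1)"
| "G m (Suc J) = bind_pmf (A m) (\<lambda>a. map_pmf (\<lambda>(s, w). (a + \<rho> ^ m * s, pm m a * w)) (G m J))"

lemma fin_G [simp, intro]: "fin_pmf (G m J)"
  by (induction J) auto

lemma pE_G_Suc:
  "pE (G m (Suc J)) f = pE (A m) (\<lambda>a. pE (G m J) (\<lambda>v. f (a + \<rho> ^ m * fst v, pm m a * snd v)))"
  by (simp add: pE_bind pE_map case_prod_unfold)

lemma map_fst_G: "map_pmf fst (G m J) = A (m * J)"
proof (induction J)
  case (Suc J)
  have "map_pmf fst (G m (Suc J)) = bind_pmf (A m) (\<lambda>a. map_pmf (\<lambda>x. a + \<rho> ^ m * x) (map_pmf fst (G m J)))"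
    by (simp add: map_bind_pmf pmf.map_comp o_def case_prod_unfold)
  also have "\<dots> = conv (A m) (map_pmf ((*) (\<rho> ^ m)) (A (m * J)))"
    unfolding Suc conv_bind by (simp add: map_pmf_def bind_assoc_pmf bind_return_pmf)
  finally show ?case by (simp add: selfsim_add[symmetric])
qed simp

lemma snd_G_pos: "v \<in> set_pmf (G m J) \<Longrightarrow> snd v > 0"
  by (induction J arbitrary: v) (auto simp: pm_pos)

lemma fst_G_bound: "v \<in> set_pmf (G m J) \<Longrightarrow> cmod (fst v) \<le> B"
  using bound[of "fst v" "m * J"] by (simp add: map_fst_G[symmetric])

text \<open>Mass times inverse mass is 1 for every cell, so the expectation amounts to counting
  cells.\<close>

lemma pE_inverse_pm:
  assumes S: "\<And>a. a \<in> S \<Longrightarrow> cmod (a - x) \<le> (4 * B + 8) * rad m"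
  shows "pE (A m) (\<lambda>a. indicator S a / pm m a) \<le> grid_const (4 * B + 8)"
proof -
  let ?C = "Dn m ` (S \<inter> set_pmf (A m))" and ?q = "map_pmf (Dn m) (A m)"
  have "pE (A m) (\<lambda>a. indicator S a / pm m a) \<le> pE (A m) (\<lambda>a. indicator ?C (Dn m a) / pm m a)"
    by (intro pE_mono) (auto simp: indicator_def pm_def)
  also have "\<dots> = pE ?q (\<lambda>c. indicator ?C c / pmf ?q c)"
    by (simp only: pE_map pm_def)
  also have "\<dots> = (\<Sum>c\<in>set_pmf ?q. pmf ?q c * (indicator ?C c / pmf ?q c))"
    by (rule pE_sum_real) simp
  also have "\<dots> = (\<Sum>c\<in>set_pmf ?q. indicator ?C c)"
    by (intro sum.cong refl) (simp add: set_pmf_eq)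
  also have "\<dots> = real (card (set_pmf ?q \<inter> ?C))"
    by (simp add: indicator_def flip: sum.inter_restrict)
  also have "set_pmf ?q \<inter> ?C = ?C" by auto
  also have "real (card ?C) \<le> grid_const (4 * B + 8)"
    using card_Dn[of "S \<inter> set_pmf (A m)" "\<lambda>x. x" x m] S by simp
  finally show ?thesis .
qed

text \<open>Block by block: only boundedly many cells of a block can lead into the ball, and
  division by their masses turns the expectation into their number. It follows that on the part
  where the recorded product is at most \<tau>, a ball has mass at most \<tau> times this
  bound.\<close>

lemma G_ball:
  "pE (G m J) (\<lambda>v. indicator (cball x ((1 + B) * rad (m * J))) (fst v) / snd v) \<le> grid_const (4 * B + 8) ^ J"
proof (induction J arbitrary: x)
  case 0
  then show ?case by (simp add: indicator_def)
next
  case (Suc J)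
  let ?K = "grid_const (4 * B + 8)"
  let ?S = "cball x ((4 * B + 8) * rad m)"
  have "pE (G m (Suc J)) (\<lambda>v. indicator (cball x ((1 + B) * rad (m * Suc J))) (fst v) / snd v) =
      pE (A m) (\<lambda>a. pE (G m J) (\<lambda>v. indicator (cball x ((1 + B) * rad (m * Suc J))) (a + \<rho> ^ m * fst v) / (pm m a * snd v)))"
    unfolding pE_G_Suc by simp
  also have "\<dots> \<le> pE (A m) (\<lambda>a. indicator ?S a / pm m a * real ?K ^ J)"
  proof (rule pE_mono)
    fix a assume a: "a \<in> set_pmf (A m)"
    define y where "y = (x - a) / \<rho> ^ m"
    have \<rho>0: "\<rho> ^ m \<noteq> 0" using rho by auto
    have dist: "cmod (x - (a + \<rho> ^ m * s)) = rad m * cmod (y - s)" for s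
    proof -
      have "\<rho> ^ m * y = x - a" unfolding y_def by (simp only: times_divide_eq_right nonzero_mult_div_cancel_left[OF \<rho>0])
      then have "x - (a + \<rho> ^ m * s) = \<rho> ^ m * (y - s)" by (simp only: right_diff_distrib) simp
      then show ?thesis by (simp add: norm_mult norm_power)
    qed
    have iff: "a + \<rho> ^ m * s \<in> cball x ((1 + B) * rad (m * Suc J)) \<longleftrightarrow> s \<in> cball y ((1 + B) * rad (m * J))" for s
    proof -
      have "(1 + B) * rad (m * Suc J) = rad m * ((1 + B) * rad (m * J))" by (simp add: power_add)
      then show ?thesis unfolding mem_cball dist_norm dist by (simp only: mult_le_cancel_left_pos[OF rad_pos])
    qed
    have ind: "indicat_real (cball x ((1 + B) * rad (m * Suc J))) (a + \<rho> ^ m * s) = indicator (cball y ((1 + B) * rad (m * J))) s" for s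
      by (simp only: indicator_def iff)
    have inS: "a \<in> ?S" if "s \<in> cball y ((1 + B) * rad (m * J))" "cmod s \<le> B" for s
    proof -
      have "rad (m * J) \<le> 1" using rad_mono[of 0 "m * J"] by simp
      then have "(1 + B) * rad (m * J) \<le> 1 + B" using B_nonneg by (intro mult_left_le) auto
      then have "cmod (y - s) \<le> 1 + B" using that(1) by (simp add: dist_norm)
      then have "cmod y \<le> 1 + B + B" using that(2) norm_triangle_sub[of y s] by linarith
      then have "rad m * cmod y \<le> rad m * (4 * B + 8)" using B_nonneg by (intro mult_left_mono) auto
      then show ?thesis using dist[of 0] by (simp add: dist_norm mult.commute)
    qed
    have "pE (G m J) (\<lambda>v. indicator (cball x ((1 + B) * rad (m * Suc J))) (a + \<rho> ^ m * fst v) / (pm m a * snd v)) =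
       pE (G m J) (\<lambda>v. indicator ?S a / pm m a * (indicator (cball y ((1 + B) * rad (m * J))) (fst v) / snd v))"
      unfolding ind using inS fst_G_bound by (intro pE_cong) (auto simp: indicator_def)
    also have "\<dots> = indicator ?S a / pm m a * pE (G m J) (\<lambda>v. indicator (cball y ((1 + B) * rad (m * J))) (fst v) / snd v)"
      by (rule integral_mult_right_zero)
    also have "\<dots> \<le> indicator ?S a / pm m a * real ?K ^ J"
      using Suc[of y] pm_pos[OF a] by (intro mult_left_mono) (auto simp: indicator_def)
    finally show "pE (G m J) (\<lambda>v. indicator (cball x ((1 + B) * rad (m * Suc J))) (a + \<rho> ^ m * fst v) / (pm m a * snd v)) \<le> indicator ?S a / pm m a * real ?K ^ J" .
  qed simp
  also have "\<dots> = pE (A m) (\<lambda>a. indicator ?S a / pm m a) * real ?K ^ J" by (rule integral_mult_left_zero)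
  also have "\<dots> \<le> real ?K * real ?K ^ J"
    using pE_inverse_pm[of ?S x m] by (intro mult_right_mono) (auto simp: dist_norm norm_minus_commute)
  finally show ?case by simp
qed

lemma G_moment:
  "pE (G m J) (\<lambda>v. snd v powr u) = pE (A m) (\<lambda>a. pm m a powr u) ^ J"
proof (induction J)
  case (Suc J)
  have "pE (G m (Suc J)) (\<lambda>v. snd v powr u) = pE (A m) (\<lambda>a. pE (G m J) (\<lambda>v. pm m a powr u * snd v powr u))"
    unfolding pE_G_Suc
  proof (intro pE_cong)
    fix a v assume "a \<in> set_pmf (A m)" "v \<in> set_pmf (G m J)"
    then show "snd (a + \<rho> ^ m * fst v, pm m a * snd v) powr u = pm m a powr u * snd v powr u"
      using pm_pos[of a m] snd_G_pos[of v m J] by (simp add: powr_mult)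
  qed
  also have "\<dots> = pE (A m) (\<lambda>a. pm m a powr u * pE (G m J) (\<lambda>v. snd v powr u))" by simp
  also have "\<dots> = pE (A m) (\<lambda>a. pm m a powr u) * pE (G m J) (\<lambda>v. snd v powr u)" by (rule integral_mult_left_zero)
  finally show ?case using Suc by simp
qed simp

text \<open>Chernoff's method: the recorded product has independent factors whose logarithms have
  mean \<open>- aent m\<close>, so a small positive moment is controlled by the entropy.\<close>

lemma large_deviation:
  fixes \<epsilon> :: real
  assumes h: "aent m \<ge> (\<beta> - \<epsilon>) * m" and \<epsilon>: "\<epsilon> > 0" and m: "m \<ge> 1"
  shows "\<exists>c>0::real. \<forall>J. pE (G m J) (\<lambda>v. of_bool (exp (- (\<beta> - 2 * \<epsilon>) * m) ^ J < snd v)) \<le> exp (- c) ^ J"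
proof -
  define M where "M = pE (A m) (\<lambda>a. (ln (pm m a))\<^sup>2)"
  \<comment> \<open>The second-order term is then at most half of the gain
    \<open>u * \<epsilon> * m\<close>, which is the distance from the entropy bound to the threshold
    \<open>\<beta> - 2 * \<epsilon>\<close>; \<open>M + 1\<close> avoids division by 0.\<close>
  define u where "u = \<epsilon> * m / (M + 1)"
  define c where "c = u * \<epsilon> * m / 2"
  have M0: "M \<ge> 0" unfolding M_def by (intro pE_nonneg) simp
  have u: "u > 0" using M0 \<epsilon> m by (simp add: u_def)
  have uM: "u * M \<le> \<epsilon> * m"
  proof -
    have "u * M \<le> u * (M + 1)" using u by simp
    also have "\<dots> = \<epsilon> * m" using M0 by (simp add: u_def)
    finally show ?thesis .
  qed
  have c: "c > 0" using u \<epsilon> m by (simp add: c_def)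
  have ae: "pE (A m) (\<lambda>a. ln (pm m a)) = - aent m"
    unfolding aent_def ent_map pm_def by simp
  have "pE (A m) (\<lambda>a. pm m a powr u) \<le> pE (A m) (\<lambda>a. 1 + u * ln (pm m a) + u\<^sup>2 / 2 * (ln (pm m a))\<^sup>2)"
  proof (rule pE_mono)
    fix a assume a: "a \<in> set_pmf (A m)"
    have "ln (pm m a) \<le> 0" using pm_pos[OF a] pm_le_1[of m a] by simp
    then have "0 \<le> - (u * ln (pm m a))" using u by (simp add: mult_le_0_iff)
    from exp_neg_le_quadratic[OF this] show "pm m a powr u \<le> 1 + u * ln (pm m a) + u\<^sup>2 / 2 * (ln (pm m a))\<^sup>2"
      using pm_pos[OF a] by (simp add: powr_def power_mult_distrib)
  qed simp
  also have "\<dots> = 1 - u * aent m + u\<^sup>2 / 2 * M"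
    by (simp add: pE_add ae M_def)
  also have "\<dots> \<le> exp (- u * aent m + u\<^sup>2 / 2 * M)"
    using exp_ge_add_one_self[of "- u * aent m + u\<^sup>2 / 2 * M"] by (simp only: mult_minus_left)
  also have "\<dots> \<le> exp (- u * ((\<beta> - \<epsilon>) * m) + c)"
  proof -
    have "u * ((\<beta> - \<epsilon>) * m) \<le> u * aent m" using h u by (intro mult_left_mono) auto
    moreover have "u * (u * M) \<le> u * (\<epsilon> * m)" using uM u by (intro mult_left_mono) auto
    ultimately show ?thesis by (simp add: c_def power2_eq_square mult_ac)
  qed
  finally have mom: "pE (A m) (\<lambda>a. pm m a powr u) \<le> exp (- u * ((\<beta> - \<epsilon>) * m) + c)" .
  have mom0: "0 \<le> pE (A m) (\<lambda>a. pm m a powr u)" by (intro pE_nonneg) simp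
  define \<tau> where "\<tau> = exp (- (\<beta> - 2 * \<epsilon>) * m)"
  have "pE (G m J) (\<lambda>v. of_bool (\<tau> ^ J < snd v)) \<le> exp (- c) ^ J" for J
  proof -
    have \<tau>J: "\<tau> ^ J > 0" by (simp add: \<tau>_def)
    have "pE (G m J) (\<lambda>v. of_bool (\<tau> ^ J < snd v)) \<le> pE (G m J) (\<lambda>v. snd v powr u * (\<tau> ^ J) powr (- u))"
    proof (rule pE_mono)
      fix v assume "v \<in> set_pmf (G m J)"
      show "of_bool (\<tau> ^ J < snd v) \<le> snd v powr u * (\<tau> ^ J) powr (- u)"
      proof (cases "\<tau> ^ J < snd v")
        case True
        have "1 = (\<tau> ^ J) powr u * (\<tau> ^ J) powr (- u)" by (simp add: \<tau>_def flip: powr_add)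
        also have "\<dots> \<le> snd v powr u * (\<tau> ^ J) powr (- u)"
          using True \<tau>J u by (intro mult_right_mono powr_mono2) auto
        finally show ?thesis using True by simp
      qed simp
    qed simp
    also have "\<dots> = pE (G m J) (\<lambda>v. snd v powr u) * (\<tau> ^ J) powr (- u)" by (rule integral_mult_left_zero)
    also have "\<dots> \<le> exp (- u * ((\<beta> - \<epsilon>) * m) + c) ^ J * (\<tau> ^ J) powr (- u)"
      unfolding G_moment using mom mom0 by (intro mult_right_mono power_mono) auto
    also have "(\<tau> ^ J) powr (- u) = exp (u * ((\<beta> - 2 * \<epsilon>) * m)) ^ J"
      unfolding powr_def using \<tau>J by (simp add: \<tau>_def ln_realpow exp_of_nat_mult[symmetric] algebra_simps)
    also have "exp (- u * ((\<beta> - \<epsilon>) * m) + c) ^ J * exp (u * ((\<beta> - 2 * \<epsilon>) * m)) ^ J = exp (- c) ^ J"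
      unfolding power_mult_distrib[symmetric] exp_add[symmetric] by (simp add: c_def algebra_simps)
    finally show ?thesis .
  qed
  then show ?thesis using c unfolding \<tau>_def by (intro exI[of _ c]) simp
qed

end

section \<open>Frostman-type bound for the smoothed measures\<close>

text \<open>The probability that \<open>x\<close> plus an independent Gaussian of variance
  \<open>v\<close> per coordinate lands in \<open>V\<close>.\<close>

definition smooth :: "real \<Rightarrow> complex set \<Rightarrow> complex \<Rightarrow> real" where
  "smooth v V x = (LINT z|lborel. indicator V z * phi v (z - x))"

lemma
  assumes V: "V \<in> sets borel" and v: "v > 0"
  shows integrable_smooth: "integrable lborel (\<lambda>z. indicator V z * phi v (z - x))"
    and smooth_nonneg: "0 \<le> smooth v V x"
    and smooth_le_1: "smooth v V x \<le> 1"
proof -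
  show i: "integrable lborel (\<lambda>z. indicator V z * phi v (z - x))"
    using integrable_mult_indicator[of V lborel, OF _ integrable_phi[OF v, of x]] V by simp
  show "0 \<le> smooth v V x" unfolding smooth_def
    by (intro Bochner_Integration.integral_nonneg) (use phi_nonneg[OF v] in auto)
  have "smooth v V x \<le> (LINT z|lborel. phi v (z - x))" unfolding smooth_def
    by (intro integral_mono[OF i integrable_phi[OF v]]) (use phi_nonneg[OF v] in \<open>auto simp: indicator_def\<close>)
  then show "smooth v V x \<le> 1" using integral_phi[OF v, of x] by simp
qed

lemma smooth_le_volume:
  assumes V: "V \<in> sets borel" "emeasure lborel V < \<infinity>" and v: "v > 0"
  shows "smooth v V x \<le> measure lborel V / (2 * pi * v)"
proof -
  have iV: "integrable lborel (\<lambda>z. indicator V z * (1 / (2 * pi * v)))"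
    using V by (intro integrable_mult_left integrable_real_indicator) auto
  have "smooth v V x \<le> (LINT z|lborel. indicator V z * (1 / (2 * pi * v)))" unfolding smooth_def
    by (intro integral_mono[OF integrable_smooth[OF V(1) v] iV] mult_left_mono phi_le[OF v]) (auto simp: indicator_def)
  also have "\<dots> = measure lborel V / (2 * pi * v)" using V by simp
  finally show ?thesis .
qed

text \<open>Interpolation between the trivial bound 1 and the volume bound. It keeps a power of the
  volume where only small probability, and no regularity, is known.\<close>

lemma smooth_le_powr:
  assumes V: "V \<in> sets borel" "emeasure lborel V < \<infinity>" and v: "v > 0" and s: "0 < s" "s \<le> 1"
  shows "smooth v V x \<le> (measure lborel V / v) powr s"
proof (cases "1 \<le> measure lborel V / v")
  case True
  then have "1 \<le> (measure lborel V / v) powr s" using s by (simp add: ge_one_powr_ge_zero)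
  then show ?thesis using smooth_le_1[OF V(1) v, of x] by linarith
next
  case False
  have "measure lborel V / (2 * pi * v) = measure lborel V / v * (1 / (2 * pi))" by simp
  also have "\<dots> \<le> measure lborel V / v * 1"
    using v pi_gt3 by (intro mult_left_mono) auto
  also have "\<dots> \<le> (measure lborel V / v) powr s"
  proof (cases "measure lborel V = 0")
    case False
    then have "0 < measure lborel V / v" using v by (simp add: zero_less_measure_iff)
    then have "(measure lborel V / v) powr 1 \<le> (measure lborel V / v) powr s"
      using \<open>\<not> 1 \<le> _\<close> s by (intro powr_mono') auto
    then show ?thesis using \<open>0 < measure lborel V / v\<close> v by simp
  qed simp
  finally show ?thesis using smooth_le_volume[OF V v, of x] by linarith
qed

text \<open>On the part weighted by \<open>g\<close>, the change of smoothing is the integral over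
  \<open>V\<close> of a function of small L2 norm, estimated by an arithmetic--geometric mean
  inequality with free parameter \<open>t\<close>. On the remainder only its mass and
  \<open>smooth_le_powr\<close> are used.\<close>

lemma smooth_increment:
  fixes P :: "'a pmf" and g :: "'a \<Rightarrow> real" and X :: "'a \<Rightarrow> complex"
  assumes fin: "fin_pmf P" and g: "\<And>w. 0 \<le> g w \<and> g w \<le> 1"
    and V: "V \<in> sets borel" "emeasure lborel V < \<infinity>" and v: "a > 0" "b > 0" and s: "0 < s" "s \<le> 1" and t: "t > 0"
    and Q: "1 / (4 * pi\<^sup>2) * (LINT \<xi>|lborel. (gs (a / 2) \<xi> - gs (b / 2) \<xi>)\<^sup>2 * (cmod (wft P g X \<xi>))\<^sup>2) \<le> Q"
  shows "pE P (\<lambda>w. smooth a V (X w)) \<le> pE P (\<lambda>w. smooth b V (X w)) + (t * Q + measure lborel V / t) / 2 +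
    pE P (\<lambda>w. 1 - g w) * (measure lborel V / a) powr s"
proof -
  define H where "H = (\<lambda>z. pE P (\<lambda>w. g w * (phi a (z - X w) - phi b (z - X w))))"
  have iH: "integrable lborel (\<lambda>z. (H z)\<^sup>2)" "(LINT z|lborel. (H z)\<^sup>2) \<le> Q"
    unfolding H_def using integrable_smooth_sq[OF fin v, of g X] integral_smooth_sq[OF fin v, of g X] Q by auto
  have i: "integrable lborel (\<lambda>z. g w * (indicator V z * phi a (z - X w) - indicator V z * phi b (z - X w)))" for w
    using V v by (intro integrable_mult_right Bochner_Integration.integrable_diff integrable_smooth)
  have I: "(LINT z|lborel. g w * (indicator V z * phi a (z - X w) - indicator V z * phi b (z - X w))) =
      g w * (smooth a V (X w) - smooth b V (X w))" for w
    using V v by (simp add: smooth_def integrable_smooth)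
  have VH: "indicator V z * H z = pE P (\<lambda>w. g w * (indicator V z * phi a (z - X w) - indicator V z * phi b (z - X w)))" for z
    unfolding H_def pE_sum_real[OF fin] sum_distrib_left by (simp add: algebra_simps)
  have iV: "integrable lborel (\<lambda>z. indicat_real V z)" using V by auto
  have "pE P (\<lambda>w. g w * (smooth a V (X w) - smooth b V (X w))) = (LINT z|lborel. indicator V z * H z)"
    unfolding VH I[symmetric] by (rule integral_pE[OF fin i, symmetric])
  also have "\<dots> \<le> (LINT z|lborel. (t * (H z)\<^sup>2 + indicator V z / t) / 2)"
  proof (rule integral_mono)
    show "integrable lborel (\<lambda>z. indicator V z * H z)" unfolding VH by (intro integrable_pE fin i)
    show "integrable lborel (\<lambda>z. (t * (H z)\<^sup>2 + indicator V z / t) / 2)" using iH(1) iV by auto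
    fix z
    have "0 \<le> t * (H z - 1 / t)\<^sup>2" using t by simp
    also have "\<dots> = t * (H z)\<^sup>2 - 2 * H z + 1 / t" using t by (simp add: power2_diff field_simps power2_eq_square)
    finally show "indicator V z * H z \<le> (t * (H z)\<^sup>2 + indicator V z / t) / 2"
      using t by (auto simp: indicator_def)
  qed
  also have "\<dots> = (t * (LINT z|lborel. (H z)\<^sup>2) + measure lborel V / t) / 2"
    using iH(1) iV by simp
  also have "\<dots> \<le> (t * Q + measure lborel V / t) / 2"
    using iH(2) t by (intro divide_right_mono add_right_mono mult_left_mono) auto
  finally have good: "pE P (\<lambda>w. g w * (smooth a V (X w) - smooth b V (X w))) \<le> (t * Q + measure lborel V / t) / 2" .
  have "pE P (\<lambda>w. smooth a V (X w)) \<le> pE P (\<lambda>w. smooth b V (X w) + (g w * (smooth a V (X w) - smooth b V (X w)) + (1 - g w) * (measure lborel V / a) powr s))"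
  proof (rule pE_mono[OF fin])
    fix w
    have "(1 - g w) * (smooth a V (X w) - smooth b V (X w)) \<le> (1 - g w) * (measure lborel V / a) powr s"
      using g[of w] smooth_le_powr[OF V v(1) s, of "X w"] smooth_nonneg[OF V(1) v(2), of "X w"] by (intro mult_left_mono) auto
    then show "smooth a V (X w) \<le> smooth b V (X w) + (g w * (smooth a V (X w) - smooth b V (X w)) + (1 - g w) * (measure lborel V / a) powr s)"
      by (simp add: algebra_simps)
  qed
  also have "\<dots> = pE P (\<lambda>w. smooth b V (X w)) + (pE P (\<lambda>w. g w * (smooth a V (X w) - smooth b V (X w))) + pE P (\<lambda>w. (1 - g w) * (measure lborel V / a) powr s))"
    by (simp only: pE_add[OF fin])
  also have "pE P (\<lambda>w. (1 - g w) * (measure lborel V / a) powr s) = pE P (\<lambda>w. 1 - g w) * (measure lborel V / a) powr s"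
    by (rule integral_mult_left_zero)
  finally show ?thesis using good by linarith
qed

text \<open>Low frequencies are damped by the difference of the two Gaussians, intermediate ones by the
  decay of the first factor, and high ones by the narrower Gaussian.\<close>

lemma frequency_split:
  fixes r v' l \<delta> C :: real and y w :: complex
  assumes r: "0 < r" "r \<le> 1" and v': "0 < v'" "v' \<le> r\<^sup>2" and \<delta>: "0 < \<delta>" and l: "0 < l"
    and decay: "1 \<le> cmod \<xi> \<Longrightarrow> cmod \<xi> * l \<le> 1 \<Longrightarrow> cmod y \<le> C * cmod \<xi> powr (- \<delta>)"
    and y: "cmod y \<le> 1" and w: "cmod w \<le> 1"
  shows "(gs (v' / 2) \<xi> - gs (r\<^sup>2 / 2) \<xi>)\<^sup>2 * (cmod (y * w))\<^sup>2 \<le>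
    exp 1 * r\<^sup>2 * gs r \<xi> + C\<^sup>2 * r powr \<delta> * (gs v' \<xi> * (cmod w)\<^sup>2) + exp (- v' / (2 * l\<^sup>2)) * gs (v' / 2) \<xi>"
proof -
  define D where "D = gs (v' / 2) \<xi> - gs (r\<^sup>2 / 2) \<xi>"
  have D: "0 \<le> D" "D \<le> gs (v' / 2) \<xi>" using gs_antimono[of "v' / 2" "r\<^sup>2 / 2" \<xi>] v' by (auto simp: D_def)
  then have D2: "D\<^sup>2 \<le> gs v' \<xi>" using power_mono[OF D(2,1), of 2] by (simp add: gs_power2)
  have yw: "(cmod (y * w))\<^sup>2 = (cmod y)\<^sup>2 * (cmod w)\<^sup>2" by (simp add: norm_mult power_mult_distrib)
  have y2: "(cmod y)\<^sup>2 \<le> 1" and w2: "(cmod w)\<^sup>2 \<le> 1" using y w by (simp_all add: power_le_one)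
  have yw1: "(cmod (y * w))\<^sup>2 \<le> 1" unfolding yw using y2 w2 by (intro mult_le_one) auto
  define T1 where "T1 = exp 1 * r\<^sup>2 * gs r \<xi>"
  define T2 where "T2 = C\<^sup>2 * r powr \<delta> * (gs v' \<xi> * (cmod w)\<^sup>2)"
  define T3 where "T3 = exp (- v' / (2 * l\<^sup>2)) * gs (v' / 2) \<xi>"
  have T: "0 \<le> T1" "0 \<le> T2" "0 \<le> T3" by (auto simp: T1_def T2_def T3_def)
  have "D\<^sup>2 * (cmod (y * w))\<^sup>2 \<le> T1 + T2 + T3"
  proof (cases "(cmod \<xi>)\<^sup>2 * r \<le> 1")
    \<comment> \<open>The low range ends at \<open>cmod \<xi> = 1 / sqrt r\<close>. Inside it the
      two Gaussians differ by at most \<open>r\<close>; beyond it the decay already gives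
      \<open>r powr \<delta>\<close> for the square.\<close>
    case True
    have "1 - r\<^sup>2 / 2 * (cmod \<xi>)\<^sup>2 \<le> gs (r\<^sup>2 / 2) \<xi>"
      using exp_ge_add_one_self[of "- (r\<^sup>2 / 2 * (cmod \<xi>)\<^sup>2)"] by (simp add: gs_def)
    moreover have "gs (v' / 2) \<xi> \<le> 1" using v' by (intro gs_le_1) auto
    moreover have "r\<^sup>2 / 2 * (cmod \<xi>)\<^sup>2 = r / 2 * ((cmod \<xi>)\<^sup>2 * r)" by (simp add: power2_eq_square)
    moreover have "r / 2 * ((cmod \<xi>)\<^sup>2 * r) \<le> r / 2 * 1" using True r by (intro mult_left_mono) auto
    ultimately have "D \<le> r" using r unfolding D_def by linarith
    then have "D\<^sup>2 \<le> r\<^sup>2" using D by (intro power_mono) auto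
    then have "D\<^sup>2 * (cmod (y * w))\<^sup>2 \<le> r\<^sup>2 * 1" using yw1 by (intro mult_mono) auto
    also have "1 \<le> exp (1 - (cmod \<xi>)\<^sup>2 * r)" using True by simp
    then have "r\<^sup>2 * 1 \<le> r\<^sup>2 * exp (1 - (cmod \<xi>)\<^sup>2 * r)" by (intro mult_left_mono) auto
    also have "\<dots> = T1" unfolding T1_def gs_def by (simp add: exp_diff exp_minus field_simps)
    finally show ?thesis using T by linarith
  next
    case False
    have x1: "1 \<le> (cmod \<xi>)\<^sup>2" and x0: "cmod \<xi> > 0"
    proof -
      have "(cmod \<xi>)\<^sup>2 * r \<le> (cmod \<xi>)\<^sup>2 * 1" using r by (intro mult_left_mono) auto
      then show "1 \<le> (cmod \<xi>)\<^sup>2" using False by linarith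
      then show "cmod \<xi> > 0" by (cases "\<xi> = 0") auto
    qed
    have x1': "1 \<le> cmod \<xi>" using x1 abs_le_square_iff[of 1 "cmod \<xi>"] by simp
    show ?thesis
    proof (cases "cmod \<xi> * l \<le> 1")
      case True
      have "(cmod y)\<^sup>2 \<le> (C * cmod \<xi> powr (- \<delta>))\<^sup>2" using decay[OF x1' True] by (intro power_mono) auto
      also have "\<dots> = C\<^sup>2 * (cmod \<xi> ^ 2) powr (- \<delta>)"
        using x0 by (simp add: power_mult_distrib power2_eq_square powr_mult)
      also have "\<dots> \<le> C\<^sup>2 * (1 / r) powr (- \<delta>)"
        using False r \<delta> by (intro mult_left_mono powr_mono2') (auto simp: divide_le_eq)
      also have "(1 / r) powr (- \<delta>) = r powr \<delta>" using r by (simp add: powr_minus_divide powr_divide)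
      finally have y3: "(cmod y)\<^sup>2 \<le> C\<^sup>2 * r powr \<delta>" .
      have "D\<^sup>2 * (cmod (y * w))\<^sup>2 \<le> gs v' \<xi> * (C\<^sup>2 * r powr \<delta> * (cmod w)\<^sup>2)"
        unfolding yw using D2 y3 by (intro mult_mono mult_right_mono) auto
      also have "\<dots> = T2" by (simp add: T2_def)
      finally show ?thesis using T by linarith
    next
      case F: False
      have "1 / l \<le> cmod \<xi>" using F l by (simp add: divide_le_eq)
      then have "(1 / l)\<^sup>2 \<le> (cmod \<xi>)\<^sup>2" using l by (intro power_mono) auto
      then have "v' / 2 * (1 / l\<^sup>2) \<le> v' / 2 * (cmod \<xi>)\<^sup>2" using v' by (intro mult_left_mono) (auto simp: power_divide)
      then have "gs (v' / 2) \<xi> \<le> exp (- v' / (2 * l\<^sup>2))" by (simp add: gs_def)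
      then have "gs (v' / 2) \<xi> * gs (v' / 2) \<xi> \<le> T3" unfolding T3_def by (intro mult_right_mono) auto
      moreover have "gs (v' / 2) \<xi> * gs (v' / 2) \<xi> = gs v' \<xi>" by (simp add: gs_mult)
      moreover have "D\<^sup>2 * (cmod (y * w))\<^sup>2 \<le> gs v' \<xi> * 1" using D2 yw1 by (intro mult_mono) auto
      ultimately show ?thesis using T by linarith
    qed
  qed
  then show ?thesis by (simp only: D_def T1_def T2_def T3_def)
qed

context selfsim_setup
begin

text \<open>One passage to the next block of scales. Decay of the first summand is combined with an
  energy bound for the truncated second one, which \<open>G_ball\<close> provides. The three terms
  of \<open>Q\<close> belong to the ranges of \<open>frequency_split\<close>; the last tends to 0 as
  \<open>n\<close> grows.\<close>

lemma density_step:
  assumes fin_b: "fin_pmf b" and \<delta>: "0 < \<delta>"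
    and decay: "\<And>\<xi>. 1 \<le> cmod \<xi> \<Longrightarrow> cmod \<xi> * rad n \<le> 1 \<Longrightarrow> cmod (ft (selfsim \<rho> b n) \<xi>) \<le> C * cmod \<xi> powr (- \<delta>)"
    and n: "m * J \<le> n" and \<tau>: "\<tau> > 0" and t: "t > 0" and s: "0 < s" "s \<le> 1"
    and V: "V \<in> sets borel" "emeasure lborel V < \<infinity>"
  defines "r \<equiv> rad (m * J)" and "v' \<equiv> (rad (m * Suc J))\<^sup>2"
  defines "Q \<equiv> 1 / (4 * pi\<^sup>2) * (exp 1 * r\<^sup>2 * (pi / r) +
      C\<^sup>2 * r powr \<delta> * (pi / v' * (8 * exp (1 / 4) * (\<tau> * real (grid_const (4 * B + 8)) ^ J))) +
      exp (- v' / (2 * (rad n)\<^sup>2)) * (2 * pi / v'))"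
  shows "pE (selfsim \<rho> (conv b d) n) (smooth v' V) \<le> pE (selfsim \<rho> (conv b d) n) (smooth (r\<^sup>2) V) +
    (t * Q + measure lborel V / t) / 2 + pE (G m J) (\<lambda>v. of_bool (\<tau> < snd v)) * (measure lborel V / v') powr s"
proof -
  let ?K = "real (grid_const (4 * B + 8))"
  define P2 where "P2 = pair_pmf (G m J) (A (n - m * J))"
  define X2 where "X2 = (\<lambda>v :: (complex \<times> real) \<times> complex. fst (fst v) + \<rho> ^ (m * J) * snd v)"
  define g2 where "g2 = (\<lambda>v :: (complex \<times> real) \<times> complex. of_bool (snd (fst v) \<le> \<tau>) :: real)"
  define P where "P = pair_pmf (selfsim \<rho> b n) P2"
  define X where "X = (\<lambda>w :: complex \<times> ((complex \<times> real) \<times> complex). fst w + X2 (snd w))"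
  define g where "g = (\<lambda>w :: complex \<times> ((complex \<times> real) \<times> complex). g2 (snd w))"
  have fin2: "fin_pmf P2" by (simp add: P2_def)
  have fin: "fin_pmf P" using fin_b by (simp add: P_def fin2)
  have finY: "fin_pmf (selfsim \<rho> b n)" using fin_b by simp
  have r: "0 < r" "r \<le> 1" using rad_mono[of 0 "m * J"] by (auto simp: r_def)
  have v': "0 < v'" "v' \<le> r\<^sup>2"
  proof -
    show "0 < v'" unfolding v'_def by (intro zero_less_power rad_pos)
    have "rad (m * Suc J) \<le> rad (m * J)" by (rule rad_mono) simp
    then show "v' \<le> r\<^sup>2" unfolding v'_def r_def by (intro power_mono) simp_all
  qed
  have X2P2: "map_pmf X2 P2 = A n"
  proof -
    have "map_pmf X2 P2 = map_pmf (\<lambda>(x, y). x + \<rho> ^ (m * J) * y) (map_pmf (map_prod fst id) P2)"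
      by (simp add: pmf.map_comp o_def X2_def case_prod_unfold)
    also have "map_pmf (map_prod fst id) P2 = pair_pmf (A (m * J)) (A (n - m * J))"
      unfolding P2_def map_fst_G[symmetric] by (simp only: pair_map_pmf1 apfst_def)
    also have "map_pmf (\<lambda>(x, y). x + \<rho> ^ (m * J) * y) \<dots> = conv (A (m * J)) (map_pmf ((*) (\<rho> ^ (m * J))) (A (n - m * J)))"
      by (simp add: map_mult_pair)
    also have "\<dots> = A n" using selfsim_add[of \<rho> d "m * J" "n - m * J"] n by simp
    finally show ?thesis .
  qed
  have N: "selfsim \<rho> (conv b d) n = map_pmf X P"
  proof -
    have "map_pmf X P = map_pmf (\<lambda>(x, y). x + y) (map_pmf (map_prod id X2) P)"
      by (simp add: pmf.map_comp o_def X_def case_prod_unfold)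
    also have "map_pmf (map_prod id X2) P = pair_pmf (selfsim \<rho> b n) (A n)"
      unfolding P_def X2P2[symmetric] by (simp only: pair_map_pmf2 apsnd_def)
    finally show ?thesis unfolding selfsim_conv unfolding conv_def by (rule sym)
  qed
  have g: "0 \<le> g w \<and> g w \<le> 1" for w by (simp add: g_def g2_def)
  have g2: "0 \<le> g2 w \<and> g2 w \<le> 1" for w by (simp add: g2_def)
  \<comment> \<open>The truncation concerns the second summand only, so the transform still
    factors.\<close>
  have W: "wft P g X \<xi> = ft (selfsim \<rho> b n) \<xi> * wft P2 g2 X2 \<xi>" for \<xi>
  proof -
    have "g (y, u) *\<^sub>R cis (Re (cnj \<xi> * X (y, u))) = cis (Re (cnj \<xi> * y)) * (g2 u *\<^sub>R cis (Re (cnj \<xi> * X2 u)))" for y u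
      unfolding g_def X_def fst_conv snd_conv distrib_left plus_complex.sel cis_mult[symmetric] mult_scaleR_right ..
    then have "wft P g X \<xi> = pE (selfsim \<rho> b n) (\<lambda>y. pE P2 (\<lambda>u. cis (Re (cnj \<xi> * y)) * (g2 u *\<^sub>R cis (Re (cnj \<xi> * X2 u)))))"
      unfolding wft_def P_def by (simp only: pE_pair[OF finY fin2])
    also have "\<dots> = pE (selfsim \<rho> b n) (\<lambda>y. cis (Re (cnj \<xi> * y)) * wft P2 g2 X2 \<xi>)"
      unfolding wft_def by (simp only: integral_mult_right_zero)
    also have "\<dots> = ft (selfsim \<rho> b n) \<xi> * wft P2 g2 X2 \<xi>"
      unfolding ft_def by (rule integral_mult_left_zero)
    finally show ?thesis .
  qed
  have ball: "pE P2 (\<lambda>w. g2 w * indicator (cball z r) (X2 w)) \<le> \<tau> * ?K ^ J" for z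
  proof -
    have "pE P2 (\<lambda>w. g2 w * indicator (cball z r) (X2 w)) \<le>
        pE P2 (\<lambda>w. \<tau> * (indicator (cball z ((1 + B) * r)) (fst (fst w)) / snd (fst w)))"
    proof (rule pE_mono[OF fin2])
      fix w assume w: "w \<in> set_pmf P2"
      have pos: "snd (fst w) > 0" using w snd_G_pos[of "fst w" m J] by (auto simp: P2_def)
      have bd: "cmod (snd w) \<le> B" using w bound[of "snd w"] by (auto simp: P2_def)
      show "g2 w * indicator (cball z r) (X2 w) \<le> \<tau> * (indicator (cball z ((1 + B) * r)) (fst (fst w)) / snd (fst w))"
      proof (cases "snd (fst w) \<le> \<tau> \<and> X2 w \<in> cball z r")
        case True
        have "fst (fst w) = X2 w - \<rho> ^ (m * J) * snd w" by (simp add: X2_def)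
        then have "z - fst (fst w) = (z - X2 w) + \<rho> ^ (m * J) * snd w" by simp
        then have "cmod (z - fst (fst w)) \<le> cmod (z - X2 w) + r * cmod (snd w)"
          unfolding r_def norm_power[symmetric] norm_mult[symmetric] by (simp only: norm_triangle_ineq)
        also have "\<dots> \<le> r + r * B" using True bd r by (intro add_mono mult_left_mono) (auto simp: dist_norm)
        finally have "fst (fst w) \<in> cball z ((1 + B) * r)" by (simp add: dist_norm algebra_simps)
        then show ?thesis using True pos by (simp add: g2_def)
      qed (use pos \<tau> in \<open>auto simp: g2_def indicator_def\<close>)
    qed
    also have "\<dots> = \<tau> * pE P2 (\<lambda>w. indicator (cball z ((1 + B) * r)) (fst (fst w)) / snd (fst w))"
      by (rule integral_mult_right_zero)
    also have "pE P2 (\<lambda>w. indicator (cball z ((1 + B) * r)) (fst (fst w)) / snd (fst w)) =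
       pE (G m J) (\<lambda>v. indicator (cball z ((1 + B) * r)) (fst v) / snd v)"
      unfolding P2_def by (simp add: pE_pair)
    also have "\<tau> * \<dots> \<le> \<tau> * ?K ^ J"
      unfolding r_def using G_ball[of m J z] \<tau> by (intro mult_left_mono) auto
    finally show ?thesis .
  qed
  \<comment> \<open>Since \<open>v' \<le> r\<^sup>2\<close>, the kernel is dominated by the one of
    width \<open>r\<close>, the radius at which \<open>ball\<close> controls the masses.\<close>
  have energy: "(LINT \<xi>|lborel. gs v' \<xi> * (cmod (wft P2 g2 X2 \<xi>))\<^sup>2) \<le> pi / v' * (8 * exp (1 / 4) * (\<tau> * ?K ^ J))"
  proof -
    let ?E = "8 * exp (1 / 4) * (\<tau> * ?K ^ J)"
    have inner: "pE P2 (\<lambda>v. g2 v * gs (1 / (4 * v')) (X2 w - X2 v)) \<le> ?E" for w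
    proof -
      have "pE P2 (\<lambda>v. g2 v * gs (1 / (4 * v')) (X2 w - X2 v)) \<le> pE P2 (\<lambda>v. g2 v * gs (1 / (4 * r\<^sup>2)) (X2 v - X2 w))"
        unfolding gs_minus_commute[of _ "X2 w"] using v' r g2 by (intro pE_mono fin2 mult_left_mono gs_antimono divide_left_mono) auto
      also have "\<dots> \<le> ?E" using g2 ball r by (intro gauss_average_le fin2) auto
      finally show ?thesis .
    qed
    have E0: "0 \<le> ?E" using \<tau> by simp
    have "g2 w * pE P2 (\<lambda>v. g2 v * gs (1 / (4 * v')) (X2 w - X2 v)) \<le> ?E" for w
      using inner[of w] E0 by (simp add: g2_def)
    then have "pE P2 (\<lambda>w. g2 w * pE P2 (\<lambda>v. g2 v * gs (1 / (4 * v')) (X2 w - X2 v))) \<le> pE P2 (\<lambda>w. ?E)"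
      by (intro pE_mono fin2)
    then show ?thesis unfolding integral_wft[OF fin2 v'(1)] using v' by (intro mult_left_mono) auto
  qed
  have "(LINT \<xi>|lborel. (gs (v' / 2) \<xi> - gs (r\<^sup>2 / 2) \<xi>)\<^sup>2 * (cmod (wft P g X \<xi>))\<^sup>2) \<le>
    (LINT \<xi>|lborel. exp 1 * r\<^sup>2 * gs r \<xi> + C\<^sup>2 * r powr \<delta> * (gs v' \<xi> * (cmod (wft P2 g2 X2 \<xi>))\<^sup>2) + exp (- v' / (2 * (rad n)\<^sup>2)) * gs (v' / 2) \<xi>)"
  proof (rule integral_mono)
    show "integrable lborel (\<lambda>\<xi>. exp 1 * r\<^sup>2 * gs r \<xi> + C\<^sup>2 * r powr \<delta> * (gs v' \<xi> * (cmod (wft P2 g2 X2 \<xi>))\<^sup>2) + exp (- v' / (2 * (rad n)\<^sup>2)) * gs (v' / 2) \<xi>)"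
      using r v' by (intro Bochner_Integration.integrable_add integrable_mult_right integrable_gs integrable_wft fin2) auto
    have c: "0 < v' / 2" "0 < r\<^sup>2 / 2" "0 < v' / 2 + r\<^sup>2 / 2" using v' r by (auto intro: add_pos_pos)
    have "integrable lborel (\<lambda>\<xi>. gs (2 * (v' / 2)) \<xi> * (cmod (wft P g X \<xi>))\<^sup>2 - 2 * (gs (v' / 2 + r\<^sup>2 / 2) \<xi> * (cmod (wft P g X \<xi>))\<^sup>2) + gs (2 * (r\<^sup>2 / 2)) \<xi> * (cmod (wft P g X \<xi>))\<^sup>2)"
      using c by (intro Bochner_Integration.integrable_add Bochner_Integration.integrable_diff integrable_mult_right integrable_wft fin) auto
    moreover have "(\<lambda>\<xi>. (gs (v' / 2) \<xi> - gs (r\<^sup>2 / 2) \<xi>)\<^sup>2 * (cmod (wft P g X \<xi>))\<^sup>2) =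
      (\<lambda>\<xi>. gs (2 * (v' / 2)) \<xi> * (cmod (wft P g X \<xi>))\<^sup>2 - 2 * (gs (v' / 2 + r\<^sup>2 / 2) \<xi> * (cmod (wft P g X \<xi>))\<^sup>2) + gs (2 * (r\<^sup>2 / 2)) \<xi> * (cmod (wft P g X \<xi>))\<^sup>2)"
      unfolding gs_power2[symmetric] gs_mult[symmetric] by (rule ext) (simp add: power2_diff algebra_simps)
    ultimately show "integrable lborel (\<lambda>\<xi>. (gs (v' / 2) \<xi> - gs (r\<^sup>2 / 2) \<xi>)\<^sup>2 * (cmod (wft P g X \<xi>))\<^sup>2)" by simp
    show "(gs (v' / 2) \<xi> - gs (r\<^sup>2 / 2) \<xi>)\<^sup>2 * (cmod (wft P g X \<xi>))\<^sup>2 \<le> exp 1 * r\<^sup>2 * gs r \<xi> + C\<^sup>2 * r powr \<delta> * (gs v' \<xi> * (cmod (wft P2 g2 X2 \<xi>))\<^sup>2) + exp (- v' / (2 * (rad n)\<^sup>2)) * gs (v' / 2) \<xi>" for \<xi>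
      unfolding W by (rule frequency_split[OF r v' \<delta> rad_pos decay norm_ft_le_1 norm_wft_le_1[OF fin2 g2]])
  qed
  also have "\<dots> = exp 1 * r\<^sup>2 * (pi / r) + C\<^sup>2 * r powr \<delta> * (LINT \<xi>|lborel. gs v' \<xi> * (cmod (wft P2 g2 X2 \<xi>))\<^sup>2) + exp (- v' / (2 * (rad n)\<^sup>2)) * (2 * pi / v')"
    using r v' integrable_gs[of r] integrable_wft[OF fin2 v'(1), of g2 X2] integrable_gs[of "v' / 2"] integral_gs[of r] integral_gs[of "v' / 2"]
    by simp
  also have "\<dots> \<le> exp 1 * r\<^sup>2 * (pi / r) + C\<^sup>2 * r powr \<delta> * (pi / v' * (8 * exp (1 / 4) * (\<tau> * ?K ^ J))) + exp (- v' / (2 * (rad n)\<^sup>2)) * (2 * pi / v')"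
    using energy by (intro add_mono mult_left_mono) auto
  finally have Qb: "1 / (4 * pi\<^sup>2) * (LINT \<xi>|lborel. (gs (v' / 2) \<xi> - gs (r\<^sup>2 / 2) \<xi>)\<^sup>2 * (cmod (wft P g X \<xi>))\<^sup>2) \<le> Q"
    unfolding Q_def by (intro mult_left_mono) auto
  have bad: "pE P (\<lambda>w. 1 - g w) = pE (G m J) (\<lambda>v. of_bool (\<tau> < snd v))"
  proof -
    have "pE P (\<lambda>w. 1 - g w) = pE (selfsim \<rho> b n) (\<lambda>y. pE (G m J) (\<lambda>v. pE (A (n - m * J)) (\<lambda>a. 1 - of_bool (snd v \<le> \<tau>))))"
      unfolding P_def P2_def by (simp only: pE_pair[OF finY] fin_G fin_selfsim[OF fin_d] pE_pair fin2[unfolded P2_def] g_def g2_def fst_conv snd_conv)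
    also have "\<dots> = pE (G m J) (\<lambda>v. 1 - of_bool (snd v \<le> \<tau>))" by simp
    also have "\<dots> = pE (G m J) (\<lambda>v. of_bool (\<tau> < snd v))" by (intro pE_cong) (auto simp: of_bool_def)
    finally show ?thesis .
  qed
  have r2: "0 < r\<^sup>2" using r by simp
  show ?thesis unfolding N pE_map
    using smooth_increment[OF fin g V v'(1) r2 s t Qb] unfolding bad .
qed

end

lemma sum_geometric_le:
  fixes q :: real
  assumes "0 \<le> q" "q < 1"
  shows "(\<Sum>i<n. q ^ i) \<le> 1 / (1 - q)"
  using assms by (simp add: sum_gp_strict divide_right_mono)

context selfsim_setup
begin

text \<open>Summing \<open>density_step\<close> over the blocks produces two geometric series: the
  truncated parts contribute powers of \<open>sqrt q\<close>, the atypical parts powers of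
  \<open>exp (- c / 2)\<close>. The length \<open>n\<close> has to be large in terms of
  \<open>J\<close>, whereas the constants are independent of both.\<close>

theorem smooth_bound:
  fixes b :: "complex pmf" and C \<delta> :: real
  assumes fin_b: "fin_pmf b" and \<delta>: "0 < \<delta>"
    and decay: "\<And>n \<xi>. 1 \<le> cmod \<xi> \<Longrightarrow> cmod \<xi> * rad n \<le> 1 \<Longrightarrow> cmod (ft (selfsim \<rho> b n) \<xi>) \<le> C * cmod \<xi> powr (- \<delta>)"
    and full: "\<And>\<epsilon>. \<epsilon> > 0 \<Longrightarrow> \<forall>\<^sub>F m in sequentially. aent m \<ge> (\<beta> - \<epsilon>) * m"
  shows "\<exists>m\<ge>1. \<exists>K. \<exists>s>0. \<forall>V\<in>sets borel. emeasure lborel V \<le> 1 \<longrightarrow> (\<forall>J. \<forall>\<^sub>F n in sequentially.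
    pE (selfsim \<rho> (conv b d) n) (smooth ((rad (m * J))\<^sup>2) V) \<le> K * measure lborel V powr s)"
proof -
  define K0 where "K0 = real (grid_const (4 * B + 8))"
  have K0: "K0 \<ge> 1" using grid_const_ge_1[of "4 * B + 8"] by (simp add: K0_def)
  \<comment> \<open>Per step the Fourier decay gains \<open>\<beta> * \<delta> / 2\<close> in the
    exponent. The entropy defect \<open>2 * \<epsilon>\<close> and the overlap constant
    \<open>ln K0 / m\<close> each consume at most a quarter of it, which leaves
    \<open>\<beta> * \<delta> / 4\<close>.\<close>
  define \<epsilon> where "\<epsilon> = \<beta> * \<delta> / 16"
  have \<epsilon>: "\<epsilon> > 0" using beta_pos \<delta> by (simp add: \<epsilon>_def)
  have "\<forall>\<^sub>F m in sequentially. aent m \<ge> (\<beta> - \<epsilon>) * m \<and> m \<ge> max 1 (nat \<lceil>8 * ln K0 / (\<beta> * \<delta>)\<rceil>)"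
    by (intro eventually_conj full \<epsilon> eventually_ge_at_top)
  from eventually_happens'[OF sequentially_bot this]
  obtain m where m': "aent m \<ge> (\<beta> - \<epsilon>) * m" "m \<ge> max 1 (nat \<lceil>8 * ln K0 / (\<beta> * \<delta>)\<rceil>)" by blast
  then have m: "aent m \<ge> (\<beta> - \<epsilon>) * m" "m \<ge> 1" "8 * ln K0 / (\<beta> * \<delta>) \<le> m"
    by (simp_all add: nat_ceiling_le_eq)
  have lnK: "ln K0 \<le> \<beta> * \<delta> * m / 8" using m(3) beta_pos \<delta> by (simp add: field_simps)
  obtain c :: real where c: "c > 0" "\<And>J. pE (G m J) (\<lambda>v. of_bool (exp (- (\<beta> - 2 * \<epsilon>) * m) ^ J < snd v)) \<le> exp (- c) ^ J"
    using large_deviation[OF m(1) \<epsilon> m(2)] by blast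
  define \<tau> where "\<tau> = exp (- (\<beta> - 2 * \<epsilon>) * m)"
  define a where "a = rad m"
  have a_exp: "a = exp (- \<beta> * m / 2)"
  proof -
    have "a = exp (ln (cmod \<rho>) * m)" using rho by (simp add: a_def exp_of_nat2_mult)
    then show ?thesis using rho by (simp add: \<beta>_def ln_div)
  qed
  have a: "0 < a" "a < 1" using m(2) beta_pos by (auto simp: a_exp)
  have radJ: "rad (m * J) = a ^ J" for J by (simp add: a_def power_mult)
  define q2 where "q2 = exp (- \<beta> * \<delta> * m / 4)"
  define q where "q = max a q2"
  have q: "0 < q" "q < 1" using a m(2) beta_pos \<delta> by (auto simp: q_def q2_def)
  have q2: "a powr \<delta> * \<tau> * K0 / a\<^sup>2 \<le> q2"
  proof -
    have "a powr \<delta> * \<tau> * K0 / a\<^sup>2 = exp (- \<beta> * m / 2 * \<delta>) * exp (- (\<beta> - 2 * \<epsilon>) * m) * exp (ln K0) / exp (- \<beta> * m / 2 * 2)"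
      using a K0 by (simp add: a_exp powr_def \<tau>_def exp_double[symmetric] mult.commute)
    also have "\<dots> = exp (- \<beta> * m / 2 * \<delta> + - (\<beta> - 2 * \<epsilon>) * m + ln K0 - - \<beta> * m / 2 * 2)"
      by (simp only: exp_add exp_diff)
    also have "\<dots> \<le> exp (- \<beta> * \<delta> * m / 4)"
    proof -
      have "- \<beta> * m / 2 * \<delta> + - (\<beta> - 2 * \<epsilon>) * m + ln K0 - - \<beta> * m / 2 * 2 = - (\<beta> * \<delta> * m / 2) + \<beta> * \<delta> * m / 8 + ln K0"
        by (simp add: \<epsilon>_def algebra_simps)
      moreover have "- (\<beta> * \<delta> * m / 2) + \<beta> * \<delta> * m / 8 + ln K0 \<le> - \<beta> * \<delta> * m / 4"
        using lnK by (simp only: mult_minus_left)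
      ultimately show ?thesis by (simp only: exp_le_cancel_iff)
    qed
    finally show ?thesis by (simp add: q2_def)
  qed
  define C2 where "C2 = C\<^sup>2 * (8 * exp (1 / 4)) * pi / a\<^sup>2"
  define C1 where "C1 = exp 1 * pi + C2 + 1"
  have C2: "C2 \<ge> 0" by (simp add: C2_def)
  have C1: "C1 \<ge> 1" using C2 by (simp add: C1_def)
  \<comment> \<open>The factor \<open>v' powr (- s)\<close> grows by at most
    \<open>exp (c / 2)\<close> per block, which half of the exponential smallness of the atypical
    part pays for. \<open>s \<le> 1 / 2\<close> allows \<open>sqrt M \<le> M powr s\<close>.\<close>
  define s where "s = min (1 / 2) (c / (2 * \<beta> * m))"
  have s: "0 < s" "s \<le> 1" "s \<le> 1 / 2" "\<beta> * m * s \<le> c / 2"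
  proof -
    show "0 < s" "s \<le> 1" "s \<le> 1 / 2" using c(1) beta_pos m(2) by (auto simp: s_def)
    have "\<beta> * m * s \<le> \<beta> * m * (c / (2 * \<beta> * m))" using beta_pos by (intro mult_left_mono) (auto simp: s_def)
    then show "\<beta> * m * s \<le> c / 2" using beta_pos m(2) by simp
  qed
  define w where "w = (\<lambda>i::nat. C1 * sqrt q ^ i + exp (c / 2) * exp (- c / 2) ^ i)"
  define K where "K = 1 + (C1 / (1 - sqrt q) + exp (c / 2) / (1 - exp (- c / 2)))"
  have sq: "0 < sqrt q" "sqrt q < 1" using q by auto
  have w0: "w i \<ge> 0" for i using C1 sq by (simp add: w_def)
  have K: "1 + (\<Sum>i<J. w i) \<le> K" for J
  proof -
    have "(\<Sum>i<J. w i) = C1 * (\<Sum>i<J. sqrt q ^ i) + exp (c / 2) * (\<Sum>i<J. exp (- c / 2) ^ i)"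
      by (simp add: w_def sum.distrib sum_distrib_left)
    also have "\<dots> \<le> C1 * (1 / (1 - sqrt q)) + exp (c / 2) * (1 / (1 - exp (- c / 2)))"
      using sq C1 c(1) by (intro add_mono mult_left_mono sum_geometric_le) auto
    finally show ?thesis by (simp add: K_def)
  qed
  have "\<forall>\<^sub>F n in sequentially. pE (selfsim \<rho> (conv b d) n) (smooth ((rad (m * J))\<^sup>2) V) \<le> K * measure lborel V powr s"
    if V: "V \<in> sets borel" "emeasure lborel V \<le> 1" for V J
  proof -
    define M where "M = measure lborel V"
    have Vfin: "emeasure lborel V < \<infinity>" using V(2) by (rule order.strict_trans1) simp
    have M: "0 \<le> M" "M \<le> 1"
    proof -
      have "emeasure lborel V = ennreal M" unfolding M_def using Vfin by (intro emeasure_eq_ennreal_measure) auto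
      then have "ennreal M \<le> 1" using V(2) by simp
      then show "M \<le> 1" by simp
    qed (simp add: M_def)
    let ?N = "\<lambda>n. selfsim \<rho> (conv b d) n"
    have finN: "fin_pmf (?N n)" for n using fin_b by simp
    have "\<forall>\<^sub>F n in sequentially. pE (?N n) (smooth ((rad (m * J))\<^sup>2) V) \<le> M powr s * (1 + (\<Sum>i<J. w i))"
    proof (cases "M = 0")
      case True
      have "smooth ((rad (m * J))\<^sup>2) V x \<le> 0" for x
        using smooth_le_powr[OF V(1) Vfin zero_less_power[OF rad_pos] s(1,2), of "m * J" 2 x] True by (simp add: M_def)
      then have "pE (?N n) (smooth ((rad (m * J))\<^sup>2) V) \<le> pE (?N n) (\<lambda>_. 0)" for n
        by (intro pE_mono finN)
      then show ?thesis using True by simp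
    next
      case False
      then have M0: "M > 0" using M by simp
      show ?thesis
      proof (induction J)
        case 0
        have "pE (?N n) (smooth 1 V) \<le> pE (?N n) (\<lambda>_. M powr s)" for n
          using smooth_le_powr[OF V(1) Vfin _ s(1,2), of 1] by (intro pE_mono finN) (simp add: M_def)
        then show ?case by simp
      next
        case (Suc J)
        define r where "r = rad (m * J)"
        define v' where "v' = (rad (m * Suc J))\<^sup>2"
        have v': "v' = a\<^sup>2 * (a\<^sup>2) ^ J" "v' > 0"
          using a unfolding v'_def radJ by (auto simp: power_mult_distrib power2_eq_square)
        have rJ: "r = a ^ J" "r > 0" using a by (simp_all add: r_def radJ)
        have "(\<lambda>n. exp (- v' / (2 * (rad n)\<^sup>2)) * (2 * pi / v')) \<longlonglongrightarrow> 0"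
        proof -
          have tends: "(\<lambda>n. (rad n)\<^sup>2 * (2 / v')) \<longlonglongrightarrow> 0\<^sup>2 * (2 / v')" using rho by (intro tendsto_intros LIMSEQ_power_zero) auto
          have "filterlim (\<lambda>n. (rad n)\<^sup>2 * (2 / v')) (at_right 0) sequentially"
          proof (rule tendsto_imp_filterlim_at_right)
            have "0 < (rad n)\<^sup>2 * (2 / v')" for n
              using v'(2) by (intro mult_pos_pos zero_less_power rad_pos divide_pos_pos) auto
            then show "\<forall>\<^sub>F n in sequentially. 0 < (rad n)\<^sup>2 * (2 / v')" by (intro always_eventually allI)
          qed (use tends in simp)
          then have "filterlim (\<lambda>n. inverse ((rad n)\<^sup>2 * (2 / v'))) at_top sequentially"
            by (rule filterlim_compose[OF filterlim_inverse_at_top_right])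
          then have "filterlim (\<lambda>n. - v' / (2 * (rad n)\<^sup>2)) at_bot sequentially"
            unfolding filterlim_uminus_at_top by (simp add: field_simps)
          then have "(\<lambda>n. exp (- v' / (2 * (rad n)\<^sup>2))) \<longlonglongrightarrow> 0"
            by (rule filterlim_compose[OF exp_at_bot])
          from tendsto_mult_left_zero[OF this] show ?thesis .
        qed
        then have "\<forall>\<^sub>F n in sequentially. exp (- v' / (2 * (rad n)\<^sup>2)) * (2 * pi / v') < q ^ J"
          using q by (intro order_tendstoD(2)) auto
        with Suc.IH eventually_ge_at_top[of "m * J"] show ?case
        proof eventually_elim
          case (elim n)
          define Q where "Q = 1 / (4 * pi\<^sup>2) * (exp 1 * r\<^sup>2 * (pi / r) +
            C\<^sup>2 * r powr \<delta> * (pi / v' * (8 * exp (1 / 4) * (\<tau> ^ J * K0 ^ J))) +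
            exp (- v' / (2 * (rad n)\<^sup>2)) * (2 * pi / v'))"
          \<comment> \<open>Balances \<open>t * Q\<close> against \<open>M / t\<close>.\<close>
          define t where "t = sqrt M / sqrt q ^ J"
          have t: "t > 0" using M0 sq by (simp add: t_def)
          have step: "pE (?N n) (smooth v' V) \<le> pE (?N n) (smooth (r\<^sup>2) V) + (t * Q + M / t) / 2 +
              pE (G m J) (\<lambda>v. of_bool (\<tau> ^ J < snd v)) * (M / v') powr s"
            using density_step[where C = C and \<delta> = \<delta> and b = b and n = n and m = m and J = J and \<tau> = "\<tau> ^ J" and t = t and s = s and V = V,
                OF fin_b \<delta> decay elim(2) _ t s(1,2) V(1) Vfin]
            unfolding M_def r_def v'_def Q_def K0_def by (simp add: \<tau>_def)
          have T1: "exp 1 * r\<^sup>2 * (pi / r) \<le> exp 1 * pi * q ^ J"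
          proof -
            have "exp 1 * r\<^sup>2 * (pi / r) = exp 1 * pi * a ^ J" using rJ by (simp add: power2_eq_square)
            also have "\<dots> \<le> exp 1 * pi * q ^ J" using a by (intro mult_left_mono power_mono) (auto simp: q_def)
            finally show ?thesis .
          qed
          have T2: "C\<^sup>2 * r powr \<delta> * (pi / v' * (8 * exp (1 / 4) * (\<tau> ^ J * K0 ^ J))) \<le> C2 * q ^ J"
          proof -
            have "r powr \<delta> = (a powr \<delta>) ^ J" unfolding rJ(1) using a by (simp add: powr_realpow[symmetric] powr_powr mult.commute)
            then have "C\<^sup>2 * r powr \<delta> * (pi / v' * (8 * exp (1 / 4) * (\<tau> ^ J * K0 ^ J))) = C2 * (a powr \<delta> * \<tau> * K0 / a\<^sup>2) ^ J"
              unfolding v'(1) C2_def by (simp add: power_mult_distrib power_divide)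
            also have "\<dots> \<le> C2 * q ^ J"
              using q2 K0 C2 by (intro mult_left_mono power_mono) (auto simp: q_def \<tau>_def)
            finally show ?thesis .
          qed
          have "Q \<le> 1 / (4 * pi\<^sup>2) * (C1 * q ^ J)"
            unfolding Q_def using T1 T2 elim(3) by (intro mult_left_mono) (auto simp: C1_def algebra_simps)
          also have "\<dots> \<le> 1 * (C1 * q ^ J)"
          proof (intro mult_right_mono)
            have "1 \<le> pi\<^sup>2" using pi_gt3 by (intro one_le_power) auto
            then show "1 / (4 * pi\<^sup>2) \<le> 1" by simp
          qed (use C1 q in simp)
          finally have Q: "Q \<le> C1 * q ^ J" by simp
          have qJ: "q ^ J = sqrt q ^ J * sqrt q ^ J" using q by (simp flip: power_mult_distrib)
          have "t * Q \<le> t * (C1 * q ^ J)" using Q t by (intro mult_left_mono) auto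
          also have "\<dots> = C1 * sqrt M * sqrt q ^ J" using sq by (simp add: t_def qJ)
          finally have tQ: "t * Q \<le> C1 * sqrt M * sqrt q ^ J" .
          have "M = sqrt M * sqrt M" using M by simp
          then have "M / t = sqrt M * sqrt q ^ J" using sq M0 unfolding t_def by (simp add: field_simps)
          also have "\<dots> \<le> C1 * (sqrt M * sqrt q ^ J)" using C1 M sq mult_right_mono[of 1 C1 "sqrt M * sqrt q ^ J"] by simp
          finally have good: "(t * Q + M / t) / 2 \<le> C1 * sqrt M * sqrt q ^ J" using tQ by simp
          also have "\<dots> \<le> C1 * M powr s * sqrt q ^ J"
            using M0 M s C1 sq by (intro mult_right_mono mult_left_mono) (auto simp: powr_half_sqrt[symmetric] intro!: powr_mono')
          finally have good: "(t * Q + M / t) / 2 \<le> M powr s * (C1 * sqrt q ^ J)" by (simp add: mult_ac)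
          have "pE (G m J) (\<lambda>v. of_bool (\<tau> ^ J < snd v)) * (M / v') powr s \<le> exp (- c) ^ J * (M powr s * exp (c / 2 * (J + 1)))"
          proof (intro mult_mono)
            show "pE (G m J) (\<lambda>v. of_bool (\<tau> ^ J < snd v)) \<le> exp (- c) ^ J" unfolding \<tau>_def by (rule c(2))
            have "v' = exp (- \<beta> * m * (J + 1))"
              unfolding v'(1) a_exp by (simp add: exp_double[symmetric] exp_of_nat_mult[symmetric] exp_add[symmetric] algebra_simps)
            then have "v' powr (- s) = exp (\<beta> * m * s * (J + 1))" by (simp add: powr_def algebra_simps)
            also have "\<dots> \<le> exp (c / 2 * (J + 1))"
              using s(4) by (simp only: exp_le_cancel_iff) (intro mult_right_mono, auto)
            finally have "M powr s * v' powr (- s) \<le> M powr s * exp (c / 2 * (J + 1))" by (intro mult_left_mono) auto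
            then show "(M / v') powr s \<le> M powr s * exp (c / 2 * (J + 1))"
              using M0 v'(2) by (simp add: powr_divide powr_minus_divide)
          qed auto
          also have "\<dots> = M powr s * (exp (c / 2) * exp (- c / 2) ^ J)"
          proof -
            have "exp (- c) ^ J * exp (c / 2 * (J + 1)) = exp (c / 2) * exp (- c / 2) ^ J"
              by (simp add: exp_of_nat_mult[symmetric] exp_add[symmetric] field_simps)
            then show ?thesis by (simp add: mult.left_commute)
          qed
          finally have bad: "pE (G m J) (\<lambda>v. of_bool (\<tau> ^ J < snd v)) * (M / v') powr s \<le> M powr s * (exp (c / 2) * exp (- c / 2) ^ J)" .
          have "pE (?N n) (smooth v' V) \<le> M powr s * (1 + (\<Sum>i<J. w i)) + M powr s * (C1 * sqrt q ^ J) + M powr s * (exp (c / 2) * exp (- c / 2) ^ J)"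
            using step good bad elim(1) unfolding r_def by linarith
          also have "\<dots> = M powr s * (1 + (\<Sum>i<Suc J. w i))" by (simp add: w_def algebra_simps)
          finally show ?case unfolding v'_def .
        qed
      qed
    qed
    then show ?thesis
    proof eventually_elim
      case (elim n)
      also have "M powr s * (1 + (\<Sum>i<J. w i)) \<le> M powr s * K" using K by (intro mult_left_mono) auto
      finally show ?case by (simp add: M_def mult.commute)
    qed
  qed
  then show ?thesis using m(2) s(1) by blast
qed

end

section \<open>Bernoulli sums with separated atoms\<close>

definition sgn_pmf :: "complex pmf" where
  "sgn_pmf = map_pmf (\<lambda>x. if x then 1 else - 1) (bernoulli_pmf (1 / 2))"

lemma set_sgn_pmf: "set_pmf sgn_pmf = {1, - 1}"
  by (auto simp: sgn_pmf_def)

lemma fin_sgn_pmf [simp, intro]: "fin_pmf sgn_pmf"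
  by (simp add: set_sgn_pmf)

lemma pmf_sgn_pmf: "x \<in> {1, - 1} \<Longrightarrow> pmf sgn_pmf x = 1 / 2"
proof -
  have inj: "inj (\<lambda>x. if x then 1 else - 1 :: complex)" by (auto simp: inj_def)
  have "pmf sgn_pmf ((\<lambda>x. if x then 1 else - 1) c) = 1 / 2" for c
    unfolding sgn_pmf_def by (subst pmf_map_inj'[OF inj]) (cases c; simp)
  from this[of True] this[of False] show "x \<in> {1, - 1} \<Longrightarrow> pmf sgn_pmf x = 1 / 2" by auto
qed

lemma pE_sgn_pmf: "pE sgn_pmf f = (1 / 2) *\<^sub>R (f 1 + f (- 1))"
  by (simp add: pE_sum set_sgn_pmf pmf_sgn_pmf scaleR_add_right)

primrec horner_list :: "complex \<Rightarrow> complex list \<Rightarrow> complex" where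
  "horner_list l [] = 0"
| "horner_list l (x # xs) = x + l * horner_list l xs"

lemma horner_list_eq: "horner_list l xs = (\<Sum>i<length xs. xs ! i * l ^ i)"
  by (induction xs) (simp_all add: sum.lessThan_Suc_shift sum_distrib_left mult_ac del: sum.lessThan_Suc)

lemma selfsim_replicate: "selfsim l d n = map_pmf (horner_list l) (replicate_pmf n d)"
  by (induction n) (simp_all add: conv_bind map_bind_pmf bind_map_pmf map_pmf_def bind_assoc_pmf bind_return_pmf)

lemma pmf_replicate_sgn: "xs \<in> set_pmf (replicate_pmf n sgn_pmf) \<Longrightarrow> pmf (replicate_pmf n sgn_pmf) xs = (1 / 2) ^ n"
proof (induction n arbitrary: xs)
  case (Suc n)
  have eq: "replicate_pmf (Suc n) sgn_pmf = map_pmf (\<lambda>(x, xs). x # xs) (pair_pmf sgn_pmf (replicate_pmf n sgn_pmf))"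
    by (simp add: pair_pmf_def map_bind_pmf map_pmf_def bind_assoc_pmf bind_return_pmf)
  have inj: "inj (\<lambda>(x :: complex, xs). x # xs)" by (auto simp: inj_def)
  obtain y ys where xs: "xs = y # ys" "y \<in> set_pmf sgn_pmf" "ys \<in> set_pmf (replicate_pmf n sgn_pmf)"
    using Suc.prems unfolding eq by auto
  have "pmf (replicate_pmf (Suc n) sgn_pmf) ((\<lambda>(x, xs). x # xs) (y, ys)) = pmf (pair_pmf sgn_pmf (replicate_pmf n sgn_pmf)) (y, ys)"
    unfolding eq by (rule pmf_map_inj'[OF inj])
  then show ?case using xs Suc.IH[OF xs(3)] by (simp add: pmf_pair pmf_sgn_pmf set_sgn_pmf)
qed simp

lemma ft_bernoulli: "ft (selfsim \<rho> sgn_pmf n) \<xi> = of_real (\<Prod>j<n. cos (Re (\<rho> ^ j * cnj \<xi>)))"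
proof (induction n arbitrary: \<xi>)
  case (Suc n)
  have "ft sgn_pmf \<xi> = of_real (cos (Re (cnj \<xi>)))"
    by (simp add: ft_def pE_sgn_pmf complex_eq_iff)
  then have "ft (selfsim \<rho> sgn_pmf (Suc n)) \<xi> = of_real (cos (Re (cnj \<xi>))) * of_real (\<Prod>j<n. cos (Re (\<rho> ^ j * cnj (cnj \<rho> * \<xi>))))"
  proof -
    have "fin_pmf (map_pmf ((*) \<rho>) (selfsim \<rho> sgn_pmf n))" by simp
    then show ?thesis by (simp only: selfsim.simps ft_conv[OF fin_sgn_pmf] ft_map_mult Suc \<open>ft sgn_pmf \<xi> = _\<close>)
  qed
  also have "(\<lambda>j. \<rho> ^ j * cnj (cnj \<rho> * \<xi>)) = (\<lambda>j. \<rho> ^ Suc j * cnj \<xi>)" by (simp add: mult_ac)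
  finally show ?case by (simp only: prod.lessThan_Suc_shift power_0 mult_1 of_real_mult)
qed simp

lemma sgn_lists_separated:
  assumes sep: "\<And>P :: nat \<Rightarrow> int. range P \<subseteq> {- 1, 0, 1} \<Longrightarrow> \<exists>i<n. P i \<noteq> 0 \<Longrightarrow> c \<le> cmod (\<Sum>i<n. of_int (P i) * l ^ i)"
    and xs: "xs \<in> set_pmf (replicate_pmf n sgn_pmf)" and ys: "ys \<in> set_pmf (replicate_pmf n sgn_pmf)" and "xs \<noteq> ys"
  shows "2 * c \<le> cmod (horner_list l xs - horner_list l ys)"
proof -
  define P :: "nat \<Rightarrow> int" where "P = (\<lambda>i. if i < n \<and> xs ! i \<noteq> ys ! i then (if xs ! i = 1 then 1 else - 1) else 0)"
  have len: "length xs = n" "length ys = n" and el: "set xs \<subseteq> {1, - 1}" "set ys \<subseteq> {1, - 1}"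
    using xs ys by (auto simp: set_replicate_pmf set_sgn_pmf lists_def)
  have P: "xs ! i - ys ! i = 2 * of_int (P i)" if "i < n" for i
  proof -
    have "xs ! i \<in> {1, - 1}" "ys ! i \<in> {1, - 1}" using subsetD[OF el(1) nth_mem[of i xs]] subsetD[OF el(2) nth_mem[of i ys]] that len by auto
    then show ?thesis using that by (auto simp: P_def)
  qed
  have "horner_list l xs - horner_list l ys = (\<Sum>i<n. (xs ! i - ys ! i) * l ^ i)"
    by (simp add: horner_list_eq len sum_subtractf algebra_simps)
  also have "\<dots> = 2 * (\<Sum>i<n. of_int (P i) * l ^ i)"
    by (simp add: P sum_distrib_left mult_ac)
  finally have "cmod (horner_list l xs - horner_list l ys) = 2 * cmod (\<Sum>i<n. of_int (P i) * l ^ i)"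
    by (simp add: norm_mult)
  moreover have "\<exists>i<n. P i \<noteq> 0"
    using \<open>xs \<noteq> ys\<close> len by (auto simp: P_def list_eq_iff_nth_eq)
  ultimately show ?thesis using sep[of P] by (auto simp: P_def)
qed

text \<open>Two sign lists with values in \<open>T\<close> would contradict the separation, so at
  most one list contributes.\<close>

lemma bernoulli_small_set:
  assumes sep: "\<And>P :: nat \<Rightarrow> int. range P \<subseteq> {- 1, 0, 1} \<Longrightarrow> \<exists>i<n. P i \<noteq> 0 \<Longrightarrow> c \<le> cmod (\<Sum>i<n. of_int (P i) * l ^ i)"
    and T: "\<And>x y. x \<in> T \<Longrightarrow> y \<in> T \<Longrightarrow> cmod (x - y) < 2 * c"
  shows "pE (selfsim l sgn_pmf n) (indicator T) \<le> (1 / 2 :: real) ^ n"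
proof -
  let ?q = "replicate_pmf n sgn_pmf"
  let ?S = "{xs \<in> set_pmf ?q. horner_list l xs \<in> T}"
  have fin: "fin_pmf ?q" by (intro fin_replicate fin_sgn_pmf)
  have one: "xs = ys" if "xs \<in> ?S" "ys \<in> ?S" for xs ys
  proof (rule ccontr)
    assume ne: "xs \<noteq> ys"
    have "2 * c \<le> cmod (horner_list l xs - horner_list l ys)"
      using sgn_lists_separated[OF sep _ _ ne] that by blast
    moreover have "cmod (horner_list l xs - horner_list l ys) < 2 * c" using that T by blast
    ultimately show False by linarith
  qed
  have "pE (selfsim l sgn_pmf n) (indicator T) = pE ?q (\<lambda>xs. indicat_real T (horner_list l xs))"
    by (simp only: selfsim_replicate pE_map)
  also have "\<dots> = (\<Sum>xs\<in>set_pmf ?q. pmf ?q xs * indicator T (horner_list l xs))"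
    by (rule pE_sum_real[OF fin])
  also have "\<dots> = (\<Sum>xs\<in>?S. pmf ?q xs)"
    by (intro sum.mono_neutral_cong_right) (auto simp: fin indicator_def)
  also have "\<dots> = (\<Sum>xs\<in>?S. (1 / 2) ^ n)" by (intro sum.cong) (auto simp: pmf_replicate_sgn)
  also have "\<dots> = real (card ?S) * (1 / 2) ^ n" by simp
  also have "\<dots> \<le> 1 * (1 / 2) ^ n"
  proof (intro mult_right_mono)
    have "card ?S \<le> Suc 0" using one by (intro card_le_Suc0_iff_eq[THEN iffD2]) (auto simp: fin)
    then show "real (card ?S) \<le> 1" by simp
  qed simp
  finally show ?thesis by simp
qed

text \<open>A single sign list already contributes this mass to the atom at its value.\<close>

lemma bernoulli_heavy_atom: "\<exists>y. pmf (selfsim l sgn_pmf n) y \<ge> (1 / 2) ^ n"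
proof -
  obtain xs where xs: "xs \<in> set_pmf (replicate_pmf n sgn_pmf)" using set_pmf_not_empty by fast
  have "pmf (replicate_pmf n sgn_pmf) xs = measure (replicate_pmf n sgn_pmf) {xs}" by (simp add: pmf.rep_eq)
  also have "\<dots> \<le> measure (replicate_pmf n sgn_pmf) (horner_list l -` {horner_list l xs})"
    by (intro measure_pmf.finite_measure_mono) auto
  also have "\<dots> = pmf (selfsim l sgn_pmf n) (horner_list l xs)" by (simp add: selfsim_replicate pmf_map)
  finally have "pmf (replicate_pmf n sgn_pmf) xs \<le> pmf (selfsim l sgn_pmf n) (horner_list l xs)" .
  then show ?thesis unfolding pmf_replicate_sgn[OF xs] by blast
qed

text \<open>Fixing a heavy atom of the first summand transfers the bound for small sets to the second summand.\<close>

lemma second_factor_small_cell: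
  assumes sep: "\<And>P :: nat \<Rightarrow> int. range P \<subseteq> {- 1, 0, 1} \<Longrightarrow> \<exists>i<k * n. P i \<noteq> 0 \<Longrightarrow> c \<le> cmod (\<Sum>i<k * n. of_int (P i) * l ^ i)"
    and eq: "selfsim l sgn_pmf (k * n) = conv (selfsim \<rho> sgn_pmf n) p" and fin: "fin_pmf p"
    and R: "R > 0" "R < c" and k: "k \<ge> 1"
  shows "pmf (map_pmf (grid R) p) a \<le> (1 / 2) ^ ((k - 1) * n)"
proof -
  let ?Y = "selfsim \<rho> sgn_pmf n"
  have finY: "fin_pmf ?Y" by (intro fin_selfsim fin_sgn_pmf)
  obtain y where y: "(1 / 2) ^ n \<le> pmf ?Y y" using bernoulli_heavy_atom by blast
  have yY: "y \<in> set_pmf ?Y" using y by (auto simp: set_pmf_iff) (metis not_le zero_less_power half_gt_zero zero_less_one)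
  define T where "T = (\<lambda>z. y + z) ` {z. grid R z = a}"
  have "cmod (u - v) < 2 * c" if "u \<in> T" "v \<in> T" for u v
  proof -
    have "grid R (u - y) = a" "grid R (v - y) = a" using that by (auto simp: T_def)
    then have "cmod (u - v) \<le> 2 * R" using grid_eq_dist[OF R(1), of "u - y" "v - y"] by simp
    then show ?thesis using R(2) by linarith
  qed
  note close = this
  have small: "pE (selfsim l sgn_pmf (k * n)) (indicator T) \<le> (1 / 2 :: real) ^ (k * n)"
  proof (rule bernoulli_small_set)
    show "c \<le> cmod (\<Sum>i<k * n. of_int (P i) * l ^ i)" if "range P \<subseteq> {- 1, 0, 1}" "\<exists>i<k * n. P i \<noteq> 0" for P :: "nat \<Rightarrow> int"
      using that by (rule sep)
  qed (rule close)
  have "pmf (map_pmf (grid R) p) a = pE p (\<lambda>z. indicat_real {z. grid R z = a} z)"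
    by (simp add: pmf_map vimage_def)
  also have "\<dots> = pE p (\<lambda>z. indicator T (y + z))"
    by (intro pE_cong) (auto simp: T_def indicator_def)
  finally have pa: "pmf (map_pmf (grid R) p) a = pE p (\<lambda>z. indicator T (y + z))" .
  have "(1 / 2) ^ n * pmf (map_pmf (grid R) p) a \<le> pmf ?Y y * pE p (\<lambda>z. indicator T (y + z))"
    unfolding pa using y by (intro mult_right_mono pE_nonneg) auto
  also have "\<dots> \<le> (\<Sum>x\<in>set_pmf ?Y. pmf ?Y x * pE p (\<lambda>z. indicat_real T (x + z)))"
    using finY yY by (intro member_le_sum mult_nonneg_nonneg pE_nonneg) auto
  also have "\<dots> = pE (conv ?Y p) (indicator T)"
    by (simp only: pE_conv[OF finY fin] pE_sum_real[OF finY])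
  also have "\<dots> \<le> (1 / 2) ^ (k * n)" using small unfolding eq .
  also have "\<dots> = (1 / 2) ^ n * (1 / 2) ^ ((k - 1) * n)"
    using k by (cases k) (simp_all add: power_add)
  finally show ?thesis by simp
qed


text \<open>Omitting one sign out of \<open>k\<close> leaves the entropy
  \<open>(k - 1) * ln 2\<close> per block, which must exceed the capacity \<open>k * x\<close> for
  the ratio \<open>l ^ k\<close>; as \<open>x < ln 2\<close>, all large \<open>k\<close> qualify. Of
  two consecutive exponents one gives a nonreal power, because the quotient of the powers is
  \<open>l\<close>.\<close>

theorem bernoulli_smooth_bound:
  fixes l :: complex
  assumes l: "l \<in> bernoulli_params"
    and separated: "separated l"
    and decay: "\<And>k. k \<ge> 1 \<Longrightarrow> Im (l ^ k) \<noteq> 0 \<Longrightarrow> fourier_decay (l ^ k)"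
  shows "\<exists>k\<ge>1. \<exists>m\<ge>1. \<exists>K. \<exists>s>0. \<forall>V\<in>sets borel. emeasure lborel V \<le> 1 \<longrightarrow> (\<forall>J. \<forall>\<^sub>F n in sequentially.
    pE (selfsim l sgn_pmf (k * n)) (smooth (((cmod l ^ k) ^ (m * J))\<^sup>2) V) \<le> K * measure lborel V powr s)"
proof -
  have l1: "2 powr (- 1 / 2) < cmod l" "cmod l < 1" "Im l \<noteq> 0"
    using l by (auto simp: bernoulli_params_def complex_is_Real_iff)
  have l0: "0 < cmod l" using l1(3) by auto
  obtain C where sep: "0 < C" "\<forall>\<^sub>F n in sequentially. \<forall>P :: nat \<Rightarrow> int. range P \<subseteq> {- 1, 0, 1} \<longrightarrow> (\<exists>i<n. P i \<noteq> 0) \<longrightarrow>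
        C ^ n \<le> cmod (\<Sum>i<n. of_int (P i) * l ^ i)"
    using separated unfolding separated_def by blast
  define x where "x = 2 * ln (1 / cmod l)"
  have x: "x < ln 2"
  proof -
    have "ln (2 powr (- 1 / 2)) < ln (cmod l)" using l1(1) l0 by (subst ln_less_cancel_iff) auto
    then show ?thesis using l0 by (simp add: x_def ln_div ln_powr)
  qed
  obtain k0 :: nat where k0: "ln 2 / (ln 2 - x) < real k0" using reals_Archimedean2 by blast
  have k0_1: "k0 \<ge> 1"
  proof -
    have "0 < ln 2 / (ln 2 - x)" using x by simp
    then have "0 < real k0" using k0 by linarith
    then show ?thesis by simp
  qed
  have "Im (l ^ k0) \<noteq> 0 \<or> Im (l ^ Suc k0) \<noteq> 0"
  proof (rule ccontr)
    assume "\<not> ?thesis"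
    then have "l ^ k0 \<in> \<real>" "l ^ Suc k0 \<in> \<real>" by (simp_all add: complex_is_Real_iff)
    then have "l ^ Suc k0 / l ^ k0 \<in> \<real>" by (rule Reals_divide[rotated])
    moreover have "l ^ Suc k0 / l ^ k0 = l" using l0 by simp
    ultimately show False using l1(3) by (simp add: complex_is_Real_iff)
  qed
  then obtain k where k: "k \<ge> k0" "Im (l ^ k) \<noteq> 0" by (metis order_refl le_SucI)
  have k1: "k \<ge> 1" using k k0_1 by simp
  have kx: "k * x < (real k - 1) * ln 2"
  proof -
    have "ln 2 / (ln 2 - x) < real k" using k0 k(1) by linarith
    then have "ln 2 < real k * (ln 2 - x)" using x by (simp add: divide_less_eq)
    then show ?thesis by (simp add: algebra_simps)
  qed
  define \<rho> where "\<rho> = l ^ k"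
  define d where "d = map_pmf ((*) l) (selfsim l sgn_pmf (k - 1))"
  define B where "B = (\<Sum>x\<in>set_pmf d. cmod x) / (1 - cmod \<rho>)"
  have \<rho>: "0 < cmod \<rho>" "cmod \<rho> < 1" "Im \<rho> \<noteq> 0"
    using l0 l1 k k1 by (auto simp: \<rho>_def norm_power power_less_one_iff)
  have fin_d: "fin_pmf d" by (simp add: d_def)
  interpret selfsim_setup \<rho> d B
  proof unfold_locales
    fix n y assume y: "y \<in> set_pmf (selfsim \<rho> d n)"
    have "cmod z \<le> (\<Sum>x\<in>set_pmf d. cmod x)" if "z \<in> set_pmf d" for z
      using that fin_d by (intro member_le_sum) auto
    from selfsim_bound[OF \<rho>(2) this y] show "cmod y \<le> B" by (simp add: B_def)
  qed (use \<rho> fin_d in auto)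
  have selfsim_k: "selfsim l sgn_pmf k = conv sgn_pmf d"
    using k1 by (cases k) (auto simp: d_def)
  have eqN: "selfsim l sgn_pmf (k * n) = conv (selfsim \<rho> sgn_pmf n) (A n)" for n
    unfolding selfsim_mult selfsim_k \<rho>_def[symmetric] by (rule selfsim_conv)
  have eqN': "selfsim l sgn_pmf (k * n) = selfsim \<rho> (conv sgn_pmf d) n" for n
    unfolding selfsim_mult selfsim_k \<rho>_def[symmetric] ..
  \<comment> \<open>Makes the cells of the fine grid smaller than the separation
    \<open>C ^ k\<close> per block.\<close>
  obtain C1 :: nat where C1: "cmod \<rho> ^ C1 < C ^ k" using real_arch_pow_inv[of "C ^ k" "cmod \<rho>"] sep(1) \<rho>(2) by auto
  define C1' where "C1' = Suc C1"
  have C1': "cmod \<rho> ^ (1 + C1') < C ^ k" "C1' \<ge> 1"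
  proof -
    have "cmod \<rho> ^ (1 + C1') \<le> cmod \<rho> ^ C1" using \<rho> by (intro power_decreasing) (auto simp: C1'_def)
    then show "cmod \<rho> ^ (1 + C1') < C ^ k" using C1 by linarith
  qed (simp add: C1'_def)
  define c0 where "c0 = (real k - 1) * ln 2"
  have "\<beta> < c0"
  proof -
    have "\<beta> = k * x" unfolding \<beta>_def using l0 by (simp add: x_def \<rho>_def norm_power ln_div ln_realpow)
    then show ?thesis using kx by (simp add: c0_def)
  qed
  moreover have "\<forall>\<^sub>F n in sequentially. ent (map_pmf (Dn (n + C1' * n)) (A n)) \<ge> c0 * n"
  proof -
    have "filterlim (\<lambda>n. k * n) sequentially sequentially"
      using k1 by (intro mult_nat_left_at_top) auto
    from eventually_compose_filterlim[OF sep(2) this] eventually_ge_at_top[of 1]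
    show ?thesis
    proof eventually_elim
      case (elim n)
      have R: "rad (n + C1' * n) < C ^ (k * n)"
      proof -
        have "rad (n + C1' * n) = (cmod \<rho> ^ (1 + C1')) ^ n" by (simp only: power_mult[symmetric] distrib_right mult_1)
        also have "\<dots> < (C ^ k) ^ n" using C1'(1) elim(2) by (intro power_strict_mono) auto
        finally show ?thesis by (simp add: power_mult)
      qed
      have "pmf (map_pmf (Dn (n + C1' * n)) (A n)) a \<le> (1 / 2) ^ ((k - 1) * n)" for a
        using elim(1) by (intro second_factor_small_cell[OF _ eqN fin_selfsim[OF fin_d] rad_pos R k1]) blast
      then have "ent (map_pmf (Dn (n + C1' * n)) (A n)) \<ge> - ln ((1 / 2) ^ ((k - 1) * n))"
        by (intro ent_ge_max) auto
      also have "- ln ((1 / 2) ^ ((k - 1) * n)) = c0 * n"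
        using k1 by (simp add: ln_realpow ln_div c0_def of_nat_diff)
      finally show ?case .
    qed
  qed
  ultimately have full: "\<forall>\<^sub>F n in sequentially. aent n \<ge> (\<beta> - \<epsilon>) * n" if "\<epsilon> > 0" for \<epsilon>
    using exists_full_entropy[of c0 C1' \<epsilon>] C1'(2) that by blast
  obtain \<delta> C' where dec: "\<delta> > 0" "\<And>n \<xi>. 1 \<le> cmod \<xi> \<Longrightarrow> cmod \<xi> * cmod \<rho> ^ n \<le> 1 \<Longrightarrow>
        (\<Prod>j<n. \<bar>cos (Re (\<rho> ^ j * \<xi>))\<bar>) \<le> C' * cmod \<xi> powr (- \<delta>)"
    using decay[OF k1 k(2)] unfolding fourier_decay_def \<rho>_def by blast
  have "cmod (ft (selfsim \<rho> sgn_pmf n) \<xi>) \<le> C' * cmod \<xi> powr (- \<delta>)" if "1 \<le> cmod \<xi>" "cmod \<xi> * rad n \<le> 1" for n \<xi>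
    using dec(2)[of "cnj \<xi>" n] that unfolding ft_bernoulli norm_of_real abs_prod by simp
  note ft_decay = this
  have n\<rho>: "cmod l ^ k = cmod \<rho>" by (simp add: \<rho>_def norm_power)
  have "\<exists>m\<ge>1. \<exists>K. \<exists>s>0. \<forall>V\<in>sets borel. emeasure lborel V \<le> 1 \<longrightarrow> (\<forall>J. \<forall>\<^sub>F n in sequentially.
    pE (selfsim l sgn_pmf (k * n)) (smooth (((cmod l ^ k) ^ (m * J))\<^sup>2) V) \<le> K * measure lborel V powr s)"
    unfolding eqN' n\<rho> by (rule smooth_bound[OF fin_sgn_pmf dec(1)]) (fact ft_decay, fact full)
  with k1 show ?thesis by (rule exI[of _ k, OF conjI])
qed

section \<open>The Bernoulli convolution as a limit of finite sums\<close>

abbreviation coin_space :: "(nat \<Rightarrow> bool) measure" where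
  "coin_space \<equiv> PiM (UNIV :: nat set) (\<lambda>_. measure_pmf (bernoulli_pmf (1 / 2)))"

definition partial :: "complex \<Rightarrow> nat \<Rightarrow> (nat \<Rightarrow> bool) \<Rightarrow> complex" where
  "partial l n \<omega> = (\<Sum>i<n. (if \<omega> i then 1 else - 1) * l ^ i)"

lemma measurable_coin:
  "i \<in> I \<Longrightarrow> Measurable.pred (PiM I (\<lambda>_. measure_pmf (bernoulli_pmf (1 / 2)))) (\<lambda>\<omega>. \<omega> i)"
  using measurable_component_singleton[of i I "\<lambda>_. measure_pmf (bernoulli_pmf (1 / 2))"]
  by (simp cong: measurable_cong_sets)

lemma measurable_partial:
  assumes "{..<n} \<subseteq> I"
  shows "partial l n \<in> borel_measurable (PiM I (\<lambda>_. measure_pmf (bernoulli_pmf (1 / 2))))"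
  unfolding partial_def
proof (rule borel_measurable_sum)
  fix i assume "i \<in> {..<n}"
  then have [measurable]: "Measurable.pred (PiM I (\<lambda>_. measure_pmf (bernoulli_pmf (1 / 2)))) (\<lambda>\<omega>. \<omega> i)"
    using assms by (intro measurable_coin) auto
  show "(\<lambda>\<omega>. (if \<omega> i then 1 else - 1) * l ^ i) \<in> borel_measurable (PiM I (\<lambda>_. measure_pmf (bernoulli_pmf (1 / 2))))"
    by measurable
qed

text \<open>Induction over the coordinates: integrating out the last coin replaces \<open>f\<close>
  by the mean of two translates.\<close>

lemma nn_integral_partial_finite:
  assumes f: "f \<in> borel_measurable borel"
  shows "(\<integral>\<^sup>+\<omega>. f (partial l n \<omega>) \<partial>PiM {..<n} (\<lambda>_. measure_pmf (bernoulli_pmf (1 / 2)))) =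
    (\<integral>\<^sup>+x. f x \<partial>measure_pmf (selfsim l sgn_pmf n))"
  using f
proof (induction n arbitrary: f)
  case 0
  then show ?case by (simp add: PiM_empty nn_integral_count_space_finite partial_def)
next
  case (Suc n)
  let ?M = "\<lambda>_::nat. measure_pmf (bernoulli_pmf (1 / 2))"
  interpret product_sigma_finite ?M
    by unfold_locales
  note [measurable] = Suc.prems
  have S: "{..<Suc n} = insert n {..<n}" by auto
  have upd: "partial l (Suc n) (x(n := y)) = partial l n x + (if y then 1 else - 1) * l ^ n" for x y
    by (simp add: partial_def)
  have meas: "(\<lambda>\<omega>. f (partial l (Suc n) \<omega>)) \<in> borel_measurable (PiM (insert n {..<n}) ?M)"
    unfolding S[symmetric] by (intro measurable_compose[OF measurable_partial Suc.prems]) auto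
  let ?g = "\<lambda>x. \<integral>\<^sup>+y. f (x + (if y then 1 else - 1) * l ^ n) \<partial>measure_pmf (bernoulli_pmf (1 / 2))"
  have g: "?g \<in> borel_measurable borel"
    by (simp add: nn_integral_measure_pmf_support[of UNIV] nn_integral_count_space_finite)
      measurable
  have "(\<integral>\<^sup>+\<omega>. f (partial l (Suc n) \<omega>) \<partial>PiM {..<Suc n} ?M) = (\<integral>\<^sup>+x. ?g (partial l n x) \<partial>PiM {..<n} ?M)"
    unfolding S by (subst product_nn_integral_insert) (use meas in \<open>simp_all add: upd\<close>)
  also have "\<dots> = (\<integral>\<^sup>+x. ?g x \<partial>measure_pmf (selfsim l sgn_pmf n))" by (rule Suc.IH[OF g])
  also have "\<dots> = (\<integral>\<^sup>+x. f x \<partial>measure_pmf (conv (selfsim l sgn_pmf n) (map_pmf ((*) (l ^ n)) sgn_pmf)))"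
    by (simp add: conv_bind sgn_pmf_def bind_map_pmf map_pmf_comp mult.commute)
  also have "conv (selfsim l sgn_pmf n) (map_pmf ((*) (l ^ n)) sgn_pmf) = selfsim l sgn_pmf (Suc n)"
    using selfsim_add[of l sgn_pmf n 1] by simp
  finally show ?case .
qed

lemma nn_integral_partial:
  assumes f: "f \<in> borel_measurable borel"
  shows "(\<integral>\<^sup>+\<omega>. f (partial l n \<omega>) \<partial>coin_space) = (\<integral>\<^sup>+x. f x \<partial>measure_pmf (selfsim l sgn_pmf n))"
proof -
  let ?M = "\<lambda>_::nat. measure_pmf (bernoulli_pmf (1 / 2))"
  interpret product_prob_space ?M UNIV
    by unfold_locales
  have "PiM {..<n} ?M = distr coin_space (PiM {..<n} ?M) (\<lambda>\<omega>. restrict \<omega> {..<n})"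
    by (rule distr_PiM_restrict_finite[symmetric]) auto
  then have "(\<integral>\<^sup>+\<omega>. f (partial l n \<omega>) \<partial>PiM {..<n} ?M) =
      (\<integral>\<^sup>+\<omega>. f (partial l n \<omega>) \<partial>distr coin_space (PiM {..<n} ?M) (\<lambda>\<omega>. restrict \<omega> {..<n}))" by simp
  also have "\<dots> = (\<integral>\<^sup>+\<omega>. f (partial l n (restrict \<omega> {..<n})) \<partial>coin_space)"
  proof (rule nn_integral_distr)
    show "(\<lambda>\<omega>. restrict \<omega> {..<n}) \<in> measurable coin_space (PiM {..<n} ?M)"
      by (rule measurable_restrict_subset) simp
    show "(\<lambda>\<omega>. f (partial l n \<omega>)) \<in> borel_measurable (distr coin_space (PiM {..<n} ?M) (\<lambda>\<omega>. restrict \<omega> {..<n}))"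
      using measurable_compose[OF measurable_partial f, of n "{..<n}" l] by simp
  qed
  also have "(\<lambda>\<omega>. partial l n (restrict \<omega> {..<n})) = partial l n" by (auto simp: partial_def)
  finally show ?thesis using nn_integral_partial_finite[OF f] by metis
qed

lemma partial_tendsto:
  assumes "cmod l < 1"
  shows "(\<lambda>n. partial l n \<omega>) \<longlonglongrightarrow> (\<Sum>n. (if \<omega> n then 1 else - 1) * l ^ n)"
proof -
  have "summable (\<lambda>n. (if \<omega> n then 1 else - 1) * l ^ n)"
  proof (rule summable_norm_cancel, rule summable_comparison_test)
    show "summable (\<lambda>n. cmod l ^ n)" using assms by (intro summable_geometric) simp
    show "\<exists>N. \<forall>n\<ge>N. norm (norm ((if \<omega> n then 1 else - 1) * l ^ n)) \<le> cmod l ^ n"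
      by (auto simp: norm_mult norm_power)
  qed
  then show ?thesis unfolding partial_def by (rule summable_LIMSEQ)
qed

text \<open>Rescaling moves the dependence on the scale from the kernel to the set, so that limits
  can be taken under one fixed Gaussian.\<close>

lemma smooth_eq_nn_integral:
  assumes V: "V \<in> sets borel" and r: "r > 0"
  shows "ennreal (smooth (r\<^sup>2) V x) = (\<integral>\<^sup>+y. indicator V (x + r *\<^sub>R y) * ennreal (phi 1 y) \<partial>lborel)"
proof -
  note [measurable] = V
  have r2: "r\<^sup>2 > 0" using r by simp
  have meas: "(\<lambda>z. indicator V z * phi (r\<^sup>2) (z - x)) \<in> borel_measurable borel"
    by (intro borel_measurable_times borel_measurable_indicator V measurable_compose[OF _ phi_measurable]) simp
  have "ennreal (smooth (r\<^sup>2) V x) = (\<integral>\<^sup>+z. ennreal (indicator V z * phi (r\<^sup>2) (z - x)) \<partial>lborel)"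
    unfolding smooth_def using phi_nonneg[OF r2]
    by (intro nn_integral_eq_integral[symmetric] integrable_smooth V r2) auto
  also have "\<dots> = (\<integral>\<^sup>+z. ennreal (indicator V z * phi (r\<^sup>2) (z - x)) \<partial>density (distr lborel borel (\<lambda>y. x + r *\<^sub>R y)) (\<lambda>_. ennreal (\<bar>r\<bar> ^ DIM(complex))))"
    using lborel_affine[of r x] r by (simp add: ennreal_power)
  also have "\<dots> = (\<integral>\<^sup>+y. ennreal (r\<^sup>2) * ennreal (indicator V (x + r *\<^sub>R y) * phi (r\<^sup>2) (x + r *\<^sub>R y - x)) \<partial>lborel)"
    using meas r by (simp add: nn_integral_density nn_integral_distr)
  also have "\<dots> = (\<integral>\<^sup>+y. indicator V (x + r *\<^sub>R y) * ennreal (phi 1 y) \<partial>lborel)"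
  proof (intro nn_integral_cong)
    fix y
    have "r\<^sup>2 * phi (r\<^sup>2) (r *\<^sub>R y) = phi 1 y"
      using r by (simp add: phi_def gs_def power_mult_distrib)
    then have "ennreal (r\<^sup>2) * ennreal (phi (r\<^sup>2) (r *\<^sub>R y)) = ennreal (phi 1 y)"
      using r2 phi_nonneg[OF r2] by (simp flip: ennreal_mult)
    then show "ennreal (r\<^sup>2) * ennreal (indicator V (x + r *\<^sub>R y) * phi (r\<^sup>2) (x + r *\<^sub>R y - x)) = indicator V (x + r *\<^sub>R y) * ennreal (phi 1 y)"
      by (auto simp: indicator_def)
  qed
  finally show ?thesis .
qed

lemma smooth_measurable [measurable]:
  assumes V: "V \<in> sets borel"
  shows "smooth v V \<in> borel_measurable borel"
proof -
  note [measurable] = V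
  have "(\<lambda>(x, z). indicator V z * phi v (z - x)) \<in> borel_measurable (borel \<Otimes>\<^sub>M lborel)"
    unfolding phi_def gs_def by measurable
  then show ?thesis unfolding smooth_def
    by (intro lborel.borel_measurable_lebesgue_integral) simp
qed

text \<open>Fatou's lemma, applied along any sequence of scales tending to zero.\<close>

lemma open_set_bound:
  fixes r :: "nat \<Rightarrow> real" and N :: "nat \<Rightarrow> nat"
  assumes l: "cmod l < 1" and V: "open V" and r: "\<And>J. r J > 0" "r \<longlonglongrightarrow> 0" and N: "filterlim N sequentially sequentially"
    and bound: "\<And>J. pE (selfsim l sgn_pmf (N J)) (smooth ((r J)\<^sup>2) V) \<le> c"
  shows "emeasure (bernoulli_conv l) V \<le> ennreal c"
proof -
  define S where "S = (\<lambda>\<omega> :: nat \<Rightarrow> bool. \<Sum>n. (if \<omega> n then 1 else - 1) * l ^ n)"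
  have Vb: "V \<in> sets borel" using V by simp
  have [measurable]: "partial l n \<in> borel_measurable coin_space" for n by (rule measurable_partial) auto
  have Slim: "(\<lambda>n. partial l n \<omega>) \<longlonglongrightarrow> S \<omega>" for \<omega> unfolding S_def by (rule partial_tendsto[OF l])
  have S: "S \<in> borel_measurable coin_space"
    by (rule borel_measurable_LIMSEQ_metric[OF _ Slim]) measurable
  have meas: "(\<lambda>\<omega>. ennreal (smooth ((r J)\<^sup>2) V (partial l (N J) \<omega>))) \<in> borel_measurable coin_space" for J
    by (intro measurable_compose[OF _ measurable_ennreal] measurable_compose[OF _ smooth_measurable[OF Vb]]) measurable
  have mass: "(\<integral>\<^sup>+y. ennreal (phi 1 y) \<partial>lborel) = 1"
  proof -
    have "(\<integral>\<^sup>+y. ennreal (phi 1 y) \<partial>lborel) = ennreal (LINT y|lborel. phi 1 y)"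
      using integrable_phi[of 1 0] by (intro nn_integral_eq_integral) (auto simp: phi_nonneg)
    then show ?thesis using integral_phi[of 1 0] by simp
  qed
  have low: "indicator V (S \<omega>) \<le> liminf (\<lambda>J. ennreal (smooth ((r J)\<^sup>2) V (partial l (N J) \<omega>)))" for \<omega>
  proof (cases "S \<omega> \<in> V")
    case True
    let ?F = "\<lambda>J y. indicator V (partial l (N J) \<omega> + r J *\<^sub>R y) * ennreal (phi 1 y)"
    have "1 = (\<integral>\<^sup>+y. ennreal (phi 1 y) \<partial>lborel)" by (simp add: mass)
    also have "\<dots> \<le> (\<integral>\<^sup>+y. liminf (\<lambda>J. ?F J y) \<partial>lborel)"
    proof (intro nn_integral_mono)
      fix y
      have "(\<lambda>J. partial l (N J) \<omega> + r J *\<^sub>R y) \<longlonglongrightarrow> S \<omega> + 0 *\<^sub>R y"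
        by (intro tendsto_intros r(2) filterlim_compose[OF Slim N])
      then have "\<forall>\<^sub>F J in sequentially. partial l (N J) \<omega> + r J *\<^sub>R y \<in> V"
        using topological_tendstoD[OF _ V] True by simp
      then have "\<forall>\<^sub>F J in sequentially. ennreal (phi 1 y) \<le> ?F J y" by eventually_elim simp
      then show "ennreal (phi 1 y) \<le> liminf (\<lambda>J. ?F J y)" by (rule Liminf_bounded)
    qed
    also have "\<dots> \<le> liminf (\<lambda>J. \<integral>\<^sup>+y. ?F J y \<partial>lborel)"
    proof (rule nn_integral_liminf)
      note [measurable] = Vb
      show "?F J \<in> borel_measurable lborel" for J
        by (intro borel_measurable_times_ennreal measurable_compose[OF _ measurable_ennreal]
          measurable_compose[OF _ borel_measurable_indicator[OF Vb]]) simp_all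
    qed
    also have "\<dots> = liminf (\<lambda>J. ennreal (smooth ((r J)\<^sup>2) V (partial l (N J) \<omega>)))"
      by (simp only: smooth_eq_nn_integral[OF Vb r(1)])
    finally show ?thesis using True by simp
  qed simp
  have "emeasure (bernoulli_conv l) V = emeasure coin_space (S -` V \<inter> space coin_space)"
    unfolding bernoulli_conv_def S_def[symmetric] by (rule emeasure_distr[OF S]) (use Vb in simp)
  also have "\<dots> = (\<integral>\<^sup>+\<omega>. indicator V (S \<omega>) \<partial>coin_space)"
  proof -
    have "S -` V \<inter> space coin_space \<in> sets coin_space" by (rule measurable_sets[OF S]) (use Vb in simp)
    from nn_integral_indicator[OF this, symmetric]
    show ?thesis by (auto intro!: nn_integral_cong simp: indicator_def)
  qed
  also have "\<dots> \<le> (\<integral>\<^sup>+\<omega>. liminf (\<lambda>J. ennreal (smooth ((r J)\<^sup>2) V (partial l (N J) \<omega>))) \<partial>coin_space)"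
    by (intro nn_integral_mono low)
  also have "\<dots> \<le> liminf (\<lambda>J. \<integral>\<^sup>+\<omega>. ennreal (smooth ((r J)\<^sup>2) V (partial l (N J) \<omega>)) \<partial>coin_space)"
    by (rule nn_integral_liminf[OF meas])
  also have "\<dots> \<le> liminf (\<lambda>J. ennreal c)"
  proof (intro Liminf_mono always_eventually allI)
    fix J
    have fin: "fin_pmf (selfsim l sgn_pmf (N J))" by simp
    have r2: "(r J)\<^sup>2 > 0" using r(1)[of J] by simp
    have "(\<integral>\<^sup>+\<omega>. ennreal (smooth ((r J)\<^sup>2) V (partial l (N J) \<omega>)) \<partial>coin_space) =
        (\<integral>\<^sup>+x. ennreal (smooth ((r J)\<^sup>2) V x) \<partial>measure_pmf (selfsim l sgn_pmf (N J)))"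
      by (rule nn_integral_partial) (intro measurable_compose[OF smooth_measurable[OF Vb] measurable_ennreal])
    also have "\<dots> = ennreal (pE (selfsim l sgn_pmf (N J)) (smooth ((r J)\<^sup>2) V))"
      using fin smooth_nonneg[OF Vb r2] by (intro nn_integral_eq_integral integrable_measure_pmf_finite) auto
    also have "\<dots> \<le> ennreal c" by (intro ennreal_leI bound)
    finally show "(\<integral>\<^sup>+\<omega>. ennreal (smooth ((r J)\<^sup>2) V (partial l (N J) \<omega>)) \<partial>coin_space) \<le> ennreal c" .
  qed
  also have "\<dots> = ennreal c" by (simp add: Liminf_const)
  finally show ?thesis .
qed

section \<open>From volume bounds to densities\<close>

text \<open>Outer regularity with an excess volume \<open>e\<close> equal to that of
  \<open>A\<close>, whence the factor 2; for null sets \<open>e\<close> tends to 0 instead. The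
  bound 1/4 keeps the open set below volume 1.\<close>

lemma borel_bound_of_open_bound:
  fixes \<nu> :: "complex measure"
  assumes fin: "finite_measure \<nu>" and sets: "sets \<nu> = sets borel" and s: "s > 0" and K: "K \<ge> 0"
    and bound: "\<And>U. open U \<Longrightarrow> emeasure lborel U \<le> 1 \<Longrightarrow> emeasure \<nu> U \<le> ennreal (K * measure lborel U powr s)"
    and A: "A \<in> sets borel" "emeasure lborel A \<le> ennreal (1 / 4)"
  shows "measure \<nu> A \<le> K * (2 * measure lborel A) powr s"
proof -
  interpret finite_measure \<nu> by fact
  have Afin: "emeasure lborel A = ennreal (measure lborel A)"
    by (rule emeasure_eq_ennreal_measure[OF neq_top_trans[OF ennreal_neq_top A(2)]])
  have A4: "measure lborel A \<le> 1 / 4" using A(2) unfolding Afin by simp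
  have step: "measure \<nu> A \<le> K * (measure lborel A + e) powr s" if e: "0 < e" "e \<le> 1 / 4" for e
  proof -
    obtain U where U: "open U" "A \<subseteq> U" "emeasure lborel (U - A) < ennreal e"
      using outer_regular_lborel[OF A(1) e(1)] by blast
    have "emeasure lborel U = emeasure lborel (A \<union> (U - A))" using U(2) by (simp add: Un_absorb1)
    also have "\<dots> = emeasure lborel A + emeasure lborel (U - A)"
      using A U by (intro plus_emeasure[symmetric]) auto
    also have "\<dots> \<le> ennreal (measure lborel A) + ennreal e" using U(3) by (intro add_mono) (auto simp: Afin)
    also have "\<dots> = ennreal (measure lborel A + e)" using e by simp
    finally have Ue: "emeasure lborel U \<le> ennreal (measure lborel A + e)" .
    have Um: "measure lborel U \<le> measure lborel A + e"
    proof -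
      have "measure lborel U \<le> enn2real (ennreal (measure lborel A + e))"
        unfolding measure_def[of lborel U] by (rule enn2real_mono[OF Ue]) simp
      also have "\<dots> = measure lborel A + e" by (rule enn2real_ennreal) (use e in simp)
      finally show ?thesis .
    qed
    have "ennreal (measure lborel A + e) \<le> 1" using A4 e by (simp del: ennreal_plus)
    then have U1: "emeasure lborel U \<le> 1" using Ue by (rule order_trans[rotated])
    have "emeasure \<nu> A \<le> emeasure \<nu> U" using U(1,2) sets by (intro emeasure_mono) auto
    also have "\<dots> \<le> ennreal (K * measure lborel U powr s)" by (rule bound[OF U(1) U1])
    also have "\<dots> \<le> ennreal (K * (measure lborel A + e) powr s)"
      using Um s K by (intro ennreal_leI mult_left_mono powr_mono2) auto
    finally show ?thesis using K by (simp add: emeasure_eq_measure)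
  qed
  show ?thesis
  proof (cases "measure lborel A = 0")
    case True
    have "(\<lambda>n. K * inverse (real (Suc n)) powr s) \<longlonglongrightarrow> K * 0"
    proof (intro tendsto_mult tendsto_const)
      show "(\<lambda>n. inverse (real (Suc n)) powr s) \<longlonglongrightarrow> 0"
        by (rule tendsto_zero_powrI[OF LIMSEQ_inverse_real_of_nat tendsto_const]) (use s in auto)
    qed
    moreover have "\<forall>\<^sub>F n in sequentially. measure \<nu> A \<le> K * inverse (real (Suc n)) powr s"
      using eventually_ge_at_top[of 3]
    proof eventually_elim
      case (elim n)
      have "inverse (real (Suc n)) \<le> 1 / 4" using elim by (simp add: field_simps)
      then show ?case using step[of "inverse (real (Suc n))"] True by simp
    qed
    ultimately have "measure \<nu> A \<le> K * 0" using tendsto_lowerbound sequentially_bot by blast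
    then show ?thesis using K by (simp add: True)
  next
    case False
    then have "0 < measure lborel A" by (simp add: zero_less_measure_iff)
    then show ?thesis using step[of "measure lborel A"] A4 by simp
  qed
qed

text \<open>A value between \<open>2 ^ j\<close> and \<open>2 ^ (j + 1)\<close> is accounted for by
  level \<open>j\<close>, a value below 1 by the summand 1.\<close>

lemma dyadic_bound:
  fixes x p :: real
  assumes x: "0 \<le> x" and p: "0 < p"
  shows "ennreal (x powr p) \<le> 1 + (\<Sum>j. ennreal (2 powr (p * (real j + 1))) * indicator {y. 2 ^ j \<le> y} x)"
proof (cases "x < 1")
  case True
  then have "x powr p \<le> 1" using x p by (intro powr_le1) auto
  then have "ennreal (x powr p) \<le> 1" by simp
  then show ?thesis by (rule order_trans) simp
next
  case False
  define j where "j = nat \<lfloor>log 2 x\<rfloor>"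
  have l0: "0 \<le> log 2 x" using False by simp
  have j: "real j \<le> log 2 x" "log 2 x < real j + 1" using l0 by (simp_all add: j_def)
  have x1: "x = 2 powr (log 2 x)" using False by simp
  have "2 ^ j = (2::real) powr real j" by (simp add: powr_realpow)
  also have "\<dots> \<le> 2 powr (log 2 x)" using j by simp
  finally have jx: "2 ^ j \<le> x" using x1 by simp
  have "x powr p = 2 powr (log 2 x * p)" by (subst x1) (simp only: powr_powr)
  also have "\<dots> \<le> 2 powr ((real j + 1) * p)" using j p by (intro powr_mono mult_right_mono) auto
  finally have "ennreal (x powr p) \<le> ennreal (2 powr (p * (real j + 1))) * indicator {y. 2 ^ j \<le> y} x"
    using jx by (simp add: mult.commute ennreal_leI)
  also have "\<dots> \<le> (\<Sum>i. ennreal (2 powr (p * (real i + 1))) * indicator {y. 2 ^ i \<le> y} x)"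
  proof -
    have "f j \<le> suminf f" for f :: "nat \<Rightarrow> ennreal"
      using sum_le_suminf[OF summableI, of "{j}" f] by simp
    then show ?thesis .
  qed
  finally show ?thesis by (rule order_trans) simp
qed

text \<open>The set where the density is at least \<open>2 ^ j\<close> has volume at most
  \<open>1 / 2 ^ j\<close>, hence measure of order at most \<open>2 powr (- s * j)\<close>. So the
  power \<open>p = s / 2\<close> of the density is integrable against \<nu>, and the power
  \<open>1 + p\<close> against volume.\<close>

lemma density_in_Lp_of_volume_bound:
  fixes \<nu> :: "complex measure"
  assumes prob: "prob_space \<nu>" and sets: "sets \<nu> = sets borel" and s: "s > 0" and K: "K \<ge> 0"
    and bound: "\<And>A. A \<in> sets borel \<Longrightarrow> emeasure lborel A \<le> ennreal (1 / 4) \<Longrightarrow> measure \<nu> A \<le> K * measure lborel A powr s"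
  shows "absolutely_continuous lborel \<nu>" "\<exists>q>1. has_density_in_Lp \<nu> q"
proof -
  interpret prob_space \<nu> by fact
  show ac: "absolutely_continuous lborel \<nu>"
    unfolding absolutely_continuous_def
  proof
    fix A :: "complex set" assume "A \<in> null_sets lborel"
    then have A: "A \<in> sets borel" "emeasure lborel A = 0" by (auto simp: null_sets_def)
    then have "measure lborel A = 0" by (simp add: measure_def)
    then have "measure \<nu> A \<le> 0" using bound[OF A(1)] A(2) by simp
    then have "emeasure \<nu> A = 0" by (simp add: emeasure_eq_measure measure_le_0_iff)
    then show "A \<in> null_sets \<nu>" using A sets by (auto simp: null_sets_def)
  qed
  define D where "D = (\<lambda>x. enn2real (RN_deriv lborel \<nu> x))"
  have [measurable]: "D \<in> borel_measurable borel" unfolding D_def by measurable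
  have D0: "0 \<le> D x" for x by (simp add: D_def)
  have sets': "sets \<nu> = sets lborel" using sets by simp
  have dens: "\<nu> = density lborel (\<lambda>x. ennreal (D x))"
  proof -
    have "AE x in lborel. RN_deriv lborel \<nu> x = ennreal (D x)"
      using sigma_finite_measure.RN_deriv_finite[OF sigma_finite_lborel sigma_finite_measure_axioms ac sets']
      by eventually_elim (auto simp: D_def less_top)
    then have "density lborel (RN_deriv lborel \<nu>) = density lborel (\<lambda>x. ennreal (D x))"
      by (intro density_cong) (auto simp: D_def)
    then show ?thesis using sigma_finite_measure.density_RN_deriv[OF sigma_finite_lborel ac sets'] by simp
  qed
  define A where "A = (\<lambda>j::nat. {x. 2 ^ j \<le> D x})"
  have Am [measurable]: "A j \<in> sets borel" for j unfolding A_def by measurable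
  have Amn: "A j \<in> sets \<nu>" for j using Am sets by simp
  have vol: "ennreal (2 ^ j) * emeasure lborel (A j) \<le> ennreal 1" for j
  proof -
    have "ennreal (2 ^ j) * emeasure lborel (A j) = (\<integral>\<^sup>+x. ennreal (2 ^ j) * indicator (A j) x \<partial>lborel)"
      by (simp add: nn_integral_cmult)
    also have "\<dots> \<le> (\<integral>\<^sup>+x. ennreal (D x) * indicator (A j) x \<partial>lborel)"
      by (intro nn_integral_mono) (auto simp: A_def indicator_def intro!: ennreal_leI)
    also have "\<dots> = emeasure \<nu> (A j)" by (subst dens) (simp add: emeasure_density)
    also have "\<dots> \<le> ennreal 1" by (simp add: emeasure_eq_measure)
    finally show ?thesis .
  qed
  \<comment> \<open>\<open>4 powr s\<close> takes care of the levels \<open>j < 2\<close>, where the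
    volume may exceed 1/4.\<close>
  define K' where "K' = K + 4 powr s"
  have mass: "emeasure \<nu> (A j) \<le> ennreal (K' * 2 powr (- s * j))" for j
  proof -
    have "measure \<nu> (A j) \<le> K' * 2 powr (- s * j)"
    proof (cases "j \<ge> 2")
      case True
      have "emeasure lborel (A j) = ennreal (1 / 2 ^ j) * (ennreal (2 ^ j) * emeasure lborel (A j))"
        by (simp add: mult.assoc[symmetric] flip: ennreal_mult)
      also have "\<dots> \<le> ennreal (1 / 2 ^ j) * ennreal 1" by (intro mult_left_mono vol) auto
      finally have v: "emeasure lborel (A j) \<le> ennreal (1 / 2 ^ j)" by simp
      have m: "measure lborel (A j) \<le> 1 / 2 ^ j" using enn2real_mono[OF v] by (simp add: measure_def)
      have "(2::real) ^ 2 \<le> 2 ^ j" using True by (intro power_increasing) auto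
      then have "(1::real) / 2 ^ j \<le> 1 / 4" by (intro divide_left_mono) auto
      then have "emeasure lborel (A j) \<le> ennreal (1 / 4)" using v by (meson ennreal_leI order_trans)
      then have "measure \<nu> (A j) \<le> K * measure lborel (A j) powr s" by (intro bound Am)
      also have "\<dots> \<le> K * (1 / 2 ^ j) powr s" using K m s by (intro mult_left_mono powr_mono2) auto
      also have "(1 / 2 ^ j) powr s = 2 powr (- s * j)"
        by (simp add: powr_divide powr_minus_divide powr_realpow[symmetric] powr_powr mult.commute)
      also have "K * \<dots> \<le> K' * 2 powr (- s * j)" by (intro mult_right_mono) (auto simp: K'_def)
      finally show ?thesis .
    next
      case False
      have "measure \<nu> (A j) \<le> 2 powr 0" by simp
      also have "\<dots> \<le> 2 powr (2 * s - s * j)" using False s by (intro powr_mono) (auto simp: mult.commute)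
      also have "\<dots> = 4 powr s * 2 powr (- s * j)"
      proof -
        have "(4::real) powr s = 2 powr (2 * s)" using powr_powr[of 2 2 s] by simp
        then show ?thesis by (simp flip: powr_add)
      qed
      also have "\<dots> \<le> K' * 2 powr (- s * j)" using K by (intro mult_right_mono) (auto simp: K'_def)
      finally show ?thesis .
    qed
    then show ?thesis by (simp add: emeasure_eq_measure ennreal_leI)
  qed
  define p where "p = s / 2"
  have p: "0 < p" using s by (simp add: p_def)
  have "(\<integral>\<^sup>+x. ennreal (D x powr (1 + p)) \<partial>lborel) = (\<integral>\<^sup>+x. ennreal (D x) * ennreal (D x powr p) \<partial>lborel)"
  proof (intro nn_integral_cong)
    fix x
    have "D x powr (1 + p) = D x * D x powr p" using D0[of x] by (cases "D x = 0") (auto simp: powr_add)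
    then show "ennreal (D x powr (1 + p)) = ennreal (D x) * ennreal (D x powr p)" using D0[of x] by (simp add: ennreal_mult)
  qed
  also have "\<dots> = (\<integral>\<^sup>+x. ennreal (D x powr p) \<partial>\<nu>)"
    by (subst dens) (simp add: nn_integral_density)
  also have "\<dots> \<le> (\<integral>\<^sup>+x. 1 + (\<Sum>j. ennreal (2 powr (p * (real j + 1))) * indicator (A j) x) \<partial>\<nu>)"
  proof (intro nn_integral_mono)
    fix x
    have "indicator {y. 2 ^ j \<le> y} (D x) = (indicator (A j) x :: ennreal)" for j by (simp add: A_def indicator_def)
    then show "ennreal (D x powr p) \<le> 1 + (\<Sum>j. ennreal (2 powr (p * (real j + 1))) * indicator (A j) x)"
      using dyadic_bound[OF D0[of x] p] by simp
  qed
  also have "\<dots> = 1 + (\<Sum>j. ennreal (2 powr (p * (real j + 1))) * emeasure \<nu> (A j))"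
  proof -
    have "(\<integral>\<^sup>+x. 1 + (\<Sum>j. ennreal (2 powr (p * (real j + 1))) * indicator (A j) x) \<partial>\<nu>) =
      (\<integral>\<^sup>+x. 1 \<partial>\<nu>) + (\<integral>\<^sup>+x. (\<Sum>j. ennreal (2 powr (p * (real j + 1))) * indicator (A j) x) \<partial>\<nu>)"
      using Amn by (intro nn_integral_add borel_measurable_suminf borel_measurable_times_ennreal borel_measurable_indicator) auto
    also have "(\<integral>\<^sup>+x. 1 \<partial>\<nu>) = 1" by (simp add: emeasure_space_1)
    also have "(\<integral>\<^sup>+x. (\<Sum>j. ennreal (2 powr (p * (real j + 1))) * indicator (A j) x) \<partial>\<nu>) =
      (\<Sum>j. \<integral>\<^sup>+x. ennreal (2 powr (p * (real j + 1))) * indicator (A j) x \<partial>\<nu>)"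
      using Amn by (intro nn_integral_suminf borel_measurable_times_ennreal borel_measurable_indicator) auto
    also have "\<dots> = (\<Sum>j. ennreal (2 powr (p * (real j + 1))) * emeasure \<nu> (A j))"
      using Amn by (simp add: nn_integral_cmult_indicator)
    finally show ?thesis .
  qed
  also have "\<dots> \<le> 1 + (\<Sum>j. ennreal (2 powr p * K' * (2 powr (- p)) ^ j))"
  proof (intro add_left_mono suminf_le summableI)
    fix j
    have "ennreal (2 powr (p * (real j + 1))) * emeasure \<nu> (A j) \<le> ennreal (2 powr (p * (real j + 1))) * ennreal (K' * 2 powr (- s * j))"
      by (intro mult_left_mono mass) auto
    also have "\<dots> = ennreal (2 powr (p * (real j + 1)) * (K' * 2 powr (- s * j)))" using K by (simp add: ennreal_mult K'_def)
    also have "2 powr (p * (real j + 1)) * (K' * 2 powr (- s * j)) = K' * 2 powr (p * (real j + 1) + - s * j)"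
      by (simp only: powr_add mult_ac)
    also have "p * (real j + 1) + - s * j = p + - p * j" by (simp add: p_def field_simps)
    also have "K' * 2 powr (p + - p * j) = 2 powr p * K' * (2 powr (- p)) ^ j"
      by (simp only: powr_add powr_powr[symmetric]) (simp add: powr_realpow)
    finally show "ennreal (2 powr (p * (real j + 1))) * emeasure \<nu> (A j) \<le> ennreal (2 powr p * K' * (2 powr (- p)) ^ j)" .
  qed
  also have "\<dots> < \<infinity>"
  proof -
    have "(2::real) powr (- p) < 1" using p by (intro powr_less_one) auto
    then have "summable (\<lambda>j. 2 powr p * K' * (2 powr (- p)) ^ j)" by (intro summable_mult summable_geometric) auto
    then have "(\<Sum>j. ennreal (2 powr p * K' * (2 powr (- p)) ^ j)) \<noteq> \<top>"
      using K by (intro ennreal_suminf_neq_top) (auto simp: K'_def)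
    then show ?thesis by (simp add: less_top)
  qed
  finally have "(\<integral>\<^sup>+x. ennreal (D x powr (1 + p)) \<partial>lborel) < \<infinity>" .
  then have "integrable lborel (\<lambda>x. D x powr (1 + p))"
    by (intro integrableI_nonneg) auto
  then have "has_density_in_Lp \<nu> (1 + p)"
    unfolding has_density_in_Lp_def using dens D0 by (intro exI[of _ D]) auto
  then show "\<exists>q>1. has_density_in_Lp \<nu> q" using p by (intro exI[of _ "1 + p"]) auto
qed

text \<open>The complement is a union of open null sets, and by Lindelof countably many of them
  suffice.\<close>

lemma measure_support_full:
  fixes \<nu> :: "complex measure"
  assumes sets: "sets \<nu> = sets borel"
  shows "emeasure \<nu> (- measure_support \<nu>) = 0"
proof -
  define F where "F = {V. open V \<and> emeasure \<nu> V = 0}"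
  have eq: "- measure_support \<nu> = \<Union>F" by (auto simp: measure_support_def F_def)
  obtain F' where F': "F' \<subseteq> F" "countable F'" "\<Union>F' = \<Union>F"
    using Lindelof[of F] unfolding F_def by auto
  have "(\<Union>V\<in>F'. V) \<in> null_sets \<nu>"
    using F' sets by (intro null_sets_UN') (auto simp: F_def null_sets_def)
  then show ?thesis using F'(3) by (simp add: eq null_sets_def)
qed

lemma positive_volume_support:
  fixes \<nu> :: "complex measure"
  assumes prob: "prob_space \<nu>" and sets: "sets \<nu> = sets borel" and ac: "absolutely_continuous lborel \<nu>"
  shows "0 < emeasure lborel (measure_support \<nu>)"
proof (rule ccontr)
  interpret prob_space \<nu> by fact
  let ?S = "measure_support \<nu>"
  have S: "?S \<in> sets borel" using closed_measure_support[OF sets] by simp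
  assume "\<not> ?thesis"
  then have "?S \<in> null_sets lborel" using S by (auto simp: null_sets_def)
  then have "emeasure \<nu> ?S = 0" using ac unfolding absolutely_continuous_def by (auto simp: null_sets_def)
  moreover have "emeasure \<nu> (?S \<union> - ?S) \<le> emeasure \<nu> ?S + emeasure \<nu> (- ?S)"
    using S sets by (intro emeasure_subadditive) auto
  moreover have "?S \<union> - ?S = space \<nu>" using sets_eq_imp_space_eq[OF sets] by auto
  ultimately show False using measure_support_full[OF sets] emeasure_space_1 by simp
qed

theorem bernoulli_conv_density:
  fixes l :: complex
  assumes l: "l \<in> bernoulli_params"
    and separated: "separated l"
    and decay: "\<And>k. k \<ge> 1 \<Longrightarrow> Im (l ^ k) \<noteq> 0 \<Longrightarrow> fourier_decay (l ^ k)"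
  shows "absolutely_continuous lborel (bernoulli_conv l)" "\<exists>q>1. has_density_in_Lp (bernoulli_conv l) q"
    "0 < emeasure lborel (bernoulli_attractor l)"
proof -
  have l1: "0 < cmod l" "cmod l < 1" using l by (auto simp: bernoulli_params_def)
  have main: "\<exists>k\<ge>1. \<exists>m\<ge>1. \<exists>K. \<exists>s>0. \<forall>V\<in>sets borel. emeasure lborel V \<le> 1 \<longrightarrow> (\<forall>J. \<forall>\<^sub>F n in sequentially.
    pE (selfsim l sgn_pmf (k * n)) (smooth (((cmod l ^ k) ^ (m * J))\<^sup>2) V) \<le> K * measure lborel V powr s)"
    by (rule bernoulli_smooth_bound[OF l separated]) (rule decay)
  obtain k m K s where b': "\<forall>V\<in>sets borel. emeasure lborel V \<le> 1 \<longrightarrow> (\<forall>J. \<forall>\<^sub>F n in sequentially.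
      pE (selfsim l sgn_pmf (k * n)) (smooth (((cmod l ^ k) ^ (m * J))\<^sup>2) V) \<le> K * measure lborel V powr s)"
    and k: "k \<ge> 1" and m: "m \<ge> 1" and s: "s > 0"
    using main by (elim exE conjE) (rule that)
  have b: "\<forall>\<^sub>F n in sequentially. pE (selfsim l sgn_pmf (k * n)) (smooth (((cmod l ^ k) ^ (m * J))\<^sup>2) V) \<le> K * measure lborel V powr s"
    if "V \<in> sets borel" "emeasure lborel V \<le> 1" for V J
    using b' that by blast
  define r where "r = (\<lambda>J. (cmod l ^ k) ^ (m * J))"
  have r: "r J > 0" for J using l1 by (simp add: r_def)
  have rlim: "r \<longlonglongrightarrow> 0"
  proof -
    have "cmod l ^ (k * m) < 1" using l1 k m by (simp add: power_less_one_iff)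
    then have "(\<lambda>J. (cmod l ^ (k * m)) ^ J) \<longlonglongrightarrow> 0" using l1 by (intro LIMSEQ_power_zero) auto
    then show ?thesis by (simp add: r_def power_mult[symmetric] mult.assoc)
  qed
  have openb: "emeasure (bernoulli_conv l) U \<le> ennreal (max K 0 * measure lborel U powr s)"
    if U: "open U" "emeasure lborel U \<le> 1" for U
  proof -
    \<comment> \<open>The bound holds for each scale only from some length on, so a length is
      selected for every \<open>J\<close>; \<open>n \<ge> J\<close> makes the lengths tend to
      infinity, as \<open>open_set_bound\<close> demands.\<close>
    have "\<forall>J. \<exists>n. n \<ge> J \<and> pE (selfsim l sgn_pmf (k * n)) (smooth ((r J)\<^sup>2) U) \<le> K * measure lborel U powr s"
    proof
      fix J
      have "\<forall>\<^sub>F n in sequentially. n \<ge> J \<and> pE (selfsim l sgn_pmf (k * n)) (smooth ((r J)\<^sup>2) U) \<le> K * measure lborel U powr s"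
        unfolding r_def using U by (intro eventually_conj eventually_ge_at_top b) auto
      from eventually_happens'[OF sequentially_bot this]
      show "\<exists>n. n \<ge> J \<and> pE (selfsim l sgn_pmf (k * n)) (smooth ((r J)\<^sup>2) U) \<le> K * measure lborel U powr s" .
    qed
    from choice[OF this] obtain n where n: "\<And>J. n J \<ge> J"
      "\<And>J. pE (selfsim l sgn_pmf (k * n J)) (smooth ((r J)\<^sup>2) U) \<le> K * measure lborel U powr s" by blast
    have "filterlim (\<lambda>J. k * n J) sequentially sequentially"
    proof (rule filterlim_at_top_mono[OF filterlim_ident])
      have "J \<le> k * n J" for J using n(1)[of J] k mult_le_mono[of 1 k J "n J"] by simp
      then show "\<forall>\<^sub>F J in sequentially. J \<le> k * n J" by simp
    qed
    then have "emeasure (bernoulli_conv l) U \<le> ennreal (K * measure lborel U powr s)"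
      by (rule open_set_bound[OF l1(2) U(1) r rlim _ n(2)])
    also have "\<dots> \<le> ennreal (max K 0 * measure lborel U powr s)"
      by (intro ennreal_leI mult_right_mono) auto
    finally show ?thesis .
  qed
  interpret prob_space "bernoulli_conv l" by (rule prob_space_bernoulli_conv)
  have "measure (bernoulli_conv l) A \<le> max K 0 * 2 powr s * measure lborel A powr s"
    if "A \<in> sets borel" "emeasure lborel A \<le> ennreal (1 / 4)" for A
    using borel_bound_of_open_bound[OF finite_measure_axioms sets_bernoulli_conv s _ openb that]
    by (simp add: powr_mult mult.assoc)
  note D = density_in_Lp_of_volume_bound[OF prob_space_axioms sets_bernoulli_conv s _ this]
  show ac: "absolutely_continuous lborel (bernoulli_conv l)" by (rule D(1)) auto
  show "\<exists>q>1. has_density_in_Lp (bernoulli_conv l) q" by (rule D(2)) auto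
  show "0 < emeasure lborel (bernoulli_attractor l)" unfolding bernoulli_attractor_def
    by (rule positive_volume_support[OF prob_space_axioms sets_bernoulli_conv ac])
qed

theorem theorem1:
  shows "\<exists>E. E \<subseteq> bernoulli_params \<and> hausdorff_dim E = 0 \<and>
    (\<forall>l \<in> bernoulli_params - E.
       absolutely_continuous lborel (bernoulli_conv l) \<and>
       (\<exists>q > 1. has_density_in_Lp (bernoulli_conv l) q) \<and>
       0 < emeasure lborel (bernoulli_attractor l))"
proof -
  define E1 where "E1 = {l \<in> bernoulli_params. \<not> separated l}"
  \<comment> \<open>The exponent that will serve for \<open>l\<close> is not known beforehand, so
    failures of decay are collected over all positive exponents with a nonreal power.\<close>
  define E2 where "E2 = (\<lambda>k. {l \<in> bernoulli_params. Im (l ^ Suc k) \<noteq> 0 \<and> \<not> fourier_decay (l ^ Suc k)})"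
  have params: "0 < cmod l" "cmod l < 1" if "l \<in> bernoulli_params" for l
    using that by (auto simp: bernoulli_params_def)
  have "dim0 E1"
    by (rule dim0_subset[OF dim0_not_separated]) (use params in \<open>auto simp: E1_def\<close>)
  moreover have "dim0 (\<Union>k. E2 k)"
  proof (rule dim0_UN)
    fix k
    have "dim0 {l. l ^ Suc k \<in> {\<rho>. 0 < cmod \<rho> \<and> cmod \<rho> < 1 \<and> Im \<rho> \<noteq> 0 \<and> \<not> fourier_decay \<rho>}}"
      by (intro dim0_power_vimage dim0_not_fourier_decay) simp
    then show "dim0 (E2 k)"
    proof (rule dim0_subset, intro subsetI)
      fix l assume l: "l \<in> E2 k"
      have "0 < cmod l" "cmod l < 1" using params l by (auto simp: E2_def)
      then have "0 < cmod (l ^ Suc k)" "cmod (l ^ Suc k) < 1"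
        unfolding norm_power by (simp_all only: zero_less_power power_less_one_iff norm_ge_zero zero_less_Suc)
      then show "l \<in> {l. l ^ Suc k \<in> {\<rho>. 0 < cmod \<rho> \<and> cmod \<rho> < 1 \<and> Im \<rho> \<noteq> 0 \<and> \<not> fourier_decay \<rho>}}"
        using l unfolding E2_def by blast
    qed
  qed
  ultimately have "hausdorff_dim (E1 \<union> (\<Union>k. E2 k)) = 0"
    by (intro dim0_hausdorff_dim dim0_Un)
  moreover have "E1 \<union> (\<Union>k. E2 k) \<subseteq> bernoulli_params" by (auto simp: E1_def E2_def)
  moreover have "absolutely_continuous lborel (bernoulli_conv l) \<and> (\<exists>q > 1. has_density_in_Lp (bernoulli_conv l) q) \<and>
      0 < emeasure lborel (bernoulli_attractor l)"
    if "l \<in> bernoulli_params - (E1 \<union> (\<Union>k. E2 k))" for l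
  proof -
    have l: "l \<in> bernoulli_params" and sep: "separated l" using that by (auto simp: E1_def)
    have dec: "fourier_decay (l ^ k)" if "k \<ge> 1" "Im (l ^ k) \<noteq> 0" for k
    proof -
      have k: "k = Suc (k - 1)" using that(1) by simp
      have "l \<notin> E2 (k - 1)" using \<open>l \<in> bernoulli_params - (E1 \<union> (\<Union>k. E2 k))\<close> by blast
      then show ?thesis using l that(2) unfolding E2_def k[symmetric] by blast
    qed
    show ?thesis
      using bernoulli_conv_density(1)[OF l sep] bernoulli_conv_density(2)[OF l sep] bernoulli_conv_density(3)[OF l sep] dec
      by blast
  qed
  ultimately show ?thesis by blast
qed

end
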